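(* Let $N\ge1$, let $\Omega\subset\mathbb{R}^N$ be a bounded Lipschitz domain, let $s_0<\min\{1,\frac N4\}$, and let $(s_n)_{n\in\mathbb{N}}\subset(0,s_0]$ satisfy $\lim_{n\to\infty}s_n=0$. Let $p\in C^1([0,s_0])$ satisfy $$2<p(s)<2_s^*:=\frac{2N}{N-2s}\ \text{ for }s\in(0,s_0),\qquad p'(0)\notin\{0,\tfrac4N\},$$ and let $\tau\in C^1([0,s_0])$ satisfy $\tau(s)\in(-\infty,\lambda_{1,s}^\omega)$ and $\tau(s)=o(s)$ as $s\to0^+$. Write $p_s=p(s)$, $\tau_s=\tau(s)$. For each $n$ let $u_{s_n}\in\mathcal{H}_\omega^{s_n}(\Omega)$ be a (Nehari) least-energy solution of the following problem with $s=s_n$: $$(I-\Delta)^su=\tau_su+|u|^{p_s-2}u\ \text{ in }\Omega,\qquad u=0\ \text{ on }\mathbb{R}^N\setminus\Omega .$$ Then there is a (Nehari) least-energy solution $u\in\mathcal{H}_0^{\ln}(\Omega)\setminus\{0\}$ of $$(I-\Delta)^{\ln}u=p'(0)\,u\ln|u|\ \text{ in }\Omega,\qquad u=0\ \text{ in }\mathbb{R}^N\setminus\Omega$$ such that, passing to a subsequence, $\lim_{n\to\infty}u_{s_n}=u$ in $L^2(\mathbb{R}^N)$. Moreover (along the subsequence) $$\lim_{n\to\infty}\frac1{s_n}J_{\omega,s_n}(u_{s_n})=J_{\ln}(u)=\frac{p'(0)}4\|u\|_2^2\qquad\text{and}\qquad\lim_{n\to\infty}\|u_{s_n}\|_{\omega,s_n}=\|u\|_2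 .$$
   Context: All functions are real-valued; $\hat u$ is the unitary Fourier transform $\hat u(\xi)=(2\pi)^{-N/2}\int_{\mathbb{R}^N}e^{-ix\cdot\xi}u(x)\,dx$; $\|\cdot\|_p$ is the $L^p$ norm. Fractional problem. The operator $(I-\Delta)^s$ has Fourier symbol $(1+|\xi|^2)^s$. Let $\mathcal{H}_\omega^s(\Omega)=\{u\in L^2(\mathbb{R}^N):\int(1+|\xi|^2)^s|\hat u|^2d\xi<\infty,\ u=0\text{ in }\mathbb{R}^N\setminus\Omega\}$, $\mathcal{E}_{\omega,s}(u,\varphi)=\int_{\mathbb{R}^N}(1+|\xi|^2)^s\hat\varphi(\xi)\overline{\hat u(\xi)}\,d\xi$, $\|u\|_{\omega,s}=\sqrt{\mathcal{E}_{\omega,s}(u,u)}$, $\lambda_{1,s}^\omega=\inf_{u\in C_c^2(\Omega)\setminus\{0\}}\mathcal{E}_{\omega,s}(u,u)/\|u\|_{L^2(\Omega)}^2$. A (weak) solution is $u\in\mathcal{H}_\omega^s(\Omega)$ with $\mathcal{E}_{\omega,s}(u,\varphi)=\int_\Omega|u|^{p_s-2}u\varphi\,dx+\tau_s\int_\Omega u\varphi\,dx$ for all $\varphi\in\mathcal{H}_\omega^s(\Omega)$. Put $J_{\omega,s}(u)=\frac12\|u\|_{\omega,s}^2-\frac1{p_s}\|u\|_{p_s}^{p_s}-\frac{\tau_s}2\|u\|_2^2$ and $\mathcal{N}_{\omega,s}=\{u\in\mathcal{H}_\omega^s(\Omega)\setminus\{0\}:\|u\|_{\omega,s}^2=\|u\|_{p_s}^{p_s}+\tau_s\|u\|_2^2\}$.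 A solution $u\in\mathcal{N}_{\omega,s}$ is a (Nehari) least-energy solution if $J_{\omega,s}(u)=\inf_{\mathcal{N}_{\omega,s}}J_{\omega,s}$. Logarithmic problem. Let $K_\nu$ be the modified Bessel function of the second kind, $d_N:=\pi^{-N/2}$, $\omega(r):=2^{1-N/2}r^{N/2}K_{N/2}(r)$, $J(y):=d_N\,\omega(|y|)/|y|^N$. Then $(I-\Delta)^{\ln}u(x)=\int_{\mathbb{R}^N}(u(x)-u(x+y))J(y)\,dy$ (symbol $\ln(1+|\xi|^2)$), $\mathcal{E}_\omega(u,v)=\frac12\iint(u(x)-u(y))(v(x)-v(y))J(x-y)\,dx\,dy$, and $\mathcal{H}_0^{\ln}(\Omega)=\{u\in L^2(\mathbb{R}^N):\mathcal{E}_\omega(u,u)<\infty,\ u\equiv0\text{ in }\mathbb{R}^N\setminus\Omega\}$. Convention: $t\ln|t|=0$, $t^2\ln t^2=0$ at $t=0$. With $k:=p'(0)$, a (weak) solution of the limiting problem is $u\in\mathcal{H}_0^{\ln}(\Omega)$ with $\mathcal{E}_\omega(u,\varphi)=k\int_\Omega\varphi u\ln|u|dx$ for all $\varphi\in\mathcal{H}_0^{\ln}(\Omega)$; $J_{\ln}(u)=\frac12\mathcal{E}_\omega(u,u)+\frac k4\int_\Omega u^2dx-\frac k4\int_\Omega u^2\ln u^2dx$; $\mathcal{N}=\{u\in\mathcal{H}_0^{\ln}(\Omega)\setminus\{0\}:\mathcal{E}_\omega(u,u)=k\int_\Omega u^2\ln|u|dx\}$. A solution $u\in\mathcal{N}$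 is a (Nehari) least-energy solution if $J_{\ln}(u)=\inf_{\mathcal{N}}J_{\ln}$. *)

theory Defs
  imports "HOL-Analysis.Analysis" "HOL-Library.Landau_Symbols"
begin

text \<open>
  The space \<open>\<real>\<^sup>N\<close> is an arbitrary Euclidean space \<open>'a\<close> with \<open>N = DIM('a)\<close>. Elements of
  \<open>L\<^sup>p\<close> spaces are represented by Borel measurable functions (every Lebesgue class contains one),
  and ``\<open>u = 0\<close> in \<open>\<real>\<^sup>N - \<Omega>\<close>'' and ``\<open>u \<noteq> 0\<close>'' are understood up to null sets.
\<close>

text \<open>
  Near each boundary point \<open>z\<close>, after a rotation taking \<open>v\<close> to the last axis, \<open>\<Omega>\<close> is the region above
  the graph of a Lipschitz function \<open>g\<close> on the hyperplane orthogonal to \<open>v\<close>.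
\<close>

definition lipschitz_domain :: "'a::euclidean_space set \<Rightarrow> bool" where
  "lipschitz_domain \<Omega> \<longleftrightarrow> open \<Omega> \<and> connected \<Omega> \<and> \<Omega> \<noteq> {} \<and>
     (\<forall>z\<in>frontier \<Omega>. \<exists>v r L g. norm v = 1 \<and> r > 0 \<and> L-lipschitz_on {y. y \<bullet> v = 0} g \<and>
        \<Omega> \<inter> ball z r = {x \<in> ball z r. g (x - (x \<bullet> v) *\<^sub>R v) < x \<bullet> v})"

definition square_integrable :: "('a::euclidean_space \<Rightarrow> real) \<Rightarrow> bool" where
  "square_integrable u \<longleftrightarrow> u \<in> borel_measurable lborel \<and> integrable lborel (\<lambda>x. (u x)\<^sup>2)"

definition Lp_norm :: "real \<Rightarrow> ('a::euclidean_space \<Rightarrow> real) \<Rightarrow> real" where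
  "Lp_norm p u = (LINT x|lborel. \<bar>u x\<bar> powr p) powr (1 / p)"

definition vanishes_outside :: "'a::euclidean_space set \<Rightarrow> ('a \<Rightarrow> real) \<Rightarrow> bool" where
  "vanishes_outside \<Omega> u \<longleftrightarrow> (AE x in lborel. x \<notin> \<Omega> \<longrightarrow> u x = 0)"

definition nontrivial :: "('a::euclidean_space \<Rightarrow> real) \<Rightarrow> bool" where
  "nontrivial u \<longleftrightarrow> \<not> (AE x in lborel. u x = 0)"

definition C2c :: "'a::euclidean_space set \<Rightarrow> ('a \<Rightarrow> real) set" where
  "C2c \<Omega> = {u. (\<exists>(D :: 'a \<Rightarrow> 'a \<Rightarrow>\<^sub>L real) (D2 :: 'a \<Rightarrow> 'a \<Rightarrow>\<^sub>L ('a \<Rightarrow>\<^sub>L real)).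
                  (\<forall>x. (u has_derivative blinfun_apply (D x)) (at x)) \<and>
                  (\<forall>x. (D has_derivative blinfun_apply (D2 x)) (at x)) \<and> continuous_on UNIV D2) \<and>
                compact (closure {x. u x \<noteq> 0}) \<and> closure {x. u x \<noteq> 0} \<subseteq> \<Omega>}"

text \<open>
  The integral formula is the unitary Fourier transform for \<open>u \<in> L\<^sup>1\<close>. It is only applied to
  \<open>L\<^sup>2\<close> functions vanishing outside a bounded set, which are in \<open>L\<^sup>1\<close>.
\<close>

definition fourier :: "('a::euclidean_space \<Rightarrow> real) \<Rightarrow> 'a \<Rightarrow> complex" where
  "fourier u \<xi> = complex_of_real ((2 * pi) powr (- (real DIM('a) / 2))) *
     (LINT x|lborel. exp (- (\<i> * complex_of_real (x \<bullet> \<xi>))) * complex_of_real (u x))"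


subsection \<open>The fractional problem\<close>

definition H_frac :: "'a::euclidean_space set \<Rightarrow> real \<Rightarrow> ('a \<Rightarrow> real) set" where
  "H_frac \<Omega> s = {u. square_integrable u \<and>
     integrable lborel (\<lambda>\<xi>. (1 + (norm \<xi>)\<^sup>2) powr s * (norm (fourier u \<xi>))\<^sup>2) \<and>
     vanishes_outside \<Omega> u}"

text \<open>
  For real-valued functions the imaginary part of the integrand is odd in \<open>\<xi>\<close>, so the integral is
  real; \<open>Re\<close> only serves to give the form the type \<open>real\<close>.
\<close>

definition E_frac :: "real \<Rightarrow> ('a::euclidean_space \<Rightarrow> real) \<Rightarrow> ('a \<Rightarrow> real) \<Rightarrow> real" where
  "E_frac s u \<phi> = Re (LINT \<xi>|lborel.
     complex_of_real ((1 + (norm \<xi>)\<^sup>2) powr s) * fourier \<phi> \<xi> * cnj (fourier u \<xi>))"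

definition norm_frac :: "real \<Rightarrow> ('a::euclidean_space \<Rightarrow> real) \<Rightarrow> real" where
  "norm_frac s u = sqrt (E_frac s u u)"

definition lambda1_frac :: "'a::euclidean_space set \<Rightarrow> real \<Rightarrow> real" where
  "lambda1_frac \<Omega> s =
     (INF u\<in>C2c \<Omega> - {\<lambda>_. 0}. E_frac s u u / (LINT x:\<Omega>|lborel. (u x)\<^sup>2))"

definition solution_frac ::
  "'a::euclidean_space set \<Rightarrow> real \<Rightarrow> real \<Rightarrow> real \<Rightarrow> ('a \<Rightarrow> real) \<Rightarrow> bool" where
  "solution_frac \<Omega> s p \<tau> u \<longleftrightarrow> u \<in> H_frac \<Omega> s \<and>
     (\<forall>\<phi>\<in>H_frac \<Omega> s. E_frac s u \<phi> =
        (LINT x:\<Omega>|lborel. \<bar>u x\<bar> powr (p - 2) * u x * \<phi> x) + \<tau> * (LINT x:\<Omega>|lborel. u x * \<phi> x))"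

definition J_frac :: "real \<Rightarrow> real \<Rightarrow> real \<Rightarrow> ('a::euclidean_space \<Rightarrow> real) \<Rightarrow> real" where
  "J_frac s p \<tau> u = 1 / 2 * (norm_frac s u)\<^sup>2 - 1 / p * Lp_norm p u powr p - \<tau> / 2 * (Lp_norm 2 u)\<^sup>2"

definition Nehari_frac ::
  "'a::euclidean_space set \<Rightarrow> real \<Rightarrow> real \<Rightarrow> real \<Rightarrow> ('a \<Rightarrow> real) set" where
  "Nehari_frac \<Omega> s p \<tau> = {u \<in> H_frac \<Omega> s. nontrivial u \<and>
     (norm_frac s u)\<^sup>2 = Lp_norm p u powr p + \<tau> * (Lp_norm 2 u)\<^sup>2}"

definition least_energy_frac ::
  "'a::euclidean_space set \<Rightarrow> real \<Rightarrow> real \<Rightarrow> real \<Rightarrow> ('a \<Rightarrow> real) \<Rightarrow> bool" where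
  "least_energy_frac \<Omega> s p \<tau> u \<longleftrightarrow> solution_frac \<Omega> s p \<tau> u \<and> u \<in> Nehari_frac \<Omega> s p \<tau> \<and>
     J_frac s p \<tau> u = (INF v\<in>Nehari_frac \<Omega> s p \<tau>. J_frac s p \<tau> v)"


subsection \<open>The logarithmic problem\<close>

text \<open>
  Modified Bessel function of the second kind, by its standard integral representation
  (for \<open>r > 0\<close> and arbitrary real order, including integer orders).
\<close>

definition bessel_K :: "real \<Rightarrow> real \<Rightarrow> real" where
  "bessel_K \<nu> r = (LINT t:{0<..}|lborel. exp (- (r * cosh t)) * cosh (\<nu> * t))"

definition omega_log :: "real \<Rightarrow> real \<Rightarrow> real" where
  "omega_log N r = 2 powr (1 - N / 2) * r powr (N / 2) * bessel_K (N / 2) r"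

definition J_kernel :: "'a::euclidean_space \<Rightarrow> real" where
  "J_kernel y =
     pi powr (- (real DIM('a) / 2)) * omega_log (real DIM('a)) (norm y) / norm y ^ DIM('a)"

definition E_log :: "('a::euclidean_space \<Rightarrow> real) \<Rightarrow> ('a \<Rightarrow> real) \<Rightarrow> real" where
  "E_log u v = 1 / 2 *
     (LINT (x, y)|(lborel \<Otimes>\<^sub>M lborel). (u x - u y) * (v x - v y) * J_kernel (x - y))"

definition H_log :: "'a::euclidean_space set \<Rightarrow> ('a \<Rightarrow> real) set" where
  "H_log \<Omega> = {u. square_integrable u \<and>
     integrable (lborel \<Otimes>\<^sub>M lborel) (\<lambda>(x, y). (u x - u y)\<^sup>2 * J_kernel (x - y)) \<and>
     vanishes_outside \<Omega> u}"

text \<open>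
  The conventions \<open>t ln \<bar>t\<bar> = 0\<close> and \<open>t\<^sup>2 ln t\<^sup>2 = 0\<close> at \<open>t = 0\<close> hold automatically below, as the
  factor \<open>t\<close> vanishes.
\<close>

definition solution_log :: "'a::euclidean_space set \<Rightarrow> real \<Rightarrow> ('a \<Rightarrow> real) \<Rightarrow> bool" where
  "solution_log \<Omega> k u \<longleftrightarrow> u \<in> H_log \<Omega> \<and>
     (\<forall>\<phi>\<in>H_log \<Omega>. E_log u \<phi> = k * (LINT x:\<Omega>|lborel. \<phi> x * u x * ln \<bar>u x\<bar>))"

definition J_log :: "'a::euclidean_space set \<Rightarrow> real \<Rightarrow> ('a \<Rightarrow> real) \<Rightarrow> real" where
  "J_log \<Omega> k u = 1 / 2 * E_log u u + k / 4 * (LINT x:\<Omega>|lborel. (u x)\<^sup>2)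
     - k / 4 * (LINT x:\<Omega>|lborel. (u x)\<^sup>2 * ln ((u x)\<^sup>2))"

definition Nehari_log :: "'a::euclidean_space set \<Rightarrow> real \<Rightarrow> ('a \<Rightarrow> real) set" where
  "Nehari_log \<Omega> k = {u \<in> H_log \<Omega>. nontrivial u \<and>
     E_log u u = k * (LINT x:\<Omega>|lborel. (u x)\<^sup>2 * ln \<bar>u x\<bar>)}"

definition least_energy_log :: "'a::euclidean_space set \<Rightarrow> real \<Rightarrow> ('a \<Rightarrow> real) \<Rightarrow> bool" where
  "least_energy_log \<Omega> k u \<longleftrightarrow> solution_log \<Omega> k u \<and> u \<in> Nehari_log \<Omega> k \<and>
     J_log \<Omega> k u = (INF v\<in>Nehari_log \<Omega> k. J_log \<Omega> k v)"

end

theory Submission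
  imports Defs "HOL-Probability.Probability" "HOL-Complex_Analysis.Great_Picard" "HOL-Real_Asymp.Real_Asymp"
begin

text \<open>
  With \<open>q\<^sub>s = p\<^sub>s - 2\<close> one has \<open>q\<^sub>s/s \<rightarrow> k = p'(0)\<close>, and the exclusions on \<open>p'(0)\<close> give \<open>0 < k < 4/N\<close>. Integrating
  over level sets the Plancherel bound for the high-frequency part of \<open>u\<close> yields
  \<open>\<integral>\<bar>u\<bar>\<^sup>p - \<integral>u\<^sup>2\<close> at most \<open>\<theta> (\<parallel>u\<parallel>\<^sub>s\<^sup>2 - \<integral>u\<^sup>2)\<close> with \<open>\<theta>\<close> close to \<open>kN/4 < 1\<close>, up to terms of order \<open>s\<close>. On the
  Nehari manifold this absorbs, so \<open>(\<parallel>u\<^sub>s\<parallel>\<^sub>s\<^sup>2 - \<integral>u\<^sub>s\<^sup>2)/s\<close> is bounded and \<open>\<integral>u\<^sub>s\<^sup>2\<close> stays away from zero. This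
  quotient dominates the logarithmic energy, whose sublevel sets are compact in \<open>L\<^sup>2\<close>. The weak equation,
  divided by \<open>s\<close>, passes to the limit against bounded test functions with \<open>H\<^sup>1\<close> regularity; these are dense in the
  logarithmic space by a Hardy inequality with logarithmic weight. Minimality follows by scaling test functions onto the
  fractional Nehari manifolds.
\<close>

text \<open>The logarithmic energy is so weak that no Sobolev embedding survives in the limit; every
  estimate has to be of first order in s with explicit constants. The number 4/N comes from coupling
  the heat time a of a low-pass filter with a level l of |u|. The filtered function stays below
  \<open>\<epsilon> l\<close> once a is of order l^(-4/N), so a frequency \<xi> is charged
  essentially for levels up to a multiple of (1+|\<xi>|^2)^(N/4). Integrating dl/l over these levels
  produces (N/4) ln(1+|\<xi>|^2), with a loss 1/(1-\<epsilon>)^2 that the gap between kN/4 and 1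
  pays for. The Lipschitz boundary acts through balls of comparable size outside the domain: they
  give the heat kernel a fixed mass in the complement at times beyond the squared boundary distance,
  and superposing these times produces the Hardy weight. Test functions are bounded and in H^1 so
  that both the power and the symbol can be expanded to first order; the passage to general
  functions in u ln|u| rests on a logarithmic Sobolev inequality for small mass.\<close>

abbreviation wave :: "'a::euclidean_space \<Rightarrow> 'a \<Rightarrow> complex"
  where "wave x \<xi> \<equiv> exp (- (\<i> * complex_of_real (x \<bullet> \<xi>)))"

abbreviation psd :: "('a::euclidean_space \<Rightarrow> real) \<Rightarrow> 'a \<Rightarrow> real"
  where "psd u \<xi> \<equiv> (norm (fourier u \<xi>))^2"

abbreviation br :: "'a::euclidean_space \<Rightarrow> real"
  where "br \<xi> \<equiv> 1 + (norm \<xi>)^2"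

abbreviation mass :: "('a::euclidean_space \<Rightarrow> real) \<Rightarrow> real"
  where "mass u \<equiv> LINT x|lborel. (u x)^2"

subsection \<open>Fourier transform and heat kernel\<close>

text \<open>Rescaling by sqrt(2 t) reduces both claims to the characteristic function of the
  standard normal law.\<close>

lemma gaussian_fourier_1d:
  fixes a t :: real
  assumes t: "t > 0"
  shows "integrable lborel (\<lambda>y. complex_of_real (exp (- (t * y\<^sup>2))) * exp (- (\<i> * complex_of_real (a * y))))"
    and "(LINT y|lborel. complex_of_real (exp (- (t * y\<^sup>2))) * exp (- (\<i> * complex_of_real (a * y)))) =
      complex_of_real (sqrt (pi / t) * exp (- a\<^sup>2 / (4 * t)))"
proof -
  define r where "r = sqrt (2 * t)"
  have r: "r > 0" "r\<^sup>2 = 2 * t" using t by (auto simp: r_def)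
  define b where "b = - a / r"
  have i0: "integrable lborel (\<lambda>x. std_normal_density x *\<^sub>R iexp (b * x))"
    by (rule Bochner_Integration.integrable_bound[OF integrable_std_normal_moment[of 0]])
       (auto simp: normal_density_nonneg)
  have e0: "(LINT x|lborel. std_normal_density x *\<^sub>R iexp (b * x)) = complex_of_real (exp (- b\<^sup>2 / 2))"
    using fun_cong[OF char_std_normal_distribution, of b]
    by (simp add: char_def integral_density normal_density_nonneg)
  let ?h = "\<lambda>x. std_normal_density x *\<^sub>R iexp (b * x)"
  have i1: "integrable lborel (\<lambda>y. ?h (0 + r * y))"
    using lborel_integrable_real_affine[OF i0, of r 0] r by simp
  have e1: "r *\<^sub>R (LINT y|lborel. ?h (0 + r * y)) = complex_of_real (exp (- b\<^sup>2 / 2))"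
    using lborel_integral_real_affine[of r ?h 0] r e0 by simp
  have eq: "?h (0 + r * y) = complex_of_real (1 / sqrt (2 * pi)) *
      (complex_of_real (exp (- (t * y\<^sup>2))) * exp (- (\<i> * complex_of_real (a * y))))" for y
    using r by (simp add: normal_density_def b_def scaleR_conv_of_real power_mult_distrib)
  have c: "complex_of_real (1 / sqrt (2 * pi)) \<noteq> 0" by simp
  from i1 show "integrable lborel (\<lambda>y. complex_of_real (exp (- (t * y\<^sup>2))) * exp (- (\<i> * complex_of_real (a * y))))"
    unfolding eq using integrable_mult_right[of "complex_of_real (sqrt (2 * pi))"] by fastforce
  have "(LINT y|lborel. complex_of_real (exp (- (t * y\<^sup>2))) * exp (- (\<i> * complex_of_real (a * y)))) =
     complex_of_real (exp (- b\<^sup>2 / 2) * sqrt (2 * pi) / r)"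
    using e1 r unfolding eq by (simp add: field_simps scaleR_conv_of_real)
  also have "exp (- b\<^sup>2 / 2) * sqrt (2 * pi) / r = sqrt (pi / t) * exp (- a\<^sup>2 / (4 * t))"
  proof -
    have "b\<^sup>2 / 2 = a\<^sup>2 / (4 * t)" using r by (simp add: b_def power_divide)
    moreover have "sqrt (2 * pi) / r = sqrt (pi / t)"
      unfolding r_def by (simp add: real_sqrt_divide[symmetric])
    ultimately show ?thesis by (metis mult.commute minus_divide_left times_divide_eq_right)
  qed
  finally show "(LINT y|lborel. complex_of_real (exp (- (t * y\<^sup>2))) * exp (- (\<i> * complex_of_real (a * y)))) =
      complex_of_real (sqrt (pi / t) * exp (- a\<^sup>2 / (4 * t)))" .
qed

text \<open>Lebesgue measure is the image of a product of one-dimensional measures under summation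
  over the basis, so a product of coordinate functions integrates factor by factor. This carries the
  Gaussian formula to dimension N.\<close>

lemma integral_lborel_prod_Basis:
  fixes f :: "'a::euclidean_space \<Rightarrow> real \<Rightarrow> complex"
  assumes "\<And>b. b \<in> Basis \<Longrightarrow> integrable lborel (f b)"
  shows "integrable lborel (\<lambda>x::'a. \<Prod>b\<in>Basis. f b (x \<bullet> b))"
    and "(LINT x|lborel. (\<Prod>b\<in>Basis. f b ((x::'a) \<bullet> b))) = (\<Prod>b\<in>Basis. (LINT x|lborel. f b x))"
proof -
  interpret product_sigma_finite "\<lambda>_::'a. lborel::real measure" by standard
  have m[measurable]: "f b \<in> borel_measurable borel" if "b \<in> Basis" for b
    using borel_measurable_integrable[OF assms[OF that]] by simp
  have eq: "(\<lambda>x. \<Prod>b\<in>Basis. f b ((\<Sum>b\<in>Basis. x b *\<^sub>R b) \<bullet> b)) = (\<lambda>x. \<Prod>b\<in>Basis. f b (x b))"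
    by (intro ext prod.cong) auto
  have m2: "(\<lambda>x::'a. \<Prod>b\<in>Basis. f b (x \<bullet> b)) \<in> borel_measurable borel" by measurable
  have m3: "(\<lambda>x. \<Sum>b\<in>Basis. x b *\<^sub>R b) \<in> measurable (\<Pi>\<^sub>M b\<in>(Basis::'a set). lborel) borel"
    by measurable
  show "integrable lborel (\<lambda>x::'a. \<Prod>b\<in>Basis. f b (x \<bullet> b))"
    apply (subst lborel_eq, subst integrable_distr_eq[OF m3 m2], subst eq)
    by (rule product_integrable_prod[OF finite_Basis assms])
  show "(LINT x|lborel. (\<Prod>b\<in>Basis. f b ((x::'a) \<bullet> b))) = (\<Prod>b\<in>Basis. (LINT x|lborel. f b x))"
    apply (subst lborel_eq, subst integral_distr[OF m3 m2], subst eq)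
    by (rule product_integral_prod[OF finite_Basis assms])
qed

lemma gaussian_fourier:
  fixes x :: "'a::euclidean_space"
  assumes t: "t > 0"
  shows "integrable lborel (\<lambda>\<xi>. complex_of_real (exp (- (t * (norm \<xi>)^2))) * wave x \<xi>)"
    and "(LINT \<xi>|lborel. complex_of_real (exp (- (t * (norm \<xi>)^2))) * wave x \<xi>) =
      complex_of_real ((pi / t) powr (real DIM('a) / 2) * exp (- (norm x)\<^sup>2 / (4 * t)))"
proof -
  let ?f = "\<lambda>b y. complex_of_real (exp (- (t * y\<^sup>2))) * exp (- (\<i> * complex_of_real ((x \<bullet> b) * y)))"
  have nrm: "(norm z)^2 = (\<Sum>b\<in>Basis. (z \<bullet> b)^2)" for z :: 'a
    by (subst power2_norm_eq_inner, subst euclidean_inner) (simp add: power2_eq_square)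
  have eq: "complex_of_real (exp (- (t * (norm \<xi>)^2))) * wave x \<xi> =
     (\<Prod>b\<in>Basis. ?f b (\<xi> \<bullet> b))" for \<xi> :: 'a
  proof -
    have "exp (- (t * (norm \<xi>)^2)) = (\<Prod>b\<in>Basis. exp (- (t * (\<xi> \<bullet> b)^2)))"
      by (simp add: nrm exp_sum[symmetric] sum_negf sum_distrib_left)
    moreover have "wave x \<xi> =
       (\<Prod>b\<in>Basis. exp (- (\<i> * complex_of_real ((x \<bullet> b) * (\<xi> \<bullet> b)))))"
      by (subst euclidean_inner) (simp add: exp_sum[symmetric] sum_negf sum_distrib_left)
    ultimately show ?thesis by (simp add: prod.distrib)
  qed
  show "integrable lborel (\<lambda>\<xi>. complex_of_real (exp (- (t * (norm \<xi>)^2))) * wave x \<xi>)"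
    unfolding eq by (rule integral_lborel_prod_Basis[OF gaussian_fourier_1d(1)[OF t]])
  have "(LINT \<xi>|lborel. complex_of_real (exp (- (t * (norm \<xi>)^2))) * wave x \<xi>) =
     (\<Prod>b\<in>Basis. complex_of_real (sqrt (pi / t) * exp (- (x \<bullet> b)\<^sup>2 / (4 * t))))"
    unfolding eq by (subst integral_lborel_prod_Basis(2)[OF gaussian_fourier_1d(1)[OF t]])
      (simp only: gaussian_fourier_1d(2)[OF t])
  also have "\<dots> = complex_of_real ((\<Prod>b\<in>(Basis::'a set). sqrt (pi / t)) * (\<Prod>b\<in>Basis. exp (- (x \<bullet> b)\<^sup>2 / (4 * t))))"
    by (simp add: prod.distrib)
  also have "(\<Prod>b\<in>Basis. exp (- (x \<bullet> b)\<^sup>2 / (4 * t))) = exp (- (norm x)\<^sup>2 / (4 * t))"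
    by (simp add: nrm exp_sum[symmetric] sum_negf sum_divide_distrib)
  also have "(\<Prod>b\<in>(Basis::'a set). sqrt (pi / t)) = (pi / t) powr (real DIM('a) / 2)"
    using t by (simp add: powr_half_sqrt[symmetric] powr_power mult.commute)
  finally show "(LINT \<xi>|lborel. complex_of_real (exp (- (t * (norm \<xi>)^2))) * wave x \<xi>) =
      complex_of_real ((pi / t) powr (real DIM('a) / 2) * exp (- (norm x)\<^sup>2 / (4 * t)))" .
qed

text \<open>The Gauss-Weierstrass kernel at time t. Its mass is 1 and its transform without the
  unitary factor is exp(-t|\<xi>|^2), so convolution with it is a smooth low-pass filter.\<close>

definition heat :: "real \<Rightarrow> 'a::euclidean_space \<Rightarrow> real" where
  "heat t x = (4 * pi * t) powr (- (real DIM('a) / 2)) * exp (- (norm x)\<^sup>2 / (4 * t))"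

lemma heat_nonneg [simp]: "0 \<le> heat t x" by (simp add: heat_def)
lemma heat_measurable [measurable]: "heat t \<in> borel_measurable borel"
  unfolding heat_def by measurable

lemma heat_measurable2 [measurable (raw)]:
  fixes g :: "'b \<Rightarrow> 'a::euclidean_space"
  assumes [measurable]: "f \<in> borel_measurable M" "g \<in> borel_measurable M"
  shows "(\<lambda>x. heat (f x) (g x)) \<in> borel_measurable M"
  unfolding heat_def by measurable

lemma heat_uminus [simp]: "heat t (- x) = heat t x"
  by (simp add: heat_def)

lemma heat_le: "t > 0 \<Longrightarrow> heat t (x::'a::euclidean_space) \<le> (4 * pi * t) powr (- (real DIM('a) / 2))"
  by (simp add: heat_def mult_left_le)

lemma heat_fourier:
  fixes \<xi> :: "'a::euclidean_space"
  assumes t: "t > 0"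
  shows "integrable lborel (heat t :: 'a \<Rightarrow> real)"
    and "(LINT x|lborel. wave x \<xi> * complex_of_real (heat t x)) = complex_of_real (exp (- (t * (norm \<xi>)^2)))"
proof -
  let ?c = "(4 * pi * t) powr (- (real DIM('a) / 2))"
  have t': "1 / (4 * t) > 0" using t by simp
  have eq: "wave x \<xi> * complex_of_real (heat t x) = complex_of_real ?c *
     (complex_of_real (exp (- (1 / (4 * t) * (norm x)^2))) * wave \<xi> x)" for x \<xi> :: 'a
    by (simp add: heat_def inner_commute mult_ac)
  have "integrable lborel (\<lambda>x::'a. exp (- (\<i> * complex_of_real (x \<bullet> 0))) * complex_of_real (heat t x))"
    unfolding eq by (intro integrable_mult_right gaussian_fourier(1)[OF t'])
  then have "integrable lborel (\<lambda>x::'a. complex_of_real (heat t x))" by simp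
  then show "integrable lborel (heat t :: 'a \<Rightarrow> real)"
    by (simp only: complex_of_real_integrable_eq)
  show "(LINT x|lborel. wave x \<xi> * complex_of_real (heat t x)) = complex_of_real (exp (- (t * (norm \<xi>)^2)))"
    unfolding eq integral_mult_right_zero gaussian_fourier(2)[OF t']
    using t by (simp add: powr_minus field_simps)
qed

lemma heat_integral: assumes "t > 0" shows "(LINT x|lborel. heat t (x::'a::euclidean_space)) = 1"
proof -
  have "complex_of_real (LINT x|lborel. heat t (x::'a)) = 1"
    using heat_fourier(2)[OF assms, of "0::'a"] by simp
  then show ?thesis using of_real_eq_1_iff by blast
qed

text \<open>The class in which all Fourier arguments run: integrability makes the pointwise integral
  \<open>fourier\<close> meaningful, and square integrability gives Plancherel. Square integrable
  functions vanishing outside a bounded set lie in it.\<close>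

definition L12 :: "('a::euclidean_space \<Rightarrow> real) set" where
  "L12 = {u. u \<in> borel_measurable borel \<and> integrable lborel u \<and> integrable lborel (\<lambda>x. (u x)^2)}"

lemma L12_D:
  assumes "u \<in> L12"
  shows "u \<in> borel_measurable borel" "integrable lborel u" "integrable lborel (\<lambda>x. (u x)^2)"
  using assms by (auto simp: L12_def)

section \<open>Elementary rules for the Fourier integral\<close>

lemma integrable_tensor:
  fixes f g :: "'a::euclidean_space \<Rightarrow> real"
  assumes f: "integrable lborel f" and g: "integrable lborel g"
  shows "integrable (lborel \<Otimes>\<^sub>M lborel) (\<lambda>(x, y). f x * g y)"
proof -
  have [measurable]: "f \<in> borel_measurable borel" "g \<in> borel_measurable borel"
    using f g by (auto dest: borel_measurable_integrable)
  show ?thesis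
  proof (rule lborel_pair.Fubini_integrable)
    show "(\<lambda>(x, y). f x * g y) \<in> borel_measurable (lborel \<Otimes>\<^sub>M lborel)" by measurable
    show "integrable lborel (\<lambda>x. LINT y|lborel. norm (case (x, y) of (x, y) \<Rightarrow> f x * g y))"
      using f by (simp add: abs_mult)
    show "AE x in lborel. integrable lborel (\<lambda>y. case (x, y) of (x, y) \<Rightarrow> f x * g y)"
      using g by simp
  qed
qed

lemma norm_iexp_minus [simp]: "norm (exp (- (\<i> * complex_of_real a))) = 1"
  by (simp add: norm_exp_eq_Re)

lemma cnj_measurable [measurable (raw)]:
  "f \<in> borel_measurable M \<Longrightarrow> (\<lambda>x. cnj (f x)) \<in> borel_measurable M"
  by (rule measurable_compose[of f M borel cnj])
     (auto intro!: borel_measurable_continuous_onI continuous_intros)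

lemma fourier_measurable [measurable]:
  assumes [measurable]: "u \<in> borel_measurable borel"
  shows "fourier u \<in> borel_measurable borel"
  unfolding fourier_def by measurable

lemma fourier_integrable:
  assumes "integrable lborel u"
  shows "integrable lborel (\<lambda>x. wave x \<xi> * complex_of_real (u x))"
proof -
  have [measurable]: "u \<in> borel_measurable borel"
    using assms by (auto dest: borel_measurable_integrable)
  show ?thesis
    by (rule Bochner_Integration.integrable_bound[OF assms]) (auto simp: norm_mult)
qed

lemma fourier_bound:
  fixes u :: "'a::euclidean_space \<Rightarrow> real"
  assumes u: "integrable lborel u"
  shows "norm (fourier u \<xi>) \<le> (2 * pi) powr (- (real DIM('a) / 2)) * (LINT x|lborel. \<bar>u x\<bar>)"
proof -
  have "norm (LINT x|lborel. wave x \<xi> * complex_of_real (u x)) \<le>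
     (LINT x|lborel. norm (wave x \<xi> * complex_of_real (u x)))"
    by (rule integral_norm_bound)
  then show ?thesis by (simp add: fourier_def norm_mult mult_left_mono)
qed

lemma fourier_diff:
  assumes "integrable lborel u" "integrable lborel v"
  shows "fourier (\<lambda>x. u x - v x) \<xi> = fourier u \<xi> - fourier v \<xi>"
  unfolding fourier_def
  using fourier_integrable[OF assms(1)] fourier_integrable[OF assms(2)]
  by (simp add: right_diff_distrib)

lemma fourier_add:
  assumes "integrable lborel u" "integrable lborel v"
  shows "fourier (\<lambda>x. u x + v x) \<xi> = fourier u \<xi> + fourier v \<xi>"
  unfolding fourier_def
  using fourier_integrable[OF assms(1)] fourier_integrable[OF assms(2)]
  by (simp add: distrib_left)

lemma fourier_scale: "fourier (\<lambda>x. c * u x) \<xi> = complex_of_real c * fourier u \<xi>"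
proof -
  have "(\<lambda>x. wave x \<xi> * complex_of_real (c * u x)) =
     (\<lambda>x. complex_of_real c * (wave x \<xi> * complex_of_real (u x)))"
    by (auto simp: mult_ac)
  then show ?thesis unfolding fourier_def by simp
qed

text \<open>Moving the transform from one factor to the other is Fubini for the absolutely
  integrable kernel u(x) g(\<xi>) exp(-i x.\<xi>). The weight g is complex valued so that it may
  itself contain a conjugated transform.\<close>

lemma fourier_multiplication:
  fixes u :: "'a::euclidean_space \<Rightarrow> real"
  assumes g: "integrable lborel g" and u: "integrable lborel u"
  shows "(LINT \<xi>|lborel. g \<xi> * fourier u \<xi>) = complex_of_real ((2 * pi) powr (- (real DIM('a) / 2))) *
     (LINT x|lborel. complex_of_real (u x) * (LINT \<xi>|lborel. g \<xi> * wave x \<xi>))"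
    and "integrable lborel (\<lambda>x. complex_of_real (u x) * (LINT \<xi>|lborel. g \<xi> * wave x \<xi>))"
proof -
  have [measurable]: "u \<in> borel_measurable borel" "g \<in> borel_measurable borel"
    using u g by (auto dest: borel_measurable_integrable)
  define F where "F = (\<lambda>(x, \<xi>). complex_of_real (u x) * (g \<xi> * wave x \<xi>))"
  have [measurable]: "F \<in> borel_measurable (lborel \<Otimes>\<^sub>M lborel)" unfolding F_def by measurable
  have iF: "integrable (lborel \<Otimes>\<^sub>M lborel) F"
    by (rule Bochner_Integration.integrable_bound[OF integrable_tensor[OF u integrable_norm[OF g]]])
       (auto simp: F_def norm_mult abs_mult)
  let ?c = "complex_of_real ((2 * pi) powr (- (real DIM('a) / 2)))"
  have "(LINT \<xi>|lborel. g \<xi> * fourier u \<xi>) = (LINT \<xi>|lborel. ?c * (LINT x|lborel. F (x, \<xi>)))"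
  proof (intro Bochner_Integration.integral_cong refl)
    fix \<xi> :: 'a
    have "(LINT x|lborel. F (x, \<xi>)) = (LINT x|lborel. g \<xi> * (wave x \<xi> * complex_of_real (u x)))"
      by (simp add: F_def mult_ac)
    then show "g \<xi> * fourier u \<xi> = ?c * (LINT x|lborel. F (x, \<xi>))"
      by (simp add: fourier_def mult_ac)
  qed
  also have "\<dots> = ?c * (LINT \<xi>|lborel. (LINT x|lborel. F (x, \<xi>)))" by simp
  also have "(LINT \<xi>|lborel. (LINT x|lborel. F (x, \<xi>))) = (LINT x|lborel. (LINT \<xi>|lborel. F (x, \<xi>)))"
    using lborel_pair.Fubini_integral[of "\<lambda>x \<xi>. F (x, \<xi>)"] iF by simp
  finally show "(LINT \<xi>|lborel. g \<xi> * fourier u \<xi>) = ?c *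
     (LINT x|lborel. complex_of_real (u x) * (LINT \<xi>|lborel. g \<xi> * wave x \<xi>))"
    by (simp add: F_def)
  show "integrable lborel (\<lambda>x. complex_of_real (u x) * (LINT \<xi>|lborel. g \<xi> * wave x \<xi>))"
    using lborel_pair.integrable_fst'[OF iF] by (simp add: F_def)
qed

text \<open>The Gaussian weight makes every integral absolutely convergent, so the multiplication
  formula applies twice, to v inside and to u outside. What remains is the transform of a Gaussian,
  which is again a heat kernel.\<close>

lemma gauss_fourier_heat:
  fixes u v :: "'a::euclidean_space \<Rightarrow> real"
  assumes t: "t > 0" and u: "integrable lborel u" and v: "integrable lborel v"
  shows "(LINT \<xi>|lborel. complex_of_real (exp (- (t * (norm \<xi>)^2))) * fourier u \<xi> * cnj (fourier v \<xi>)) =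
     complex_of_real (LINT x|lborel. u x * (LINT y|lborel. v y * heat t (x - y)))"
proof -
  have [measurable]: "u \<in> borel_measurable borel" "v \<in> borel_measurable borel"
    using u v by (auto dest: borel_measurable_integrable)
  define c where "c = (2 * pi) powr (- (real DIM('a) / 2))"
  let ?G = "\<lambda>\<xi>::'a. complex_of_real (exp (- (t * (norm \<xi>)^2)))"
  have G: "integrable lborel ?G"
    using gaussian_fourier(1)[OF t, of "0::'a"] by simp
  define K where "K = c * (LINT x|lborel. \<bar>v x\<bar>)"
  have K: "norm (fourier v \<xi>) \<le> K" for \<xi>
    using fourier_bound[OF v, of \<xi>] by (simp add: K_def c_def)
  have Gv: "integrable lborel (\<lambda>\<xi>. ?G \<xi> * cnj (fourier v \<xi>))"
  proof (rule Bochner_Integration.integrable_bound[OF integrable_mult_right[of "complex_of_real K", OF G]])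
    have "norm (fourier v \<xi>) \<le> \<bar>K\<bar>" for \<xi> using K[of \<xi>] by linarith
    then show "AE x in lborel. norm (?G x * cnj (fourier v x)) \<le> norm (complex_of_real K * ?G x)"
      by (simp add: norm_mult mult.commute mult_left_mono)
  qed measurable
  have inner: "(LINT \<xi>|lborel. ?G \<xi> * cnj (fourier v \<xi>) * wave x \<xi>) =
      complex_of_real (c * (LINT y|lborel. v y * ((pi / t) powr (real DIM('a) / 2) * exp (- (norm (x - y))\<^sup>2 / (4 * t)))))" for x
  proof -
    let ?g = "\<lambda>\<xi>. ?G \<xi> * exp (\<i> * complex_of_real (x \<bullet> \<xi>))"
    have g: "integrable lborel ?g"
      by (rule Bochner_Integration.integrable_bound[OF G]) (auto simp: norm_mult)
    have "(LINT \<xi>|lborel. ?G \<xi> * cnj (fourier v \<xi>) * wave x \<xi>) =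
       cnj (LINT \<xi>|lborel. ?g \<xi> * fourier v \<xi>)"
      unfolding Bochner_Integration.integral_cnj[symmetric] by (intro Bochner_Integration.integral_cong refl) (simp add: exp_cnj mult_ac)
    also have "\<dots> = cnj (complex_of_real c * (LINT y|lborel. complex_of_real (v y) *
        (LINT \<xi>|lborel. ?g \<xi> * wave y \<xi>)))"
      unfolding c_def by (subst fourier_multiplication(1)[OF g v]) simp
    also have "(\<lambda>y. (LINT \<xi>|lborel. ?g \<xi> * wave y \<xi>)) =
       (\<lambda>y. complex_of_real ((pi / t) powr (real DIM('a) / 2) * exp (- (norm (y - x))\<^sup>2 / (4 * t))))"
    proof
      fix y
      have "(LINT \<xi>|lborel. ?g \<xi> * wave y \<xi>) =
        (LINT \<xi>|lborel. ?G \<xi> * wave (y - x) \<xi>)"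
        by (intro Bochner_Integration.integral_cong refl)
           (simp add: inner_diff_left mult_exp_exp right_diff_distrib)
      then show "(LINT \<xi>|lborel. ?g \<xi> * wave y \<xi>) =
         complex_of_real ((pi / t) powr (real DIM('a) / 2) * exp (- (norm (y - x))\<^sup>2 / (4 * t)))"
        unfolding gaussian_fourier(2)[OF t] by simp
    qed
    also have "(LINT y|lborel. complex_of_real (v y) * complex_of_real ((pi / t) powr (real DIM('a) / 2) * exp (- (norm (y - x))\<^sup>2 / (4 * t)))) =
      complex_of_real (LINT y|lborel. v y * ((pi / t) powr (real DIM('a) / 2) * exp (- (norm (x - y))\<^sup>2 / (4 * t))))"
      unfolding of_real_mult[symmetric] norm_minus_commute[of _ x] by (rule integral_complex_of_real)
    finally show ?thesis by simp
  qed
  have "(LINT \<xi>|lborel. ?G \<xi> * fourier u \<xi> * cnj (fourier v \<xi>)) =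
    (LINT \<xi>|lborel. ?G \<xi> * cnj (fourier v \<xi>) * fourier u \<xi>)"
    by (intro Bochner_Integration.integral_cong refl) (simp add: mult_ac)
  also have "\<dots> = complex_of_real c * (LINT x|lborel. complex_of_real (u x) *
     complex_of_real (c * (LINT y|lborel. v y * ((pi / t) powr (real DIM('a) / 2) * exp (- (norm (x - y))\<^sup>2 / (4 * t))))))"
    unfolding fourier_multiplication(1)[OF Gv u] inner c_def ..
  also have "\<dots> = complex_of_real (LINT x|lborel. c * (u x * (c * (LINT y|lborel. v y * ((pi / t) powr (real DIM('a) / 2) * exp (- (norm (x - y))\<^sup>2 / (4 * t)))))))"
    unfolding of_real_mult[symmetric] integral_complex_of_real by simp
  also have "(LINT x|lborel. c * (u x * (c * (LINT y|lborel. v y * ((pi / t) powr (real DIM('a) / 2) * exp (- (norm (x - y))\<^sup>2 / (4 * t))))))) =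
    (LINT x|lborel. u x * (LINT y|lborel. v y * heat t (x - y)))"
  proof (intro Bochner_Integration.integral_cong refl)
    fix x
    \<comment> \<open>The two unitary factors (2 pi)^(-N/2) and the Gaussian integral combine to
      exactly the normalisation of \<open>heat\<close>.\<close>
    have cc: "c * c * (pi / t) powr (real DIM('a) / 2) = (4 * pi * t) powr (- (real DIM('a) / 2))"
    proof -
      have "c * c * (pi / t) powr (real DIM('a) / 2) = ((2 * pi) * (2 * pi)) powr (- (real DIM('a) / 2)) * (t / pi) powr (- (real DIM('a) / 2))"
        using t unfolding c_def by (subst powr_mult) (auto simp: powr_minus powr_divide divide_simps)
      also have "\<dots> = ((2 * pi) * (2 * pi) * (t / pi)) powr (- (real DIM('a) / 2))"
        using t by (subst (2) powr_mult) auto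
      also have "(2 * pi) * (2 * pi) * (t / pi) = 4 * pi * t" by simp
      finally show ?thesis .
    qed
    have "(\<lambda>y. v y * heat t (x - y)) = (\<lambda>y. c * c * (v y * ((pi / t) powr (real DIM('a) / 2) * exp (- (norm (x - y))\<^sup>2 / (4 * t)))))"
      unfolding heat_def cc[symmetric] by (auto simp: mult_ac)
    then show "c * (u x * (c * (LINT y|lborel. v y * ((pi / t) powr (real DIM('a) / 2) * exp (- (norm (x - y))\<^sup>2 / (4 * t)))))) =
       u x * (LINT y|lborel. v y * heat t (x - y))"
      by (simp add: mult_ac)
  qed
  finally show ?thesis .
qed

subsection \<open>Plancherel's theorem\<close>

lemma nn_integral_shift:
  fixes f :: "'a::euclidean_space \<Rightarrow> ennreal"
  assumes [measurable]: "f \<in> borel_measurable borel"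
  shows "(\<integral>\<^sup>+x. f (c + x) \<partial>lborel) = (\<integral>\<^sup>+x. f x \<partial>lborel)"
  by (subst (2) lborel_distr_plus[of c, symmetric]) (simp add: nn_integral_distr)

lemma nn_integral_reflect:
  fixes f :: "'a::euclidean_space \<Rightarrow> ennreal"
  assumes [measurable]: "f \<in> borel_measurable borel"
  shows "(\<integral>\<^sup>+x. f (c - x) \<partial>lborel) = (\<integral>\<^sup>+x. f x \<partial>lborel)"
proof -
  have "lborel = distr lborel borel (\<lambda>x::'a. c - x)"
    using lborel_affine[of "-1" c] by (simp add: density_1)
  then have "(\<integral>\<^sup>+x. f x \<partial>lborel) = (\<integral>\<^sup>+x. f x \<partial>distr lborel borel (\<lambda>x::'a. c - x))" by simp
  then show ?thesis by (simp add: nn_integral_distr)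
qed

lemma integrable_reflect:
  fixes f :: "'a::euclidean_space \<Rightarrow> real"
  assumes f: "integrable lborel f"
  shows "integrable lborel (\<lambda>x. f (c - x))" "(LINT x|lborel. f (c - x)) = (LINT x|lborel. f x)"
proof -
  have [measurable]: "f \<in> borel_measurable borel" using f by (auto dest: borel_measurable_integrable)
  have *: "lborel = distr lborel borel (\<lambda>x::'a. c - x)"
    using lborel_affine[of "-1" c] by (simp add: density_1)
  have "integrable (distr lborel borel (\<lambda>x::'a. c - x)) f" using * f by simp
  then show "integrable lborel (\<lambda>x. f (c - x))" by (subst (asm) integrable_distr_eq) auto
  have "(LINT x|lborel. f x) = (LINT x|distr lborel borel (\<lambda>x::'a. c - x). f x)" using * by simp
  then show "(LINT x|lborel. f (c - x)) = (LINT x|lborel. f x)" by (subst (asm) integral_distr) auto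
qed

text \<open>Truncating u in value and in space leaves a bounded function of bounded support.
  Continuous functions converge to it almost everywhere, and clipping them makes dominated
  convergence apply.\<close>

lemma L2_approx_continuous:
  fixes u :: "'a::euclidean_space \<Rightarrow> real"
  assumes um[measurable]: "u \<in> borel_measurable borel" and u2: "integrable lborel (\<lambda>x. (u x)^2)" and e: "e > 0"
  obtains g R where "continuous_on UNIV g" "R > 0" "\<And>x. \<bar>g x\<bar> \<le> R" "\<And>x. norm x > R \<Longrightarrow> g x = 0"
    "(\<integral>\<^sup>+x. ennreal ((u x - g x)^2) \<partial>lborel) < ennreal e"
proof -
  define v where "v n x = (if \<bar>u x\<bar> \<le> real n \<and> norm x \<le> real n then u x else 0)" for n :: nat and x
  have [measurable]: "v n \<in> borel_measurable borel" for n unfolding v_def by measurable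
  have "(\<lambda>n. \<integral>\<^sup>+x. ennreal ((u x - v n x)^2) \<partial>lborel) \<longlonglongrightarrow> (\<integral>\<^sup>+x. 0 \<partial>(lborel::'a measure))"
  proof (rule nn_integral_dominated_convergence)
    show "AE x in lborel. ennreal ((u x - v n x)^2) \<le> ennreal ((u x)^2)" for n
      by (auto simp: v_def)
    show "(\<integral>\<^sup>+x. ennreal ((u x)^2) \<partial>lborel) < \<infinity>"
      using u2 by (simp add: integrable_iff_bounded)
    have "(\<lambda>n. ennreal ((u x - v n x)^2)) \<longlonglongrightarrow> 0" for x
    proof -
      have "eventually (\<lambda>n. \<bar>u x\<bar> \<le> real n \<and> norm x \<le> real n) sequentially"
        by (intro eventually_conj) (auto intro!: filterlim_at_top[THEN iffD1, rule_format, OF filterlim_real_sequentially])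
      then have "eventually (\<lambda>n. ennreal ((u x - v n x)^2) = 0) sequentially"
        by eventually_elim (simp add: v_def)
      then show ?thesis by (simp add: tendsto_eventually)
    qed
    then show "AE x in lborel. (\<lambda>n. ennreal ((u x - v n x)^2)) \<longlonglongrightarrow> 0" by simp
  qed auto
  then have "eventually (\<lambda>n. (\<integral>\<^sup>+x. ennreal ((u x - v n x)^2) \<partial>lborel) < ennreal (e / 8)) sequentially"
    using e by (intro order_tendstoD(2)) auto
  then obtain n where n: "(\<integral>\<^sup>+x. ennreal ((u x - v n x)^2) \<partial>lborel) < ennreal (e / 8)"
    using eventually_happens'[OF sequentially_bot] by blast
  let ?w = "v n"
  \<comment> \<open>The extra 1 leaves room for a tent cutoff that equals 1 on the ball of radius n
    and vanishes beyond R, so clipping does not change the limit.\<close>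
  define R where "R = real n + 1"
  have "?w \<in> borel_measurable lborel" by simp
  then have "?w \<in> borel_measurable lebesgue" by (rule measurable_completion)
  then have "?w measurable_on UNIV" by (rule lebesgue_measurable_imp_measurable_on) simp
  then obtain N g where N: "negligible N" and gc: "\<And>k. continuous_on UNIV (g k)"
    and gl: "\<And>x. x \<notin> N \<Longrightarrow> (\<lambda>k. g k x) \<longlonglongrightarrow> ?w x"
    unfolding measurable_on_def by auto
  define h where "h k x = max (- R) (min R (g k x)) * max 0 (min 1 (R - norm x))" for k :: nat and x :: 'a
  have hc: "continuous_on UNIV (h k)" for k
    unfolding h_def by (intro continuous_intros gc)
  have [measurable]: "h k \<in> borel_measurable borel" for k
    using hc by (rule borel_measurable_continuous_onI)
  have hb: "\<bar>h k x\<bar> \<le> R" for k x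
  proof -
    have "\<bar>h k x\<bar> = \<bar>max (- R) (min R (g k x))\<bar> * \<bar>max 0 (min 1 (R - norm x))\<bar>"
      by (simp add: h_def abs_mult)
    also have "\<dots> \<le> R * 1"
      by (intro mult_mono) (auto simp: R_def abs_le_iff)
    finally show ?thesis by simp
  qed
  have hz: "h k x = 0" if "norm x > R" for k x
    using that by (auto simp: h_def)
  have N0: "AE x in lborel. x \<notin> N"
    using AE_not_in[OF N[unfolded negligible_iff_null_sets]] by (simp add: AE_completion_iff)
  have [measurable]: "(indicator (cball (0::'a) R) :: 'a \<Rightarrow> ennreal) \<in> borel_measurable borel"
    by (intro borel_measurable_indicator borel_closed closed_cball)
  have "(\<lambda>k. \<integral>\<^sup>+x. ennreal ((?w x - h k x)^2) \<partial>lborel) \<longlonglongrightarrow> (\<integral>\<^sup>+x. 0 \<partial>(lborel::'a measure))"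
  proof (rule nn_integral_dominated_convergence)
    show "AE x in lborel. ennreal ((?w x - h k x)^2) \<le> ennreal ((2 * R)^2) * indicator (cball 0 R) x" for k
    proof (rule AE_I2)
      fix x :: 'a
      show "ennreal ((?w x - h k x)^2) \<le> ennreal ((2 * R)^2) * indicator (cball 0 R) x"
      proof (cases "norm x \<le> R")
        case True
        have "\<bar>?w x\<bar> \<le> R" by (auto simp: v_def R_def)
        then have "\<bar>?w x - h k x\<bar> \<le> 2 * R" using hb[of k x] by linarith
        then have "(?w x - h k x)^2 \<le> (2 * R)^2" by (metis abs_ge_zero power2_abs power_mono)
        then show ?thesis using True by (simp add: ennreal_leI)
      next
        case False
        then have "?w x = 0" "h k x = 0" using hz[of x k] by (auto simp: v_def R_def)
        then show ?thesis by simp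
      qed
    qed
    show "(\<integral>\<^sup>+x. ennreal ((2 * R)^2) * indicator (cball 0 R) x \<partial>(lborel::'a measure)) < \<infinity>"
      using emeasure_bounded_finite[of "cball (0::'a) R"] by (simp add: nn_integral_cmult_indicator ennreal_mult_less_top)
    have "(\<lambda>k. ennreal ((?w x - h k x)^2)) \<longlonglongrightarrow> 0" if "x \<notin> N" for x
    proof -
      have "(\<lambda>k. h k x) \<longlonglongrightarrow> max (- R) (min R (?w x)) * max 0 (min 1 (R - norm x))"
        unfolding h_def by (intro tendsto_intros gl that)
      also have "max (- R) (min R (?w x)) * max 0 (min 1 (R - norm x)) = ?w x"
        by (auto simp: v_def R_def)
      finally have "(\<lambda>k. (?w x - h k x)^2) \<longlonglongrightarrow> (?w x - ?w x)\<^sup>2"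
        by (intro tendsto_intros)
      then have "(\<lambda>k. ennreal ((?w x - h k x)^2)) \<longlonglongrightarrow> ennreal ((?w x - ?w x)^2)"
        by (rule tendsto_ennrealI)
      then show ?thesis by simp
    qed
    then show "AE x in lborel. (\<lambda>k. ennreal ((?w x - h k x)^2)) \<longlonglongrightarrow> 0" using N0 by auto
  qed auto
  then have "eventually (\<lambda>k. (\<integral>\<^sup>+x. ennreal ((?w x - h k x)^2) \<partial>lborel) < ennreal (e / 8)) sequentially"
    using e by (intro order_tendstoD(2)) auto
  then obtain k where k: "(\<integral>\<^sup>+x. ennreal ((?w x - h k x)^2) \<partial>lborel) < ennreal (e / 8)"
    using eventually_happens'[OF sequentially_bot] by blast
  have "(\<integral>\<^sup>+x. ennreal ((u x - h k x)^2) \<partial>lborel) \<le>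
     (\<integral>\<^sup>+x. 2 * ennreal ((u x - ?w x)^2) + 2 * ennreal ((?w x - h k x)^2) \<partial>lborel)"
  proof (rule nn_integral_mono)
    fix x
    have "(u x - h k x)^2 \<le> 2 * (u x - ?w x)^2 + 2 * (?w x - h k x)^2"
      using sum_squares_bound[of "u x - ?w x" "?w x - h k x"] by (simp add: power2_eq_square algebra_simps)
    then have "ennreal ((u x - h k x)^2) \<le> ennreal (2 * (u x - ?w x)^2 + 2 * (?w x - h k x)^2)"
      by (rule ennreal_leI)
    then show "ennreal ((u x - h k x)^2) \<le> 2 * ennreal ((u x - ?w x)^2) + 2 * ennreal ((?w x - h k x)^2)"
      by (simp add: ennreal_mult')
  qed
  also have "\<dots> = 2 * (\<integral>\<^sup>+x. ennreal ((u x - ?w x)^2) \<partial>lborel) + 2 * (\<integral>\<^sup>+x. ennreal ((?w x - h k x)^2) \<partial>lborel)"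
    by (subst nn_integral_add) (auto simp: nn_integral_cmult)
  also have "\<dots> \<le> 2 * ennreal (e / 8) + 2 * ennreal (e / 8)"
    using n k by (intro add_mono mult_left_mono) auto
  also have "2 * ennreal (e / 8) = ennreal (e / 4)"
    using e by (subst ennreal_numeral[symmetric], subst ennreal_mult[symmetric]) auto
  also have "ennreal (e / 4) + ennreal (e / 4) < ennreal e"
    using e by (subst ennreal_plus[symmetric]) (auto intro!: ennreal_lessI)
  finally show ?thesis
    using that[of "h k" R] hc hb hz by (auto simp: R_def)
qed

lemma L2_translation_bound:
  fixes u :: "'a::euclidean_space \<Rightarrow> real"
  assumes um[measurable]: "u \<in> borel_measurable borel"
  shows "(\<integral>\<^sup>+x. ennreal ((u x - u (x - z))^2) \<partial>lborel) \<le> 4 * (\<integral>\<^sup>+x. ennreal ((u x)^2) \<partial>lborel)"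
proof -
  have "(\<integral>\<^sup>+x. ennreal ((u x - u (x - z))^2) \<partial>lborel) \<le>
     (\<integral>\<^sup>+x. 2 * ennreal ((u x)^2) + 2 * ennreal ((u (- z + x))^2) \<partial>lborel)"
  proof (rule nn_integral_mono)
    fix x
    have "(u x - u (x - z))^2 \<le> 2 * (u x)^2 + 2 * (u (x - z))^2"
      using sum_squares_bound[of "u x" "- u (x - z)"] by (simp add: power2_eq_square algebra_simps)
    then have "ennreal ((u x - u (x - z))^2) \<le> ennreal (2 * (u x)^2 + 2 * (u (x - z))^2)"
      by (rule ennreal_leI)
    then show "ennreal ((u x - u (x - z))^2) \<le> 2 * ennreal ((u x)^2) + 2 * ennreal ((u (- z + x))^2)"
      by (simp add: ennreal_mult')
  qed
  also have "\<dots> = 2 * (\<integral>\<^sup>+x. ennreal ((u x)^2) \<partial>lborel) + 2 * (\<integral>\<^sup>+x. ennreal ((u (- z + x))^2) \<partial>lborel)"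
    by (subst nn_integral_add) (auto simp: nn_integral_cmult)
  also have "(\<integral>\<^sup>+x. ennreal ((u (- z + x))^2) \<partial>lborel) = (\<integral>\<^sup>+x. ennreal ((u x)^2) \<partial>lborel)"
    by (rule nn_integral_shift[of "\<lambda>x. ennreal ((u x)^2)"]) measurable
  finally show ?thesis by (simp add: distrib_right[symmetric])
qed

text \<open>For a continuous g of bounded support this is dominated convergence along a sequence of
  shifts; u inherits it because shifting preserves the distance from u to g.\<close>

lemma L2_translation_continuous:
  fixes u :: "'a::euclidean_space \<Rightarrow> real"
  assumes um[measurable]: "u \<in> borel_measurable borel" and u2: "integrable lborel (\<lambda>x. (u x)^2)" and e: "e > 0"
  obtains d where "d > 0" "\<And>z. norm z < d \<Longrightarrow> (\<integral>\<^sup>+x. ennreal ((u x - u (x - z))^2) \<partial>lborel) \<le> ennreal e"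
proof -
  \<comment> \<open>Squaring a sum of three terms costs a factor 3 for each of them, so the total is
    9 e/12, below e.\<close>
  from e have e': "e / 12 > 0" by simp
  from L2_approx_continuous[OF um u2 e'] obtain g R where gc: "continuous_on UNIV g" and R: "R > 0"
    and gb: "\<And>x. \<bar>g x\<bar> \<le> R" and gz: "\<And>x. norm x > R \<Longrightarrow> g x = 0"
    and ug: "(\<integral>\<^sup>+x. ennreal ((u x - g x)^2) \<partial>lborel) < ennreal (e / 12)" by blast
  have [measurable]: "g \<in> borel_measurable borel" using gc by (rule borel_measurable_continuous_onI)
  define T where "T z = (\<integral>\<^sup>+x. ennreal ((g x - g (x - z))^2) \<partial>lborel)" for z
  have "\<exists>d>0. \<forall>z. norm z < d \<longrightarrow> T z < ennreal (e / 12)"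
  proof (rule ccontr)
    assume "\<not> ?thesis"
    then have "\<forall>n::nat. \<exists>z. norm z < 1 / Suc n \<and> \<not> T z < ennreal (e / 12)" by force
    then obtain z where z: "\<And>n::nat. norm (z n) < 1 / Suc n" and zT: "\<And>n. \<not> T (z n) < ennreal (e / 12)"
      by metis
    have z0: "z \<longlonglongrightarrow> 0"
    proof (rule Lim_null_comparison)
      show "eventually (\<lambda>n. norm (z n) \<le> 1 / Suc n) sequentially" using less_imp_le[OF z] by simp
      show "(\<lambda>n. 1 / real (Suc n)) \<longlonglongrightarrow> 0" by (rule LIMSEQ_Suc) (rule lim_1_over_n)
    qed
    have zn1: "norm (z n) < 1" for n using z[of n] by (rule less_le_trans) simp
    have [measurable]: "(indicator (cball (0::'a) (R + 1)) :: 'a \<Rightarrow> ennreal) \<in> borel_measurable borel"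
      by (intro borel_measurable_indicator borel_closed closed_cball)
    have "(\<lambda>n. T (z n)) \<longlonglongrightarrow> (\<integral>\<^sup>+x. 0 \<partial>(lborel::'a measure))"
      unfolding T_def
    proof (rule nn_integral_dominated_convergence)
      show "AE x in lborel. ennreal ((g x - g (x - z n))^2) \<le> ennreal ((2 * R)^2) * indicator (cball 0 (R + 1)) x" for n
      proof (rule AE_I2)
        fix x :: 'a
        show "ennreal ((g x - g (x - z n))^2) \<le> ennreal ((2 * R)^2) * indicator (cball 0 (R + 1)) x"
        proof (cases "norm x \<le> R + 1")
          case True
          have "\<bar>g x - g (x - z n)\<bar> \<le> 2 * R" using gb[of x] gb[of "x - z n"] by linarith
          then have "(g x - g (x - z n))^2 \<le> (2 * R)^2" by (metis abs_ge_zero power2_abs power_mono)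
          then show ?thesis using True by (simp add: ennreal_leI)
        next
          case False
          have "norm x \<le> norm (x - z n) + norm (z n)" by norm
          then have "g x = 0" "g (x - z n) = 0" using False zn1[of n] by (auto intro!: gz)
          then show ?thesis by simp
        qed
      qed
      show "(\<integral>\<^sup>+x. ennreal ((2 * R)^2) * indicator (cball 0 (R + 1)) x \<partial>(lborel::'a measure)) < \<infinity>"
        using emeasure_bounded_finite[of "cball (0::'a) (R + 1)"] by (simp add: nn_integral_cmult_indicator ennreal_mult_less_top)
      have "(\<lambda>n. ennreal ((g x - g (x - z n))^2)) \<longlonglongrightarrow> 0" for x
      proof -
        have c: "isCont g (x - 0)" using gc by (simp add: continuous_on_eq_continuous_at)
        have "(\<lambda>n. g (x - z n)) \<longlonglongrightarrow> g (x - 0)"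
          by (rule isCont_tendsto_compose[OF c]) (intro tendsto_intros z0)
        then have "(\<lambda>n. (g x - g (x - z n))^2) \<longlonglongrightarrow> (g x - g (x - 0))\<^sup>2"
          by (intro tendsto_intros)
        from tendsto_ennrealI[OF this] show ?thesis by simp
      qed
      then show "AE x in lborel. (\<lambda>n. ennreal ((g x - g (x - z n))^2)) \<longlonglongrightarrow> 0" by simp
    qed simp_all
    then have "eventually (\<lambda>n. T (z n) < ennreal (e / 12)) sequentially"
      using e by (intro order_tendstoD(2)) auto
    then show False using zT eventually_happens'[OF sequentially_bot] by blast
  qed
  then obtain d where d: "d > 0" "\<And>z. norm z < d \<Longrightarrow> T z < ennreal (e / 12)" by blast
  show ?thesis
  proof (rule that[OF d(1)])
    fix z :: 'a assume z: "norm z < d"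
    have "(\<integral>\<^sup>+x. ennreal ((u x - u (x - z))^2) \<partial>lborel) \<le>
       (\<integral>\<^sup>+x. 3 * ennreal ((u x - g x)^2) + 3 * ennreal ((g x - g (x - z))^2) + 3 * ennreal ((u (- z + x) - g (- z + x))^2) \<partial>lborel)"
    proof (rule nn_integral_mono)
      fix x
      have tri: "(a + b - c)^2 \<le> 3 * a\<^sup>2 + 3 * b\<^sup>2 + 3 * c\<^sup>2" for a b c :: real
        using sum_squares_bound[of a b] sum_squares_bound[of a "-c"] sum_squares_bound[of b "-c"]
        by (simp add: power2_eq_square algebra_simps)
      have "(u x - u (x - z))^2 \<le> 3 * (u x - g x)^2 + 3 * (g x - g (x - z))^2 + 3 * (u (x - z) - g (x - z))^2"
        using tri[of "u x - g x" "g x - g (x - z)" "u (x - z) - g (x - z)"] by simp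
      then have "ennreal ((u x - u (x - z))^2) \<le> ennreal (3 * (u x - g x)^2 + 3 * (g x - g (x - z))^2 + 3 * (u (x - z) - g (x - z))^2)"
        by (rule ennreal_leI)
      then show "ennreal ((u x - u (x - z))^2) \<le> 3 * ennreal ((u x - g x)^2) + 3 * ennreal ((g x - g (x - z))^2) + 3 * ennreal ((u (- z + x) - g (- z + x))^2)"
        by (simp add: ennreal_mult')
    qed
    also have "\<dots> = 3 * (\<integral>\<^sup>+x. ennreal ((u x - g x)^2) \<partial>lborel) + 3 * T z + 3 * (\<integral>\<^sup>+x. ennreal ((u (- z + x) - g (- z + x))^2) \<partial>lborel)"
      by (simp add: nn_integral_add nn_integral_cmult T_def)
    also have "(\<integral>\<^sup>+x. ennreal ((u (- z + x) - g (- z + x))^2) \<partial>lborel) = (\<integral>\<^sup>+x. ennreal ((u x - g x)^2) \<partial>lborel)"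
      by (rule nn_integral_shift[of "\<lambda>x. ennreal ((u x - g x)^2)"]) measurable
    also have "3 * (\<integral>\<^sup>+x. ennreal ((u x - g x)^2) \<partial>lborel) + 3 * T z + 3 * (\<integral>\<^sup>+x. ennreal ((u x - g x)^2) \<partial>lborel)
       \<le> 3 * ennreal (e / 12) + 3 * ennreal (e / 12) + 3 * ennreal (e / 12)"
      using ug d(2)[OF z] by (intro add_mono mult_left_mono) auto
    also have "3 * ennreal (e / 12) = ennreal (e / 4)"
      using e by (subst ennreal_numeral[symmetric], subst ennreal_mult[symmetric]) auto
    also have "ennreal (e / 4) + ennreal (e / 4) + ennreal (e / 4) \<le> ennreal e"
      using e by (subst ennreal_plus[symmetric], simp, simp)+ (auto intro!: ennreal_leI)
    finally show "(\<integral>\<^sup>+x. ennreal ((u x - u (x - z))^2) \<partial>lborel) \<le> ennreal e" .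
  qed
qed

section \<open>The heat quadratic form and its small-time limit\<close>

lemma heat_second_moment:
  fixes z :: "'a::euclidean_space"
  assumes t: "t > 0"
  shows "(norm z)^2 * heat t z \<le> 4 * t * 2 powr (real DIM('a) / 2) * heat (2 * t) z"
proof -
  define y where "y = (norm z)^2 / (4 * t)"
  have y0: "y \<ge> 0" using t by (simp add: y_def)
  \<comment> \<open>The elementary bound y exp(-y) \<le> exp(-y/2) trades the factor |z|^2 for a
    doubled time, so no second moment has to be computed.\<close>
  have "y \<le> (1 + y / 4)^2" using zero_le_power2[of "1 - y / 4"] by (simp add: power2_eq_square algebra_simps)
  also have "\<dots> \<le> (exp (y / 4))^2" using y0 exp_ge_add_one_self[of "y/4"] by (intro power_mono) auto
  also have "\<dots> = exp (y / 2)" by (simp add: power2_eq_square mult_exp_exp)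
  finally have "y * exp (- y) \<le> exp (y / 2) * exp (- y)" by (intro mult_right_mono) auto
  also have "\<dots> = exp (- y / 2)" by (simp add: mult_exp_exp)
  finally have *: "y * exp (- y) \<le> exp (- y / 2)" .
  have n: "(norm z)^2 = 4 * t * y" using t by (simp add: y_def)
  have e1: "exp (- (norm z)\<^sup>2 / (4 * t)) = exp (- y)" by (simp add: y_def)
  have e2: "exp (- (norm z)\<^sup>2 / (4 * (2 * t))) = exp (- y / 2)" by (simp add: y_def)
  have c: "(4 * pi * t) powr (- (real DIM('a) / 2)) = 2 powr (real DIM('a) / 2) * (4 * pi * (2 * t)) powr (- (real DIM('a) / 2))"
  proof -
    have "4 * pi * t = (4 * pi * (2 * t)) / 2" by simp
    then have "(4 * pi * t) powr (- (real DIM('a) / 2)) = (4 * pi * (2 * t)) powr (- (real DIM('a) / 2)) / 2 powr (- (real DIM('a) / 2))"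
      using t by (metis less_eq_real_def mult_pos_pos pi_gt_zero powr_divide zero_less_numeral)
    then show ?thesis by (simp add: powr_minus field_simps)
  qed
  have "(norm z)^2 * heat t z = (4 * t * (4 * pi * t) powr (- (real DIM('a) / 2))) * (y * exp (- y))"
    by (simp add: heat_def e1 n mult_ac)
  also have "\<dots> \<le> (4 * t * (4 * pi * t) powr (- (real DIM('a) / 2))) * exp (- y / 2)"
    using t * by (intro mult_left_mono) auto
  also have "\<dots> = 4 * t * 2 powr (real DIM('a) / 2) * heat (2 * t) z"
    unfolding heat_def e2 c by (simp add: mult_ac)
  finally show ?thesis .
qed

lemma heat_nn_integral:
  assumes "t > 0"
  shows "(\<integral>\<^sup>+x. ennreal (heat t (x::'a::euclidean_space)) \<partial>lborel) = 1"
  using heat_fourier(1)[OF assms] heat_integral[OF assms] by (subst nn_integral_eq_integral) auto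

lemma heat_second_moment_nn:
  assumes t: "t > 0"
  shows "(\<integral>\<^sup>+z. ennreal ((norm z)^2 * heat t (z::'a::euclidean_space)) \<partial>lborel) \<le> ennreal (4 * 2 powr (real DIM('a) / 2) * t)"
proof -
  have "(\<integral>\<^sup>+z. ennreal ((norm z)^2 * heat t (z::'a)) \<partial>lborel) \<le>
     (\<integral>\<^sup>+z. ennreal (4 * t * 2 powr (real DIM('a) / 2)) * ennreal (heat (2 * t) (z::'a)) \<partial>lborel)"
    using heat_second_moment[OF t] t by (intro nn_integral_mono) (auto simp: ennreal_mult'[symmetric] intro!: ennreal_leI)
  also have "\<dots> = ennreal (4 * t * 2 powr (real DIM('a) / 2))"
    using t by (simp add: nn_integral_cmult heat_nn_integral)
  finally show ?thesis by (simp add: mult_ac)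
qed

text \<open>Expanding the square and using that the kernel has mass 1 gives the first identity, and
  the substitution z = x - y gives the second. The last inequality is nonnegativity of the form; it
  allows the extended value to be read as a real number.\<close>

lemma heat_form_differences:
  fixes u :: "'a::euclidean_space \<Rightarrow> real"
  assumes t: "t > 0" and um[measurable]: "u \<in> borel_measurable borel" and u2: "integrable lborel (\<lambda>x. (u x)^2)"
  shows "(\<integral>\<^sup>+x. (\<integral>\<^sup>+y. ennreal ((u x - u y)^2 * heat t (x - y)) \<partial>lborel) \<partial>lborel) =
     ennreal (2 * mass u - 2 * (LINT x|lborel. u x * (LINT y|lborel. u y * heat t (x - y))))"
    and "(\<integral>\<^sup>+x. (\<integral>\<^sup>+y. ennreal ((u x - u y)^2 * heat t (x - y)) \<partial>lborel) \<partial>lborel) =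
      (\<integral>\<^sup>+z. ennreal (heat t z) * (\<integral>\<^sup>+x. ennreal ((u x - u (x - z))^2) \<partial>lborel) \<partial>lborel)"
    and "2 * (LINT x|lborel. u x * (LINT y|lborel. u y * heat t (x - y))) \<le> 2 * mass u"
proof -
  let ?M = "lborel \<Otimes>\<^sub>M (lborel :: 'a measure)"
  define A where "A = mass u"
  define P where "P = (LINT x|lborel. u x * (LINT y|lborel. u y * heat t (x - y)))"
  have h1: "integrable lborel (\<lambda>y::'a. heat t (x - y))" "(LINT y|lborel. heat t (x - y)) = 1" for x :: 'a
    using integrable_reflect(1)[OF heat_fourier(1)[OF t], of x]
      integrable_reflect(2)[OF heat_fourier(1)[OF t], of x] heat_integral[OF t, where 'a='a] by simp_all
  have I1: "integrable ?M (\<lambda>(x, y). (u x)^2 * heat t (x - y))"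
  proof (rule lborel_pair.Fubini_integrable)
    show "integrable lborel (\<lambda>x. LINT y|lborel. norm (case (x, y) of (x, y) \<Rightarrow> (u x)\<^sup>2 * heat t (x - y)))"
      using u2 h1 by simp
    show "AE x in lborel. integrable lborel (\<lambda>y. case (x, y) of (x, y) \<Rightarrow> (u x)\<^sup>2 * heat t (x - y))"
      using h1 by simp
  qed measurable
  have L1: "integral\<^sup>L ?M (\<lambda>(x, y). (u x)^2 * heat t (x - y)) = A"
    using lborel_pair.integral_fst'[OF I1] h1 by (simp add: A_def)
  have sw: "(\<lambda>(x, y). (u y)^2 * heat t (x - y)) = (\<lambda>(x, y). case (y, x) of (x, y) \<Rightarrow> (u x)\<^sup>2 * heat t (x - y))"
    unfolding heat_def by (intro ext) (clarsimp simp: norm_minus_commute)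
  have I2: "integrable ?M (\<lambda>(x, y). (u y)^2 * heat t (x - y))"
    unfolding sw by (rule lborel_pair.integrable_product_swap[OF I1])
  have L2: "integral\<^sup>L ?M (\<lambda>(x, y). (u y)^2 * heat t (x - y)) = A"
    unfolding sw by (subst lborel_pair.integral_product_swap) (simp_all add: L1)
  have I3: "integrable ?M (\<lambda>(x, y). u x * (u y * heat t (x - y)))"
  proof (rule Bochner_Integration.integrable_bound[OF Bochner_Integration.integrable_add[OF I1 I2]])
    show "AE z in ?M. norm (case z of (x, y) \<Rightarrow> u x * (u y * heat t (x - y))) \<le>
       norm ((case z of (x, y) \<Rightarrow> (u x)\<^sup>2 * heat t (x - y)) + (case z of (x, y) \<Rightarrow> (u y)\<^sup>2 * heat t (x - y)))"
    proof (rule AE_I2, clarify)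
      fix x y :: 'a
      have "\<bar>u x * u y\<bar> \<le> (u x)^2 + (u y)^2"
        using sum_squares_bound[of "\<bar>u x\<bar>" "\<bar>u y\<bar>"] zero_le_power2[of "u x"] zero_le_power2[of "u y"]
        unfolding abs_mult power2_abs by linarith
      then have "\<bar>u x * u y\<bar> * heat t (x - y) \<le> ((u x)^2 + (u y)^2) * heat t (x - y)"
        by (rule mult_right_mono) simp
      then show "norm (u x * (u y * heat t (x - y))) \<le> norm ((u x)^2 * heat t (x - y) + (u y)^2 * heat t (x - y))"
        by (simp add: abs_mult distrib_right)
    qed
  qed measurable
  have L3: "integral\<^sup>L ?M (\<lambda>(x, y). u x * (u y * heat t (x - y))) = P"
    using lborel_pair.integral_fst'[OF I3] by (simp add: P_def)
  let ?F = "\<lambda>(x, y). (u x - u y)^2 * heat t (x - y)"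
  have F: "?F = (\<lambda>z. (case z of (x, y) \<Rightarrow> (u x)\<^sup>2 * heat t (x - y)) + (case z of (x, y) \<Rightarrow> (u y)\<^sup>2 * heat t (x - y))
     - 2 * (case z of (x, y) \<Rightarrow> u x * (u y * heat t (x - y))))"
    by (auto simp: power2_eq_square algebra_simps)
  have IF: "integrable ?M ?F" unfolding F using I1 I2 I3 by auto
  have LF: "integral\<^sup>L ?M ?F = A + A - 2 * P" unfolding F using I1 I2 I3 L1 L2 L3 by simp
  have "0 \<le> integral\<^sup>L ?M ?F" by (intro integral_nonneg_AE) auto
  then show "2 * (LINT x|lborel. u x * (LINT y|lborel. u y * heat t (x - y))) \<le> 2 * mass u"
    using LF by (simp add: A_def P_def)
  have "(\<integral>\<^sup>+x. (\<integral>\<^sup>+y. ennreal ((u x - u y)^2 * heat t (x - y)) \<partial>lborel) \<partial>lborel) = (\<integral>\<^sup>+z. ennreal (?F z) \<partial>?M)"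
    by (subst lborel.nn_integral_fst[symmetric]) auto
  also have "\<dots> = ennreal (2 * A - 2 * P)"
    using LF by (subst nn_integral_eq_integral[OF IF]) auto
  finally show "(\<integral>\<^sup>+x. (\<integral>\<^sup>+y. ennreal ((u x - u y)^2 * heat t (x - y)) \<partial>lborel) \<partial>lborel) =
     ennreal (2 * mass u - 2 * (LINT x|lborel. u x * (LINT y|lborel. u y * heat t (x - y))))"
    by (simp add: A_def P_def)
  have "(\<integral>\<^sup>+x. (\<integral>\<^sup>+y. ennreal ((u x - u y)^2 * heat t (x - y)) \<partial>lborel) \<partial>lborel) =
    (\<integral>\<^sup>+x. (\<integral>\<^sup>+z. ennreal ((u x - u (x - z))^2 * heat t z) \<partial>lborel) \<partial>lborel)"
  proof (rule nn_integral_cong)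
    fix x
    show "(\<integral>\<^sup>+y. ennreal ((u x - u y)^2 * heat t (x - y)) \<partial>lborel) = (\<integral>\<^sup>+z. ennreal ((u x - u (x - z))^2 * heat t z) \<partial>lborel)"
      using nn_integral_reflect[of "\<lambda>y. ennreal ((u x - u y)^2 * heat t (x - y))" x] by simp
  qed
  also have "\<dots> = (\<integral>\<^sup>+z. (\<integral>\<^sup>+x. ennreal ((u x - u (x - z))^2 * heat t z) \<partial>lborel) \<partial>lborel)"
    by (rule lborel_pair.Fubini'[symmetric]) measurable
  also have "\<dots> = (\<integral>\<^sup>+z. ennreal (heat t z) * (\<integral>\<^sup>+x. ennreal ((u x - u (x - z))^2) \<partial>lborel) \<partial>lborel)"
    by (simp add: ennreal_mult mult.commute nn_integral_cmult)
  finally show "(\<integral>\<^sup>+x. (\<integral>\<^sup>+y. ennreal ((u x - u y)^2 * heat t (x - y)) \<partial>lborel) \<partial>lborel) =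
      (\<integral>\<^sup>+z. ennreal (heat t z) * (\<integral>\<^sup>+x. ennreal ((u x - u (x - z))^2) \<partial>lborel) \<partial>lborel)" .
qed

text \<open>A Chebyshev split: shifts shorter than d change u little by translation continuity, and
  the mass of the kernel beyond d is at most a multiple of t/d^2 by the second moment.\<close>

lemma heat_form_differences_limit:
  fixes u :: "'a::euclidean_space \<Rightarrow> real"
  assumes um[measurable]: "u \<in> borel_measurable borel" and u2: "integrable lborel (\<lambda>x. (u x)^2)"
  shows "((\<lambda>t. \<integral>\<^sup>+x. (\<integral>\<^sup>+y. ennreal ((u x - u y)^2 * heat t (x - y)) \<partial>lborel) \<partial>lborel) \<longlongrightarrow> 0) (at_right 0)"
proof (rule order_tendstoI)
  let ?D = "\<lambda>t. \<integral>\<^sup>+x. (\<integral>\<^sup>+y. ennreal ((u x - u y)^2 * heat t (x - y)) \<partial>lborel) \<partial>lborel"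
  fix a :: ennreal
  { assume "a < 0" then show "eventually (\<lambda>t. a < ?D t) (at_right 0)" by simp }
  assume a: "0 < a"
  define e where "e = (if a = \<infinity> then 1 else enn2real a / 2)"
  have e: "e > 0" "ennreal e < a"
    using a by (cases a; auto simp: e_def ennreal_less_iff zero_less_iff_neq_zero)+
  define A where "A = mass u"
  have A0: "A \<ge> 0" by (simp add: A_def)
  have An: "(\<integral>\<^sup>+x. ennreal ((u x)^2) \<partial>lborel) = ennreal A"
    using u2 by (simp add: A_def nn_integral_eq_integral)
  obtain d where d: "d > 0" "\<And>z. norm z < d \<Longrightarrow> (\<integral>\<^sup>+x. ennreal ((u x - u (x - z))^2) \<partial>lborel) \<le> ennreal (e / 2)"
    using L2_translation_continuous[OF um u2, of "e / 2"] e by auto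
  define B where "B = 4 * A / d\<^sup>2 * (4 * 2 powr (real DIM('a) / 2))"
  have B0: "B \<ge> 0" using A0 by (simp add: B_def)
  have bound: "?D t \<le> ennreal (e / 2 + B * t)" if t: "t > 0" for t
  proof -
    have "?D t = (\<integral>\<^sup>+z. ennreal (heat t z) * (\<integral>\<^sup>+x. ennreal ((u x - u (x - z))^2) \<partial>lborel) \<partial>lborel)"
      by (rule heat_form_differences(2)[OF t um u2])
    also have "\<dots> \<le> (\<integral>\<^sup>+z. ennreal (e / 2) * ennreal (heat t z) + ennreal (4 * A / d\<^sup>2) * ennreal ((norm z)^2 * heat t (z::'a)) \<partial>lborel)"
    proof (rule nn_integral_mono)
      fix z :: 'a
      let ?T = "\<integral>\<^sup>+x. ennreal ((u x - u (x - z))^2) \<partial>lborel"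
      have "?T \<le> ennreal (e / 2 + 4 * A / d\<^sup>2 * (norm z)^2)"
      proof (cases "norm z < d")
        case True
        have "?T \<le> ennreal (e / 2)" using d(2)[OF True] .
        also have "\<dots> \<le> ennreal (e / 2 + 4 * A / d\<^sup>2 * (norm z)^2)"
          using A0 by (intro ennreal_leI) simp
        finally show ?thesis .
      next
        case False
        have "?T \<le> 4 * ennreal A" using L2_translation_bound[OF um, of z] An by simp
        also have "\<dots> = ennreal (4 * A)" using A0 by (simp add: ennreal_mult'')
        also have "\<dots> \<le> ennreal (e / 2 + 4 * A / d\<^sup>2 * (norm z)^2)"
        proof (rule ennreal_leI)
          have "d\<^sup>2 \<le> (norm z)^2" using False d by (intro power_mono) auto
          then have "4 * A * d\<^sup>2 \<le> 4 * A * (norm z)^2" using A0 by (intro mult_left_mono) auto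
          then have "4 * A \<le> 4 * A / d\<^sup>2 * (norm z)^2" using d by (simp add: field_simps)
          then show "4 * A \<le> e / 2 + 4 * A / d\<^sup>2 * (norm z)^2" using e by simp
        qed
        finally show ?thesis .
      qed
      then have "ennreal (heat t z) * ?T \<le> ennreal (heat t z) * ennreal (e / 2 + 4 * A / d\<^sup>2 * (norm z)^2)"
        by (rule mult_left_mono) simp
      also have "\<dots> = ennreal (e / 2) * ennreal (heat t z) + ennreal (4 * A / d\<^sup>2) * ennreal ((norm z)^2 * heat t (z::'a))"
        using A0 e by (simp add: ennreal_mult'[symmetric] ennreal_plus[symmetric] algebra_simps del: ennreal_plus)
      finally show "ennreal (heat t z) * ?T \<le> ennreal (e / 2) * ennreal (heat t z) + ennreal (4 * A / d\<^sup>2) * ennreal ((norm z)^2 * heat t (z::'a))" .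
    qed
    also have "\<dots> = ennreal (e / 2) + ennreal (4 * A / d\<^sup>2) * (\<integral>\<^sup>+z. ennreal ((norm z)^2 * heat t (z::'a)) \<partial>lborel)"
      using t by (simp add: nn_integral_add nn_integral_cmult heat_nn_integral)
    also have "\<dots> \<le> ennreal (e / 2) + ennreal (4 * A / d\<^sup>2) * ennreal (4 * 2 powr (real DIM('a) / 2) * t)"
      by (intro add_left_mono mult_left_mono heat_second_moment_nn[OF t]) simp
    also have "\<dots> = ennreal (e / 2 + B * t)"
      using A0 e t by (simp add: B_def ennreal_mult'[symmetric] ennreal_plus[symmetric] mult_ac del: ennreal_plus)
    finally show ?thesis .
  qed
  have "((\<lambda>t. e / 2 + B * t) \<longlongrightarrow> e / 2 + B * 0) (at_right 0)" by (intro tendsto_intros)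
  from order_tendstoD(2)[OF this, of e] have "eventually (\<lambda>t. e / 2 + B * t < e) (at_right 0)"
    using e by simp
  moreover have "eventually (\<lambda>t::real. t > 0) (at_right 0)" by (rule eventually_at_right_less)
  ultimately show "eventually (\<lambda>t. ?D t < a) (at_right 0)"
  proof eventually_elim
    case (elim t)
    have "?D t \<le> ennreal (e / 2 + B * t)" using bound elim by simp
    also have "\<dots> \<le> ennreal e" using elim by (intro ennreal_leI) simp
    finally show ?case using e by simp
  qed
qed

lemma gauss_fourier_heat_real:
  fixes u :: "'a::euclidean_space \<Rightarrow> real"
  assumes t: "t > 0" and u: "integrable lborel u"
  shows "integrable lborel (\<lambda>\<xi>. exp (- (t * (norm \<xi>)^2)) * psd u \<xi>)"
    and "(LINT \<xi>|lborel. exp (- (t * (norm \<xi>)^2)) * psd u \<xi>) =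
      (LINT x|lborel. u x * (LINT y|lborel. u y * heat t (x - y)))"
proof -
  have [measurable]: "u \<in> borel_measurable borel" using u by (auto dest: borel_measurable_integrable)
  have eq: "complex_of_real (exp (- (t * (norm \<xi>)^2))) * fourier u \<xi> * cnj (fourier u \<xi>) =
    complex_of_real (exp (- (t * (norm \<xi>)^2)) * psd u \<xi>)" for \<xi>
    using complex_norm_square[of "fourier u \<xi>"] by (simp add: mult.assoc)
  have "complex_of_real (LINT \<xi>|lborel. exp (- (t * (norm \<xi>)^2)) * psd u \<xi>) =
     complex_of_real (LINT x|lborel. u x * (LINT y|lborel. u y * heat t (x - y)))"
    using gauss_fourier_heat[OF t u u] unfolding eq integral_complex_of_real .
  then show "(LINT \<xi>|lborel. exp (- (t * (norm \<xi>)^2)) * psd u \<xi>) =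
      (LINT x|lborel. u x * (LINT y|lborel. u y * heat t (x - y)))"
    by (simp only: of_real_eq_iff)
  define K where "K = (2 * pi) powr (- (real DIM('a) / 2)) * (LINT x|lborel. \<bar>u x\<bar>)"
  have G: "integrable lborel (\<lambda>\<xi>::'a. exp (- (t * (norm \<xi>)^2)))"
    using gaussian_fourier(1)[OF t, of "0::'a"] by (simp only: complex_of_real_integrable_eq inner_zero_left of_real_0 mult_zero_right exp_zero minus_zero mult_1_right)
  show "integrable lborel (\<lambda>\<xi>. exp (- (t * (norm \<xi>)^2)) * psd u \<xi>)"
  proof (rule Bochner_Integration.integrable_bound[OF integrable_mult_left[of "K\<^sup>2", OF G]])
    have "psd u \<xi> \<le> K\<^sup>2" for \<xi>
      using fourier_bound[OF u, of \<xi>] by (intro power_mono) (auto simp: K_def)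
    then show "AE x in lborel. norm (exp (- (t * (norm x)^2)) * psd u x) \<le> norm (exp (- (t * (norm x)^2)) * K\<^sup>2)"
      by (simp add: abs_mult)
  qed measurable
qed

text \<open>The Gaussian regularisations of both sides agree, and their difference from
  the \<open>L\<^sup>2\<close> norm is controlled by translation continuity.\<close>

theorem plancherel:
  fixes u :: "'a::euclidean_space \<Rightarrow> real"
  assumes "u \<in> L12"
  shows "integrable lborel (\<lambda>\<xi>. psd u \<xi>)"
    and "(LINT \<xi>|lborel. psd u \<xi>) = mass u"
proof -
  note um[measurable] = L12_D(1)[OF assms] and ui = L12_D(2)[OF assms] and u2 = L12_D(3)[OF assms]
  define A where "A = mass u"
  define P where "P t = (LINT x|lborel. u x * (LINT y|lborel. u y * heat t (x - y)))" for t
  define r where "r n = 1 / real (Suc n)" for n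
  have r: "r n > 0" for n by (simp add: r_def)
  have r0: "r \<longlonglongrightarrow> 0" unfolding r_def by (rule LIMSEQ_Suc) (rule lim_1_over_n)
  have "filterlim r (at_right 0) sequentially"
    using r r0 by (auto simp: filterlim_at less_imp_neq[symmetric] intro!: always_eventually)
  from filterlim_compose[OF heat_form_differences_limit[OF um u2] this]
  have lim: "(\<lambda>n. ennreal (2 * A - 2 * P (r n))) \<longlonglongrightarrow> 0"
    unfolding heat_form_differences(1)[OF r um u2] A_def P_def .
  have "(\<lambda>n. enn2real (ennreal (2 * A - 2 * P (r n)))) \<longlonglongrightarrow> enn2real 0"
    using lim by (intro tendsto_enn2real) auto
  moreover have "2 * P (r n) \<le> 2 * A" for n
    using heat_form_differences(3)[OF r um u2] by (simp add: A_def P_def)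
  ultimately have "(\<lambda>n. 2 * A - 2 * P (r n)) \<longlonglongrightarrow> 0" by simp
  then have "(\<lambda>n. A - (2 * A - 2 * P (r n)) / 2) \<longlonglongrightarrow> A - 0 / 2" by (intro tendsto_intros) auto
  moreover have "A - (2 * A - 2 * P (r n)) / 2 = P (r n)" for n by (simp add: field_simps)
  ultimately have PA: "(\<lambda>n. P (r n)) \<longlonglongrightarrow> A" by simp
  let ?f = "\<lambda>n \<xi>. exp (- (r n * (norm \<xi>)^2)) * psd u \<xi>"
  have hb: "integrable lborel (\<lambda>\<xi>. psd u \<xi>) \<and> (LINT \<xi>|lborel. psd u \<xi>) = A"
  proof (intro conjI)
    have i: "integrable lborel (?f n)" for n by (rule gauss_fourier_heat_real(1)[OF r ui])
    \<comment> \<open>The Gaussian factors increase to 1 as \<open>r n\<close> decreases, so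
      monotone convergence yields integrability together with the value.\<close>
    have mono: "AE \<xi> in lborel. mono (\<lambda>n. ?f n \<xi>)"
    proof (rule AE_I2, rule monoI)
      fix \<xi> :: 'a and m n :: nat assume "m \<le> n"
      then have "r n \<le> r m" by (simp add: r_def frac_le)
      then show "?f m \<xi> \<le> ?f n \<xi>" by (intro mult_right_mono) (auto intro!: mult_right_mono)
    qed
    have lim: "AE \<xi> in lborel. (\<lambda>n. ?f n \<xi>) \<longlonglongrightarrow> (psd u \<xi>)"
    proof (rule AE_I2)
      fix \<xi> :: 'a
      have "(\<lambda>n. ?f n \<xi>) \<longlonglongrightarrow> exp (- (0 * (norm \<xi>)^2)) * psd u \<xi>"
        by (intro tendsto_intros r0)
      then show "(\<lambda>n. ?f n \<xi>) \<longlonglongrightarrow> (psd u \<xi>)" by simp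
    qed
    have l: "(\<lambda>n. LINT \<xi>|lborel. ?f n \<xi>) \<longlonglongrightarrow> A"
      using PA unfolding gauss_fourier_heat_real(2)[OF r ui] P_def .
    have m: "(\<lambda>\<xi>. psd u \<xi>) \<in> borel_measurable lborel" by measurable
    show "integrable lborel (\<lambda>\<xi>. psd u \<xi>)"
      by (rule integrable_monotone_convergence[OF i mono lim l m])
    show "(LINT \<xi>|lborel. psd u \<xi>) = A"
      by (rule integral_monotone_convergence[OF i mono lim l m])
  qed
  then show "integrable lborel (\<lambda>\<xi>. psd u \<xi>)"
    and "(LINT \<xi>|lborel. psd u \<xi>) = mass u"
    by (auto simp: A_def)
qed

text \<open>This is twice the quadratic form of the identity minus the heat semigroup, read in
  position and in frequency. Extended integrals allow it to be integrated over t afterwards without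
  a finiteness question.\<close>

lemma heat_form_fourier:
  fixes u :: "'a::euclidean_space \<Rightarrow> real"
  assumes t: "t > 0" and u: "u \<in> L12"
  shows "(\<integral>\<^sup>+x. (\<integral>\<^sup>+y. ennreal ((u x - u y)^2 * heat t (x - y)) \<partial>lborel) \<partial>lborel) =
    (\<integral>\<^sup>+\<xi>. ennreal (2 * (1 - exp (- (t * (norm \<xi>)^2))) * psd u \<xi>) \<partial>lborel)"
proof -
  note i = gauss_fourier_heat_real(1)[OF t L12_D(2)[OF u]] plancherel(1)[OF u]
  have eq: "2 * (1 - exp (- (t * (norm \<xi>)^2))) * psd u \<xi> =
     2 * psd u \<xi> - 2 * (exp (- (t * (norm \<xi>)^2)) * psd u \<xi>)" for \<xi>
    by (simp add: algebra_simps)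
  have "(LINT \<xi>|lborel. 2 * psd u \<xi> - 2 * (exp (- (t * (norm \<xi>)^2)) * psd u \<xi>)) =
      2 * mass u - 2 * (LINT x|lborel. u x * (LINT y|lborel. u y * heat t (x - y)))"
    using i plancherel(2)[OF u] gauss_fourier_heat_real(2)[OF t L12_D(2)[OF u]] by simp
  moreover have "(\<integral>\<^sup>+\<xi>. ennreal (2 * (1 - exp (- (t * (norm \<xi>)^2))) * psd u \<xi>) \<partial>lborel) =
     ennreal (LINT \<xi>|lborel. 2 * (1 - exp (- (t * (norm \<xi>)^2))) * psd u \<xi>)"
    unfolding eq using i by (intro nn_integral_eq_integral) (simp, use t in \<open>simp add: mult_left_le_one_le\<close>)
  ultimately show ?thesis
    unfolding heat_form_differences(1)[OF t L12_D(1,3)[OF u]] eq by simp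
qed

subsection \<open>Convolution and logarithmic Sobolev inequalities\<close>

text \<open>A bounded probability density. The bound C is a parameter because the supremum estimate
  for convolutions is quantitative in it.\<close>

definition prob_kernel :: "('a::euclidean_space \<Rightarrow> real) \<Rightarrow> real \<Rightarrow> bool" where
  "prob_kernel K C \<longleftrightarrow> K \<in> borel_measurable borel \<and> integrable lborel K \<and>
     (\<forall>x. 0 \<le> K x \<and> K x \<le> C) \<and> (LINT x|lborel. K x) = 1"

definition conv :: "('a::euclidean_space \<Rightarrow> real) \<Rightarrow> ('a \<Rightarrow> real) \<Rightarrow> 'a \<Rightarrow> real" where
  "conv K u x = (LINT y|lborel. K (x - y) * u y)"

lemma prob_kernel_heat:
  "t > 0 \<Longrightarrow> prob_kernel (heat t :: 'a::euclidean_space \<Rightarrow> real) ((4 * pi * t) powr (- (real DIM('a) / 2)))"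
  by (simp add: prob_kernel_def heat_fourier(1) heat_integral heat_le)

lemma integral_shift:
  fixes f :: "'a::euclidean_space \<Rightarrow> 'b::{banach, second_countable_topology}"
  assumes [measurable]: "f \<in> borel_measurable borel"
  shows "(LINT x|lborel. f (c + x)) = (LINT x|lborel. f x)"
  by (subst (2) lborel_distr_plus[of c, symmetric]) (simp add: integral_distr)

context
  fixes K u :: "'a::euclidean_space \<Rightarrow> real" and C :: real
  assumes K: "prob_kernel K C" and u: "u \<in> L12"
begin

lemma conv_measurable [measurable]: "K \<in> borel_measurable borel" "u \<in> borel_measurable borel"
  "conv K u \<in> borel_measurable borel"
proof -
  show [measurable]: "K \<in> borel_measurable borel" using K by (simp add: prob_kernel_def)
  show [measurable]: "u \<in> borel_measurable borel" using u by (simp add: L12_def)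
  show "conv K u \<in> borel_measurable borel" unfolding conv_def by measurable
qed

lemma K_bounds: "0 \<le> K x" "K x \<le> C" using K by (auto simp: prob_kernel_def)

lemma C_nonneg: "0 \<le> C" using K_bounds[of 0] by linarith

lemma K_reflect: "integrable lborel (\<lambda>y. K (x - y))" "(LINT y|lborel. K (x - y)) = 1"
  using K integrable_reflect[of K x] by (auto simp: prob_kernel_def)

lemma conv_integrable1: "integrable lborel (\<lambda>y. K (x - y) * u y)"
  by (rule Bochner_Integration.integrable_bound[OF integrable_mult_right[of C, OF L12_D(2)[OF u]]])
     (auto simp: abs_mult C_nonneg K_bounds intro!: mult_right_mono)

lemma conv_integrable2: "integrable lborel (\<lambda>y. K (x - y) * (u y)^2)"
  by (rule Bochner_Integration.integrable_bound[OF integrable_mult_right[of C, OF L12_D(3)[OF u]]])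
     (auto simp: abs_mult C_nonneg K_bounds intro!: mult_right_mono)

text \<open>Jensen's inequality, obtained from the nonnegative variance of u under the density K(x -
  y).\<close>

lemma conv_square_le: "(conv K u x)^2 \<le> (LINT y|lborel. K (x - y) * (u y)^2)"
proof -
  define c where "c = conv K u x"
  have eq: "K (x - y) * (u y - c)^2 = K (x - y) * (u y)^2 - 2 * c * (K (x - y) * u y) + c\<^sup>2 * K (x - y)" for y
    by (simp add: power2_eq_square algebra_simps)
  have "0 \<le> (LINT y|lborel. K (x - y) * (u y - c)^2)"
    by (intro integral_nonneg_AE AE_I2 mult_nonneg_nonneg K_bounds) simp
  also have "\<dots> = (LINT y|lborel. K (x - y) * (u y)^2) - 2 * c * c + c\<^sup>2 * 1"
    unfolding eq using conv_integrable1[of x] conv_integrable2[of x] K_reflect[of x]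
    by (simp add: c_def conv_def)
  finally show ?thesis by (simp add: c_def power2_eq_square)
qed

lemma conv_sup_bound: "(conv K u x)^2 \<le> C * (LINT y|lborel. (u y)^2)"
proof -
  have "(LINT y|lborel. K (x - y) * (u y)^2) \<le> (LINT y|lborel. C * (u y)^2)"
    using conv_integrable2 L12_D(3)[OF u] by (intro integral_mono) (auto intro!: mult_right_mono K_bounds)
  then show ?thesis using conv_square_le[of x] by simp
qed

lemma conv_pair_integrable:
  assumes v: "integrable lborel v"
  shows "integrable (lborel \<Otimes>\<^sub>M lborel) (\<lambda>(y, x). v y * K (x - y))"
proof (rule lborel_pair.Fubini_integrable)
  have [measurable]: "v \<in> borel_measurable borel" using v by (auto dest: borel_measurable_integrable)
  have k: "integrable lborel (\<lambda>x. K (x - y))" "(LINT x|lborel. K (x - y)) = 1" for y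
  proof -
    have "integrable (distr lborel borel ((+) (- y))) K" using K lborel_distr_plus[of "-y"] by (simp add: prob_kernel_def)
    then show "integrable lborel (\<lambda>x. K (x - y))" by (subst (asm) integrable_distr_eq) auto
    show "(LINT x|lborel. K (x - y)) = 1" using integral_shift[of K "-y"] K by (simp add: prob_kernel_def)
  qed
  show "(\<lambda>(y, x). v y * K (x - y)) \<in> borel_measurable (lborel \<Otimes>\<^sub>M lborel)" by measurable
  show "integrable lborel (\<lambda>x. LINT y|lborel. norm (case (x, y) of (y, x) \<Rightarrow> v y * K (x - y)))"
    using k v by (simp add: abs_mult K_bounds)
  show "AE x in lborel. integrable lborel (\<lambda>y. case (x, y) of (y, x) \<Rightarrow> v y * K (x - y))"
    using k by simp
qed

lemma conv_L12: "conv K u \<in> L12"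
  unfolding L12_def
proof (intro CollectI conjI)
  show "conv K u \<in> borel_measurable borel" by measurable
  show "integrable lborel (conv K u)"
    using lborel_pair.integrable_snd[OF conv_pair_integrable[OF L12_D(2)[OF u]]]
    by (simp add: conv_def[abs_def] mult.commute)
  have "integrable lborel (\<lambda>x. LINT y|lborel. K (x - y) * (u y)^2)"
    using lborel_pair.integrable_snd[OF conv_pair_integrable[OF L12_D(3)[OF u]]]
    by (simp add: mult.commute)
  then show "integrable lborel (\<lambda>x. (conv K u x)^2)"
    by (rule Bochner_Integration.integrable_bound) (use conv_square_le in \<open>auto intro!: order_trans[OF _ abs_ge_self]\<close>)
qed

text \<open>The transform of K appears without its unitary factor, which is why no power of 2 pi
  occurs here; for \<open>heat\<close> this factor is exactly exp(-t|\<xi>|^2).\<close>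

lemma fourier_conv:
  "fourier (conv K u) \<xi> = (LINT x|lborel. wave x \<xi> * complex_of_real (K x)) * fourier u \<xi>"
proof -
  let ?e = "\<lambda>x. wave x \<xi>"
  let ?F = "\<lambda>(y, x). ?e x * complex_of_real (u y * K (x - y))"
  have iF: "integrable (lborel \<Otimes>\<^sub>M lborel) ?F"
    by (rule Bochner_Integration.integrable_bound[OF conv_pair_integrable[OF L12_D(2)[OF u]]])
       (auto simp: norm_mult)
  have "(LINT x|lborel. ?e x * complex_of_real (conv K u x)) = (LINT x|lborel. (LINT y|lborel. ?F (y, x)))"
  proof (intro Bochner_Integration.integral_cong refl)
    fix x
    have "complex_of_real (conv K u x) = (LINT y|lborel. complex_of_real (K (x - y) * u y))"
      unfolding integral_complex_of_real conv_def ..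
    then show "?e x * complex_of_real (conv K u x) = (LINT y|lborel. ?F (y, x))"
      unfolding prod.case mult.commute[of "u _"] by (simp only: integral_mult_right_zero)
  qed
  also have "\<dots> = (LINT y|lborel. (LINT x|lborel. ?F (y, x)))"
    using lborel_pair.Fubini_integral[of "\<lambda>y x. ?F (y, x)"] iF by (simp add: case_prod_unfold)
  also have "\<dots> = (LINT y|lborel. (LINT x|lborel. ?e x * complex_of_real (K x)) * (?e y * complex_of_real (u y)))"
  proof (intro Bochner_Integration.integral_cong refl)
    fix y
    have "(LINT x|lborel. ?F (y, x)) = (LINT x|lborel. ?F (y, y + x))"
      unfolding prod.case
      by (rule integral_shift[of "\<lambda>x. ?e x * complex_of_real (u y * K (x - y))", symmetric]) measurable
    also have "\<dots> = (LINT x|lborel. (?e y * complex_of_real (u y)) * (?e x * complex_of_real (K x)))"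
      by (intro Bochner_Integration.integral_cong refl) (simp add: inner_add_left distrib_left exp_add exp_diff exp_minus field_simps)
    finally show "(LINT x|lborel. ?F (y, x)) = (LINT x|lborel. ?e x * complex_of_real (K x)) * (?e y * complex_of_real (u y))"
      by simp
  qed
  finally show ?thesis by (simp add: fourier_def)
qed

end

declare conv_measurable [measurable del]

lemma L12_diff: "u \<in> L12 \<Longrightarrow> v \<in> L12 \<Longrightarrow> (\<lambda>x. u x - v x) \<in> L12"
  and L12_add: "u \<in> L12 \<Longrightarrow> v \<in> L12 \<Longrightarrow> (\<lambda>x. u x + v x) \<in> L12"
  and L12_scale: "u \<in> L12 \<Longrightarrow> (\<lambda>x. c * u x) \<in> L12"
proof -
  have sq: "integrable lborel (\<lambda>x. (f x + g x)^2)"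
    if [measurable]: "f \<in> borel_measurable borel" "g \<in> borel_measurable borel"
      and f: "integrable lborel (\<lambda>x. (f x)^2)" and g: "integrable lborel (\<lambda>x. (g x)^2)" for f g :: "'a \<Rightarrow> real"
  proof (rule Bochner_Integration.integrable_bound)
    show "integrable lborel (\<lambda>x. 2 * (f x)^2 + 2 * (g x)^2)" using f g by simp
    have "(f x + g x)^2 \<le> 2 * (f x)^2 + 2 * (g x)^2" for x
      using sum_squares_bound[of "f x" "g x"] by (simp add: power2_eq_square algebra_simps)
    then show "AE x in lborel. norm ((f x + g x)^2) \<le> norm (2 * (f x)^2 + 2 * (g x)^2)"
      by (auto intro!: order_trans[OF _ abs_ge_self])
  qed measurable
  show "(\<lambda>x. u x - v x) \<in> L12" if "u \<in> L12" "v \<in> L12"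
    using that sq[of u "\<lambda>x. - v x"] by (auto simp: L12_def)
  show "(\<lambda>x. u x + v x) \<in> L12" if "u \<in> L12" "v \<in> L12"
    using that sq[of u v] by (auto simp: L12_def)
  show "(\<lambda>x. c * u x) \<in> L12" if "u \<in> L12"
    using that by (auto simp: L12_def power_mult_distrib)
qed

text \<open>On \<open>{\<bar>u\<bar> > l}\<close> the low-frequency part is at most \<open>\<epsilon>\<bar>u\<bar>\<close>, so that \<open>u\<close> is dominated by its
  high-frequency part with a constant close to \<open>1\<close>; the exact constant is what makes the
  condition \<open>p'(0) < 4/N\<close> sufficient.\<close>

lemma level_set_high_frequency:
  fixes u :: "'a::euclidean_space \<Rightarrow> real"
  assumes u: "u \<in> L12" and \<epsilon>: "0 < \<epsilon>" "\<epsilon> < 1" and l: "l > 0" and a: "a > 0"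
    and small: "(4 * pi * a) powr (- (real DIM('a) / 2)) * mass u \<le> (\<epsilon> * l)^2"
  shows "(\<integral>\<^sup>+x. ennreal ((u x)^2) * indicator {x. l < \<bar>u x\<bar>} x \<partial>lborel) \<le>
    ennreal (1 / (1 - \<epsilon>)^2) * (\<integral>\<^sup>+\<xi>. ennreal ((1 - exp (- (a * (norm \<xi>)^2)))^2 * psd u \<xi>) \<partial>lborel)"
proof -
  note [measurable] = L12_D(1)[OF u]
  define w where "w = conv (heat a) u"
  note K = prob_kernel_heat[OF a, where 'a='a]
  have w: "w \<in> L12" unfolding w_def by (rule conv_L12[OF K u])
  note [measurable] = L12_D(1)[OF w]
  have wb: "\<bar>w x\<bar> \<le> \<epsilon> * l" for x
  proof -
    have "(w x)^2 \<le> (\<epsilon> * l)^2" unfolding w_def using conv_sup_bound[OF K u, of x] small by linarith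
    then show ?thesis using \<epsilon> l by (simp add: abs_le_square_iff[symmetric] abs_mult)
  qed
  have d: "(\<lambda>x. u x - w x) \<in> L12" by (rule L12_diff[OF u w])
  have F: "fourier (\<lambda>x. u x - w x) \<xi> = complex_of_real (1 - exp (- (a * (norm \<xi>)^2))) * fourier u \<xi>" for \<xi>
  proof -
    have "fourier (\<lambda>x. u x - w x) \<xi> = fourier u \<xi> - fourier w \<xi>"
      by (rule fourier_diff[OF L12_D(2)[OF u] L12_D(2)[OF w]])
    also have "fourier w \<xi> = complex_of_real (exp (- (a * (norm \<xi>)^2))) * fourier u \<xi>"
      unfolding w_def fourier_conv[OF K u] heat_fourier(2)[OF a] ..
    finally show ?thesis by (simp add: left_diff_distrib)
  qed
  have "(\<integral>\<^sup>+x. ennreal ((u x)^2) * indicator {x. l < \<bar>u x\<bar>} x \<partial>lborel) \<le>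
     (\<integral>\<^sup>+x. ennreal (1 / (1 - \<epsilon>)^2) * ennreal ((u x - w x)^2) \<partial>lborel)"
  proof (rule nn_integral_mono)
    fix x
    show "ennreal ((u x)^2) * indicator {x. l < \<bar>u x\<bar>} x \<le> ennreal (1 / (1 - \<epsilon>)^2) * ennreal ((u x - w x)^2)"
    proof (cases "l < \<bar>u x\<bar>")
      case True
      have "\<bar>w x\<bar> \<le> \<epsilon> * \<bar>u x\<bar>" using wb[of x] True \<epsilon> by (meson less_imp_le mult_left_mono order_trans)
      then have "(1 - \<epsilon>) * \<bar>u x\<bar> \<le> \<bar>u x - w x\<bar>" by (simp add: left_diff_distrib)
      then have "((1 - \<epsilon>) * \<bar>u x\<bar>)^2 \<le> \<bar>u x - w x\<bar>\<^sup>2" using \<epsilon> by (intro power_mono) auto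
      then have "(1 - \<epsilon>)^2 * (u x)^2 \<le> (u x - w x)^2"
        by (simp add: power_mult_distrib)
      then have "(u x)^2 \<le> 1 / (1 - \<epsilon>)^2 * (u x - w x)^2"
        using \<epsilon> by (simp add: pos_le_divide_eq mult.commute)
      then show ?thesis using True by (simp add: ennreal_mult'[symmetric] ennreal_leI del: times_divide_eq_left)
    qed simp
  qed
  also have "\<dots> = ennreal (1 / (1 - \<epsilon>)^2) * (\<integral>\<^sup>+x. ennreal ((u x - w x)^2) \<partial>lborel)"
    by (rule nn_integral_cmult) measurable
  also have "(\<integral>\<^sup>+x. ennreal ((u x - w x)^2) \<partial>lborel) = ennreal (LINT x|lborel. (u x - w x)^2)"
    by (rule nn_integral_eq_integral[OF L12_D(3)[OF d]]) simp
  also have "(LINT x|lborel. (u x - w x)^2) = (LINT \<xi>|lborel. psd (\<lambda>x. u x - w x) \<xi>)"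
    by (rule plancherel(2)[OF d, symmetric])
  also have "ennreal \<dots> = (\<integral>\<^sup>+\<xi>. ennreal (psd (\<lambda>x. u x - w x) \<xi>) \<partial>lborel)"
    by (rule nn_integral_eq_integral[OF plancherel(1)[OF d], symmetric]) simp
  also have "(\<lambda>\<xi>. psd (\<lambda>x. u x - w x) \<xi>) =
      (\<lambda>\<xi>. (1 - exp (- (a * (norm \<xi>)^2)))^2 * psd u \<xi>)"
    unfolding F norm_mult power_mult_distrib norm_of_real by simp
  finally show ?thesis .
qed

text \<open>The filter 1 - exp(-z) acts as a switch at the level l = B S. Below this level it is
  bounded by 1, and F accounts for the levels. Above, it is at most z, whose square decays like a
  power of l, and the tail costs only \<open>n / 4\<close> times (B S)^q. Keeping F abstract treats
  the logarithm (q = 0) and the power x^q/q at once.\<close>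

lemma high_frequency_weight_integral:
  fixes q :: real and n :: real
  assumes n: "n > 0" and q: "0 \<le> q" "q \<le> 4 / n" and B: "B > 0" and S: "S \<ge> 1"
    and Y: "0 \<le> Y" "Y \<le> S powr (4 / n)"
    and F: "\<And>x. x > 0 \<Longrightarrow> (F has_real_derivative x powr (q - 1)) (at x)"
  shows "(\<integral>\<^sup>+l. ennreal (l powr (q - 1)) * indicator {B<..} l * ennreal ((1 - exp (- ((B / l) powr (4 / n) * Y)))^2) \<partial>lborel)
    \<le> ennreal (F (B * S) - F B + n / 4 * (B * S) powr q)"
proof -
  let ?r = "8 / n"
  \<comment> \<open>The bound q \<le> 4/n keeps the decay exponent of the tail at least 4/n; this is
    the origin of the constant n/4.\<close>
  have rq: "?r - q \<ge> 4 / n" using q by (simp add: field_simps)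
  have rq0: "?r - q > 0" using rq n by (smt (verit) divide_pos_pos)
  have BS: "B \<le> B * S" "B * S > 0" using B S by auto
  let ?T = "\<lambda>x. - ((B * S) powr ?r) * (x powr (q - ?r) / (?r - q))"
  have "(\<integral>\<^sup>+l. ennreal (l powr (q - 1)) * indicator {B<..} l * ennreal ((1 - exp (- ((B / l) powr (4 / n) * Y)))^2) \<partial>lborel)
    \<le> (\<integral>\<^sup>+l. ennreal (l powr (q - 1)) * indicator {B..B * S} l +
        ennreal ((B * S) powr ?r * l powr (q - ?r - 1)) * indicator {B * S..} l \<partial>lborel)"
  proof (rule nn_integral_mono)
    fix x :: real
    let ?z = "(B / x) powr (4 / n) * Y"
    have z0: "0 \<le> ?z" using Y by simp
    have e1: "(1 - exp (- ?z))^2 \<le> 1" using z0 by (intro power_le_one) auto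
    show "ennreal (x powr (q - 1)) * indicator {B<..} x * ennreal ((1 - exp (- ?z))^2) \<le>
      ennreal (x powr (q - 1)) * indicator {B..B * S} x + ennreal ((B * S) powr ?r * x powr (q - ?r - 1)) * indicator {B * S..} x"
    proof (cases "x \<le> B * S")
      case True
      have "ennreal (x powr (q - 1)) * indicator {B<..} x * ennreal ((1 - exp (- ?z))^2) \<le> ennreal (x powr (q - 1)) * indicator {B<..} x * ennreal 1"
        using e1 by (intro mult_left_mono ennreal_leI) auto
      also have "\<dots> \<le> ennreal (x powr (q - 1)) * indicator {B..B * S} x"
        using True by (auto split: split_indicator)
      also have "\<dots> \<le> ennreal (x powr (q - 1)) * indicator {B..B * S} x + ennreal ((B * S) powr ?r * x powr (q - ?r - 1)) * indicator {B * S..} x"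
        by simp
      finally show ?thesis .
    next
      case False
      then have x: "x > B * S" "x > 0" using BS by auto
      have "1 - exp (- ?z) \<le> ?z" using exp_ge_add_one_self[of "- ?z"] by linarith
      also have "?z \<le> (B / x) powr (4 / n) * S powr (4 / n)" using Y by (intro mult_left_mono) auto
      also have "\<dots> = (B * S / x) powr (4 / n)" using B S x by (simp add: powr_mult[symmetric])
      finally have "(1 - exp (- ?z))^2 \<le> ((B * S / x) powr (4 / n))^2" using z0 by (intro power_mono) auto
      also have "\<dots> = (B * S / x) powr ?r" using BS x by (simp add: power2_eq_square powr_add[symmetric])
      also have "\<dots> = (B * S) powr ?r * x powr (- ?r)" using BS x by (simp add: powr_divide powr_minus_divide)
      finally have "x powr (q - 1) * (1 - exp (- ?z))^2 \<le> x powr (q - 1) * ((B * S) powr ?r * x powr (- ?r))"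
        by (intro mult_left_mono) auto
      also have "\<dots> = (B * S) powr ?r * x powr (q - ?r - 1)"
        by (simp add: powr_add[symmetric] mult.left_commute algebra_simps)
      finally have "ennreal (x powr (q - 1) * (1 - exp (- ?z))^2) \<le> ennreal ((B * S) powr ?r * x powr (q - ?r - 1))"
        by (rule ennreal_leI)
      then show ?thesis using x BS by (simp add: ennreal_mult)
    qed
  qed
  also have "\<dots> = (\<integral>\<^sup>+l. ennreal (l powr (q - 1)) * indicator {B..B * S} l \<partial>lborel) +
      (\<integral>\<^sup>+l. ennreal ((B * S) powr ?r * l powr (q - ?r - 1)) * indicator {B * S..} l \<partial>lborel)"
    by (rule nn_integral_add) measurable
  also have "(\<integral>\<^sup>+l. ennreal (l powr (q - 1)) * indicator {B..B * S} l \<partial>lborel) = ennreal (F (B * S) - F B)"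
    using B by (intro nn_integral_FTC_Icc F BS) auto
  also have "(\<integral>\<^sup>+l. ennreal ((B * S) powr ?r * l powr (q - ?r - 1)) * indicator {B * S..} l \<partial>lborel) = ennreal (0 - ?T (B * S))"
  proof (rule nn_integral_FTC_atLeast[where F = ?T and T = 0])
    fix x assume "B * S \<le> x"
    then have x: "x > 0" using BS by linarith
    show "(?T has_real_derivative (B * S) powr ?r * x powr (q - ?r - 1)) (at x)"
    proof -
      have 1: "((\<lambda>x. x powr (q - ?r)) has_real_derivative (q - ?r) * x powr (q - ?r - 1)) (at x)"
        using x by (rule has_real_derivative_powr)
      have 2: "- c * ((- d) * y / d) = c * y" if "d \<noteq> 0" for c d y :: real using that by simp
      show ?thesis
        using DERIV_cmult[OF DERIV_cdivide[OF 1, of "?r - q"], of "- ((B * S) powr ?r)"]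
          2[of "?r - q" "(B * S) powr ?r" "x powr (q - ?r - 1)"] rq0 by simp
    qed
  next
    have "((\<lambda>x. x powr (q - ?r)) \<longlongrightarrow> 0) at_top"
      by (rule tendsto_neg_powr) (use rq0 in \<open>auto intro: filterlim_ident\<close>)
    then have "(?T \<longlongrightarrow> - ((B * S) powr ?r) * (0 / (?r - q))) at_top"
      using rq0 by (intro tendsto_intros) auto
    then show "(?T \<longlongrightarrow> 0) at_top" by simp
  qed auto
  also have "0 - ?T (B * S) = (B * S) powr q / (?r - q)"
    using BS by (simp add: powr_add[symmetric])
  also have "ennreal (F (B * S) - F B) + ennreal ((B * S) powr q / (?r - q)) \<le> ennreal (F (B * S) - F B + n / 4 * (B * S) powr q)"
  proof -
    have "F B \<le> F (B * S)"
    proof (rule DERIV_nonneg_imp_nondecreasing[OF BS(1)])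
      fix x assume "B \<le> x"
      then show "\<exists>y. (F has_real_derivative y) (at x) \<and> 0 \<le> y"
        using F[of x] B by (intro exI[of _ "x powr (q - 1)"]) simp
    qed
    moreover have "(B * S) powr q / (?r - q) \<le> (B * S) powr q / (4 / n)"
      using rq n by (intro divide_left_mono mult_pos_pos rq0) auto
    moreover have "0 \<le> (B * S) powr q / (?r - q)" using rq0 by simp
    ultimately show ?thesis by (subst ennreal_plus[symmetric]) (auto intro!: ennreal_leI simp: mult.commute)
  qed
  finally show ?thesis .
qed

text \<open>Writing F(|u|) - F(B) as an integral over the levels between B and |u| and exchanging
  integrals reduces the claim to the estimate on each set where |u| exceeds l; the integral over
  levels is then bounded for each \<xi> separately. The starting level B is proportional to the L2
  norm, so the estimate respects multiplication of u by constants.\<close>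

theorem layered_log_sobolev:
  fixes u :: "'a::euclidean_space \<Rightarrow> real" and q \<epsilon> :: real
  defines "n \<equiv> real DIM('a)"
  defines "B \<equiv> sqrt (mass u) / \<epsilon>"
  assumes u: "u \<in> L12" and pos: "mass u > 0" and \<epsilon>: "0 < \<epsilon>" "\<epsilon> < 1"
    and q: "0 \<le> q" "q \<le> 4 / n"
    and F: "\<And>x. x > 0 \<Longrightarrow> (F has_real_derivative x powr (q - 1)) (at x)"
    and [measurable]: "F \<in> borel_measurable borel"
  shows "(\<integral>\<^sup>+x. ennreal ((u x)^2 * (F (max B \<bar>u x\<bar>) - F B)) \<partial>lborel) \<le> ennreal (1 / (1 - \<epsilon>)^2) *
    (\<integral>\<^sup>+\<xi>. ennreal (psd u \<xi> *
      (F (B * br \<xi> powr (n / 4)) - F B + n / 4 * (B * br \<xi> powr (n / 4)) powr q)) \<partial>lborel)"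
proof -
  note [measurable] = L12_D(1)[OF u]
  define m2 where "m2 = mass u"
  have B: "B > 0" using pos \<epsilon> by (simp add: B_def)
  have n: "n > 0" by (simp add: n_def)
  let ?c = "ennreal (1 / (1 - \<epsilon>)^2)"
  \<comment> \<open>The heat time for which the supremum bound of the filtered function equals
    \<open>\<epsilon> * l\<close> exactly; it decreases like l^(-4/n).\<close>
  define a where "a l = (B / l) powr (4 / n) / (4 * pi)" for l
  have "(\<integral>\<^sup>+x. ennreal ((u x)^2 * (F (max B \<bar>u x\<bar>) - F B)) \<partial>lborel) =
     (\<integral>\<^sup>+x. (\<integral>\<^sup>+l. ennreal ((u x)^2) * (ennreal (l powr (q - 1)) * indicator {B<..} l * indicator {x. l < \<bar>u x\<bar>} x) \<partial>lborel) \<partial>lborel)"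
  proof (rule nn_integral_cong)
    fix x
    let ?r = "max B \<bar>u x\<bar>"
    have "(\<integral>\<^sup>+l. ennreal (l powr (q - 1)) * indicator {B<..} l * indicator {x. l < \<bar>u x\<bar>} x \<partial>lborel) =
       (\<integral>\<^sup>+l. ennreal (l powr (q - 1)) * indicator {B..?r} l \<partial>lborel)"
    proof (rule nn_integral_cong_AE)
      have "AE l in lborel. l \<noteq> B" "AE l in lborel. l \<noteq> ?r" by (rule AE_lborel_singleton)+
      then show "AE l in lborel. ennreal (l powr (q - 1)) * indicator {B<..} l * indicator {x. l < \<bar>u x\<bar>} x =
         ennreal (l powr (q - 1)) * indicator {B..?r} l"
        by eventually_elim (auto split: split_indicator simp: max_def split: if_splits)
    qed
    also have "\<dots> = ennreal (F ?r - F B)"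
      using B by (intro nn_integral_FTC_Icc F) auto
    finally show "ennreal ((u x)^2 * (F ?r - F B)) =
      (\<integral>\<^sup>+l. ennreal ((u x)^2) * (ennreal (l powr (q - 1)) * indicator {B<..} l * indicator {x. l < \<bar>u x\<bar>} x) \<partial>lborel)"
      by (subst nn_integral_cmult) (auto simp: ennreal_mult')
  qed
  also have "\<dots> = (\<integral>\<^sup>+l. (\<integral>\<^sup>+x. ennreal ((u x)^2) * (ennreal (l powr (q - 1)) * indicator {B<..} l * indicator {x. l < \<bar>u x\<bar>} x) \<partial>lborel) \<partial>lborel)"
    by (rule lborel_pair.Fubini'[symmetric]) measurable
  also have "\<dots> = (\<integral>\<^sup>+l. ennreal (l powr (q - 1)) * indicator {B<..} l *
      (\<integral>\<^sup>+x. ennreal ((u x)^2) * indicator {x. l < \<bar>u x\<bar>} x \<partial>lborel) \<partial>lborel)"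
    by (intro nn_integral_cong) (simp add: nn_integral_cmult[symmetric] mult_ac)
  also have "\<dots> \<le> (\<integral>\<^sup>+l. ennreal (l powr (q - 1)) * indicator {B<..} l * (?c *
      (\<integral>\<^sup>+\<xi>. ennreal ((1 - exp (- (a l * (norm \<xi>)^2)))^2 * psd u \<xi>) \<partial>lborel)) \<partial>lborel)"
  proof (rule nn_integral_mono)
    fix l :: real
    show "ennreal (l powr (q - 1)) * indicator {B<..} l * (\<integral>\<^sup>+x. ennreal ((u x)^2) * indicator {x. l < \<bar>u x\<bar>} x \<partial>lborel)
      \<le> ennreal (l powr (q - 1)) * indicator {B<..} l * (?c *
      (\<integral>\<^sup>+\<xi>. ennreal ((1 - exp (- (a l * (norm \<xi>)^2)))^2 * psd u \<xi>) \<partial>lborel))"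
    proof (cases "B < l")
      case True
      then have l: "l > 0" using B by simp
      have a: "a l > 0" using B l by (simp add: a_def)
      have "(4 * pi * a l) powr (- (real DIM('a) / 2)) = (B / l) powr (-2)"
        using B l n by (simp add: a_def powr_powr n_def[symmetric])
      also have "\<dots> = l\<^sup>2 / B\<^sup>2" using B l by (simp add: powr_minus powr_numeral power_divide)
      finally have "(4 * pi * a l) powr (- (real DIM('a) / 2)) * m2 \<le> (\<epsilon> * l)^2"
        using pos \<epsilon> by (simp add: B_def power_divide power_mult_distrib m2_def[symmetric])
      then have "(\<integral>\<^sup>+x. ennreal ((u x)^2) * indicator {x. l < \<bar>u x\<bar>} x \<partial>lborel) \<le> ?c *
         (\<integral>\<^sup>+\<xi>. ennreal ((1 - exp (- (a l * (norm \<xi>)^2)))^2 * psd u \<xi>) \<partial>lborel)"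
        unfolding m2_def by (rule level_set_high_frequency[OF u \<epsilon> l a])
      then show ?thesis by (rule mult_left_mono) simp
    qed simp
  qed
  also have "\<dots> = ?c * (\<integral>\<^sup>+l. (\<integral>\<^sup>+\<xi>. ennreal (psd u \<xi>) * (ennreal (l powr (q - 1)) * indicator {B<..} l * ennreal ((1 - exp (- (a l * (norm \<xi>)^2)))^2)) \<partial>lborel) \<partial>lborel)"
    unfolding a_def by (simp add: nn_integral_cmult[symmetric] ennreal_mult mult_ac)
  also have "(\<integral>\<^sup>+l. (\<integral>\<^sup>+\<xi>. ennreal (psd u \<xi>) * (ennreal (l powr (q - 1)) * indicator {B<..} l * ennreal ((1 - exp (- (a l * (norm \<xi>)^2)))^2)) \<partial>lborel) \<partial>lborel) =
    (\<integral>\<^sup>+\<xi>. (\<integral>\<^sup>+l. ennreal (psd u \<xi>) * (ennreal (l powr (q - 1)) * indicator {B<..} l * ennreal ((1 - exp (- (a l * (norm \<xi>)^2)))^2)) \<partial>lborel) \<partial>lborel)"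
    unfolding a_def by (rule lborel_pair.Fubini'[symmetric]) measurable
  also have "\<dots> \<le> (\<integral>\<^sup>+\<xi>. ennreal (psd u \<xi> *
      (F (B * br \<xi> powr (n / 4)) - F B + n / 4 * (B * br \<xi> powr (n / 4)) powr q)) \<partial>lborel)"
  proof (rule nn_integral_mono)
    fix \<xi> :: 'a
    let ?S = "br \<xi> powr (n / 4)"
    define Y where "Y = (norm \<xi>)^2 / (4 * pi)"
    \<comment> \<open>Dropping 4 pi only raises the switching level by a constant factor and leaves
      the leading coefficient of the logarithm unchanged.\<close>
    have "Y \<le> (norm \<xi>)^2 / 1" unfolding Y_def using pi_gt3 by (intro divide_left_mono) auto
    also have "\<dots> \<le> ?S powr (4 / n)" using n by (simp add: powr_powr add_nonneg_pos)
    finally have Y: "0 \<le> Y" "Y \<le> ?S powr (4 / n)" by (auto simp: Y_def)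
    have S: "?S \<ge> 1" using n by (intro ge_one_powr_ge_zero) auto
    have eq: "a l * (norm \<xi>)^2 = (B / l) powr (4 / n) * Y" for l by (simp add: a_def Y_def)
    have "(\<integral>\<^sup>+l. ennreal (psd u \<xi>) * (ennreal (l powr (q - 1)) * indicator {B<..} l * ennreal ((1 - exp (- (a l * (norm \<xi>)^2)))^2)) \<partial>lborel)
       = ennreal (psd u \<xi>) * (\<integral>\<^sup>+l. ennreal (l powr (q - 1)) * indicator {B<..} l * ennreal ((1 - exp (- ((B / l) powr (4 / n) * Y)))^2) \<partial>lborel)"
      unfolding eq by (rule nn_integral_cmult) measurable
    also have "\<dots> \<le> ennreal (psd u \<xi>) * ennreal (F (B * ?S) - F B + n / 4 * (B * ?S) powr q)"
      by (intro mult_left_mono high_frequency_weight_integral[OF n q B S Y F]) auto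
    finally show "(\<integral>\<^sup>+l. ennreal (psd u \<xi>) * (ennreal (l powr (q - 1)) * indicator {B<..} l * ennreal ((1 - exp (- (a l * (norm \<xi>)^2)))^2)) \<partial>lborel)
      \<le> ennreal (psd u \<xi> * (F (B * ?S) - F B + n / 4 * (B * ?S) powr q))"
      by (simp add: ennreal_mult')
  qed
  finally show ?thesis by (simp add: mult_left_mono)
qed

subsection \<open>The kernel of the logarithmic operator\<close>

text \<open>The substitution rule is applied on compact intervals, so both sides are exhausted by
  the intervals matching -n \<le> w \<le> n and compared by monotone convergence.\<close>

lemma nn_integral_exp_substitution:
  fixes f :: "real \<Rightarrow> real" and c :: real
  assumes [measurable]: "f \<in> borel_measurable borel" and c: "c > 0"
  shows "(\<integral>\<^sup>+t. ennreal (f t) * indicator {0<..} t \<partial>lborel) = (\<integral>\<^sup>+w. ennreal (f (c * exp w)) * ennreal (c * exp w) \<partial>lborel)"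
proof (rule LIMSEQ_unique)
  let ?A = "\<lambda>n. {c * exp (- real n)..c * exp (real n)}"
  have ind: "eventually (\<lambda>n. t \<in> ?A n) sequentially" if t: "t > 0" for t
  proof -
    obtain m :: nat where m: "\<bar>ln (t / c)\<bar> \<le> real m" using real_arch_simple by blast
    have "t \<in> ?A n" if "m \<le> n" for n
    proof -
      have "- real n \<le> ln (t / c)" "ln (t / c) \<le> real n" using m that by linarith+
      then have "exp (- real n) \<le> exp (ln (t / c))" "exp (ln (t / c)) \<le> exp (real n)" by simp_all
      then show ?thesis using c t by (simp add: field_simps)
    qed
    then show ?thesis by (auto simp: eventually_sequentially)
  qed
  have mono: "?A m \<subseteq> ?A n" if "m \<le> n" for m n
    using that c by (auto intro: order_trans[of _ "c * exp (- real m)"] order_trans[of _ "c * exp (real m)"])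
  show "(\<lambda>n. \<integral>\<^sup>+t. ennreal (f t) * indicator (?A n) t \<partial>lborel) \<longlonglongrightarrow> (\<integral>\<^sup>+t. ennreal (f t) * indicator {0<..} t \<partial>lborel)"
  proof (rule nn_integral_LIMSEQ)
    show "incseq (\<lambda>n t. ennreal (f t) * indicator (?A n) t)"
    proof (intro incseq_SucI le_funI)
      fix n t
      show "ennreal (f t) * indicator (?A n) t \<le> ennreal (f t) * indicator (?A (Suc n)) t"
      proof (cases "t \<in> ?A n")
        case True
        moreover have "?A n \<subseteq> ?A (Suc n)" by (rule mono) simp
        ultimately have "t \<in> ?A (Suc n)" by (rule rev_subsetD)
        with True show ?thesis by (simp only: indicator_simps order_refl)
      qed simp
    qed
    show "(\<lambda>n. ennreal (f t) * indicator (?A n) t) \<longlonglongrightarrow> ennreal (f t) * indicator {0<..} t" for t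
    proof (cases "t > 0")
      case True
      have "eventually (\<lambda>n. ennreal (f t) * indicator (?A n) t = ennreal (f t) * indicator {0<..} t) sequentially"
        using ind[OF True] by eventually_elim (use True in simp)
      then show ?thesis by (rule tendsto_eventually)
    next
      case False
      then have "t \<notin> ?A n" for n using c by (smt (verit) atLeastAtMost_iff exp_gt_zero mult_pos_pos)
      then show ?thesis using False by simp
    qed
  qed measurable
  have "(\<integral>\<^sup>+t. ennreal (f t) * indicator (?A n) t \<partial>lborel) =
     (\<integral>\<^sup>+w. ennreal (f (c * exp w)) * ennreal (c * exp w) * indicator {- real n..real n} w \<partial>lborel)" for n
  proof -
    have "(\<integral>\<^sup>+t. ennreal (f t * indicator (?A n) t) \<partial>lborel) =
      (\<integral>\<^sup>+w. ennreal (f (c * exp w) * (c * exp w) * indicator {- real n..real n} w) \<partial>lborel)"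
    proof (rule nn_integral_substitution)
      show "((\<lambda>w. c * exp w) has_real_derivative c * exp x) (at x)" for x
        by (auto intro!: derivative_eq_intros)
    qed (use c in \<open>auto simp: set_borel_measurable_def intro!: continuous_intros\<close>)
    moreover have "(\<integral>\<^sup>+t. ennreal (f t * indicator (?A n) t) \<partial>lborel) = (\<integral>\<^sup>+t. ennreal (f t) * indicator (?A n) t \<partial>lborel)"
      by (intro nn_integral_cong) (simp add: indicator_def)
    moreover have "(\<integral>\<^sup>+w. ennreal (f (c * exp w) * (c * exp w) * indicator {- real n..real n} w) \<partial>lborel) =
      (\<integral>\<^sup>+w. ennreal (f (c * exp w)) * ennreal (c * exp w) * indicator {- real n..real n} w \<partial>lborel)"
      using c by (intro nn_integral_cong) (simp add: indicator_def ennreal_mult'')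
    ultimately show ?thesis by simp
  qed
  moreover have "(\<lambda>n. \<integral>\<^sup>+w. ennreal (f (c * exp w)) * ennreal (c * exp w) * indicator {- real n..real n} w \<partial>lborel) \<longlonglongrightarrow>
     (\<integral>\<^sup>+w. ennreal (f (c * exp w)) * ennreal (c * exp w) \<partial>lborel)"
  proof (rule nn_integral_LIMSEQ)
    show "incseq (\<lambda>n w. ennreal (f (c * exp w)) * ennreal (c * exp w) * indicator {- real n..real n} w)"
      by (intro incseq_SucI le_funI) (auto split: split_indicator)
    show "(\<lambda>n. ennreal (f (c * exp w)) * ennreal (c * exp w) * indicator {- real n..real n} w) \<longlonglongrightarrow> ennreal (f (c * exp w)) * ennreal (c * exp w)" for w
    proof -
      obtain m :: nat where m: "\<bar>w\<bar> \<le> real m" using real_arch_simple by blast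
      have "eventually (\<lambda>n. ennreal (f (c * exp w)) * ennreal (c * exp w) * indicator {- real n..real n} w = ennreal (f (c * exp w)) * ennreal (c * exp w)) sequentially"
        using eventually_ge_at_top[of m]
      proof eventually_elim
        case (elim n)
        then have "real m \<le> real n" by simp
        then have "w \<in> {- real n..real n}" using m by auto
        then show ?case by simp
      qed
      then show ?thesis by (rule tendsto_eventually)
    qed
  qed measurable
  ultimately show "(\<lambda>n. \<integral>\<^sup>+t. ennreal (f t) * indicator (?A n) t \<partial>lborel) \<longlonglongrightarrow>
     (\<integral>\<^sup>+w. ennreal (f (c * exp w)) * ennreal (c * exp w) \<partial>lborel)" by simp
qed

text \<open>The right side is the maximum of the left one over y, attained at y = a/b; the proof is
  the tangent bound for ln at that point.\<close>

lemma powr_exp_bounded: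
  fixes a b :: real
  assumes "a > 0" "b > 0" "y > 0"
  shows "y powr a * exp (- (b * y)) \<le> exp (a * ln (a / b) - a)"
proof -
  have "ln (b * y / a) \<le> b * y / a - 1" using assms by (intro ln_le_minus_one) simp
  then have "ln y \<le> b * y / a - 1 + ln (a / b)" using assms by (simp add: ln_div ln_mult)
  then have "a * ln y \<le> a * (b * y / a - 1 + ln (a / b))" using assms by (intro mult_left_mono) auto
  also have "\<dots> = b * y - a + a * ln (a / b)" using assms by (simp add: field_simps)
  finally have "a * ln y - b * y \<le> a * ln (a / b) - a" by simp
  then have "exp (a * ln y - b * y) \<le> exp (a * ln (a / b) - a)" by simp
  then show ?thesis using assms by (simp add: powr_def exp_diff exp_minus field_simps)
qed

lemma nn_integral_exp_neg:
  assumes "c > 0"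
  shows "(\<integral>\<^sup>+t. ennreal (exp (- (c * t))) * indicator {0<..} t \<partial>lborel) = ennreal (1 / c)"
proof -
  have "(\<integral>\<^sup>+t. ennreal (exp (- (c * t))) * indicator {0<..} t \<partial>lborel) = (\<integral>\<^sup>+t. ennreal (exp (- (c * t))) * indicator {0..} t \<partial>lborel)"
  proof (rule nn_integral_cong_AE)
    have "AE t in lborel. t \<noteq> (0::real)" by (rule AE_lborel_singleton)
    then show "AE t in lborel. ennreal (exp (- (c * t))) * indicator {0<..} t = ennreal (exp (- (c * t))) * indicator {0..} t"
      by eventually_elim (auto split: split_indicator)
  qed
  also have "\<dots> = ennreal (0 - (- exp (- (c * 0)) / c))"
  proof (rule nn_integral_FTC_atLeast[where F = "\<lambda>t. - exp (- (c * t)) / c" and T = 0])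
    show "((\<lambda>t. - exp (- (c * t)) / c) has_real_derivative exp (- (c * x))) (at x)" for x
      using assms by (auto intro!: derivative_eq_intros)
    show "((\<lambda>t. - exp (- (c * t)) / c) \<longlongrightarrow> 0) at_top"
      using assms by real_asymp
  qed auto
  finally show ?thesis by simp
qed

text \<open>Writing (exp(-t) - exp(-(1 + y) t))/t as the integral of exp(-(1 + r) t) over r from 0
  to y and exchanging the order leaves the integral of 1/(1 + r).\<close>

lemma frullani:
  assumes y: "y \<ge> 0"
  shows "(\<integral>\<^sup>+t. ennreal (exp (- t) * (1 - exp (- (t * y))) / t) * indicator {0<..} t \<partial>lborel) = ennreal (ln (1 + y))"
proof -
  have "(\<integral>\<^sup>+t. ennreal (exp (- t) * (1 - exp (- (t * y))) / t) * indicator {0<..} t \<partial>lborel) =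
    (\<integral>\<^sup>+t. (\<integral>\<^sup>+r. ennreal (exp (- ((1 + r) * t))) * indicator {0<..} t * indicator {0..y} r \<partial>lborel) \<partial>lborel)"
  proof (rule nn_integral_cong)
    fix t :: real
    show "ennreal (exp (- t) * (1 - exp (- (t * y))) / t) * indicator {0<..} t =
       (\<integral>\<^sup>+r. ennreal (exp (- ((1 + r) * t))) * indicator {0<..} t * indicator {0..y} r \<partial>lborel)"
    proof (cases "t > 0")
      case True
      have "(\<integral>\<^sup>+r. ennreal (exp (- ((1 + r) * t))) * indicator {0..y} r \<partial>lborel) =
         ennreal (- exp (- ((1 + y) * t)) / t - (- exp (- ((1 + 0) * t)) / t))"
      proof (rule nn_integral_FTC_Icc[where F = "\<lambda>r. - exp (- ((1 + r) * t)) / t"])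
        show "((\<lambda>r. - exp (- ((1 + r) * t)) / t) has_real_derivative exp (- ((1 + r) * t))) (at r)" for r
          using True by (auto intro!: derivative_eq_intros)
      qed (use y in auto)
      also have "- exp (- ((1 + y) * t)) / t - (- exp (- ((1 + 0) * t)) / t) = exp (- t) * (1 - exp (- (t * y))) / t"
        using True by (simp add: field_simps mult_exp_exp)
      finally show ?thesis using True by simp
    qed simp
  qed
  also have "\<dots> = (\<integral>\<^sup>+r. (\<integral>\<^sup>+t. ennreal (exp (- ((1 + r) * t))) * indicator {0<..} t * indicator {0..y} r \<partial>lborel) \<partial>lborel)"
    by (rule lborel_pair.Fubini'[symmetric]) measurable
  also have "\<dots> = (\<integral>\<^sup>+r. ennreal (1 / (1 + r)) * indicator {0..y} r \<partial>lborel)"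
  proof (rule nn_integral_cong)
    fix r :: real
    show "(\<integral>\<^sup>+t. ennreal (exp (- ((1 + r) * t))) * indicator {0<..} t * indicator {0..y} r \<partial>lborel) = ennreal (1 / (1 + r)) * indicator {0..y} r"
    proof (cases "r \<in> {0..y}")
      case True
      then show ?thesis using nn_integral_exp_neg[of "1 + r"] by simp
    qed simp
  qed
  also have "\<dots> = ennreal (ln (1 + y) - ln (1 + 0))"
  proof (rule nn_integral_FTC_Icc[where F = "\<lambda>r. ln (1 + r)"])
    show "((\<lambda>r. ln (1 + r)) has_real_derivative 1 / (1 + r)) (at r)" if "r \<in> {0..y}" for r
      using that by (auto intro!: derivative_eq_intros)
  qed (use y in auto)
  finally show ?thesis by simp
qed

text \<open>The kernel is a superposition of heat kernels, with the same weight as in Frullani's formula for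
  the symbol \<open>ln (1 + \<bar>\<xi>\<bar>\<^sup>2)\<close>.\<close>

lemma J_kernel_heat:
  fixes z :: "'a::euclidean_space"
  assumes z: "z \<noteq> 0"
  shows "ennreal (J_kernel z) = (\<integral>\<^sup>+t. ennreal (exp (- t) * heat t z / t) * indicator {0<..} t \<partial>lborel)"
proof -
  define r where "r = norm z"
  define \<nu> where "\<nu> = real DIM('a) / 2"
  have r: "r > 0" using z by (simp add: r_def)
  have nu: "\<nu> > 0" by (simp add: \<nu>_def)
  let ?I = "\<integral>\<^sup>+t. ennreal (exp (- t) * heat t z / t) * indicator {0<..} t \<partial>lborel"
  let ?g = "\<lambda>w. exp (- (r * cosh w))"
  have [measurable]: "(cosh :: real \<Rightarrow> real) \<in> borel_measurable borel"
    by (auto intro!: borel_measurable_continuous_onI continuous_intros)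
  \<comment> \<open>Finiteness matters: a divergent integral would make the Bochner integral in
    \<open>bessel_K\<close> default to 0.\<close>
  have fin: "?I < \<infinity>"
  proof -
    define C where "C = (4 * pi) powr (- \<nu>) * exp ((\<nu> + 1) * ln ((\<nu> + 1) / (r\<^sup>2 / 4)) - (\<nu> + 1))"
    have "?I \<le> (\<integral>\<^sup>+t. ennreal C * (ennreal (exp (- (1 * t))) * indicator {0<..} t) \<partial>lborel)"
    proof (rule nn_integral_mono)
      fix t :: real
      show "ennreal (exp (- t) * heat t z / t) * indicator {0<..} t \<le> ennreal C * (ennreal (exp (- (1 * t))) * indicator {0<..} t)"
      proof (cases "t > 0")
        case True
        have "(1 / t) powr (\<nu> + 1) * exp (- (r\<^sup>2 / 4 * (1 / t))) \<le> exp ((\<nu> + 1) * ln ((\<nu> + 1) / (r\<^sup>2 / 4)) - (\<nu> + 1))"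
          using True r nu by (intro powr_exp_bounded) auto
        then have *: "(4 * pi) powr (- \<nu>) * ((1 / t) powr (\<nu> + 1) * exp (- (r\<^sup>2 / 4 * (1 / t)))) \<le> C"
          unfolding C_def by (intro mult_left_mono) auto
        have "heat t z / t = (4 * pi) powr (- \<nu>) * ((1 / t) powr (\<nu> + 1) * exp (- (r\<^sup>2 / 4 * (1 / t))))"
          using True by (simp add: heat_def \<nu>_def[symmetric] r_def[symmetric] powr_mult powr_minus_divide powr_add powr_divide)
        then have "exp (- t) * heat t z / t \<le> C * exp (- (1 * t))"
          using * by (simp add: mult.commute[of C] mult_left_mono flip: times_divide_eq_right)
        then show ?thesis using True by (simp add: ennreal_mult'[symmetric] ennreal_mult''[symmetric] ennreal_leI)
      qed simp
    qed
    also have "\<dots> = ennreal C" using nn_integral_exp_neg[of 1] by (simp add: nn_integral_cmult)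
    finally show ?thesis by (rule order_le_less_trans) simp
  qed
  \<comment> \<open>The substitution t = (r/2) exp w symmetrises the exponent: t + r^2/(4 t) becomes
    r cosh w, as in the Bessel integral.\<close>
  have "?I = (\<integral>\<^sup>+w. ennreal (exp (- (r / 2 * exp w)) * heat (r / 2 * exp w) z / (r / 2 * exp w)) * ennreal (r / 2 * exp w) \<partial>lborel)"
    using r by (intro nn_integral_exp_substitution) auto
  also have "\<dots> = (\<integral>\<^sup>+w. ennreal ((2 * pi * r) powr (- \<nu>)) * ennreal (?g w * exp (- (\<nu> * w))) \<partial>lborel)"
  proof (rule nn_integral_cong)
    fix w :: real
    define \<tau> where "\<tau> = r / 2 * exp w"
    have t: "\<tau> > 0" using r by (simp add: \<tau>_def)
    have e: "\<tau> + r\<^sup>2 / (4 * \<tau>) = r * cosh w"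
      using r by (simp add: \<tau>_def cosh_field_def exp_minus power2_eq_square field_simps)
    have "4 * pi * \<tau> = 2 * pi * r * exp w" by (simp add: \<tau>_def)
    then have "(4 * pi * \<tau>) powr (- \<nu>) = (2 * pi * r * exp w) powr (- \<nu>)" by (simp only:)
    also have "\<dots> = (2 * pi * r) powr (- \<nu>) * exp w powr (- \<nu>)" by (rule powr_mult)
    also have "exp w powr (- \<nu>) = exp (- (\<nu> * w))" by (simp add: powr_def)
    finally have "(4 * pi * \<tau>) powr (- \<nu>) = (2 * pi * r) powr (- \<nu>) * exp (- (\<nu> * w))" .
    then have "exp (- \<tau>) * heat \<tau> z = (2 * pi * r) powr (- \<nu>) * (exp (- (\<tau> + r\<^sup>2 / (4 * \<tau>))) * exp (- (\<nu> * w)))"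
      by (simp add: heat_def \<nu>_def[symmetric] r_def[symmetric] mult_exp_exp)
    then have "exp (- \<tau>) * heat \<tau> z / \<tau> * \<tau> = (2 * pi * r) powr (- \<nu>) * (?g w * exp (- (\<nu> * w)))"
      using t e by simp
    then show "ennreal (exp (- (r / 2 * exp w)) * heat (r / 2 * exp w) z / (r / 2 * exp w)) * ennreal (r / 2 * exp w) =
       ennreal ((2 * pi * r) powr (- \<nu>)) * ennreal (?g w * exp (- (\<nu> * w)))"
      unfolding \<tau>_def[symmetric] using t by (simp add: ennreal_mult''[symmetric])
  qed
  also have "\<dots> = ennreal ((2 * pi * r) powr (- \<nu>)) * (\<integral>\<^sup>+w. ennreal (?g w * exp (- (\<nu> * w))) \<partial>lborel)"
    by (rule nn_integral_cmult) measurable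
  also have "(\<integral>\<^sup>+w. ennreal (?g w * exp (- (\<nu> * w))) \<partial>lborel) =
     (\<integral>\<^sup>+w. ennreal (?g w * exp (- (\<nu> * w))) * indicator {0<..} w + ennreal (?g w * exp (- (\<nu> * w))) * indicator {..<0} w \<partial>lborel)"
  proof (rule nn_integral_cong_AE)
    have "AE t in lborel. t \<noteq> (0::real)" by (rule AE_lborel_singleton)
    then show "AE w in lborel. ennreal (?g w * exp (- (\<nu> * w))) =
       ennreal (?g w * exp (- (\<nu> * w))) * indicator {0<..} w + ennreal (?g w * exp (- (\<nu> * w))) * indicator {..<0} w"
      by eventually_elim (auto split: split_indicator)
  qed
  also have "\<dots> = (\<integral>\<^sup>+w. ennreal (?g w * exp (- (\<nu> * w))) * indicator {0<..} w \<partial>lborel) + (\<integral>\<^sup>+w. ennreal (?g w * exp (- (\<nu> * w))) * indicator {..<0} w \<partial>lborel)"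
    by (rule nn_integral_add) measurable
  \<comment> \<open>Reflecting the negative half-line pairs exp(-\<nu> w) with exp(\<nu> w), which
    gives twice the hyperbolic cosine.\<close>
  also have "(\<integral>\<^sup>+w. ennreal (?g w * exp (- (\<nu> * w))) * indicator {..<0} w \<partial>lborel) =
     (\<integral>\<^sup>+w. ennreal (?g w * exp (\<nu> * w)) * indicator {0<..} w \<partial>lborel)"
    by (subst nn_integral_real_affine[where c = "-1" and t = 0]) (auto intro!: nn_integral_cong split: split_indicator)
  also have "(\<integral>\<^sup>+w. ennreal (?g w * exp (- (\<nu> * w))) * indicator {0<..} w \<partial>lborel) + (\<integral>\<^sup>+w. ennreal (?g w * exp (\<nu> * w)) * indicator {0<..} w \<partial>lborel)
     = (\<integral>\<^sup>+w. 2 * ennreal (indicator {0<..} w * (?g w * cosh (\<nu> * w))) \<partial>lborel)"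
    by (subst nn_integral_add[symmetric])
       (auto intro!: nn_integral_cong simp: cosh_field_def ennreal_plus[symmetric] ennreal_mult'' [symmetric] distrib_left
          simp del: ennreal_plus split: split_indicator simp flip: ennreal_numeral)
  also have "\<dots> = 2 * (\<integral>\<^sup>+w. ennreal (indicator {0<..} w * (?g w * cosh (\<nu> * w))) \<partial>lborel)"
    by (rule nn_integral_cmult) measurable
  finally have I: "?I = ennreal ((2 * pi * r) powr (- \<nu>)) * (2 * (\<integral>\<^sup>+w. ennreal (indicator {0<..} w * (?g w * cosh (\<nu> * w))) \<partial>lborel))" .
  have c0: "(2 * pi * r) powr (- \<nu>) > 0" using r by simp
  have "(\<integral>\<^sup>+w. ennreal (indicator {0<..} w * (?g w * cosh (\<nu> * w))) \<partial>lborel) < \<infinity>"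
    using fin c0 unfolding I by (auto simp: ennreal_mult_less_top less_top[symmetric] ennreal_mult_eq_top_iff)
  then have "integrable lborel (\<lambda>w. indicator {0<..} w * (?g w * cosh (\<nu> * w)))"
    by (intro integrableI_nonneg) (auto simp: cosh_real_nonneg)
  then have "(\<integral>\<^sup>+w. ennreal (indicator {0<..} w * (?g w * cosh (\<nu> * w))) \<partial>lborel) = ennreal (bessel_K \<nu> r)"
    by (subst nn_integral_eq_integral) (auto simp: bessel_K_def set_lebesgue_integral_def cosh_real_nonneg)
  then have I2: "?I = ennreal ((2 * pi * r) powr (- \<nu>) * (2 * bessel_K \<nu> r))"
    unfolding I by (simp add: ennreal_mult')
  have "(2 * pi * r) powr (- \<nu>) * (2 * bessel_K \<nu> r) = J_kernel z"
  proof -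
    have rn: "r ^ DIM('a) = r powr \<nu> * r powr \<nu>"
      using r by (simp add: powr_add[symmetric] \<nu>_def powr_realpow)
    have "J_kernel z = pi powr (- \<nu>) * (2 powr (1 - \<nu>) * r powr \<nu> * bessel_K \<nu> r) / (r powr \<nu> * r powr \<nu>)"
      unfolding J_kernel_def omega_log_def r_def[symmetric] \<nu>_def[symmetric] rn ..
    also have "\<dots> = pi powr (- \<nu>) * 2 powr (1 - \<nu>) * r powr (- \<nu>) * bessel_K \<nu> r"
      using r by (simp add: powr_minus_divide)
    also have "2 powr (1 - \<nu>) = 2 * 2 powr (- \<nu>)" by (simp add: powr_diff powr_minus_divide)
    finally show ?thesis using r by (simp add: powr_mult mult_ac)
  qed
  with I2 show ?thesis by simp
qed

section \<open>The logarithmic quadratic form in position and in frequency\<close>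

lemma J_kernel_nonneg [simp]: "0 \<le> J_kernel z"
proof -
  have "0 \<le> bessel_K \<nu> r" for \<nu> r
    unfolding bessel_K_def set_lebesgue_integral_def
    by (intro integral_nonneg_AE AE_I2) (auto simp: cosh_real_nonneg)
  then show ?thesis by (simp add: J_kernel_def omega_log_def)
qed

lemma J_kernel_measurable [measurable]: "J_kernel \<in> borel_measurable borel"
proof -
  have [measurable]: "(cosh :: real \<Rightarrow> real) \<in> borel_measurable borel"
    by (auto intro!: borel_measurable_continuous_onI continuous_intros)
  have [measurable]: "bessel_K \<nu> \<in> borel_measurable borel" for \<nu>
    unfolding bessel_K_def[abs_def] set_lebesgue_integral_def by measurable
  show ?thesis unfolding J_kernel_def[abs_def] omega_log_def[abs_def] by measurable
qed

lemma nn_log_form_heat: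
  fixes G :: "'a::euclidean_space \<Rightarrow> 'a \<Rightarrow> real"
  assumes [measurable]: "case_prod G \<in> borel_measurable (borel \<Otimes>\<^sub>M borel)" and G: "\<And>x y. 0 \<le> G x y"
  shows "(\<integral>\<^sup>+x. (\<integral>\<^sup>+y. ennreal (G x y * J_kernel (x - y)) \<partial>lborel) \<partial>lborel) =
    (\<integral>\<^sup>+t. ennreal (exp (- t) / t) * indicator {0<..} t * (\<integral>\<^sup>+x. (\<integral>\<^sup>+y. ennreal (G x y * heat t (x - y)) \<partial>lborel) \<partial>lborel) \<partial>lborel)"
proof -
  have "(\<integral>\<^sup>+x. (\<integral>\<^sup>+y. ennreal (G x y * J_kernel (x - y)) \<partial>lborel) \<partial>lborel) =
     (\<integral>\<^sup>+x. (\<integral>\<^sup>+y. (\<integral>\<^sup>+t. ennreal (exp (- t) / t) * indicator {0<..} t * ennreal (G x y * heat t (x - y)) \<partial>lborel) \<partial>lborel) \<partial>lborel)"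
  proof (rule nn_integral_cong, rule nn_integral_cong_AE)
    fix x :: 'a
    \<comment> \<open>On the diagonal \<open>J_kernel\<close> has the default value 0 of a division
      by 0 and the heat representation fails, but the diagonal is a null set.\<close>
    have "AE y in lborel. y \<noteq> x" by (rule AE_lborel_singleton)
    then show "AE y in lborel. ennreal (G x y * J_kernel (x - y)) = (\<integral>\<^sup>+t. ennreal (exp (- t) / t) * indicator {0<..} t * ennreal (G x y * heat t (x - y)) \<partial>lborel)"
    proof eventually_elim
      case (elim y)
      then have "x - y \<noteq> 0" by simp
      note J = J_kernel_heat[OF this]
      have "ennreal (G x y * J_kernel (x - y)) = ennreal (G x y) * ennreal (J_kernel (x - y))"
        using G by (simp add: ennreal_mult)
      also have "\<dots> = (\<integral>\<^sup>+t. ennreal (G x y) * (ennreal (exp (- t) * heat t (x - y) / t) * indicator {0<..} t) \<partial>lborel)"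
        unfolding J by (rule nn_integral_cmult[symmetric]) measurable
      also have "\<dots> = (\<integral>\<^sup>+t. ennreal (exp (- t) / t) * indicator {0<..} t * ennreal (G x y * heat t (x - y)) \<partial>lborel)"
        using G by (intro nn_integral_cong) (auto simp: ennreal_mult'[symmetric] mult_ac split: split_indicator)
      finally show ?case .
    qed
  qed
  also have "\<dots> = (\<integral>\<^sup>+x. (\<integral>\<^sup>+t. (\<integral>\<^sup>+y. ennreal (exp (- t) / t) * indicator {0<..} t * ennreal (G x y * heat t (x - y)) \<partial>lborel) \<partial>lborel) \<partial>lborel)"
    by (intro nn_integral_cong lborel_pair.Fubini'[symmetric]) measurable
  also have "\<dots> = (\<integral>\<^sup>+t. (\<integral>\<^sup>+x. (\<integral>\<^sup>+y. ennreal (exp (- t) / t) * indicator {0<..} t * ennreal (G x y * heat t (x - y)) \<partial>lborel) \<partial>lborel) \<partial>lborel)"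
    by (rule lborel_pair.Fubini'[symmetric]) measurable
  also have "\<dots> = (\<integral>\<^sup>+t. ennreal (exp (- t) / t) * indicator {0<..} t * (\<integral>\<^sup>+x. (\<integral>\<^sup>+y. ennreal (G x y * heat t (x - y)) \<partial>lborel) \<partial>lborel) \<partial>lborel)"
    by (simp add: nn_integral_cmult)
  finally show ?thesis .
qed

text \<open>Integrating the heat forms against exp(-t)/t gives the kernel form on one side and, by
  Frullani, the symbol ln(1+|\<xi>|^2) on the other. The factor 2 matches the 1/2 in the energy.
  With extended integrals the identity also decides finiteness of both sides at once.\<close>

theorem nn_log_form_fourier:
  fixes u :: "'a::euclidean_space \<Rightarrow> real"
  assumes u: "u \<in> L12"
  shows "(\<integral>\<^sup>+x. (\<integral>\<^sup>+y. ennreal ((u x - u y)^2 * J_kernel (x - y)) \<partial>lborel) \<partial>lborel) =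
    2 * (\<integral>\<^sup>+\<xi>. ennreal (ln (br \<xi>) * psd u \<xi>) \<partial>lborel)"
proof -
  note [measurable] = L12_D(1)[OF u]
  have "(\<integral>\<^sup>+x. (\<integral>\<^sup>+y. ennreal ((u x - u y)^2 * J_kernel (x - y)) \<partial>lborel) \<partial>lborel) =
    (\<integral>\<^sup>+t. ennreal (exp (- t) / t) * indicator {0<..} t * (\<integral>\<^sup>+x. (\<integral>\<^sup>+y. ennreal ((u x - u y)^2 * heat t (x - y)) \<partial>lborel) \<partial>lborel) \<partial>lborel)"
    by (rule nn_log_form_heat) auto
  also have "\<dots> = (\<integral>\<^sup>+t. (\<integral>\<^sup>+\<xi>. ennreal (2 * psd u \<xi>) *
      (ennreal (exp (- t) * (1 - exp (- (t * (norm \<xi>)^2))) / t) * indicator {0<..} t) \<partial>lborel) \<partial>lborel)"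
  proof (rule nn_integral_cong)
    fix t :: real
    show "ennreal (exp (- t) / t) * indicator {0<..} t * (\<integral>\<^sup>+x. (\<integral>\<^sup>+y. ennreal ((u x - u y)^2 * heat t (x - y)) \<partial>lborel) \<partial>lborel) =
       (\<integral>\<^sup>+\<xi>. ennreal (2 * psd u \<xi>) * (ennreal (exp (- t) * (1 - exp (- (t * (norm \<xi>)^2))) / t) * indicator {0<..} t) \<partial>lborel)"
    proof (cases "t > 0")
      case True
      show ?thesis
        unfolding heat_form_fourier[OF True u]
        using True by (subst nn_integral_cmult[symmetric], measurable) (auto intro!: nn_integral_cong simp: ennreal_mult'[symmetric] mult_ac)
    qed simp
  qed
  also have "\<dots> = (\<integral>\<^sup>+\<xi>. (\<integral>\<^sup>+t. ennreal (2 * psd u \<xi>) *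
      (ennreal (exp (- t) * (1 - exp (- (t * (norm \<xi>)^2))) / t) * indicator {0<..} t) \<partial>lborel) \<partial>lborel)"
    by (rule lborel_pair.Fubini'[symmetric]) measurable
  also have "\<dots> = (\<integral>\<^sup>+\<xi>. 2 * ennreal (ln (br \<xi>) * psd u \<xi>) \<partial>lborel)"
  proof (rule nn_integral_cong)
    fix \<xi> :: 'a
    have "(\<integral>\<^sup>+t. ennreal (2 * psd u \<xi>) *
      (ennreal (exp (- t) * (1 - exp (- (t * (norm \<xi>)^2))) / t) * indicator {0<..} t) \<partial>lborel) =
      ennreal (2 * psd u \<xi>) * (\<integral>\<^sup>+t. ennreal (exp (- t) * (1 - exp (- (t * (norm \<xi>)^2))) / t) * indicator {0<..} t \<partial>lborel)"
      by (rule nn_integral_cmult) measurable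
    also have "\<dots> = ennreal (2 * psd u \<xi>) * ennreal (ln (br \<xi>))"
      by (subst frullani) simp_all
    also have "\<dots> = 2 * ennreal (ln (br \<xi>) * psd u \<xi>)"
      by (simp add: ennreal_mult' ennreal_mult'' mult_ac)
    finally show "(\<integral>\<^sup>+t. ennreal (2 * psd u \<xi>) *
      (ennreal (exp (- t) * (1 - exp (- (t * (norm \<xi>)^2))) / t) * indicator {0<..} t) \<partial>lborel) =
      2 * ennreal (ln (br \<xi>) * psd u \<xi>)" .
  qed
  also have "\<dots> = 2 * (\<integral>\<^sup>+\<xi>. ennreal (ln (br \<xi>) * psd u \<xi>) \<partial>lborel)"
    by (rule nn_integral_cmult) measurable
  finally show ?thesis .
qed

subsection \<open>The logarithmic energy\<close>

text \<open>Membership in the logarithmic space without the support condition, expressed in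
  frequency.\<close>

definition log_regular :: "('a::euclidean_space \<Rightarrow> real) \<Rightarrow> bool" where
  "log_regular u \<longleftrightarrow> u \<in> L12 \<and> integrable lborel (\<lambda>\<xi>. ln (br \<xi>) * psd u \<xi>)"

definition log_energy :: "('a::euclidean_space \<Rightarrow> real) \<Rightarrow> real" where
  "log_energy u = (LINT \<xi>|lborel. ln (br \<xi>) * psd u \<xi>)"

lemma log_energy_nonneg: "0 \<le> log_energy u"
  unfolding log_energy_def by (intro integral_nonneg_AE AE_I2) auto

text \<open>On a bounded set |u| \<le> 1 + u^2 has an integrable right side.\<close>

lemma square_integrable_bounded_L12:
  fixes u :: "'a::euclidean_space \<Rightarrow> real"
  assumes \<Omega>: "bounded \<Omega>" and u: "square_integrable u" and v: "vanishes_outside \<Omega> u"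
  shows "u \<in> L12"
proof -
  have [measurable]: "u \<in> borel_measurable borel" using u by (simp add: square_integrable_def)
  have u2: "integrable lborel (\<lambda>x. (u x)^2)" using u by (simp add: square_integrable_def)
  obtain R where "\<And>x. x \<in> \<Omega> \<Longrightarrow> norm x \<le> R" using \<Omega> by (auto simp: bounded_iff)
  then have R: "\<Omega> \<subseteq> cball 0 R" by auto
  have i: "integrable lborel (indicator (cball (0::'a) R) :: 'a \<Rightarrow> real)"
    using emeasure_bounded_finite[of "cball (0::'a) R"] by (intro integrable_real_indicator) auto
  have "integrable lborel u"
  proof (rule Bochner_Integration.integrable_bound[OF Bochner_Integration.integrable_add[OF i u2]])
    have "AE x in lborel. x \<notin> \<Omega> \<longrightarrow> u x = 0" using v by (simp add: vanishes_outside_def)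
    then show "AE x in lborel. norm (u x) \<le> norm (indicator (cball 0 R) x + (u x)^2)"
    proof eventually_elim
      case (elim x)
      have "\<bar>u x\<bar> \<le> 1 + (u x)^2" using sum_squares_bound[of 1 "\<bar>u x\<bar>"] by simp
      then show ?case using elim R by (auto split: split_indicator)
    qed
  qed measurable
  then show ?thesis using u2 by (simp add: L12_def)
qed

text \<open>The extended identity needs no regularity, so finiteness of the kernel form and of the
  frequency integral are equivalent. This translates the logarithmic space into frequency.\<close>

lemma log_form_pair:
  fixes u :: "'a::euclidean_space \<Rightarrow> real"
  assumes u: "u \<in> L12"
  shows "integrable (lborel \<Otimes>\<^sub>M lborel) (\<lambda>(x, y). (u x - u y)^2 * J_kernel (x - y)) \<longleftrightarrow> log_regular u"
    and "log_regular u \<Longrightarrow> (LINT (x, y)|(lborel \<Otimes>\<^sub>M lborel). (u x - u y)^2 * J_kernel (x - y)) = 2 * log_energy u"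
proof -
  note [measurable] = L12_D(1)[OF u]
  let ?F = "\<lambda>(x, y). (u x - u y)^2 * J_kernel (x - y)"
  let ?W = "\<integral>\<^sup>+\<xi>. ennreal (ln (br \<xi>) * psd u \<xi>) \<partial>lborel"
  have m: "?F \<in> borel_measurable (lborel \<Otimes>\<^sub>M lborel)" by measurable
  have eq: "(\<integral>\<^sup>+z. ennreal (?F z) \<partial>(lborel \<Otimes>\<^sub>M lborel)) = 2 * ?W"
    using nn_log_form_fourier[OF u] by (subst lborel.nn_integral_fst[symmetric]) auto
  have "integrable (lborel \<Otimes>\<^sub>M lborel) ?F \<longleftrightarrow> (\<integral>\<^sup>+z. ennreal (?F z) \<partial>(lborel \<Otimes>\<^sub>M lborel)) < \<infinity>"
    using m by (subst integrable_iff_bounded) (auto simp: case_prod_unfold abs_mult)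
  also have "\<dots> \<longleftrightarrow> ?W < \<infinity>" unfolding eq by (auto simp: ennreal_mult_less_top)
  also have "\<dots> \<longleftrightarrow> log_regular u" using u by (simp add: log_regular_def integrable_iff_bounded abs_mult)
  finally show iff: "integrable (lborel \<Otimes>\<^sub>M lborel) ?F \<longleftrightarrow> log_regular u" .
  assume l: "log_regular u"
  then have "integrable (lborel \<Otimes>\<^sub>M lborel) ?F" using iff by simp
  then have "(\<integral>\<^sup>+z. ennreal (?F z) \<partial>(lborel \<Otimes>\<^sub>M lborel)) = ennreal (integral\<^sup>L (lborel \<Otimes>\<^sub>M lborel) ?F)"
    by (rule nn_integral_eq_integral) auto
  moreover have "?W = ennreal (log_energy u)"
    unfolding log_energy_def using l by (intro nn_integral_eq_integral) (auto simp: log_regular_def)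
  ultimately have "ennreal (integral\<^sup>L (lborel \<Otimes>\<^sub>M lborel) ?F) = ennreal (2 * log_energy u)"
    using eq by (simp add: ennreal_mult' log_energy_nonneg)
  moreover have "0 \<le> integral\<^sup>L (lborel \<Otimes>\<^sub>M lborel) ?F" by (intro integral_nonneg_AE AE_I2) auto
  ultimately show "integral\<^sup>L (lborel \<Otimes>\<^sub>M lborel) ?F = 2 * log_energy u"
    using log_energy_nonneg[of u] by (simp add: ennreal_inj)
qed

lemma E_log_self: "log_regular u \<Longrightarrow> E_log u u = log_energy u"
  using log_form_pair(2)[of u] by (simp add: E_log_def power2_eq_square log_regular_def)

lemma H_log_iff:
  assumes "bounded \<Omega>"
  shows "u \<in> H_log \<Omega> \<longleftrightarrow> log_regular u \<and> vanishes_outside \<Omega> u"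
proof
  assume "u \<in> H_log \<Omega>"
  then have u: "square_integrable u" "vanishes_outside \<Omega> u"
    "integrable (lborel \<Otimes>\<^sub>M lborel) (\<lambda>(x, y). (u x - u y)^2 * J_kernel (x - y))"
    by (auto simp: H_log_def)
  show "log_regular u \<and> vanishes_outside \<Omega> u"
    using log_form_pair(1)[OF square_integrable_bounded_L12[OF assms u(1,2)]] u by simp
next
  assume "log_regular u \<and> vanishes_outside \<Omega> u"
  then have u: "u \<in> L12" "log_regular u" "vanishes_outside \<Omega> u" by (auto simp: log_regular_def)
  then show "u \<in> H_log \<Omega>"
    using log_form_pair(1)[OF u(1)] by (auto simp: H_log_def square_integrable_def L12_def)
qed

lemma norm_add_square: "(norm (a + b :: complex))^2 = (norm a)^2 + 2 * Re (a * cnj b) + (norm b)^2"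
  unfolding cmod_power2 by (simp add: power2_eq_square algebra_simps)

lemma norm_diff_square: "(norm (a - b :: complex))^2 = (norm a)^2 - 2 * Re (a * cnj b) + (norm b)^2"
  unfolding cmod_power2 by (simp add: power2_eq_square algebra_simps)

lemma abs_Re_mult_cnj_le: "\<bar>Re (a * cnj b)\<bar> \<le> (norm a)^2 + (norm b)^2"
proof -
  have "\<bar>Re (a * cnj b)\<bar> \<le> norm a * norm b" using abs_Re_le_cmod[of "a * cnj b"] by (simp add: norm_mult)
  also have "\<dots> \<le> (norm a)^2 + (norm b)^2"
  proof -
    have "0 \<le> norm a * norm b" by simp
    then show ?thesis using sum_squares_bound[of "norm a" "norm b"] by linarith
  qed
  finally show ?thesis .
qed

lemma weighted_cross_integrable:
  fixes f g :: "'a::euclidean_space \<Rightarrow> complex"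
  assumes [measurable]: "f \<in> borel_measurable borel" "g \<in> borel_measurable borel" "w \<in> borel_measurable borel"
    and f: "integrable lborel (\<lambda>x. w x * (norm (f x))^2)" and g: "integrable lborel (\<lambda>x. w x * (norm (g x))^2)"
    and w: "\<And>x. 0 \<le> w x"
  shows "integrable lborel (\<lambda>x. w x * Re (f x * cnj (g x)))"
proof (rule Bochner_Integration.integrable_bound[OF Bochner_Integration.integrable_add[OF f g]])
  show "AE x in lborel. norm (w x * Re (f x * cnj (g x))) \<le> norm (w x * (norm (f x))^2 + w x * (norm (g x))^2)"
  proof (rule AE_I2)
    fix x
    have "w x * \<bar>Re (f x * cnj (g x))\<bar> \<le> w x * ((norm (f x))^2 + (norm (g x))^2)"
      by (intro mult_left_mono abs_Re_mult_cnj_le w)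
    then have "\<bar>w x * Re (f x * cnj (g x))\<bar> \<le> w x * (norm (f x))^2 + w x * (norm (g x))^2"
      unfolding abs_mult distrib_left using w[of x] by simp
    then show "norm (w x * Re (f x * cnj (g x))) \<le> norm (w x * (norm (f x))^2 + w x * (norm (g x))^2)"
      unfolding real_norm_def by linarith
  qed
qed measurable

lemma log_regular_combination:
  assumes u: "log_regular u" and v: "log_regular v"
  shows "log_regular (\<lambda>x. u x + v x)" "log_regular (\<lambda>x. u x - v x)" "log_regular (\<lambda>x. c * u x)"
    and "log_energy (\<lambda>x. u x + v x) = log_energy u + 2 * (LINT \<xi>|lborel. ln (br \<xi>) * Re (fourier u \<xi> * cnj (fourier v \<xi>))) + log_energy v"
    and "log_energy (\<lambda>x. u x - v x) = log_energy u - 2 * (LINT \<xi>|lborel. ln (br \<xi>) * Re (fourier u \<xi> * cnj (fourier v \<xi>))) + log_energy v"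
    and "log_energy (\<lambda>x. c * u x) = c\<^sup>2 * log_energy u"
proof -
  have L: "u \<in> L12" "v \<in> L12" using u v by (auto simp: log_regular_def)
  note i = L12_D(2)[OF L(1)] L12_D(2)[OF L(2)]
  note [measurable] = L12_D(1)[OF L(1)] L12_D(1)[OF L(2)]
  let ?w = "\<lambda>\<xi>::'a. ln (br \<xi>)"
  have iu: "integrable lborel (\<lambda>\<xi>. ?w \<xi> * psd u \<xi>)"
    and iv: "integrable lborel (\<lambda>\<xi>. ?w \<xi> * psd v \<xi>)" using u v by (auto simp: log_regular_def)
  have ic: "integrable lborel (\<lambda>\<xi>. ?w \<xi> * Re (fourier u \<xi> * cnj (fourier v \<xi>)))"
    by (rule weighted_cross_integrable[OF _ _ _ iu iv]) auto
  have ea: "?w \<xi> * psd (\<lambda>x. u x + v x) \<xi> = ?w \<xi> * psd u \<xi> +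
     2 * (?w \<xi> * Re (fourier u \<xi> * cnj (fourier v \<xi>))) + ?w \<xi> * psd v \<xi>" for \<xi>
    unfolding fourier_add[OF i] norm_add_square by (simp only: distrib_left mult.left_commute mult.commute mult.assoc)
  have ed: "?w \<xi> * psd (\<lambda>x. u x - v x) \<xi> = ?w \<xi> * psd u \<xi> -
     2 * (?w \<xi> * Re (fourier u \<xi> * cnj (fourier v \<xi>))) + ?w \<xi> * psd v \<xi>" for \<xi>
    unfolding fourier_diff[OF i] norm_diff_square by (simp only: distrib_left right_diff_distrib mult.left_commute mult.commute mult.assoc)
  have es: "?w \<xi> * psd (\<lambda>x. c * u x) \<xi> = c\<^sup>2 * (?w \<xi> * psd u \<xi>)" for \<xi>
    by (simp add: fourier_scale norm_mult power_mult_distrib)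
  show "log_regular (\<lambda>x. u x + v x)" "log_regular (\<lambda>x. u x - v x)" "log_regular (\<lambda>x. c * u x)"
    unfolding log_regular_def ea ed es using iu iv ic L12_add[OF L] L12_diff[OF L] L12_scale[OF L(1)] by auto
  show "log_energy (\<lambda>x. u x + v x) = log_energy u + 2 * (LINT \<xi>|lborel. ln (br \<xi>) * Re (fourier u \<xi> * cnj (fourier v \<xi>))) + log_energy v"
    unfolding log_energy_def ea
    by (subst Bochner_Integration.integral_add, use iu iv ic in simp, use iv in simp)
       (subst Bochner_Integration.integral_add, use iu iv ic in simp_all)
  show "log_energy (\<lambda>x. u x - v x) = log_energy u - 2 * (LINT \<xi>|lborel. ln (br \<xi>) * Re (fourier u \<xi> * cnj (fourier v \<xi>))) + log_energy v"
    unfolding log_energy_def ed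
    by (subst Bochner_Integration.integral_add, use iu iv ic in simp, use iv in simp)
       (subst Bochner_Integration.integral_diff, use iu iv ic in simp_all)
  show "log_energy (\<lambda>x. c * u x) = c\<^sup>2 * log_energy u"
    unfolding log_energy_def es by simp
qed

text \<open>Only the quadratic form is known in frequency so far, so the bilinear one follows by
  polarisation with u + v and u - v.\<close>

lemma E_log_fourier:
  fixes u v :: "'a::euclidean_space \<Rightarrow> real"
  assumes u: "log_regular u" and v: "log_regular v"
  shows "E_log u v = (LINT \<xi>|lborel. ln (br \<xi>) * Re (fourier u \<xi> * cnj (fourier v \<xi>)))"
proof -
  let ?M = "lborel \<Otimes>\<^sub>M (lborel :: 'a measure)"
  have L: "u \<in> L12" "v \<in> L12" "(\<lambda>x. u x + v x) \<in> L12" "(\<lambda>x. u x - v x) \<in> L12"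
    and r: "log_regular (\<lambda>x. u x + v x)" "log_regular (\<lambda>x. u x - v x)"
    using u v log_regular_combination(1,2)[OF u v] by (auto simp: log_regular_def)
  have P: "integrable ?M (\<lambda>(x, y). ((u x + v x) - (u y + v y))^2 * J_kernel (x - y))"
    "integrable ?M (\<lambda>(x, y). ((u x - v x) - (u y - v y))^2 * J_kernel (x - y))"
    using log_form_pair(1)[OF L(3)] log_form_pair(1)[OF L(4)] r by auto
  have "E_log u v = 1 / 2 * (LINT z|?M. 1 / 4 * ((case z of (x, y) \<Rightarrow> ((u x + v x) - (u y + v y))\<^sup>2 * J_kernel (x - y)) -
      (case z of (x, y) \<Rightarrow> ((u x - v x) - (u y - v y))\<^sup>2 * J_kernel (x - y))))"
    unfolding E_log_def
    by (intro arg_cong[where f = "\<lambda>x. 1 / 2 * x"] Bochner_Integration.integral_cong) (auto simp: power2_eq_square algebra_simps)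
  also have "\<dots> = 1 / 8 * (2 * log_energy (\<lambda>x. u x + v x) - 2 * log_energy (\<lambda>x. u x - v x))"
    using log_form_pair(2)[OF L(3) r(1)] log_form_pair(2)[OF L(4) r(2)] P by (simp add: case_prod_unfold)
  also have "\<dots> = (LINT \<xi>|lborel. ln (br \<xi>) * Re (fourier u \<xi> * cnj (fourier v \<xi>)))"
    unfolding log_regular_combination(4,5)[OF u v] by simp
  finally show ?thesis .
qed

section \<open>Logarithmic Sobolev inequalities and integrability of the entropy\<close>

lemma one_plus_square_ge_1: "1 \<le> 1 + (norm (\<xi>::'a::euclidean_space))^2" by simp

text \<open>The case q = 0, F = ln, \<open>\<epsilon>\<close> = 1/2 of the layered inequality: B
  becomes 2 m, and the loss 1/(1 - 1/2)^2 = 4 cancels the denominator of N/4.\<close>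

lemma log_sobolev:
  fixes u :: "'a::euclidean_space \<Rightarrow> real"
  defines "m \<equiv> sqrt (mass u)"
  assumes u: "log_regular u" and pos: "mass u > 0"
  shows "(\<integral>\<^sup>+x. ennreal ((u x)^2 * (ln (max (2 * m) \<bar>u x\<bar>) - ln (2 * m))) \<partial>lborel) \<le>
    ennreal (real DIM('a) * (log_energy u + m\<^sup>2))"
proof -
  let ?n = "real DIM('a)"
  have L: "u \<in> L12" using u by (simp add: log_regular_def)
  note [measurable] = L12_D(1)[OF L]
  have m: "m > 0" using pos by (simp add: m_def)
  let ?R = "\<lambda>\<xi>. psd u \<xi> * (ln (m / (1 / 2) * br \<xi> powr (?n / 4)) - ln (m / (1 / 2)) + ?n / 4 * (m / (1 / 2) * br \<xi> powr (?n / 4)) powr 0)"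
  have "(\<integral>\<^sup>+x. ennreal ((u x)^2 * (ln (max (m / (1 / 2)) \<bar>u x\<bar>) - ln (m / (1 / 2)))) \<partial>lborel) \<le>
     ennreal (1 / (1 - 1 / 2)^2) * (\<integral>\<^sup>+\<xi>. ennreal (?R \<xi>) \<partial>lborel)"
    unfolding m_def
    by (rule layered_log_sobolev[OF L pos]) (auto intro!: derivative_eq_intros simp: powr_minus_divide)
  also have "?R = (\<lambda>\<xi>. ?n / 4 * (ln (br \<xi>) * psd u \<xi>) + ?n / 4 * psd u \<xi>)"
  proof
    fix \<xi> :: 'a
    have p: "0 < 1 + (norm \<xi>)^2" by (simp add: add_pos_nonneg)
    have "ln (2 * m * br \<xi> powr (?n / 4)) = ln (2 * m) + ?n / 4 * ln (br \<xi>)"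
      using m p by (subst ln_mult) (auto simp: ln_powr)
    moreover have "(2 * m * br \<xi> powr (?n / 4)) powr 0 = 1" using m p by auto
    ultimately show "?R \<xi> = ?n / 4 * (ln (br \<xi>) * psd u \<xi>) + ?n / 4 * psd u \<xi>"
      by (simp add: algebra_simps)
  qed
  also have "(\<integral>\<^sup>+\<xi>. ennreal (?n / 4 * (ln (br \<xi>) * psd u \<xi>) + ?n / 4 * psd u \<xi>) \<partial>lborel) =
     ennreal (?n / 4 * log_energy u + ?n / 4 * m\<^sup>2)"
    using u plancherel[OF L] pos
    by (subst nn_integral_eq_integral) (auto simp: log_regular_def log_energy_def m_def)
  also have "ennreal (1 / (1 - 1 / 2)^2) * \<dots> = ennreal (?n * (log_energy u + m\<^sup>2))"
  proof -
    have "0 \<le> ?n / 4 * log_energy u + ?n / 4 * m\<^sup>2" using log_energy_nonneg[of u] by simp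
    then have "ennreal (1 / (1 - 1 / 2)^2) * ennreal (?n / 4 * log_energy u + ?n / 4 * m\<^sup>2) =
      ennreal (1 / (1 - 1 / 2)^2 * (?n / 4 * log_energy u + ?n / 4 * m\<^sup>2))"
      by (intro ennreal_mult[symmetric]) auto
    also have "1 / (1 - 1 / 2)^2 * (?n / 4 * log_energy u + ?n / 4 * m\<^sup>2) = ?n * (log_energy u + m\<^sup>2)"
      by (simp add: power2_eq_square algebra_simps)
    finally show ?thesis .
  qed
  finally show ?thesis by (simp add: mult.commute)
qed

text \<open>For mass at most 1/4 the threshold 2 m is at most 1, so the fixed threshold 1 may
  replace it. The bound then tends to 0 together with energy and mass, which is what controls the
  entropy of small differences.\<close>

lemma log_sobolev_small:
  fixes u :: "'a::euclidean_space \<Rightarrow> real"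
  assumes u: "log_regular u" and small: "mass u \<le> 1 / 4"
  shows "(\<integral>\<^sup>+x. ennreal ((u x)^2 * ln (max 1 \<bar>u x\<bar>)) \<partial>lborel) \<le>
    ennreal (real DIM('a) * (log_energy u + mass u))"
proof (cases "mass u > 0")
  case True
  define m where "m = sqrt (mass u)"
  have "m \<le> sqrt (1 / 4)" unfolding m_def using small by (rule real_sqrt_le_mono)
  then have m: "0 < m" "2 * m \<le> 1" using True by (auto simp: m_def real_sqrt_divide)
  have "(\<integral>\<^sup>+x. ennreal ((u x)^2 * ln (max 1 \<bar>u x\<bar>)) \<partial>lborel) \<le>
    (\<integral>\<^sup>+x. ennreal ((u x)^2 * (ln (max (2 * m) \<bar>u x\<bar>) - ln (2 * m))) \<partial>lborel)"
  proof (intro nn_integral_mono ennreal_leI mult_left_mono)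
    fix x
    show "ln (max 1 \<bar>u x\<bar>) \<le> ln (max (2 * m) \<bar>u x\<bar>) - ln (2 * m)"
    proof (cases "\<bar>u x\<bar> \<le> 1")
      case True
      have "ln (2 * m) \<le> ln (max (2 * m) \<bar>u x\<bar>)" using m by simp
      moreover have "max 1 \<bar>u x\<bar> = 1" using True by simp
      ultimately show ?thesis by simp
    next
      case False
      then have "max 1 \<bar>u x\<bar> = \<bar>u x\<bar>" "max (2 * m) \<bar>u x\<bar> = \<bar>u x\<bar>" using m by auto
      then show ?thesis using m by simp
    qed
  qed simp
  also have "\<dots> \<le> ennreal (real DIM('a) * (log_energy u + m\<^sup>2))"
    unfolding m_def by (rule log_sobolev[OF u True])
  finally show ?thesis using True by (simp add: m_def)
next
  case False
  have i: "integrable lborel (\<lambda>x. (u x)^2)" using u by (simp add: log_regular_def L12_def)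
  have "0 \<le> mass u" by simp
  then have "mass u = 0" using False by linarith
  then have "AE x in lborel. (u x)^2 = 0" using integral_nonneg_eq_0_iff_AE[OF i] by simp
  then have "AE x in lborel. ennreal ((u x)^2 * ln (max 1 \<bar>u x\<bar>)) = 0" by eventually_elim simp
  then have "(\<integral>\<^sup>+x. ennreal ((u x)^2 * ln (max 1 \<bar>u x\<bar>)) \<partial>lborel) = (\<integral>\<^sup>+x. 0 \<partial>(lborel::'a measure))"
    by (rule nn_integral_cong_AE)
  then show ?thesis by simp
qed

text \<open>Moving the threshold from 2 m to 1 costs at most |ln(2 m)| u^2, which is
  integrable.\<close>

lemma log_regular_integrable:
  fixes u :: "'a::euclidean_space \<Rightarrow> real"
  assumes u: "log_regular u"
  shows "integrable lborel (\<lambda>x. (u x)^2 * ln (max 1 \<bar>u x\<bar>))"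
proof (cases "mass u > 0")
  case True
  define m where "m = sqrt (mass u)"
  have m: "m > 0" using True by (simp add: m_def)
  have L: "u \<in> L12" using u by (simp add: log_regular_def)
  note [measurable] = L12_D(1)[OF L]
  have "(\<integral>\<^sup>+x. ennreal ((u x)^2 * (ln (max (2 * m) \<bar>u x\<bar>) - ln (2 * m))) \<partial>lborel) < \<infinity>"
    using log_sobolev[OF u True] unfolding m_def by (rule order_le_less_trans) simp
  then have i: "integrable lborel (\<lambda>x. (u x)^2 * (ln (max (2 * m) \<bar>u x\<bar>) - ln (2 * m)))"
    using m by (intro integrableI_nonneg) auto
  show ?thesis
  proof (rule Bochner_Integration.integrable_bound[OF Bochner_Integration.integrable_add[OF i integrable_mult_right[of "\<bar>ln (2 * m)\<bar>", OF L12_D(3)[OF L]]]])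
    show "AE x in lborel. norm ((u x)^2 * ln (max 1 \<bar>u x\<bar>)) \<le> norm ((u x)^2 * (ln (max (2 * m) \<bar>u x\<bar>) - ln (2 * m)) + \<bar>ln (2 * m)\<bar> * (u x)^2)"
    proof (rule AE_I2)
      fix x
      have a: "0 \<le> ln (max (2 * m) \<bar>u x\<bar>) - ln (2 * m)" using m by simp
      have "ln (max 1 \<bar>u x\<bar>) \<le> (ln (max (2 * m) \<bar>u x\<bar>) - ln (2 * m)) + \<bar>ln (2 * m)\<bar>"
      proof (cases "\<bar>u x\<bar> \<le> 1")
        case True
        then have "max 1 \<bar>u x\<bar> = 1" by simp
        then show ?thesis using a by simp
      next
        case False
        then have "ln \<bar>u x\<bar> \<le> ln (max (2 * m) \<bar>u x\<bar>)" using m by (subst ln_le_cancel_iff) auto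
        then show ?thesis using False by (simp add: max_def)
      qed
      then have "(u x)^2 * ln (max 1 \<bar>u x\<bar>) \<le> (u x)^2 * ((ln (max (2 * m) \<bar>u x\<bar>) - ln (2 * m)) + \<bar>ln (2 * m)\<bar>)"
        by (rule mult_left_mono) simp
      then show "norm ((u x)^2 * ln (max 1 \<bar>u x\<bar>)) \<le> norm ((u x)^2 * (ln (max (2 * m) \<bar>u x\<bar>) - ln (2 * m)) + \<bar>ln (2 * m)\<bar> * (u x)^2)"
        using a by (simp add: distrib_left mult.commute)
    qed
  qed measurable
next
  case False
  have L: "u \<in> L12" using u by (simp add: log_regular_def)
  note [measurable] = L12_D(1)[OF L]
  have "0 \<le> mass u" by simp
  then have "mass u = 0" using False by linarith
  then have "AE x in lborel. (u x)^2 = 0" using integral_nonneg_eq_0_iff_AE[OF L12_D(3)[OF L]] by simp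
  then have "AE x in lborel. (u x)^2 * ln (max 1 \<bar>u x\<bar>) = 0" by eventually_elim simp
  then show ?thesis using integrable_cong_AE[of "\<lambda>x. (u x)^2 * ln (max 1 \<bar>u x\<bar>)" lborel "\<lambda>x. 0"] by simp
qed

text \<open>A Young inequality for t^2 ln t: when |b| > 1 the larger of |a| and |b| replaces the
  smaller, and when |b| \<le> 1 the factor |b ln|b|| is at most 1. The mixed term is thus bounded by
  terms each involving only one of the two numbers.\<close>

lemma abs_mult_ln_le:
  fixes a b :: real
  shows "\<bar>a * b * ln \<bar>b\<bar>\<bar> \<le> a\<^sup>2 * ln (max 1 \<bar>a\<bar>) + b\<^sup>2 * ln (max 1 \<bar>b\<bar>) + \<bar>a\<bar>"
proof -
  have a0: "0 \<le> a\<^sup>2 * ln (max 1 \<bar>a\<bar>)" "0 \<le> b\<^sup>2 * ln (max 1 \<bar>b\<bar>)" by auto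
  consider "b = 0" | "b \<noteq> 0" "\<bar>b\<bar> \<le> 1" | "\<bar>b\<bar> > 1" "\<bar>a\<bar> \<le> \<bar>b\<bar>" | "\<bar>b\<bar> > 1" "\<bar>a\<bar> > \<bar>b\<bar>" by linarith
  then show ?thesis
  proof cases
    case 1 then show ?thesis using a0 by simp
  next
    case 2
    have "- ln \<bar>b\<bar> \<le> 1 / \<bar>b\<bar> - 1" using ln_le_minus_one[of "1 / \<bar>b\<bar>"] 2 by (simp add: ln_div)
    then have "\<bar>b\<bar> * (- ln \<bar>b\<bar>) \<le> \<bar>b\<bar> * (1 / \<bar>b\<bar> - 1)" by (intro mult_left_mono) auto
    also have "\<dots> = 1 - \<bar>b\<bar>" using 2 by (simp add: field_simps)
    also have "\<dots> \<le> 1" by simp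
    finally have "\<bar>b * ln \<bar>b\<bar>\<bar> \<le> 1" using 2 by (simp add: abs_mult)
    then have "\<bar>a\<bar> * \<bar>b * ln \<bar>b\<bar>\<bar> \<le> \<bar>a\<bar> * 1" by (intro mult_left_mono) auto
    then have "\<bar>a * b * ln \<bar>b\<bar>\<bar> \<le> \<bar>a\<bar>" by (simp add: abs_mult mult.assoc)
    then show ?thesis using a0 by linarith
  next
    case 3
    have "\<bar>a * b * ln \<bar>b\<bar>\<bar> = \<bar>a\<bar> * (\<bar>b\<bar> * ln \<bar>b\<bar>)" using 3 by (simp add: abs_mult)
    also have "\<dots> \<le> \<bar>b\<bar> * (\<bar>b\<bar> * ln \<bar>b\<bar>)" using 3 by (intro mult_right_mono) auto
    also have "\<dots> = b\<^sup>2 * ln (max 1 \<bar>b\<bar>)" using 3 by (simp add: power2_eq_square max_def)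
    finally show ?thesis using a0 by linarith
  next
    case 4
    have "\<bar>a * b * ln \<bar>b\<bar>\<bar> = \<bar>a\<bar> * (\<bar>b\<bar> * ln \<bar>b\<bar>)" using 4 by (simp add: abs_mult)
    also have "\<dots> \<le> \<bar>a\<bar> * (\<bar>a\<bar> * ln \<bar>a\<bar>)" using 4 by (intro mult_left_mono mult_mono) auto
    also have "\<dots> = a\<^sup>2 * ln (max 1 \<bar>a\<bar>)" using 4 by (simp add: power2_eq_square max_def)
    finally show ?thesis using a0 by linarith
  qed
qed

lemma log_regular_product_integrable:
  fixes u v :: "'a::euclidean_space \<Rightarrow> real"
  assumes u: "log_regular u" and v: "log_regular v"
  shows "integrable lborel (\<lambda>x. v x * u x * ln \<bar>u x\<bar>)"
proof -
  have L: "u \<in> L12" "v \<in> L12" using u v by (auto simp: log_regular_def)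
  note [measurable] = L12_D(1)[OF L(1)] L12_D(1)[OF L(2)]
  have i: "integrable lborel (\<lambda>x. (v x)^2 * ln (max 1 \<bar>v x\<bar>) + (u x)^2 * ln (max 1 \<bar>u x\<bar>) + \<bar>v x\<bar>)"
    using log_regular_integrable[OF u] log_regular_integrable[OF v] L12_D(2)[OF L(2)] by auto
  show ?thesis
  proof (rule Bochner_Integration.integrable_bound[OF i])
    show "AE x in lborel. norm (v x * u x * ln \<bar>u x\<bar>) \<le> norm ((v x)^2 * ln (max 1 \<bar>v x\<bar>) + (u x)^2 * ln (max 1 \<bar>u x\<bar>) + \<bar>v x\<bar>)"
      unfolding real_norm_def by (intro AE_I2 order_trans[OF abs_mult_ln_le abs_ge_self])
  qed measurable
qed

section \<open>The power inequality for fractional energies\<close>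

lemma powr_le_linear: "1 \<le> x \<Longrightarrow> 0 \<le> \<theta> \<Longrightarrow> \<theta> \<le> 1 \<Longrightarrow> x powr \<theta> \<le> 1 + \<theta> * (x - 1)" for x :: real
  using Youngs_inequality_0[of \<theta> "1 - \<theta>" x 1] by (simp add: algebra_simps)

text \<open>The layered inequality with F = x^q/q. The choice of \<open>\<theta>\<close> turns
  (1+|\<xi>|^2)^(qN/4) into W^\<theta> with W = (1+|\<xi>|^2)^s, and concavity linearises it:
  W^\<theta> \<le> 1 + \<theta>(W - 1). Hence the energy excess X enters with the coefficient
  \<open>\<theta>\<close>, up to factors tending to 1 as first q and then \<open>\<epsilon>\<close>
  tends to 0, and for fixed B the other terms exceed the mass only by order q.\<close>

theorem fractional_log_sobolev:
  fixes u :: "'a::euclidean_space \<Rightarrow> real" and q s \<theta> \<epsilon> :: real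
  defines "n \<equiv> real DIM('a)"
  defines "M \<equiv> LINT x|lborel. (u x)^2"
  defines "B \<equiv> sqrt M / \<epsilon>"
  defines "X \<equiv> (LINT \<xi>|lborel. br \<xi> powr s * psd u \<xi>) - M"
  assumes u: "u \<in> L12" and pos: "M > 0" and \<epsilon>: "0 < \<epsilon>" "\<epsilon> < 1"
    and q: "0 < q" "q \<le> 4 / n" and s: "s > 0" and \<theta>: "\<theta> * s = q * n / 4" "\<theta> \<le> 1"
    and fin: "integrable lborel (\<lambda>\<xi>. br \<xi> powr s * psd u \<xi>)"
  shows "integrable lborel (\<lambda>x. \<bar>u x\<bar> powr (2 + q))"
    and "(LINT x|lborel. \<bar>u x\<bar> powr (2 + q)) \<le>
      B powr q * M + B powr q / (1 - \<epsilon>)^2 * (\<theta> * (1 + q * n / 4) * X + q * n / 4 * M)"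
proof -
  note [measurable] = L12_D(1)[OF u]
  have n: "n > 0" by (simp add: n_def)
  have B: "B > 0" using pos \<epsilon> by (simp add: B_def)
  have \<theta>0: "0 \<le> \<theta>" using \<theta> s q n by (smt (verit) divide_nonneg_pos mult_nonneg_nonneg mult_neg_pos)
  let ?F = "\<lambda>x::real. x powr q / q"
  let ?w = "\<lambda>\<xi>::'a. 1 + (norm \<xi>)^2"
  let ?c = "B powr q / q"
  let ?G = "\<lambda>\<xi>. ?c * (\<theta> * (1 + q * n / 4)) * (?w \<xi> powr s * psd u \<xi> - psd u \<xi>) + ?c * (q * n / 4) * psd u \<xi>"
  have w1: "1 \<le> ?w \<xi> powr s" for \<xi> using s by (intro ge_one_powr_ge_zero) auto
  have "(\<integral>\<^sup>+x. ennreal ((u x)^2 * (?F (max B \<bar>u x\<bar>) - ?F B)) \<partial>lborel) \<le> ennreal (1 / (1 - \<epsilon>)^2) *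
    (\<integral>\<^sup>+\<xi>. ennreal (psd u \<xi> *
      (?F (B * ?w \<xi> powr (n / 4)) - ?F B + n / 4 * (B * ?w \<xi> powr (n / 4)) powr q)) \<partial>lborel)"
    unfolding B_def M_def n_def
  proof (rule layered_log_sobolev[OF u _ \<epsilon>])
    show "0 < mass u" using pos by (simp add: M_def)
    show "0 \<le> q" "q \<le> 4 / real DIM('a)" using q by (auto simp: n_def)
    show "(?F has_real_derivative x powr (q - 1)) (at x)" if "x > 0" for x
      using DERIV_cdivide[OF has_real_derivative_powr[OF that, of q], of q] q by simp
  qed measurable
  also have "(\<integral>\<^sup>+\<xi>. ennreal (psd u \<xi> *
      (?F (B * ?w \<xi> powr (n / 4)) - ?F B + n / 4 * (B * ?w \<xi> powr (n / 4)) powr q)) \<partial>lborel) \<le> (\<integral>\<^sup>+\<xi>. ennreal (?G \<xi>) \<partial>lborel)"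
  proof (intro nn_integral_mono ennreal_leI)
    fix \<xi> :: 'a
    define W where "W = ?w \<xi> powr s"
    have p: "(?w \<xi> powr (n / 4)) powr q = W powr \<theta>"
    proof -
      have "n / 4 * q = s * \<theta>" using \<theta>(1) by (simp add: mult.commute)
      then show ?thesis by (simp only: W_def powr_powr)
    qed
    have "W powr \<theta> \<le> 1 + \<theta> * (W - 1)" using powr_le_linear[of W \<theta>] w1[of \<xi>] \<theta>0 \<theta> by (simp add: W_def)
    then have "?c * ((W powr \<theta> - 1) + q * n / 4 * W powr \<theta>) \<le> ?c * (\<theta> * (W - 1) + q * n / 4 * (1 + \<theta> * (W - 1)))"
      using q n by (intro mult_left_mono add_mono) (auto intro!: mult_left_mono)
    moreover have "?F (B * ?w \<xi> powr (n / 4)) - ?F B + n / 4 * (B * ?w \<xi> powr (n / 4)) powr q = ?c * ((W powr \<theta> - 1) + q * n / 4 * W powr \<theta>)"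
      using B q by (simp add: powr_mult p field_simps)
    ultimately have "psd u \<xi> * (?F (B * ?w \<xi> powr (n / 4)) - ?F B + n / 4 * (B * ?w \<xi> powr (n / 4)) powr q)
       \<le> psd u \<xi> * (?c * (\<theta> * (W - 1) + q * n / 4 * (1 + \<theta> * (W - 1))))"
      by (intro mult_left_mono) auto
    also have "\<dots> = ?G \<xi>" using q by (simp add: W_def[symmetric] field_simps)
    finally show "psd u \<xi> * (?F (B * ?w \<xi> powr (n / 4)) - ?F B + n / 4 * (B * ?w \<xi> powr (n / 4)) powr q) \<le> ?G \<xi>" .
  qed
  also have "(\<integral>\<^sup>+\<xi>. ennreal (?G \<xi>) \<partial>lborel) = ennreal (?c * (\<theta> * (1 + q * n / 4)) * X + ?c * (q * n / 4) * M)"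
  proof (subst nn_integral_eq_integral)
    note pl = plancherel[OF u]
    show "integrable lborel ?G" using fin pl(1) by auto
    have "0 \<le> ?G \<xi>" for \<xi>
      using w1[of \<xi>] \<theta>0 q n by (intro add_nonneg_nonneg mult_nonneg_nonneg) (auto simp: mult_le_cancel_right1)
    then show "AE \<xi> in lborel. 0 \<le> ?G \<xi>" by simp
    have "(LINT \<xi>|lborel. ?G \<xi>) = ?c * (\<theta> * (1 + q * n / 4)) * X + ?c * (q * n / 4) * M"
      using fin pl by (simp add: X_def M_def)
    then show "ennreal (LINT \<xi>|lborel. ?G \<xi>) = ennreal (?c * (\<theta> * (1 + q * n / 4)) * X + ?c * (q * n / 4) * M)" by simp
  qed
  finally have main: "(\<integral>\<^sup>+x. ennreal ((u x)^2 * (?F (max B \<bar>u x\<bar>) - ?F B)) \<partial>lborel) \<le>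
     ennreal (1 / (1 - \<epsilon>)^2 * (?c * (\<theta> * (1 + q * n / 4)) * X + ?c * (q * n / 4) * M))"
    by (subst ennreal_mult') (simp_all add: mult_left_mono)
  have X0: "0 \<le> X"
  proof -
    have "(LINT \<xi>|lborel. psd u \<xi>) \<le> (LINT \<xi>|lborel. ?w \<xi> powr s * psd u \<xi>)"
      using fin plancherel(1)[OF u] w1 by (intro integral_mono) (auto simp: mult_le_cancel_right1)
    then show ?thesis using plancherel(2)[OF u] by (simp add: X_def M_def)
  qed
  define D where "D = 1 / (1 - \<epsilon>)^2 * (?c * (\<theta> * (1 + q * n / 4)) * X + ?c * (q * n / 4) * M)"
  have D0: "D \<ge> 0" unfolding D_def using X0 \<theta>0 q n pos by (intro mult_nonneg_nonneg add_nonneg_nonneg) auto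
  let ?H = "\<lambda>x. (u x)^2 * (?F (max B \<bar>u x\<bar>) - ?F B)"
  have H0: "0 \<le> ?H x" for x
    using B q by (intro mult_nonneg_nonneg) (auto intro!: divide_right_mono powr_mono2)
  have iH: "integrable lborel ?H"
    using H0 main by (intro integrableI_nonneg) (auto intro: order_le_less_trans)
  have "ennreal (LINT x|lborel. ?H x) \<le> ennreal D"
    using main nn_integral_eq_integral[OF iH] H0 by (simp add: D_def)
  then have lH: "(LINT x|lborel. ?H x) \<le> D" using D0 by (simp add: ennreal_le_iff)
  have iB: "integrable lborel (\<lambda>x. B powr q * (u x)^2 + q * ?H x)"
    using iH L12_D(3)[OF u] by simp
  have ptw: "\<bar>u x\<bar> powr (2 + q) \<le> B powr q * (u x)^2 + q * ?H x" for x
  proof -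
    have "\<bar>u x\<bar> powr (2 + q) = (u x)^2 * \<bar>u x\<bar> powr q"
      by (cases "u x = 0") (simp_all add: powr_add powr_numeral)
    also have "\<dots> \<le> (u x)^2 * (max B \<bar>u x\<bar>) powr q" using q by (intro mult_left_mono powr_mono2) auto
    also have "\<dots> = B powr q * (u x)^2 + q * ?H x" using q by (simp add: field_simps)
    finally show ?thesis .
  qed
  show i: "integrable lborel (\<lambda>x. \<bar>u x\<bar> powr (2 + q))"
  proof (rule Bochner_Integration.integrable_bound[OF iB])
    show "AE x in lborel. norm (\<bar>u x\<bar> powr (2 + q)) \<le> norm (B powr q * (u x)^2 + q * ?H x)"
      using ptw by (intro AE_I2) (metis abs_ge_self order_trans powr_ge_zero real_norm_def abs_of_nonneg)
  qed measurable
  have "(LINT x|lborel. \<bar>u x\<bar> powr (2 + q)) \<le> (LINT x|lborel. B powr q * (u x)^2 + q * ?H x)"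
    using ptw by (intro integral_mono i iB)
  also have "\<dots> = B powr q * M + q * (LINT x|lborel. ?H x)"
    using iH L12_D(3)[OF u] by (simp add: M_def)
  also have "\<dots> \<le> B powr q * M + q * D" using lH q by simp
  also have "q * D = B powr q / (1 - \<epsilon>)^2 * (\<theta> * (1 + q * n / 4) * X + q * n / 4 * M)"
  proof -
    have "q * (i * (P / q * a * X + P / q * b * M)) = P * i * (a * X + b * M)" for i P a b
      using q by (simp add: field_simps)
    from this[of "1 / (1 - \<epsilon>)^2" "B powr q" "\<theta> * (1 + q * n / 4)" "q * n / 4"] show ?thesis
      unfolding D_def by simp
  qed
  finally show "(LINT x|lborel. \<bar>u x\<bar> powr (2 + q)) \<le>
      B powr q * M + B powr q / (1 - \<epsilon>)^2 * (\<theta> * (1 + q * n / 4) * X + q * n / 4 * M)" by simp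
qed

subsection \<open>Exterior balls and a Hardy inequality\<close>

text \<open>Moving down by \<rho>/2 along the chart axis leaves a gap to the graph. A point of the
  small ball deviates by at most \<beta>\<rho> in height and 2\<beta>\<rho> sideways, where the
  graph can fall by 2L\<beta>\<rho>; the choice \<beta> = 1/(4(1+L)) keeps the total within
  \<rho>/2.\<close>

lemma lipschitz_chart_exterior_ball:
  fixes \<Omega> :: "'a::euclidean_space set"
  assumes v: "norm v = 1" and lip: "L-lipschitz_on {y. y \<bullet> v = 0} g"
    and chart: "\<Omega> \<inter> ball z R = {x \<in> ball z R. g (x - (x \<bullet> v) *\<^sub>R v) < x \<bullet> v}"
    and z': "z' \<in> ball z (R / 2)" "z' \<notin> \<Omega>" and \<rho>: "0 < \<rho>" "\<rho> \<le> R / 2"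
  shows "ball (z' - (\<rho> / 2) *\<^sub>R v) (1 / (4 * (1 + L)) * \<rho>) \<subseteq> ball z' \<rho> - \<Omega>"
proof
  fix y
  define \<beta> where "\<beta> = 1 / (4 * (1 + L))"
  define h where "h x = x - (x \<bullet> v) *\<^sub>R v" for x
  define e where "e = y - (z' - (\<rho> / 2) *\<^sub>R v)"
  have L: "0 \<le> L" using lip by (rule lipschitz_on_nonneg)
  have \<beta>: "0 < \<beta>" "\<beta> \<le> 1 / 4" "\<beta> * (1 + 2 * L) \<le> 1 / 2" using L by (auto simp: \<beta>_def field_simps)
  assume "y \<in> ball (z' - (\<rho> / 2) *\<^sub>R v) (1 / (4 * (1 + L)) * \<rho>)"
  then have e: "norm e < \<beta> * \<rho>" by (simp add: e_def \<beta>_def dist_norm norm_minus_commute)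
  have y: "y = z' - (\<rho> / 2) *\<^sub>R v + e" by (simp add: e_def)
  have vv: "v \<bullet> v = 1" using v by (simp add: norm_eq_1)
  have hv: "h x \<bullet> v = 0" for x using vv by (simp add: h_def inner_diff_left)
  have ev: "\<bar>e \<bullet> v\<bar> \<le> norm e" using Cauchy_Schwarz_ineq2[of e v] v by simp
  have "y - z' = - ((\<rho> / 2) *\<^sub>R v) + e" unfolding y by simp
  then have "norm (y - z') \<le> norm (- ((\<rho> / 2) *\<^sub>R v)) + norm e" by (simp only: norm_triangle_ineq)
  also have "\<dots> < \<rho> / 2 + \<beta> * \<rho>" using e v \<rho> by simp
  also have "\<dots> \<le> \<rho> / 2 + 1 / 4 * \<rho>" using \<beta> \<rho> by (intro add_left_mono mult_right_mono) auto
  finally have yz: "norm (y - z') < \<rho>" using \<rho> by simp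
  have yR: "y \<in> ball z R"
  proof -
    have "dist z y \<le> dist z z' + dist z' y" by (rule dist_triangle)
    then show ?thesis using z' yz \<rho> by (simp add: dist_norm norm_minus_commute)
  qed
  have zR: "z' \<in> ball z R" using z'(1) \<rho> by simp
  have gz: "z' \<bullet> v \<le> g (h z')" using chart z'(2) zR unfolding h_def by fastforce
  have hh: "h y - h z' = e - (e \<bullet> v) *\<^sub>R v"
    unfolding h_def y by (simp add: inner_diff_left inner_add_left vv algebra_simps)
  have "norm (h y - h z') \<le> norm e + norm ((e \<bullet> v) *\<^sub>R v)" unfolding hh by (rule norm_triangle_ineq4)
  also have "\<dots> \<le> 2 * (\<beta> * \<rho>)" using ev e v by simp
  finally have "dist (h y) (h z') \<le> 2 * (\<beta> * \<rho>)" by (simp add: dist_norm)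
  then have "L * dist (h y) (h z') \<le> L * (2 * (\<beta> * \<rho>))" using L by (rule mult_left_mono)
  moreover have "dist (g (h y)) (g (h z')) \<le> L * dist (h y) (h z')"
    using lipschitz_onD[OF lip, of "h y" "h z'"] hv by simp
  ultimately have g1: "g (h z') - L * (2 * (\<beta> * \<rho>)) \<le> g (h y)" unfolding dist_real_def by linarith
  have "y \<bullet> v = z' \<bullet> v - \<rho> / 2 + e \<bullet> v" unfolding y by (simp add: inner_diff_left inner_add_left vv)
  also have "\<dots> \<le> z' \<bullet> v - \<rho> / 2 + \<beta> * \<rho>" using ev e by simp
  finally have yv: "y \<bullet> v \<le> z' \<bullet> v - \<rho> / 2 + \<beta> * \<rho>" .
  have "\<beta> * (1 + 2 * L) * \<rho> \<le> 1 / 2 * \<rho>" using \<beta> \<rho> by (intro mult_right_mono) auto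
  then have "\<beta> * \<rho> + L * (2 * (\<beta> * \<rho>)) \<le> \<rho> / 2" by (simp add: algebra_simps)
  then have "\<not> g (h y) < y \<bullet> v" using yv g1 gz by linarith
  then have "y \<notin> \<Omega>" using chart yR unfolding h_def by blast
  then show "y \<in> ball z' \<rho> - \<Omega>" using yz by (simp add: dist_norm norm_minus_commute)
qed

lemma lipschitz_domain_exterior_balls:
  fixes \<Omega> :: "'a::euclidean_space set"
  assumes "bounded \<Omega>" "lipschitz_domain \<Omega>"
  obtains \<beta> r where "\<beta> > 0" "r > 0"
    "\<And>z \<rho>. z \<in> frontier \<Omega> \<Longrightarrow> 0 < \<rho> \<Longrightarrow> \<rho> \<le> r \<Longrightarrow> \<exists>c. ball c (\<beta> * \<rho>) \<subseteq> ball z \<rho> - \<Omega>"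
proof -
  have op: "open \<Omega>" using assms by (simp add: lipschitz_domain_def)
  \<comment> \<open>Radius and ratio must serve all frontier points near z, not only z itself; this
    is what survives the passage to a finite subcover of the compact frontier.\<close>
  define good where "good z p \<longleftrightarrow> fst p > 0 \<and> snd p > 0 \<and>
    (\<forall>z'\<in>frontier \<Omega> \<inter> ball z (fst p). \<forall>\<rho>. 0 < \<rho> \<and> \<rho> \<le> fst p \<longrightarrow> (\<exists>c. ball c (snd p * \<rho>) \<subseteq> ball z' \<rho> - \<Omega>))"
    for z :: 'a and p :: "real \<times> real"
  have "\<exists>p. good z p" if "z \<in> frontier \<Omega>" for z
  proof -
    have "\<forall>z\<in>frontier \<Omega>. \<exists>v r L g. norm v = 1 \<and> r > 0 \<and> L-lipschitz_on {y. y \<bullet> v = 0} g \<and>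
        \<Omega> \<inter> ball z r = {x \<in> ball z r. g (x - (x \<bullet> v) *\<^sub>R v) < x \<bullet> v}"
      using assms(2) unfolding lipschitz_domain_def by (elim conjE)
    from bspec[OF this that] obtain v R L g where c: "norm v = 1" "R > 0" "L-lipschitz_on {y. y \<bullet> v = 0} g"
      "\<Omega> \<inter> ball z R = {x \<in> ball z R. g (x - (x \<bullet> v) *\<^sub>R v) < x \<bullet> v}"
      by (elim exE conjE)
    have L: "0 \<le> L" using c(3) by (rule lipschitz_on_nonneg)
    have nin: "z' \<notin> \<Omega>" if "z' \<in> frontier \<Omega>" for z' using op that by (auto simp: frontier_def interior_open)
    have ext: "\<exists>c. ball c (1 / (4 * (1 + L)) * \<rho>) \<subseteq> ball z' \<rho> - \<Omega>"
      if "z' \<in> frontier \<Omega> \<inter> ball z (R / 2)" "0 < \<rho>" "\<rho> \<le> R / 2" for z' \<rho>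
      using that by (intro exI[of _ "z' - (\<rho> / 2) *\<^sub>R v"] lipschitz_chart_exterior_ball[OF c(1,3,4)] nin) simp_all
    then have "\<forall>z'\<in>frontier \<Omega> \<inter> ball z (R / 2). \<forall>\<rho>. 0 < \<rho> \<and> \<rho> \<le> R / 2 \<longrightarrow> (\<exists>c. ball c (1 / (4 * (1 + L)) * \<rho>) \<subseteq> ball z' \<rho> - \<Omega>)"
      by (intro ballI allI impI) (erule conjE, rule ext)
    then show ?thesis using c(2) L by (intro exI[of _ "(R / 2, 1 / (4 * (1 + L)))"]) (simp add: good_def)
  qed
  then have "\<forall>z\<in>frontier \<Omega>. \<exists>p. good z p" by blast
  then obtain f where f: "\<forall>z\<in>frontier \<Omega>. good z (f z)" using bchoice by blast
  define R where "R z = fst (f z)" for z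
  define \<beta> where "\<beta> z = snd (f z)" for z
  have R: "R z > 0" and \<beta>: "\<beta> z > 0" if "z \<in> frontier \<Omega>" for z
    using f that by (auto simp: good_def R_def \<beta>_def)
  have ext: "\<exists>c. ball c (\<beta> z * \<rho>) \<subseteq> ball z' \<rho> - \<Omega>"
    if "z \<in> frontier \<Omega>" "z' \<in> frontier \<Omega> \<inter> ball z (R z)" "0 < \<rho>" "\<rho> \<le> R z" for z z' \<rho>
  proof -
    from f that(1) have "good z (f z)" by blast
    then have "\<forall>\<rho>. 0 < \<rho> \<and> \<rho> \<le> R z \<longrightarrow> (\<exists>c. ball c (\<beta> z * \<rho>) \<subseteq> ball z' \<rho> - \<Omega>)"
      unfolding good_def R_def[symmetric] \<beta>_def[symmetric] using that(2) by blast
    then show ?thesis using that(3,4) by blast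
  qed
  have "compact (frontier \<Omega>)" using assms(1) by (rule compact_frontier_bounded)
  then obtain C where C: "C \<subseteq> frontier \<Omega>" "finite C" "frontier \<Omega> \<subseteq> (\<Union>z\<in>C. ball z (R z))"
  proof (rule compactE_image[of _ "frontier \<Omega>" "\<lambda>z. ball z (R z)"])
    show "frontier \<Omega> \<subseteq> (\<Union>z\<in>frontier \<Omega>. ball z (R z))"
      using R centre_in_ball by blast
  qed simp_all
  define r0 where "r0 = Min (insert 1 (R ` C))"
  define b0 where "b0 = Min (insert 1 (\<beta> ` C))"
  have "r0 > 0" unfolding r0_def using C R by (subst Min_gr_iff) auto
  moreover have "b0 > 0" unfolding b0_def using C \<beta> by (subst Min_gr_iff) auto
  moreover have "\<exists>c. ball c (b0 * \<rho>) \<subseteq> ball z \<rho> - \<Omega>" if z: "z \<in> frontier \<Omega>" and \<rho>: "0 < \<rho>" "\<rho> \<le> r0" for z \<rho>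
  proof -
    obtain x where x: "x \<in> C" "z \<in> ball x (R x)" using C z by auto
    have "r0 \<le> R x" "b0 \<le> \<beta> x" unfolding r0_def b0_def using C x by auto
    obtain c where c: "ball c (\<beta> x * \<rho>) \<subseteq> ball z \<rho> - \<Omega>"
      using ext[of x z \<rho>] x C z \<rho> \<open>r0 \<le> R x\<close> by auto
    have "ball c (b0 * \<rho>) \<subseteq> ball c (\<beta> x * \<rho>)"
      using \<open>b0 \<le> \<beta> x\<close> \<rho> by (intro subset_ball mult_right_mono) auto
    then show ?thesis using c by blast
  qed
  ultimately show ?thesis using that[of b0 r0] by simp
qed

text \<open>A nearest point z of the complement is a limit of domain points: those on the segment
  from z to x are closer to x than the complement is.\<close>

lemma nearest_point_frontier:
  fixes \<Omega> :: "'a::euclidean_space set"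
  assumes op: "open \<Omega>" and bd: "bounded \<Omega>" and x: "x \<in> \<Omega>"
  obtains z where "z \<in> frontier \<Omega>" "infdist x (- \<Omega>) = dist x z" "infdist x (- \<Omega>) > 0"
proof -
  have "\<Omega> \<noteq> UNIV" using bd not_bounded_UNIV by blast
  then have ne: "- \<Omega> \<noteq> {}" by blast
  have cl: "closed (- \<Omega>)" using op by (simp add: closed_def)
  obtain z where z: "z \<in> - \<Omega>" "infdist x (- \<Omega>) = dist x z"
    using infdist_attains_inf[OF cl ne] by blast
  have d: "dist x z > 0" using x z by auto
  have "z \<in> closure \<Omega>"
    unfolding closure_approachable
  proof (intro allI impI)
    fix e :: real assume e: "e > 0"
    define \<tau> where "\<tau> = min (1 / 2) (e / (2 * dist x z))"
    have t: "0 < \<tau>" "\<tau> < 1" "\<tau> * dist x z < e"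
    proof -
      show "0 < \<tau>" "\<tau> < 1" using e d by (auto simp: \<tau>_def)
      have "\<tau> * dist x z \<le> e / (2 * dist x z) * dist x z" using d by (intro mult_right_mono) (auto simp: \<tau>_def)
      also have "\<dots> < e" using d e by simp
      finally show "\<tau> * dist x z < e" .
    qed
    define p where "p = z + \<tau> *\<^sub>R (x - z)"
    have "x - p = (1 - \<tau>) *\<^sub>R (x - z)" by (simp add: p_def algebra_simps)
    then have "dist x p = (1 - \<tau>) * dist x z" using t by (simp add: dist_norm)
    then have "dist x p < infdist x (- \<Omega>)" using t d z by simp
    then have "p \<in> \<Omega>" using infdist_le[of p "- \<Omega>" x] by fastforce
    moreover have "dist p z < e" using t by (simp add: p_def dist_norm norm_minus_commute)
    ultimately show "\<exists>y\<in>\<Omega>. dist y z < e" by blast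
  qed
  then have "z \<in> frontier \<Omega>" using z op by (simp add: frontier_def interior_open)
  then show ?thesis using that z d by simp
qed

section \<open>The Hardy inequality with logarithmic weight\<close>

lemma infdist_measurable [measurable]: "(\<lambda>x. infdist x S) \<in> borel_measurable borel"
  by (intro borel_measurable_continuous_onI continuous_intros)

text \<open>Once sqrt t exceeds the boundary distance, an exterior ball of radius \<beta> sqrt t
  lies within 2 sqrt t of x. There the kernel is at least exp(-1) times its maximum, and the volume
  of order t^(N/2) cancels the factor t^(-N/2), so the mass is bounded below independently of
  t.\<close>

lemma exterior_heat_mass:
  fixes \<Omega> :: "'a::euclidean_space set"
  assumes op: "open \<Omega>" and bd: "bounded \<Omega>" and \<beta>: "\<beta> > 0"
    and ext: "\<And>z \<rho>. z \<in> frontier \<Omega> \<Longrightarrow> 0 < \<rho> \<Longrightarrow> \<rho> \<le> r \<Longrightarrow> \<exists>c. ball c (\<beta> * \<rho>) \<subseteq> ball z \<rho> - \<Omega>"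
    and x: "x \<in> \<Omega>" and t: "(infdist x (- \<Omega>))^2 \<le> t" "t \<le> r\<^sup>2" "r > 0"
  shows "ennreal ((4 * pi) powr (- (real DIM('a) / 2)) * exp (-1) * (unit_ball_vol (real DIM('a)) * \<beta> ^ DIM('a)))
    \<le> (\<integral>\<^sup>+y. ennreal (heat t (x - y)) * indicator (- \<Omega>) y \<partial>lborel)"
proof -
  let ?n = "DIM('a)"
  obtain z where z: "z \<in> frontier \<Omega>" "infdist x (- \<Omega>) = dist x z" "infdist x (- \<Omega>) > 0"
    using nearest_point_frontier[OF op bd x] by blast
  have "0 < (infdist x (- \<Omega>))^2" using z(3) by simp
  then have t0: "t > 0" using t(1) by linarith
  have "sqrt t \<le> r" using t by (intro real_le_lsqrt) auto
  then have st: "0 < sqrt t" "sqrt t \<le> r" using t0 by auto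
  obtain c where c: "ball c (\<beta> * sqrt t) \<subseteq> ball z (sqrt t) - \<Omega>" using ext[OF z(1) st] by blast
  have dx: "dist x z \<le> sqrt t" using t(1) z(2) by (simp add: real_le_rsqrt)
  let ?h = "(4 * pi * t) powr (- (real ?n / 2)) * exp (-1)"
  have hl: "?h \<le> heat t (x - y)" if "y \<in> ball c (\<beta> * sqrt t)" for y
  proof -
    have "dist z y < sqrt t" using that c by auto
    then have "dist x y \<le> 2 * sqrt t" using dx dist_triangle[of x y z] by linarith
    then have "(norm (x - y))^2 \<le> (2 * sqrt t)^2" unfolding dist_norm by (intro power_mono) auto
    also have "\<dots> = 4 * t" using t0 by (simp add: power_mult_distrib)
    finally have "exp (-1) \<le> exp (- (norm (x - y))\<^sup>2 / (4 * t))" using t0 by simp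
    then show ?thesis unfolding heat_def by (intro mult_left_mono) auto
  qed
  have m: "ball c (\<beta> * sqrt t) \<in> sets borel" by simp
  have "(\<beta> * sqrt t) ^ ?n = \<beta> ^ ?n * t powr (real ?n / 2)"
    using t0 by (simp add: power_mult_distrib powr_half_sqrt[symmetric] powr_power mult.commute)
  then have "(4 * pi) powr (- (real ?n / 2)) * exp (-1) * (unit_ball_vol (real ?n) * \<beta> ^ ?n) = ?h * (unit_ball_vol (real ?n) * (\<beta> * sqrt t) ^ ?n)"
    using t0 by (simp add: powr_mult powr_minus_divide)
  also have "ennreal \<dots> = ennreal ?h * emeasure lborel (ball c (\<beta> * sqrt t))"
    using \<beta> t0 by (subst emeasure_ball) (auto simp: ennreal_mult')
  also have "\<dots> = (\<integral>\<^sup>+y. ennreal ?h * indicator (ball c (\<beta> * sqrt t)) y \<partial>lborel)"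
    using m by (simp add: nn_integral_cmult_indicator)
  also have "\<dots> \<le> (\<integral>\<^sup>+y. ennreal (heat t (x - y)) * indicator (- \<Omega>) y \<partial>lborel)"
  proof (rule nn_integral_mono)
    fix y
    show "ennreal ?h * indicator (ball c (\<beta> * sqrt t)) y \<le> ennreal (heat t (x - y)) * indicator (- \<Omega>) y"
    proof (cases "y \<in> ball c (\<beta> * sqrt t)")
      case True
      then have "y \<in> - \<Omega>" using c by auto
      then show ?thesis using True hl[OF True] by (simp only: indicator_simps mult_1_right ennreal_leI)
    next
      case False
      then have "indicator (ball c (\<beta> * sqrt t)) y = (0 :: ennreal)" by (simp del: mem_ball)
      then show ?thesis by (simp only: mult_zero_right zero_le)
    qed
  qed
  finally show ?thesis .
qed

text \<open>A logarithmic boundary weight: for fixed r > 0 it grows like 2 ln(1/d) as d tends to 0.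
  Keeping it as an integral over time allows it to be exchanged with the heat representation of the
  kernel.\<close>

definition hardy_weight :: "real \<Rightarrow> real \<Rightarrow> ennreal" where
  "hardy_weight r d = (\<integral>\<^sup>+t. ennreal (exp (- t) / t) * indicator {0<..} t * (if d\<^sup>2 \<le> t \<and> t \<le> r\<^sup>2 then 1 else 0) \<partial>lborel)"

text \<open>Restricting y to the complement, where u vanishes, leaves u(x)^2 times the heat mass of
  the complement. That mass is bounded below for times between d^2 and r^2, and integrating
  exp(-t)/t over these times produces the weight.\<close>

lemma log_hardy:
  fixes \<Omega> :: "'a::euclidean_space set"
  assumes bd: "bounded \<Omega>" and lip: "lipschitz_domain \<Omega>"
  obtains c r where "c > 0" "r > 0"
    "\<And>u. u \<in> borel_measurable borel \<Longrightarrow> (\<And>x. x \<notin> \<Omega> \<Longrightarrow> u x = 0) \<Longrightarrow>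
      ennreal c * (\<integral>\<^sup>+x. ennreal ((u x)^2) * hardy_weight r (infdist x (- \<Omega>)) \<partial>lborel) \<le>
      (\<integral>\<^sup>+x. (\<integral>\<^sup>+y. ennreal ((u x - u y)^2 * J_kernel (x - y)) \<partial>lborel) \<partial>lborel)"
proof -
  have op: "open \<Omega>" using lip by (simp add: lipschitz_domain_def)
  then have [measurable]: "\<Omega> \<in> sets borel" by simp
  obtain \<beta> r where \<beta>: "\<beta> > 0" and r: "r > 0"
    and ext: "\<And>z \<rho>. z \<in> frontier \<Omega> \<Longrightarrow> 0 < \<rho> \<Longrightarrow> \<rho> \<le> r \<Longrightarrow> \<exists>c. ball c (\<beta> * \<rho>) \<subseteq> ball z \<rho> - \<Omega>"
    using lipschitz_domain_exterior_balls[OF bd lip] by blast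
  define c where "c = (4 * pi) powr (- (real DIM('a) / 2)) * exp (-1) * (unit_ball_vol (real DIM('a)) * \<beta> ^ DIM('a))"
  have c: "c > 0" using \<beta> by (simp add: c_def)
  show ?thesis
  proof (rule that[OF c r])
    fix u :: "'a \<Rightarrow> real" assume [measurable]: "u \<in> borel_measurable borel" and u0: "\<And>x. x \<notin> \<Omega> \<Longrightarrow> u x = 0"
    let ?d = "\<lambda>x. infdist x (- \<Omega>)"
    let ?I = "\<lambda>t x. (if (?d x)\<^sup>2 \<le> t \<and> t \<le> r\<^sup>2 then 1 else 0 :: ennreal)"
    have "ennreal c * (\<integral>\<^sup>+x. ennreal ((u x)^2) * hardy_weight r (?d x) \<partial>lborel) =
       (\<integral>\<^sup>+x. (\<integral>\<^sup>+t. ennreal (exp (- t) / t) * indicator {0<..} t * (ennreal c * (ennreal ((u x)^2) * ?I t x)) \<partial>lborel) \<partial>lborel)"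
      unfolding hardy_weight_def by (simp add: nn_integral_cmult[symmetric] mult_ac)
    also have "\<dots> = (\<integral>\<^sup>+t. (\<integral>\<^sup>+x. ennreal (exp (- t) / t) * indicator {0<..} t * (ennreal c * (ennreal ((u x)^2) * ?I t x)) \<partial>lborel) \<partial>lborel)"
      by (rule lborel_pair.Fubini'[symmetric]) measurable
    also have "\<dots> = (\<integral>\<^sup>+t. ennreal (exp (- t) / t) * indicator {0<..} t * (\<integral>\<^sup>+x. ennreal c * (ennreal ((u x)^2) * ?I t x) \<partial>lborel) \<partial>lborel)"
      by (simp add: nn_integral_cmult)
    also have "\<dots> \<le> (\<integral>\<^sup>+t. ennreal (exp (- t) / t) * indicator {0<..} t * (\<integral>\<^sup>+x. (\<integral>\<^sup>+y. ennreal ((u x - u y)^2 * heat t (x - y)) \<partial>lborel) \<partial>lborel) \<partial>lborel)"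
    proof (intro nn_integral_mono mult_left_mono)
      fix t :: real and x :: 'a
      show "ennreal c * (ennreal ((u x)^2) * ?I t x) \<le> (\<integral>\<^sup>+y. ennreal ((u x - u y)^2 * heat t (x - y)) \<partial>lborel)"
      proof (cases "x \<in> \<Omega> \<and> (?d x)\<^sup>2 \<le> t \<and> t \<le> r\<^sup>2")
        case True
        have "ennreal c * (ennreal ((u x)^2) * ?I t x) = ennreal ((u x)^2) * ennreal c" using True by (simp add: mult.commute)
        also have "\<dots> \<le> ennreal ((u x)^2) * (\<integral>\<^sup>+y. ennreal (heat t (x - y)) * indicator (- \<Omega>) y \<partial>lborel)"
          unfolding c_def using True r by (intro mult_left_mono exterior_heat_mass[OF op bd \<beta> ext]) auto
        also have "\<dots> = (\<integral>\<^sup>+y. ennreal ((u x)^2) * (ennreal (heat t (x - y)) * indicator (- \<Omega>) y) \<partial>lborel)"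
          by (rule nn_integral_cmult[symmetric]) measurable
        also have "\<dots> \<le> (\<integral>\<^sup>+y. ennreal ((u x - u y)^2 * heat t (x - y)) \<partial>lborel)"
          using u0 by (intro nn_integral_mono) (auto simp: ennreal_mult' split: split_indicator)
        finally show ?thesis .
      next
        case False
        then show ?thesis using u0 by auto
      qed
    qed auto
    also have "\<dots> = (\<integral>\<^sup>+x. (\<integral>\<^sup>+y. ennreal ((u x - u y)^2 * J_kernel (x - y)) \<partial>lborel) \<partial>lborel)"
      by (rule nn_log_form_heat[symmetric]) auto
    finally show "ennreal c * (\<integral>\<^sup>+x. ennreal ((u x)^2) * hardy_weight r (?d x) \<partial>lborel) \<le>
      (\<integral>\<^sup>+x. (\<integral>\<^sup>+y. ennreal ((u x - u y)^2 * J_kernel (x - y)) \<partial>lborel) \<partial>lborel)" .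
  qed
qed

text \<open>Three ranges of time: below d^2 the linear bound integrates to at most A, between d^2
  and r^2 the bound 1 gives the Hardy weight, and beyond r^2 one has 1/t \<le> 1/r^2.\<close>

lemma truncated_second_moment_kernel:
  fixes d r A :: real
  assumes d: "d > 0" and r: "r > 0" and A: "A \<ge> 0"
  shows "(\<integral>\<^sup>+t. ennreal (exp (- t) / t) * indicator {0<..} t * ennreal (min 1 (A * t / d\<^sup>2)) \<partial>lborel) \<le> ennreal (A + 1 / r\<^sup>2) + hardy_weight r d"
proof -
  have "(\<integral>\<^sup>+t. ennreal (exp (- t) / t) * indicator {0<..} t * ennreal (min 1 (A * t / d\<^sup>2)) \<partial>lborel) \<le>
    (\<integral>\<^sup>+t. (ennreal (A / d\<^sup>2) * indicator {0..d\<^sup>2} t + ennreal (1 / r\<^sup>2) * (ennreal (exp (- (1 * t))) * indicator {0<..} t)) +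
       ennreal (exp (- t) / t) * indicator {0<..} t * (if d\<^sup>2 \<le> t \<and> t \<le> r\<^sup>2 then 1 else 0) \<partial>lborel)"
  proof (rule nn_integral_mono)
    fix t :: real
    let ?a = "ennreal (A / d\<^sup>2) * indicator {0..d\<^sup>2} t" and ?b = "ennreal (1 / r\<^sup>2) * (ennreal (exp (- (1 * t))) * indicator {0<..} t)"
      and ?c = "ennreal (exp (- t) / t) * indicator {0<..} t * (if d\<^sup>2 \<le> t \<and> t \<le> r\<^sup>2 then 1 else 0)"
    let ?l = "ennreal (exp (- t) / t) * indicator {0<..} t * ennreal (min 1 (A * t / d\<^sup>2))"
    consider "t \<le> 0" | "0 < t" "t < d\<^sup>2" | "0 < t" "d\<^sup>2 \<le> t" "t \<le> r\<^sup>2" | "0 < t" "d\<^sup>2 \<le> t" "r\<^sup>2 < t" by linarith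
    then show "?l \<le> ?a + ?b + ?c"
    proof cases
      case 1 then show ?thesis by simp
    next
      case 2
      have "exp (- t) / t * min 1 (A * t / d\<^sup>2) \<le> exp (- t) / t * (A * t / d\<^sup>2)" using 2 by (intro mult_left_mono) auto
      also have "\<dots> = exp (- t) * (A / d\<^sup>2)" using 2 by simp
      also have "\<dots> \<le> 1 * (A / d\<^sup>2)" using 2 A by (intro mult_right_mono) auto
      finally have "?l \<le> ?a" using 2 A by (simp add: ennreal_mult'[symmetric] ennreal_leI del: times_divide_eq_right)
      also have "\<dots> \<le> ?a + ?b + ?c" by (simp add: add.assoc)
      finally show ?thesis .
    next
      case 3
      have "ennreal (exp (- t) / t) * ennreal (min 1 (A * t / d\<^sup>2)) \<le> ennreal (exp (- t) / t) * ennreal 1"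
        by (intro mult_left_mono ennreal_leI) auto
      then have "?l \<le> ?c" using 3 by simp
      also have "\<dots> \<le> ?a + ?b + ?c" by simp
      finally show ?thesis .
    next
      case 4
      have "ennreal (exp (- t) / t) * ennreal (min 1 (A * t / d\<^sup>2)) \<le> ennreal (exp (- t) / t) * ennreal 1"
        by (intro mult_left_mono ennreal_leI) auto
      also have "exp (- t) / t \<le> exp (- t) / r\<^sup>2" using 4 r by (intro divide_left_mono) auto
      then have "ennreal (exp (- t) / t) * ennreal 1 \<le> ennreal (exp (- t) / r\<^sup>2)" by (simp add: ennreal_leI)
      also have "ennreal (exp (- t) / r\<^sup>2) = ennreal (1 / r\<^sup>2) * ennreal (exp (- t))" by (simp add: ennreal_mult'[symmetric])
      finally have "?l \<le> ?b" using 4 by simp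
      also have "\<dots> \<le> ?a + ?b + ?c" by (simp add: add.assoc add_increasing)
      finally show ?thesis .
    qed
  qed
  also have "\<dots> = ennreal (A / d\<^sup>2) * ennreal (d\<^sup>2) + ennreal (1 / r\<^sup>2) + hardy_weight r d"
    unfolding hardy_weight_def using nn_integral_exp_neg[of 1]
    by (simp add: nn_integral_add nn_integral_cmult nn_integral_cmult_indicator)
  also have "ennreal (A / d\<^sup>2) * ennreal (d\<^sup>2) = ennreal A" using d A by (simp add: ennreal_mult'[symmetric])
  also have "ennreal A + ennreal (1 / r\<^sup>2) = ennreal (A + 1 / r\<^sup>2)" using A by (simp add: ennreal_plus)
  finally show ?thesis .
qed

text \<open>The minimum in the integrand dominates the squared increments of all boundary cutoffs.
  Averaged against the heat kernel it is at most \<open>min 1 (A * t / (d x)^2)\<close>, by mass 1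
  and the second moment, and the integral over time then costs a constant plus the Hardy
  weight.\<close>

lemma cutoff_domination_integral:
  fixes u d :: "'a::euclidean_space \<Rightarrow> real"
  assumes um[measurable]: "u \<in> borel_measurable borel" and u2: "integrable lborel (\<lambda>x. (u x)^2)"
    and [measurable]: "d \<in> borel_measurable borel" and d: "\<And>x. u x \<noteq> 0 \<Longrightarrow> d x > 0" and r: "r > 0"
    and H: "(\<integral>\<^sup>+x. ennreal ((u x)^2) * hardy_weight r (d x) \<partial>lborel) < \<infinity>"
  shows "(\<integral>\<^sup>+x. (\<integral>\<^sup>+y. ennreal ((u x)^2 * min 1 (16 * (norm (x - y))^2 / (d x)^2) * J_kernel (x - y)) \<partial>lborel) \<partial>lborel) < \<infinity>"
proof -
  \<comment> \<open>The factor 16 is the constant of the cutoff increments, the rest is the second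
    moment of the heat kernel.\<close>
  define A where "A = 16 * (4 * 2 powr (real DIM('a) / 2))"
  have A: "A \<ge> 0" by (simp add: A_def)
  let ?G = "\<lambda>x y. (u x)^2 * min 1 (16 * (norm (x - y))^2 / (d x)^2)"
  have "(\<integral>\<^sup>+x. (\<integral>\<^sup>+y. ennreal (?G x y * J_kernel (x - y)) \<partial>lborel) \<partial>lborel) =
    (\<integral>\<^sup>+t. ennreal (exp (- t) / t) * indicator {0<..} t * (\<integral>\<^sup>+x. (\<integral>\<^sup>+y. ennreal (?G x y * heat t (x - y)) \<partial>lborel) \<partial>lborel) \<partial>lborel)"
    by (rule nn_log_form_heat) auto
  also have "\<dots> \<le> (\<integral>\<^sup>+t. ennreal (exp (- t) / t) * indicator {0<..} t * (\<integral>\<^sup>+x. ennreal ((u x)^2) * ennreal (min 1 (A * t / (d x)^2)) \<partial>lborel) \<partial>lborel)"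
  proof (rule nn_integral_mono)
    fix t :: real
    show "ennreal (exp (- t) / t) * indicator {0<..} t * (\<integral>\<^sup>+x. (\<integral>\<^sup>+y. ennreal (?G x y * heat t (x - y)) \<partial>lborel) \<partial>lborel) \<le>
       ennreal (exp (- t) / t) * indicator {0<..} t * (\<integral>\<^sup>+x. ennreal ((u x)^2) * ennreal (min 1 (A * t / (d x)^2)) \<partial>lborel)"
    proof (cases "t > 0")
      case True
      have "(\<integral>\<^sup>+y. ennreal (?G x y * heat t (x - y)) \<partial>lborel) \<le> ennreal ((u x)^2) * ennreal (min 1 (A * t / (d x)^2))" for x
      proof -
        let ?m = "\<lambda>y. min 1 (16 * (norm (x - y))^2 / (d x)^2)"
        have "(\<integral>\<^sup>+y. ennreal (?m y * heat t (x - y)) \<partial>lborel) \<le> ennreal (min 1 (A * t / (d x)^2))"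
        proof -
          have "(\<integral>\<^sup>+y. ennreal (?m y * heat t (x - y)) \<partial>lborel) \<le> (\<integral>\<^sup>+y. ennreal (heat t (x - y)) \<partial>lborel)"
            by (intro nn_integral_mono ennreal_leI) (auto intro!: mult_left_le_one_le)
          also have "\<dots> = 1" using nn_integral_reflect[of "\<lambda>y. ennreal (heat t y)" x] heat_nn_integral[OF True, where 'a='a] by simp
          finally have 1: "(\<integral>\<^sup>+y. ennreal (?m y * heat t (x - y)) \<partial>lborel) \<le> 1" .
          have "(\<integral>\<^sup>+y. ennreal (?m y * heat t (x - y)) \<partial>lborel) \<le> (\<integral>\<^sup>+y. ennreal (16 / (d x)^2) * ennreal ((norm (x - y))^2 * heat t (x - y)) \<partial>lborel)"
          proof (rule nn_integral_mono)
            fix y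
            have "?m y * heat t (x - y) \<le> 16 * (norm (x - y))^2 / (d x)^2 * heat t (x - y)"
              by (intro mult_right_mono) auto
            also have "\<dots> = 16 / (d x)^2 * ((norm (x - y))^2 * heat t (x - y))" by simp
            finally show "ennreal (?m y * heat t (x - y)) \<le> ennreal (16 / (d x)^2) * ennreal ((norm (x - y))^2 * heat t (x - y))"
              by (simp only: ennreal_mult'[symmetric] ennreal_leI zero_le_divide_iff zero_le_numeral zero_le_power2 simp_thms)
          qed
          also have "\<dots> = ennreal (16 / (d x)^2) * (\<integral>\<^sup>+y. ennreal ((norm (x - y))^2 * heat t (x - y)) \<partial>lborel)"
            by (rule nn_integral_cmult) measurable
          also have "(\<integral>\<^sup>+y. ennreal ((norm (x - y))^2 * heat t (x - y)) \<partial>lborel) = (\<integral>\<^sup>+y. ennreal ((norm y)^2 * heat t (y::'a)) \<partial>lborel)"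
            by (rule nn_integral_reflect[of "\<lambda>y. ennreal ((norm y)^2 * heat t y)"]) measurable
          also have "ennreal (16 / (d x)^2) * \<dots> \<le> ennreal (16 / (d x)^2) * ennreal (4 * 2 powr (real DIM('a) / 2) * t)"
            by (intro mult_left_mono heat_second_moment_nn[OF True]) simp
          also have "\<dots> = ennreal (A * t / (d x)^2)" using True by (simp add: A_def ennreal_mult'[symmetric])
          finally show ?thesis using 1 by (auto simp: min_def)
        qed
        then have "ennreal ((u x)^2) * (\<integral>\<^sup>+y. ennreal (?m y * heat t (x - y)) \<partial>lborel) \<le> ennreal ((u x)^2) * ennreal (min 1 (A * t / (d x)^2))"
          by (rule mult_left_mono) simp
        also have "ennreal ((u x)^2) * (\<integral>\<^sup>+y. ennreal (?m y * heat t (x - y)) \<partial>lborel) = (\<integral>\<^sup>+y. ennreal ((u x)^2) * ennreal (?m y * heat t (x - y)) \<partial>lborel)"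
          by (rule nn_integral_cmult[symmetric]) measurable
        also have "\<dots> = (\<integral>\<^sup>+y. ennreal (?G x y * heat t (x - y)) \<partial>lborel)"
          by (simp only: ennreal_mult'[symmetric] zero_le_power2 mult.assoc)
        finally show ?thesis .
      qed
      then show ?thesis by (intro mult_left_mono nn_integral_mono) auto
    qed simp
  qed
  also have "\<dots> = (\<integral>\<^sup>+t. (\<integral>\<^sup>+x. ennreal ((u x)^2) * (ennreal (exp (- t) / t) * indicator {0<..} t * ennreal (min 1 (A * t / (d x)^2))) \<partial>lborel) \<partial>lborel)"
    by (simp add: nn_integral_cmult[symmetric] mult_ac)
  also have "\<dots> = (\<integral>\<^sup>+x. (\<integral>\<^sup>+t. ennreal ((u x)^2) * (ennreal (exp (- t) / t) * indicator {0<..} t * ennreal (min 1 (A * t / (d x)^2))) \<partial>lborel) \<partial>lborel)"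
    by (rule lborel_pair.Fubini'[symmetric]) measurable
  also have "\<dots> = (\<integral>\<^sup>+x. ennreal ((u x)^2) * (\<integral>\<^sup>+t. ennreal (exp (- t) / t) * indicator {0<..} t * ennreal (min 1 (A * t / (d x)^2)) \<partial>lborel) \<partial>lborel)"
    by (intro nn_integral_cong nn_integral_cmult) measurable
  also have "\<dots> \<le> (\<integral>\<^sup>+x. ennreal ((u x)^2) * (ennreal (A + 1 / r\<^sup>2) + hardy_weight r (d x)) \<partial>lborel)"
  proof (rule nn_integral_mono)
    fix x
    show "ennreal ((u x)^2) * (\<integral>\<^sup>+t. ennreal (exp (- t) / t) * indicator {0<..} t * ennreal (min 1 (A * t / (d x)^2)) \<partial>lborel) \<le>
      ennreal ((u x)^2) * (ennreal (A + 1 / r\<^sup>2) + hardy_weight r (d x))"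
    proof (cases "u x = 0")
      case False
      then show ?thesis using truncated_second_moment_kernel[OF d r A, of x] by (intro mult_left_mono) auto
    qed simp
  qed
  also have "\<dots> = ennreal (A + 1 / r\<^sup>2) * (\<integral>\<^sup>+x. ennreal ((u x)^2) \<partial>lborel) + (\<integral>\<^sup>+x. ennreal ((u x)^2) * hardy_weight r (d x) \<partial>lborel)"
  proof -
    have [measurable]: "(\<lambda>x. hardy_weight r (d x)) \<in> borel_measurable borel" unfolding hardy_weight_def by measurable
    show ?thesis by (simp add: distrib_left nn_integral_add nn_integral_cmult[symmetric] mult.commute)
  qed
  also have "\<dots> < \<infinity>"
    using H u2 by (auto simp: integrable_iff_bounded ennreal_mult_less_top)
  finally show ?thesis .
qed

subsection \<open>Density of test functions\<close>

lemma fourier_cong_AE: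
  fixes u v :: "'a::euclidean_space \<Rightarrow> real"
  assumes [measurable]: "u \<in> borel_measurable borel" "v \<in> borel_measurable borel" and ae: "AE x in lborel. u x = v x"
  shows "fourier u = fourier v"
proof
  fix \<xi> :: 'a
  have "(LINT x|lborel. wave x \<xi> * complex_of_real (u x)) =
    (LINT x|lborel. wave x \<xi> * complex_of_real (v x))"
  proof (rule integral_cong_AE)
    show "AE x in lborel. wave x \<xi> * complex_of_real (u x) =
      wave x \<xi> * complex_of_real (v x)"
      using ae by eventually_elim simp
  qed measurable
  then show "fourier u \<xi> = fourier v \<xi>" by (simp add: fourier_def)
qed

lemma L12_cong_AE:
  fixes u v :: "'a::euclidean_space \<Rightarrow> real"
  assumes u: "u \<in> L12" and [measurable]: "v \<in> borel_measurable borel" and ae: "AE x in lborel. u x = v x"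
  shows "v \<in> L12"
proof -
  note [measurable] = L12_D(1)[OF u]
  have "integrable lborel v" using L12_D(2)[OF u] ae by (subst integrable_cong_AE[of v lborel u]) auto
  moreover have "integrable lborel (\<lambda>x. (v x)^2)"
    using L12_D(3)[OF u] ae by (subst integrable_cong_AE[of "\<lambda>x. (v x)^2" lborel "\<lambda>x. (u x)^2"]) auto
  ultimately show ?thesis by (simp add: L12_def)
qed

lemma log_regular_cong_AE:
  fixes u v :: "'a::euclidean_space \<Rightarrow> real"
  assumes u: "log_regular u" and v: "v \<in> borel_measurable borel" and ae: "AE x in lborel. u x = v x"
  shows "log_regular v" "log_energy v = log_energy u"
proof -
  have L: "u \<in> L12" using u by (simp add: log_regular_def)
  have F: "fourier u = fourier v" by (rule fourier_cong_AE[OF L12_D(1)[OF L] v ae])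
  show "log_regular v" "log_energy v = log_energy u"
    using u L12_cong_AE[OF L v ae] F by (auto simp: log_regular_def log_energy_def)
qed

lemma log_energy_add_le:
  fixes u v :: "'a::euclidean_space \<Rightarrow> real"
  assumes u: "log_regular u" and v: "log_regular v"
  shows "log_energy (\<lambda>x. u x + v x) \<le> 2 * log_energy u + 2 * log_energy v"
  using log_regular_combination(4,5)[OF u v] log_energy_nonneg[of "\<lambda>x. u x - v x"] by linarith

lemma L2_add_le:
  fixes u v :: "'a::euclidean_space \<Rightarrow> real"
  assumes u: "u \<in> L12" and v: "v \<in> L12"
  shows "(LINT x|lborel. (u x + v x)^2) \<le> 2 * mass u + 2 * mass v"
proof -
  have "(LINT x|lborel. (u x + v x)^2) \<le> (LINT x|lborel. 2 * (u x)^2 + 2 * (v x)^2)"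
  proof (rule integral_mono)
    show "integrable lborel (\<lambda>x. (u x + v x)^2)" using L12_D(3)[OF L12_add[OF u v]] .
    show "integrable lborel (\<lambda>x. 2 * (u x)^2 + 2 * (v x)^2)" using L12_D(3)[OF u] L12_D(3)[OF v] by simp
    fix x
    show "(u x + v x)^2 \<le> 2 * (u x)^2 + 2 * (v x)^2"
      using sum_squares_bound[of "u x" "v x"] by (simp add: power2_eq_square algebra_simps)
  qed
  then show ?thesis using L12_D(3)[OF u] L12_D(3)[OF v] by simp
qed

text \<open>The profile varies only for k a between 1 and 2, where its slope k is comparable to 1/a;
  for much larger a the two distances must differ by a fixed fraction of a before the values differ.
  The bound is free of k and so serves all cutoffs simultaneously.\<close>

lemma cutoff_profile_difference:
  fixes k a b :: real
  defines "\<zeta> \<equiv> \<lambda>a. 1 - min 1 (max 0 (k * a - 1))"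
  assumes k: "k > 0" and a: "a > 0" and b: "b \<ge> 0"
  shows "(\<zeta> a - \<zeta> b)^2 \<le> min 1 (16 * (a - b)^2 / a\<^sup>2)"
proof -
  have 1: "\<bar>\<zeta> a - \<zeta> b\<bar> \<le> 1" by (auto simp: \<zeta>_def)
  have 2: "\<bar>\<zeta> a - \<zeta> b\<bar> \<le> 4 * \<bar>a - b\<bar> / a"
  proof (cases "k * a \<le> 4")
    case True
    have "\<bar>(1 - min 1 (max 0 (p - 1))) - (1 - min 1 (max 0 (q - 1)))\<bar> \<le> \<bar>p - q\<bar>" for p q :: real
      by (auto simp: min_def max_def abs_if)
    then have "\<bar>\<zeta> a - \<zeta> b\<bar> \<le> \<bar>k * a - k * b\<bar>" unfolding \<zeta>_def .
    also have "\<dots> = k * \<bar>a - b\<bar>" using k by (simp add: right_diff_distrib[symmetric] abs_mult)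
    also have "\<dots> \<le> 4 / a * \<bar>a - b\<bar>" using True a by (intro mult_right_mono) (auto simp: field_simps)
    finally show ?thesis by simp
  next
    case False
    then have za: "\<zeta> a = 0" by (simp add: \<zeta>_def)
    show ?thesis
    proof (cases "k * b < 2")
      case True
      then have "k * b < k * (a / 2)" using False by simp
      then have "b < a / 2" using k by simp
      then have "1 \<le> 4 * \<bar>a - b\<bar> / a" using a by (simp add: field_simps)
      then show ?thesis using 1 by linarith
    next
      case False
      then have "\<zeta> b = 0" by (simp add: \<zeta>_def)
      then show ?thesis using za a by simp
    qed
  qed
  have "(\<zeta> a - \<zeta> b)^2 \<le> 1" using 1 by (simp add: abs_square_le_1)
  moreover have "(\<zeta> a - \<zeta> b)^2 \<le> (4 * \<bar>a - b\<bar> / a)^2"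
    using 2 by (metis abs_ge_zero power2_abs power_mono)
  moreover have "(4 * \<bar>a - b\<bar> / a)^2 = 16 * (a - b)^2 / a\<^sup>2" by (simp add: power_divide power_mult_distrib)
  ultimately show ?thesis by simp
qed

text \<open>The removed part \<open>v n\<close>, which is \<open>\<zeta> n\<close> times u, tends to
  0 at every point, since points where u is nonzero have positive distance to the complement. Its
  increments have a majorant independent of n, integrable by the Hardy inequality, so its energy
  tends to 0 by dominated convergence.\<close>

lemma cutoff_approximation:
  fixes \<Omega> :: "'a::euclidean_space set" and u :: "'a \<Rightarrow> real"
  assumes bd: "bounded \<Omega>" and lip: "lipschitz_domain \<Omega>" and u: "log_regular u"
    and u0: "\<And>x. x \<notin> \<Omega> \<Longrightarrow> u x = 0" and e: "e > 0"
  obtains w \<delta> where "\<delta> > 0" "log_regular w" "\<And>x. infdist x (- \<Omega>) \<le> \<delta> \<Longrightarrow> w x = 0"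
    "log_energy (\<lambda>x. u x - w x) < e" "(LINT x|lborel. (u x - w x)^2) < e"
proof -
  have op: "open \<Omega>" using lip by (simp add: lipschitz_domain_def)
  have L: "u \<in> L12" using u by (simp add: log_regular_def)
  note um[measurable] = L12_D(1)[OF L]
  let ?M = "lborel \<Otimes>\<^sub>M (lborel :: 'a measure)"
  define d where "d x = infdist x (- \<Omega>)" for x
  have [measurable]: "d \<in> borel_measurable borel" unfolding d_def[abs_def] by measurable
  have d0: "d x \<ge> 0" for x by (simp add: d_def infdist_nonneg)
  have dpos: "d x > 0" if "u x \<noteq> 0" for x
  proof -
    have "x \<in> \<Omega>" using u0 that by blast
    then show ?thesis using nearest_point_frontier[OF op bd] unfolding d_def by metis
  qed
  have dlip: "\<bar>d x - d y\<bar> \<le> norm (x - y)" for x y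
    using infdist_triangle[of x "- \<Omega>" y] infdist_triangle[of y "- \<Omega>" x]
    by (simp add: d_def dist_norm norm_minus_commute abs_le_iff)
  define \<zeta> where "\<zeta> n x = 1 - min 1 (max 0 (real (Suc n) * d x - 1))" for n x
  have [measurable]: "\<zeta> n \<in> borel_measurable borel" for n unfolding \<zeta>_def[abs_def] by measurable
  have z01: "0 \<le> \<zeta> n x" "\<zeta> n x \<le> 1" for n x by (auto simp: \<zeta>_def)
  define v where "v n x = \<zeta> n x * u x" for n x
  have [measurable]: "v n \<in> borel_measurable borel" for n unfolding v_def[abs_def] by measurable
  have vle: "\<bar>v n x\<bar> \<le> \<bar>u x\<bar>" for n x using z01[of n x] by (simp add: v_def abs_mult mult_left_le_one_le)
  have vsq: "(v n x)^2 \<le> (u x)^2" for n x using vle by (simp add: abs_le_square_iff)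
  have vL: "v n \<in> L12" for n
  proof -
    have "integrable lborel (v n)" by (rule Bochner_Integration.integrable_bound[OF L12_D(2)[OF L]]) (use vle in auto)
    moreover have "integrable lborel (\<lambda>x. (v n x)^2)" by (rule Bochner_Integration.integrable_bound[OF L12_D(3)[OF L]]) (use vsq in auto)
    ultimately show ?thesis by (simp add: L12_def)
  qed
  have vlim: "(\<lambda>n. v n x) \<longlonglongrightarrow> 0" for x
  proof (cases "u x = 0")
    case False
    obtain m :: nat where m: "2 / d x \<le> real m" using real_arch_simple by blast
    have "v n x = 0" if "m \<le> n" for n
    proof -
      have "2 / d x \<le> real (Suc n)" using m that by simp
      then have "2 \<le> real (Suc n) * d x" using dpos[OF False] by (simp add: field_simps)
      then show ?thesis by (simp add: v_def \<zeta>_def)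
    qed
    then have "eventually (\<lambda>n. v n x = 0) sequentially" by (auto simp: eventually_sequentially)
    then show ?thesis by (rule tendsto_eventually)
  qed (simp add: v_def)
  let ?D = "\<lambda>(x, y). 4 * ((u x - u y)^2 * J_kernel (x - y)) + 2 * ((u x)^2 * min 1 (16 * (norm (x - y))^2 / (d x)^2) * J_kernel (x - y))"
  have dom: "(v n x - v n y)^2 * J_kernel (x - y) \<le> ?D (x, y)" for n x y
  proof -
    have n1: "(v n x - v n y)^2 \<le> 4 * (u x - u y)^2 + 2 * ((u x)^2 * min 1 (16 * (norm (x - y))^2 / (d x)^2))"
    \<comment> \<open>Where u x = 0 the distance d x may be 0, so the profile estimate is reserved
      for points where u is nonzero.\<close>
    proof (cases "u x = 0 \<or> u y = 0")
      case True
      then have "(v n x - v n y)^2 \<le> (u x - u y)^2" using vsq[of n x] vsq[of n y] by (auto simp: v_def)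
      moreover have "0 \<le> (u x)^2 * min 1 (16 * (norm (x - y))^2 / (d x)^2)" by simp
      moreover have "0 \<le> (u x - u y)^2" by simp
      ultimately show ?thesis by linarith
    next
      case False
      have dx: "d x > 0" using False dpos by simp
      have "(\<zeta> n x - \<zeta> n y)^2 \<le> min 1 (16 * (d x - d y)^2 / (d x)^2)"
        unfolding \<zeta>_def by (rule cutoff_profile_difference) (use dx d0 in auto)
      also have "\<dots> \<le> min 1 (16 * (norm (x - y))^2 / (d x)^2)"
      proof -
        have "(d x - d y)^2 \<le> (norm (x - y))^2" using dlip[of x y] by (metis abs_ge_zero power2_abs power_mono)
        then have "16 * (d x - d y)^2 / (d x)^2 \<le> 16 * (norm (x - y))^2 / (d x)^2" by (intro divide_right_mono) auto
        then show ?thesis by auto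
      qed
      finally have z: "(u x)^2 * (\<zeta> n x - \<zeta> n y)^2 \<le> (u x)^2 * min 1 (16 * (norm (x - y))^2 / (d x)^2)"
        by (intro mult_left_mono) auto
      have y1: "(\<zeta> n y)^2 * (u x - u y)^2 \<le> 1 * (u x - u y)^2"
        using z01[of n y] by (intro mult_right_mono power_le_one) auto
      have "v n x - v n y = \<zeta> n y * (u x - u y) + u x * (\<zeta> n x - \<zeta> n y)" by (simp add: v_def algebra_simps)
      then have "(v n x - v n y)^2 \<le> 2 * (\<zeta> n y * (u x - u y))^2 + 2 * (u x * (\<zeta> n x - \<zeta> n y))^2"
        using sum_squares_bound[of "\<zeta> n y * (u x - u y)" "u x * (\<zeta> n x - \<zeta> n y)"] by (simp add: power2_sum)
      also have "\<dots> = 2 * ((\<zeta> n y)^2 * (u x - u y)^2) + 2 * ((u x)^2 * (\<zeta> n x - \<zeta> n y)^2)"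
        by (simp add: power_mult_distrib)
      finally show ?thesis using z y1 zero_le_power2[of "u x - u y"] by linarith
    qed
    have "(v n x - v n y)^2 * J_kernel (x - y) \<le> (4 * (u x - u y)^2 + 2 * ((u x)^2 * min 1 (16 * (norm (x - y))^2 / (d x)^2))) * J_kernel (x - y)"
      using n1 by (rule mult_right_mono) simp
    then show ?thesis by (simp add: distrib_right mult.assoc)
  qed
  have domfin: "(\<integral>\<^sup>+z. ennreal (?D z) \<partial>?M) < \<infinity>"
  proof -
    obtain c r where c: "c > 0" "r > 0" and H: "\<And>u. u \<in> borel_measurable borel \<Longrightarrow> (\<And>x. x \<notin> \<Omega> \<Longrightarrow> u x = 0) \<Longrightarrow>
      ennreal c * (\<integral>\<^sup>+x. ennreal ((u x)^2) * hardy_weight r (infdist x (- \<Omega>)) \<partial>lborel) \<le>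
      (\<integral>\<^sup>+x. (\<integral>\<^sup>+y. ennreal ((u x - u y)^2 * J_kernel (x - y)) \<partial>lborel) \<partial>lborel)"
      using log_hardy[OF bd lip] by blast
    have I: "integrable ?M (\<lambda>(x, y). (u x - u y)^2 * J_kernel (x - y))" using log_form_pair(1)[OF L] u by simp
    have Ifin: "(\<integral>\<^sup>+x. (\<integral>\<^sup>+y. ennreal ((u x - u y)^2 * J_kernel (x - y)) \<partial>lborel) \<partial>lborel) < \<infinity>"
    proof -
      have "(\<integral>\<^sup>+x. (\<integral>\<^sup>+y. ennreal ((u x - u y)^2 * J_kernel (x - y)) \<partial>lborel) \<partial>lborel) =
        (\<integral>\<^sup>+z. ennreal (case z of (x, y) \<Rightarrow> (u x - u y)\<^sup>2 * J_kernel (x - y)) \<partial>?M)"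
        by (subst lborel.nn_integral_fst[symmetric]) auto
      also have "\<dots> < \<infinity>" using I by (subst nn_integral_eq_integral) auto
      finally show ?thesis .
    qed
    have "ennreal c * (\<integral>\<^sup>+x. ennreal ((u x)^2) * hardy_weight r (infdist x (- \<Omega>)) \<partial>lborel) < \<infinity>"
      using H[OF um u0] Ifin by (rule order_le_less_trans)
    then have "(\<integral>\<^sup>+x. ennreal ((u x)^2) * hardy_weight r (d x) \<partial>lborel) < \<infinity>"
      using c unfolding d_def by (auto simp: ennreal_mult_less_top)
    from cutoff_domination_integral[OF um L12_D(3)[OF L] _ dpos c(2) this]
    have 2: "(\<integral>\<^sup>+x. (\<integral>\<^sup>+y. ennreal ((u x)^2 * min 1 (16 * (norm (x - y))^2 / (d x)^2) * J_kernel (x - y)) \<partial>lborel) \<partial>lborel) < \<infinity>" by simp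
    have "(\<integral>\<^sup>+z. ennreal (?D z) \<partial>?M) = (\<integral>\<^sup>+x. (\<integral>\<^sup>+y. 4 * ennreal ((u x - u y)^2 * J_kernel (x - y)) + 2 * ennreal ((u x)^2 * min 1 (16 * (norm (x - y))^2 / (d x)^2) * J_kernel (x - y)) \<partial>lborel) \<partial>lborel)"
      by (subst lborel.nn_integral_fst[symmetric]) (auto simp: ennreal_mult' intro!: nn_integral_cong)
    also have "\<dots> = 4 * (\<integral>\<^sup>+x. (\<integral>\<^sup>+y. ennreal ((u x - u y)^2 * J_kernel (x - y)) \<partial>lborel) \<partial>lborel) +
      2 * (\<integral>\<^sup>+x. (\<integral>\<^sup>+y. ennreal ((u x)^2 * min 1 (16 * (norm (x - y))^2 / (d x)^2) * J_kernel (x - y)) \<partial>lborel) \<partial>lborel)"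
      by (simp add: nn_integral_add nn_integral_cmult)
    also have "\<dots> < \<infinity>" using Ifin 2 by (auto simp: ennreal_mult_less_top)
    finally show ?thesis .
  qed
  have lim1: "(\<lambda>n. \<integral>\<^sup>+z. ennreal (case z of (x, y) \<Rightarrow> (v n x - v n y)\<^sup>2 * J_kernel (x - y)) \<partial>?M) \<longlonglongrightarrow> (\<integral>\<^sup>+z. 0 \<partial>(lborel \<Otimes>\<^sub>M lborel :: ('a \<times> 'a) measure))"
  proof (rule nn_integral_dominated_convergence[where w = "\<lambda>z. ennreal (?D z)"])
    show "AE z in ?M. ennreal (case z of (x, y) \<Rightarrow> (v n x - v n y)\<^sup>2 * J_kernel (x - y)) \<le> ennreal (?D z)" for n
      using dom[of n] by (intro AE_I2 ennreal_leI) (simp add: case_prod_unfold)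
    show "(\<integral>\<^sup>+z. ennreal (?D z) \<partial>?M) < \<infinity>" by (rule domfin)
    show "AE z in ?M. (\<lambda>n. ennreal (case z of (x, y) \<Rightarrow> (v n x - v n y)\<^sup>2 * J_kernel (x - y))) \<longlonglongrightarrow> 0"
    proof (rule AE_I2)
      fix z :: "'a \<times> 'a"
      have "(\<lambda>n. (v n (fst z) - v n (snd z))^2 * J_kernel (fst z - snd z)) \<longlonglongrightarrow> (0 - 0)\<^sup>2 * J_kernel (fst z - snd z)"
        by (intro tendsto_intros vlim)
      from tendsto_ennrealI[OF this]
      show "(\<lambda>n. ennreal (case z of (x, y) \<Rightarrow> (v n x - v n y)\<^sup>2 * J_kernel (x - y))) \<longlonglongrightarrow> 0"
        by (simp add: case_prod_unfold)
    qed
  qed measurable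
  have lim2: "(\<lambda>n. LINT x|lborel. (v n x)^2) \<longlonglongrightarrow> (LINT x|(lborel :: 'a measure). 0 :: real)"
  proof (rule integral_dominated_convergence[where w = "\<lambda>x. (u x)^2"])
    show "AE x in lborel. (\<lambda>n. (v n x)^2) \<longlonglongrightarrow> 0"
    proof (rule AE_I2)
      fix x
      have "(\<lambda>n. (v n x)^2) \<longlonglongrightarrow> 0\<^sup>2" by (intro tendsto_intros vlim)
      then show "(\<lambda>n. (v n x)^2) \<longlonglongrightarrow> 0" by simp
    qed
  qed (use L12_D(3)[OF L] vsq in auto)
  have "eventually (\<lambda>n. (\<integral>\<^sup>+z. ennreal (case z of (x, y) \<Rightarrow> (v n x - v n y)\<^sup>2 * J_kernel (x - y)) \<partial>?M) < ennreal e) sequentially"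
    using lim1 e by (intro order_tendstoD(2)) auto
  moreover have "eventually (\<lambda>n. mass (v n) < e) sequentially"
    using lim2 e by (intro order_tendstoD(2)) auto
  ultimately have "eventually (\<lambda>n. (\<integral>\<^sup>+z. ennreal (case z of (x, y) \<Rightarrow> (v n x - v n y)\<^sup>2 * J_kernel (x - y)) \<partial>?M) < ennreal e \<and> (mass (v n)) < e) sequentially"
    by (rule eventually_conj)
  then obtain n where n1: "(\<integral>\<^sup>+z. ennreal (case z of (x, y) \<Rightarrow> (v n x - v n y)\<^sup>2 * J_kernel (x - y)) \<partial>?M) < ennreal e"
    and n2: "mass (v n) < e"
    using eventually_happens'[OF sequentially_bot] by blast
  let ?F = "\<lambda>z. case z of (x, y) \<Rightarrow> (v n x - v n y)\<^sup>2 * J_kernel (x - y)"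
  have I: "integrable ?M ?F"
    using n1 by (intro integrableI_nonneg) (auto simp: case_prod_unfold intro: order.strict_trans)
  then have vr: "log_regular (v n)" using log_form_pair(1)[OF vL] by simp
  have "ennreal (integral\<^sup>L ?M ?F) < ennreal e" using n1 I by (subst (asm) nn_integral_eq_integral) auto
  then have "integral\<^sup>L ?M ?F < e" by (meson ennreal_leI not_le)
  then have le: "log_energy (v n) < e" using log_form_pair(2)[OF vL vr] log_energy_nonneg[of "v n"] by simp
  show ?thesis
  proof (rule that[of "1 / real (Suc n)" "\<lambda>x. u x - v n x"])
    show "0 < 1 / real (Suc n)" by simp
    show "log_regular (\<lambda>x. u x - v n x)" by (rule log_regular_combination(2)[OF u vr])
    show "u x - v n x = 0" if "infdist x (- \<Omega>) \<le> 1 / real (Suc n)" for x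
    proof -
      have "real (Suc n) * d x \<le> 1" using that by (simp add: d_def field_simps)
      then show ?thesis by (simp add: v_def \<zeta>_def)
    qed
    show "log_energy (\<lambda>x. u x - (u x - v n x)) < e" "(LINT x|lborel. (u x - (u x - v n x))^2) < e"
      using le n2 by simp_all
  qed
qed

text \<open>A normalised tent function. Being Lipschitz with bounded support, it has a transform
  decaying like 1/|\<xi>|, just enough to put convolutions with L2 functions in H^1.\<close>

lemma mollifier_exists:
  assumes \<epsilon>: "\<epsilon> > 0"
  obtains K :: "'a::euclidean_space \<Rightarrow> real" and C D where "prob_kernel K C" "\<And>x. \<epsilon> \<le> norm x \<Longrightarrow> K x = 0"
    "\<And>\<xi>. norm \<xi> * norm (LINT x|lborel. wave x \<xi> * complex_of_real (K x)) \<le> D"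
    "\<And>\<xi>. norm (1 - (LINT x|lborel. wave x \<xi> * complex_of_real (K x))) \<le> \<epsilon> * norm \<xi>"
    "\<And>\<xi>. norm (LINT x|lborel. wave x \<xi> * complex_of_real (K x)) \<le> 1"
proof -
  let ?b = "\<lambda>x::'a. max 0 (\<epsilon> - norm x)"
  let ?i = "\<lambda>y::'a. (indicator (cball y \<epsilon>) :: 'a \<Rightarrow> real)"
  have ii: "integrable lborel (?i y)" for y
    using emeasure_bounded_finite[of "cball y \<epsilon>"] by (intro integrable_real_indicator) auto
  have bm[measurable]: "?b \<in> borel_measurable borel" by measurable
  have ib: "integrable lborel ?b"
    by (rule Bochner_Integration.integrable_bound[OF integrable_mult_right[of \<epsilon>, OF ii[of 0]]])
       (use \<epsilon> in \<open>auto split: split_indicator\<close>)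
  define c where "c = (LINT x|lborel. ?b x)"
  have c: "c > 0"
  proof -
    have fin: "emeasure lborel (ball (0::'a) (\<epsilon> / 2)) < \<infinity>" by (rule emeasure_bounded_finite) simp
    have "(LINT x|lborel. \<epsilon> / 2 * indicator (ball (0::'a) (\<epsilon> / 2)) x) \<le> c"
      unfolding c_def
    proof (rule integral_mono[OF _ ib])
      show "integrable lborel (\<lambda>x. \<epsilon> / 2 * indicator (ball (0::'a) (\<epsilon> / 2)) x)"
        using fin by (intro integrable_mult_right integrable_real_indicator) auto
      show "\<epsilon> / 2 * indicator (ball (0::'a) (\<epsilon> / 2)) x \<le> ?b x" for x
        using \<epsilon> by (auto split: split_indicator)
    qed
    moreover have "(LINT x|lborel. \<epsilon> / 2 * indicator (ball (0::'a) (\<epsilon> / 2)) x) = \<epsilon> / 2 * measure lborel (ball (0::'a) (\<epsilon> / 2))"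
      by simp
    moreover have "measure lborel (ball (0::'a) (\<epsilon> / 2)) > 0" using content_ball_pos[of "\<epsilon> / 2" "0::'a"] \<epsilon> by simp
    ultimately show ?thesis using \<epsilon> by (smt (verit) mult_pos_pos half_gt_zero)
  qed
  define K where "K x = ?b x / c" for x
  have Km[measurable]: "K \<in> borel_measurable borel" unfolding K_def[abs_def] by measurable
  have iK: "integrable lborel K" unfolding K_def[abs_def] using ib by simp
  have K0: "0 \<le> K x" "K x \<le> \<epsilon> / c" for x using c \<epsilon> by (auto simp: K_def intro!: divide_right_mono)
  have K1: "(LINT x|lborel. K x) = 1" unfolding K_def using c by (simp add: c_def[symmetric])
  have P: "prob_kernel K (\<epsilon> / c)" using iK K0 K1 by (simp add: prob_kernel_def)
  have Kz: "K x = 0" if "\<epsilon> \<le> norm x" for x using that by (simp add: K_def)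
  let ?e = "\<lambda>\<xi> x::'a. wave x \<xi>"
  let ?F = "\<lambda>\<xi>. LINT x|lborel. ?e \<xi> x * complex_of_real (K x)"
  note iF = fourier_integrable[OF iK]
  define V where "V = measure lborel (cball (0::'a) \<epsilon>)"
  have V: "measure lborel (cball y \<epsilon>) = V" for y :: 'a
    using content_cball_conv_ball[of y \<epsilon>] content_cball_conv_ball[of "0::'a" \<epsilon>] \<epsilon> by (simp add: V_def content_ball)
  have F1: "norm (?F \<xi>) \<le> 1" for \<xi>
  proof -
    have "norm (?F \<xi>) \<le> (LINT x|lborel. norm (?e \<xi> x * complex_of_real (K x)))" by (rule integral_norm_bound)
    then show ?thesis using K0 K1 by (simp add: norm_mult)
  qed
  have F2: "norm (1 - ?F \<xi>) \<le> \<epsilon> * norm \<xi>" for \<xi>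
  proof -
    have i1: "integrable lborel (\<lambda>x. complex_of_real (K x))" using iK by simp
    have "1 - ?F \<xi> = (LINT x|lborel. complex_of_real (K x) - ?e \<xi> x * complex_of_real (K x))"
      using iF[of \<xi>] i1 K1 by simp
    also have "norm \<dots> \<le> (LINT x|lborel. norm (complex_of_real (K x) - ?e \<xi> x * complex_of_real (K x)))"
      by (rule integral_norm_bound)
    also have "\<dots> \<le> (LINT x|lborel. \<epsilon> * norm \<xi> * K x)"
    proof (rule integral_mono)
      show "integrable lborel (\<lambda>x. norm (complex_of_real (K x) - ?e \<xi> x * complex_of_real (K x)))"
        by (intro integrable_norm Bochner_Integration.integrable_diff i1 iF)
      show "integrable lborel (\<lambda>x. \<epsilon> * norm \<xi> * K x)" using iK by simp
      fix x
      have "complex_of_real (K x) - ?e \<xi> x * complex_of_real (K x) = complex_of_real (K x) * (1 - ?e \<xi> x)"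
        by (simp add: algebra_simps)
      then have "norm (complex_of_real (K x) - ?e \<xi> x * complex_of_real (K x)) = K x * norm (1 - ?e \<xi> x)"
        using K0[of x] by (simp add: norm_mult)
      also have "norm (1 - ?e \<xi> x) \<le> \<bar>x \<bullet> \<xi>\<bar>"
        using iexp_approx1[of "- (x \<bullet> \<xi>)" 0] by (simp add: norm_minus_commute)
      then have "K x * norm (1 - ?e \<xi> x) \<le> K x * (\<epsilon> * norm \<xi>)"
      proof (cases "norm x < \<epsilon>")
        case True
        have "\<bar>x \<bullet> \<xi>\<bar> \<le> norm x * norm \<xi>" by (rule Cauchy_Schwarz_ineq2)
        also have "\<dots> \<le> \<epsilon> * norm \<xi>" using True by (intro mult_right_mono) auto
        finally show ?thesis using \<open>norm (1 - ?e \<xi> x) \<le> \<bar>x \<bullet> \<xi>\<bar>\<close> K0[of x] by (intro mult_left_mono) auto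
      qed (simp add: Kz)
      finally show "norm (complex_of_real (K x) - ?e \<xi> x * complex_of_real (K x)) \<le> \<epsilon> * norm \<xi> * K x"
        by (simp add: mult_ac)
    qed
    also have "\<dots> = \<epsilon> * norm \<xi>" using K1 by simp
    finally show ?thesis .
  qed
  have F3: "norm \<xi> * norm (?F \<xi>) \<le> pi * V / c" for \<xi>
  proof (cases "\<xi> = 0")
    case False
    \<comment> \<open>Shifting by half a wavelength reverses the sign of the exponential, so twice
      the transform is an integral of K(x) - K(y + x), which is of the size of norm y =
      pi/|\<xi>|.\<close>
    define y where "y = (pi / (norm \<xi>)^2) *\<^sub>R \<xi>"
    have y1: "y \<bullet> \<xi> = pi" using False by (simp add: y_def power2_norm_eq_inner[symmetric])
    have y2: "norm y = pi / norm \<xi>" using False by (simp add: y_def power2_eq_square)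
    let ?g = "\<lambda>x. ?e \<xi> x * complex_of_real (K (y + x))"
    have iK': "integrable lborel (\<lambda>x. K (y + x))"
    proof -
      have "integrable (distr lborel borel ((+) y)) K" using iK lborel_distr_plus[of y] by simp
      then show ?thesis by (subst (asm) integrable_distr_eq) auto
    qed
    have ig: "integrable lborel ?g" by (rule fourier_integrable[OF iK'])
    have "?F \<xi> = (LINT x|lborel. ?e \<xi> (y + x) * complex_of_real (K (y + x)))"
      by (rule integral_shift[of "\<lambda>x. ?e \<xi> x * complex_of_real (K x)" y, symmetric]) measurable
    also have "\<dots> = (LINT x|lborel. - ?g x)"
    proof (intro Bochner_Integration.integral_cong refl)
      fix x
      have "?e \<xi> (y + x) = exp (- (\<i> * complex_of_real pi)) * ?e \<xi> x"
        by (simp add: inner_add_left y1 distrib_left exp_diff exp_minus exp_add field_simps)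
      also have "exp (- (\<i> * complex_of_real pi)) = -1" by (simp add: exp_minus mult.commute)
      finally show "?e \<xi> (y + x) * complex_of_real (K (y + x)) = - ?g x" by simp
    qed
    finally have "2 * ?F \<xi> = (LINT x|lborel. ?e \<xi> x * complex_of_real (K x) - ?g x)"
      using iF[of \<xi>] ig by simp
    then have "norm (2 * ?F \<xi>) \<le> (LINT x|lborel. norm (?e \<xi> x * complex_of_real (K x) - ?g x))"
      by (simp only: integral_norm_bound)
    also have "\<dots> \<le> (LINT x|lborel. norm y / c * (?i 0 x + ?i (- y) x))"
    proof (rule integral_mono)
      show "integrable lborel (\<lambda>x. norm (?e \<xi> x * complex_of_real (K x) - ?g x))"
        by (intro integrable_norm Bochner_Integration.integrable_diff iF ig)
      show "integrable lborel (\<lambda>x. norm y / c * (?i 0 x + ?i (- y) x))" using ii by simp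
      fix x
      have "?e \<xi> x * complex_of_real (K x) - ?g x = ?e \<xi> x * complex_of_real (K x - K (y + x))"
        by (simp add: algebra_simps)
      then have "norm (?e \<xi> x * complex_of_real (K x) - ?g x) = \<bar>K x - K (y + x)\<bar>"
        by (simp only: norm_mult norm_iexp_minus norm_of_real) simp
      also have "\<dots> \<le> norm y / c * (?i 0 x + ?i (- y) x)"
      proof (cases "norm x \<le> \<epsilon> \<or> norm (y + x) \<le> \<epsilon>")
        case True
        have "\<bar>norm (y + x) - norm x\<bar> \<le> norm y" using norm_triangle_ineq3[of "y + x" x] by simp
        then have "\<bar>?b x - ?b (y + x)\<bar> \<le> norm y" by (auto simp: max_def abs_if split: if_splits)
        then have "\<bar>K x - K (y + x)\<bar> \<le> norm y / c * 1"
          using c by (simp add: K_def diff_divide_distrib[symmetric] divide_right_mono)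
        also have "\<dots> \<le> norm y / c * (?i 0 x + ?i (- y) x)"
        proof (intro mult_left_mono)
          have "dist (- y) x = norm (y + x)" by (simp add: dist_norm norm_minus_commute add.commute)
          then show "1 \<le> ?i 0 x + ?i (- y) x" using True by (auto split: split_indicator)
        qed (use c in simp)
        finally show ?thesis .
      next
        case False
        then show ?thesis using c Kz[of x] Kz[of "y + x"] by simp
      qed
      finally show "norm (?e \<xi> x * complex_of_real (K x) - ?g x) \<le> norm y / c * (?i 0 x + ?i (- y) x)" .
    qed
    also have "\<dots> = norm y / c * (V + V)" using ii[of 0] ii[of "- y"] V by simp
    also have "\<dots> = 2 * (norm y / c * V)" by (simp only: distrib_left mult_2)
    finally have "2 * norm (?F \<xi>) \<le> 2 * (norm y / c * V)" by (simp only: norm_mult norm_numeral)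
    then have "norm (?F \<xi>) \<le> norm y / c * V" by (simp only: mult_le_cancel_left_pos zero_less_numeral)
    then have "norm \<xi> * norm (?F \<xi>) \<le> norm \<xi> * (norm y / c * V)" by (intro mult_left_mono) auto
    also have "\<dots> = pi * V / c" using False by (simp add: y2)
    finally show ?thesis .
  qed (use c in \<open>simp add: V_def\<close>)
  show ?thesis by (rule that[OF P Kz F3 F2 F1])
qed

text \<open>The class on which both energies can be differentiated in the exponent: boundedness
  dominates the quotients of |w|^p near p = 2, and the H^1 weight dominates the difference quotients
  of the symbol.\<close>

definition test_function :: "'a::euclidean_space set \<Rightarrow> ('a \<Rightarrow> real) \<Rightarrow> bool" where
  "test_function \<Omega> w \<longleftrightarrow> w \<in> L12 \<and> (\<forall>x. x \<notin> \<Omega> \<longrightarrow> w x = 0) \<and> (\<exists>C. \<forall>x. \<bar>w x\<bar> \<le> C) \<and>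
     integrable lborel (\<lambda>\<xi>. br \<xi> * psd w \<xi>)"

lemma test_function_log_regular:
  assumes "test_function \<Omega> w" shows "log_regular w"
proof -
  have w: "w \<in> L12" and i: "integrable lborel (\<lambda>\<xi>. br \<xi> * psd w \<xi>)"
    using assms by (auto simp: test_function_def)
  note [measurable] = L12_D(1)[OF w]
  have "integrable lborel (\<lambda>\<xi>. ln (br \<xi>) * psd w \<xi>)"
  proof (rule Bochner_Integration.integrable_bound[OF i])
    have "ln (br \<xi>) * psd w \<xi> \<le> br \<xi> * psd w \<xi>" for \<xi>
      using ln_le_minus_one[of "1 + (norm \<xi>)^2"] by (intro mult_right_mono) (auto simp: add_pos_nonneg)
    then show "AE \<xi> in lborel. norm (ln (br \<xi>) * psd w \<xi>) \<le> norm (br \<xi> * psd w \<xi>)"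
      by (auto simp: abs_mult)
  qed measurable
  then show ?thesis using w by (simp add: log_regular_def)
qed

text \<open>The margin between the support of w and the complement keeps the convolution zero
  outside the domain, the decay bound D gives the H^1 weight, and the supremum bound for
  convolutions gives boundedness.\<close>

lemma test_function_conv:
  fixes K w :: "'a::euclidean_space \<Rightarrow> real"
  assumes P: "prob_kernel K C" and Kz: "\<And>x. \<epsilon> \<le> norm x \<Longrightarrow> K x = 0"
    and KD: "\<And>\<xi>. norm \<xi> * norm (LINT x|lborel. wave x \<xi> * complex_of_real (K x)) \<le> D"
    and K1: "\<And>\<xi>. norm (LINT x|lborel. wave x \<xi> * complex_of_real (K x)) \<le> 1"
    and w: "w \<in> L12" and supp: "\<And>x y. x \<notin> \<Omega> \<Longrightarrow> w y \<noteq> 0 \<Longrightarrow> \<epsilon> \<le> norm (x - y)"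
  shows "test_function \<Omega> (conv K w)"
  unfolding test_function_def
proof (intro conjI allI impI)
  show L: "conv K w \<in> L12" by (rule conv_L12[OF P w])
  note [measurable] = L12_D(1)[OF L] L12_D(1)[OF w]
  show "conv K w x = 0" if "x \<notin> \<Omega>" for x
  proof -
    have "K (x - y) * w y = 0" for y using Kz supp[OF that, of y] by (cases "w y = 0") auto
    then show ?thesis unfolding conv_def by (simp only:) simp
  qed
  show "\<exists>C. \<forall>x. \<bar>conv K w x\<bar> \<le> C"
  proof (intro exI allI)
    fix x
    show "\<bar>conv K w x\<bar> \<le> sqrt (C * (LINT y|lborel. (w y)^2))"
      using conv_sup_bound[OF P w, of x] by (intro real_le_rsqrt) simp
  qed
  show "integrable lborel (\<lambda>\<xi>. br \<xi> * psd (conv K w) \<xi>)"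
  proof (rule Bochner_Integration.integrable_bound[OF integrable_mult_right[of "1 + D\<^sup>2", OF plancherel(1)[OF w]]])
    show "AE \<xi> in lborel. norm (br \<xi> * psd (conv K w) \<xi>) \<le> norm ((1 + D\<^sup>2) * psd w \<xi>)"
    proof (rule AE_I2)
      fix \<xi> :: 'a
      let ?F = "LINT x|lborel. wave x \<xi> * complex_of_real (K x)"
      have "(norm \<xi> * norm ?F)^2 \<le> D\<^sup>2" using KD[of \<xi>] by (intro power_mono) auto
      moreover have "(norm ?F)^2 \<le> 1" using K1[of \<xi>] by (intro power_le_one) auto
      ultimately have a: "br \<xi> * (norm ?F)^2 \<le> 1 + D\<^sup>2" by (simp add: algebra_simps power_mult_distrib)
      have "br \<xi> * psd (conv K w) \<xi> = (br \<xi> * (norm ?F)^2) * psd w \<xi>"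
        unfolding fourier_conv[OF P w] norm_mult power_mult_distrib by (simp only: mult.assoc)
      also have "\<dots> \<le> (1 + D\<^sup>2) * psd w \<xi>" using a by (intro mult_right_mono) auto
      finally show "norm (br \<xi> * psd (conv K w) \<xi>) \<le> norm ((1 + D\<^sup>2) * psd w \<xi>)"
        by (simp add: abs_mult)
    qed
  qed measurable
qed

lemma tendsto_weighted_L2:
  fixes f :: "'a::euclidean_space \<Rightarrow> complex" and m :: "nat \<Rightarrow> 'a \<Rightarrow> complex" and w :: "'a \<Rightarrow> real"
  assumes i: "integrable lborel (\<lambda>\<xi>. w \<xi> * (norm (f \<xi>))^2)" and w: "\<And>\<xi>. 0 \<le> w \<xi>"
    and [measurable]: "f \<in> borel_measurable borel" "\<And>n. m n \<in> borel_measurable borel" "w \<in> borel_measurable borel"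
    and b: "\<And>n \<xi>. norm (m n \<xi>) \<le> C" and l: "\<And>\<xi>. (\<lambda>n. m n \<xi>) \<longlonglongrightarrow> 0"
  shows "(\<lambda>n. LINT \<xi>|lborel. w \<xi> * (norm (m n \<xi> * f \<xi>))^2) \<longlonglongrightarrow> 0"
    and "integrable lborel (\<lambda>\<xi>. w \<xi> * (norm (m n \<xi> * f \<xi>))^2)"
proof -
  have dom: "norm (w \<xi> * (norm (m n \<xi> * f \<xi>))^2) \<le> C\<^sup>2 * (w \<xi> * (norm (f \<xi>))^2)" for n \<xi>
  proof -
    have "(norm (m n \<xi>))^2 \<le> C\<^sup>2" using b[of n \<xi>] by (intro power_mono) auto
    then have "(norm (m n \<xi>))^2 * (w \<xi> * (norm (f \<xi>))^2) \<le> C\<^sup>2 * (w \<xi> * (norm (f \<xi>))^2)"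
      using w[of \<xi>] by (intro mult_right_mono) auto
    then show ?thesis using w[of \<xi>] by (simp add: norm_mult power_mult_distrib abs_mult mult_ac)
  qed
  have "(\<lambda>n. LINT \<xi>|lborel. w \<xi> * (norm (m n \<xi> * f \<xi>))^2) \<longlonglongrightarrow> (LINT \<xi>|(lborel :: 'a measure). (0::real))"
  proof (rule integral_dominated_convergence[where w = "\<lambda>\<xi>. C\<^sup>2 * (w \<xi> * (norm (f \<xi>))^2)"])
    show "AE \<xi> in lborel. (\<lambda>n. w \<xi> * (norm (m n \<xi> * f \<xi>))^2) \<longlonglongrightarrow> 0"
    proof (rule AE_I2)
      fix \<xi> :: 'a
      have "(\<lambda>n. w \<xi> * (norm (m n \<xi> * f \<xi>))^2) \<longlonglongrightarrow> w \<xi> * (norm (0 * f \<xi>))^2" by (intro tendsto_intros l)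
      then show "(\<lambda>n. w \<xi> * (norm (m n \<xi> * f \<xi>))^2) \<longlonglongrightarrow> 0" by simp
    qed
    show "integrable lborel (\<lambda>\<xi>. C\<^sup>2 * (w \<xi> * (norm (f \<xi>))^2))" using i by simp
    show "AE \<xi> in lborel. norm (w \<xi> * (norm (m n \<xi> * f \<xi>))^2) \<le> C\<^sup>2 * (w \<xi> * (norm (f \<xi>))^2)" for n
      using dom by simp
  qed measurable
  then show "(\<lambda>n. LINT \<xi>|lborel. w \<xi> * (norm (m n \<xi> * f \<xi>))^2) \<longlonglongrightarrow> 0" by simp
  show "integrable lborel (\<lambda>\<xi>. w \<xi> * (norm (m n \<xi> * f \<xi>))^2)"
  proof (rule Bochner_Integration.integrable_bound[OF integrable_mult_right[of "C\<^sup>2", OF i]])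
    show "AE \<xi> in lborel. norm (w \<xi> * (norm (m n \<xi> * f \<xi>))^2) \<le> norm (C\<^sup>2 * (w \<xi> * (norm (f \<xi>))^2))"
      by (intro AE_I2 order_trans[OF dom]) simp
  qed measurable
qed

text \<open>Cutting off near the boundary first creates a margin, and mollifying with radius at most
  this margin keeps the support in the domain. The error multiplier, 1 minus the transform of the
  mollifier, is bounded by 2 and tends to 0 pointwise, so it vanishes in the energy and in
  L2.\<close>

theorem test_functions_dense:
  fixes \<Omega> :: "'a::euclidean_space set" and u :: "'a \<Rightarrow> real"
  assumes bd: "bounded \<Omega>" and lip: "lipschitz_domain \<Omega>" and u: "log_regular u"
    and van: "vanishes_outside \<Omega> u" and e: "e > 0"
  obtains w where "test_function \<Omega> w" "log_energy (\<lambda>x. u x - w x) < e" "(LINT x|lborel. (u x - w x)^2) < e"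
proof -
  have op: "open \<Omega>" using lip by (simp add: lipschitz_domain_def)
  then have [measurable]: "\<Omega> \<in> sets borel" by simp
  have L: "u \<in> L12" using u by (simp add: log_regular_def)
  note um[measurable] = L12_D(1)[OF L]
  \<comment> \<open>The cutoff argument works with exact vanishing outside the domain, while u
    vanishes there only almost everywhere.\<close>
  define u' where "u' x = indicator \<Omega> x * u x" for x
  have u'm[measurable]: "u' \<in> borel_measurable borel" unfolding u'_def[abs_def] by measurable
  have ae: "AE x in lborel. u x = u' x"
    using van unfolding vanishes_outside_def by eventually_elim (auto simp: u'_def split: split_indicator)
  have u': "log_regular u'" by (rule log_regular_cong_AE(1)[OF u u'm ae])
  have u'0: "u' x = 0" if "x \<notin> \<Omega>" for x using that by (simp add: u'_def)
  have e4: "e / 4 > 0" using e by simp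
  obtain v \<delta> where \<delta>: "\<delta> > 0" and v: "log_regular v" and vz: "\<And>x. infdist x (- \<Omega>) \<le> \<delta> \<Longrightarrow> v x = 0"
    and v1: "log_energy (\<lambda>x. u' x - v x) < e / 4" and v2: "(LINT x|lborel. (u' x - v x)^2) < e / 4"
    using cutoff_approximation[OF bd lip u' u'0 e4] by blast
  have vL: "v \<in> L12" using v by (simp add: log_regular_def)
  note [measurable] = L12_D(1)[OF vL]
  define \<epsilon> where "\<epsilon> n = \<delta> / real (Suc n)" for n
  have eps: "\<epsilon> n > 0" "\<epsilon> n \<le> \<delta>" for n using \<delta> by (auto simp: \<epsilon>_def field_simps)
  let ?F = "\<lambda>K \<xi>. LINT x|lborel. wave x \<xi> * complex_of_real (K x)"
  have "\<exists>K::'a \<Rightarrow> real. \<exists>C D. prob_kernel K C \<and> (\<forall>x. \<epsilon> n \<le> norm x \<longrightarrow> K x = 0) \<and>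
     (\<forall>\<xi>. norm \<xi> * norm (?F K \<xi>) \<le> D) \<and> (\<forall>\<xi>. norm (1 - ?F K \<xi>) \<le> \<epsilon> n * norm \<xi>) \<and> (\<forall>\<xi>. norm (?F K \<xi>) \<le> 1)" for n
  proof -
    obtain K :: "'a \<Rightarrow> real" and C D where "prob_kernel K C" "\<And>x. \<epsilon> n \<le> norm x \<Longrightarrow> K x = 0"
      "\<And>\<xi>. norm \<xi> * norm (?F K \<xi>) \<le> D" "\<And>\<xi>. norm (1 - ?F K \<xi>) \<le> \<epsilon> n * norm \<xi>" "\<And>\<xi>. norm (?F K \<xi>) \<le> 1"
      by (rule mollifier_exists[OF eps(1)[of n], where 'a='a]) (rule that)
    then show ?thesis by (intro exI[of _ K] exI[of _ C] exI[of _ D]) simp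
  qed
  then have "\<forall>n. \<exists>K::'a \<Rightarrow> real. \<exists>C D. prob_kernel K C \<and> (\<forall>x. \<epsilon> n \<le> norm x \<longrightarrow> K x = 0) \<and>
     (\<forall>\<xi>. norm \<xi> * norm (?F K \<xi>) \<le> D) \<and> (\<forall>\<xi>. norm (1 - ?F K \<xi>) \<le> \<epsilon> n * norm \<xi>) \<and> (\<forall>\<xi>. norm (?F K \<xi>) \<le> 1)" by blast
  from choice[OF this] obtain K :: "nat \<Rightarrow> 'a \<Rightarrow> real" where K: "\<forall>n. \<exists>C D. prob_kernel (K n) C \<and> (\<forall>x. \<epsilon> n \<le> norm x \<longrightarrow> K n x = 0) \<and>
     (\<forall>\<xi>. norm \<xi> * norm (?F (K n) \<xi>) \<le> D) \<and> (\<forall>\<xi>. norm (1 - ?F (K n) \<xi>) \<le> \<epsilon> n * norm \<xi>) \<and> (\<forall>\<xi>. norm (?F (K n) \<xi>) \<le> 1)"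
    by (elim exE)
  have Km[measurable]: "K n \<in> borel_measurable borel" for n
    using spec[OF K, of n] by (auto simp: prob_kernel_def)
  have tf: "test_function \<Omega> (conv (K n) v)" and
    FT: "fourier (conv (K n) v) \<xi> = ?F (K n) \<xi> * fourier v \<xi>" for n \<xi>
  proof -
    from spec[OF K, of n] obtain C D where k: "prob_kernel (K n) C" "\<forall>x. \<epsilon> n \<le> norm x \<longrightarrow> K n x = 0"
      "\<forall>\<xi>. norm \<xi> * norm (?F (K n) \<xi>) \<le> D" "\<forall>\<xi>. norm (?F (K n) \<xi>) \<le> 1" by (elim exE conjE)
    show "test_function \<Omega> (conv (K n) v)"
    proof (rule test_function_conv[OF k(1) _ _ _ vL, of "\<epsilon> n"])
      fix x y assume x: "x \<notin> \<Omega>" and y: "v y \<noteq> 0"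
      have "\<delta> < infdist y (- \<Omega>)" using vz[of y] y by (meson not_le)
      also have "\<dots> \<le> dist y x" using x by (intro infdist_le) simp
      finally show "\<epsilon> n \<le> norm (x - y)" using eps(2)[of n] by (simp add: dist_norm norm_minus_commute)
    qed (use k in auto)
    show "fourier (conv (K n) v) \<xi> = ?F (K n) \<xi> * fourier v \<xi>" by (rule fourier_conv[OF k(1) vL])
  qed
  have cr: "log_regular (conv (K n) v)" for n by (rule test_function_log_regular[OF tf])
  have cL: "conv (K n) v \<in> L12" for n using cr by (simp add: log_regular_def)
  have FD: "fourier (\<lambda>x. v x - conv (K n) v x) \<xi> = (1 - ?F (K n) \<xi>) * fourier v \<xi>" for n \<xi>
    unfolding fourier_diff[OF L12_D(2)[OF vL] L12_D(2)[OF cL]] FT by (simp add: left_diff_distrib)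
  define m where "m n \<xi> = 1 - ?F (K n) \<xi>" for n \<xi>
  have mm: "m n \<in> borel_measurable borel" for n unfolding m_def[abs_def] by measurable
  have mb: "norm (m n \<xi>) \<le> 2" for n \<xi>
  proof -
    have "norm (?F (K n) \<xi>) \<le> 1" using spec[OF K, of n] by blast
    then show ?thesis unfolding m_def using norm_triangle_ineq4[of 1 "?F (K n) \<xi>"] by simp
  qed
  have ml: "(\<lambda>n. m n \<xi>) \<longlonglongrightarrow> 0" for \<xi>
  proof (rule Lim_null_comparison)
    have "norm (m n \<xi>) \<le> \<epsilon> n * norm \<xi>" for n unfolding m_def using spec[OF K, of n] by blast
    then show "eventually (\<lambda>n. norm (m n \<xi>) \<le> \<epsilon> n * norm \<xi>) sequentially" by simp
    have "\<epsilon> \<longlonglongrightarrow> 0" unfolding \<epsilon>_def by (rule LIMSEQ_Suc) (rule lim_const_over_n)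
    then show "(\<lambda>n. \<epsilon> n * norm \<xi>) \<longlonglongrightarrow> 0" using tendsto_mult_left_zero by blast
  qed
  have l1: "(\<lambda>n. log_energy (\<lambda>x. v x - conv (K n) v x)) \<longlonglongrightarrow> 0"
    unfolding log_energy_def FD m_def[symmetric]
    by (rule tendsto_weighted_L2(1)[OF _ _ _ mm _ mb ml]) (use v in \<open>auto simp: log_regular_def\<close>)
  have "(\<lambda>n. LINT \<xi>|lborel. 1 * (norm (m n \<xi> * fourier v \<xi>))^2) \<longlonglongrightarrow> 0"
    by (rule tendsto_weighted_L2(1)[OF _ _ _ mm _ mb ml]) (use plancherel(1)[OF vL] in auto)
  moreover have "(LINT \<xi>|lborel. 1 * (norm (m n \<xi> * fourier v \<xi>))^2) = (LINT x|lborel. (v x - conv (K n) v x)^2)" for n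
    using plancherel(2)[OF L12_diff[OF vL cL[of n]]] unfolding FD m_def by simp
  ultimately have l2: "(\<lambda>n. LINT x|lborel. (v x - conv (K n) v x)^2) \<longlonglongrightarrow> 0" by simp
  have "eventually (\<lambda>n. log_energy (\<lambda>x. v x - conv (K n) v x) < e / 4 \<and> (LINT x|lborel. (v x - conv (K n) v x)^2) < e / 4) sequentially"
    using order_tendstoD(2)[OF l1 e4] order_tendstoD(2)[OF l2 e4] by (rule eventually_conj)
  then obtain n where n: "log_energy (\<lambda>x. v x - conv (K n) v x) < e / 4" "(LINT x|lborel. (v x - conv (K n) v x)^2) < e / 4"
    using eventually_happens'[OF sequentially_bot] by blast
  define w where "w = conv (K n) v"
  have wr: "log_regular w" and wL: "w \<in> L12" unfolding w_def by (rule cr, rule cL)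
  note [measurable] = L12_D(1)[OF wL]
  have r1: "log_regular (\<lambda>x. u' x - v x)" and r2: "log_regular (\<lambda>x. v x - w x)" and r3: "log_regular (\<lambda>x. u' x - w x)"
    using log_regular_combination(2) u' v wr by blast+
  have eqw: "(\<lambda>x. (u' x - v x) + (v x - w x)) = (\<lambda>x. u' x - w x)" by auto
  have "log_energy (\<lambda>x. u' x - w x) < e" "(LINT x|lborel. (u' x - w x)^2) < e"
    using log_energy_add_le[OF r1 r2] L2_add_le[of "\<lambda>x. u' x - v x" "\<lambda>x. v x - w x"] r1 r2 v1 v2 n
    unfolding eqw w_def[symmetric] by (auto simp: log_regular_def)
  moreover have "log_energy (\<lambda>x. u x - w x) = log_energy (\<lambda>x. u' x - w x)"
    by (rule log_regular_cong_AE(2)[OF r3]) (measurable, use ae in auto)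
  moreover have "(LINT x|lborel. (u x - w x)^2) = (LINT x|lborel. (u' x - w x)^2)"
    by (rule integral_cong_AE) (measurable, use ae in auto)
  ultimately show ?thesis using that[of w] tf[of n] by (simp add: w_def)
qed

text \<open>A mollifier convolved with its reflected translate. It is nonzero because its transform
  at 0 is a product of two nonzero numbers.\<close>

lemma nontrivial_test_function_exists:
  fixes \<Omega> :: "'a::euclidean_space set"
  assumes op: "open \<Omega>" and ne: "\<Omega> \<noteq> {}"
  obtains w where "test_function \<Omega> w" "mass w > 0"
proof -
  obtain a r where r: "r > 0" "ball a r \<subseteq> \<Omega>" using op ne by (metis all_not_in_conv open_contains_ball)
  let ?F = "\<lambda>K \<xi>. LINT x|lborel. wave x \<xi> * complex_of_real (K x)"
  have r2: "r / 2 > 0" using r by simp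
  obtain K :: "'a \<Rightarrow> real" and C D where K: "prob_kernel K C" "\<And>x. r / 2 \<le> norm x \<Longrightarrow> K x = 0"
      "\<And>\<xi>. norm \<xi> * norm (?F K \<xi>) \<le> D" "\<And>\<xi>. norm (1 - ?F K \<xi>) \<le> r / 2 * norm \<xi>" "\<And>\<xi>. norm (?F K \<xi>) \<le> 1"
    by (rule mollifier_exists[OF r2, where 'a='a]) (rule that)
  have [measurable]: "K \<in> borel_measurable borel" using K(1) by (simp add: prob_kernel_def)
  define v where "v x = K (a - x)" for x
  have [measurable]: "v \<in> borel_measurable borel" unfolding v_def[abs_def] by measurable
  have iv: "integrable lborel v" and lv: "(LINT x|lborel. v x) = 1"
    unfolding v_def[abs_def] using integrable_reflect[of K a] K(1) by (auto simp: prob_kernel_def)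
  have Kb: "0 \<le> K x" "K x \<le> C" for x using K(1) by (auto simp: prob_kernel_def)
  have vL: "v \<in> L12"
  proof -
    have "integrable lborel (\<lambda>x. (v x)^2)"
    proof (rule Bochner_Integration.integrable_bound[OF integrable_mult_right[of C, OF iv]])
      have "(v x)^2 \<le> C * v x" for x
        unfolding v_def power2_eq_square by (intro mult_right_mono Kb)
      then show "AE x in lborel. norm ((v x)^2) \<le> norm (C * v x)"
        by (auto intro: order_trans[OF _ abs_ge_self])
    qed measurable
    then show ?thesis using iv by (simp add: L12_def)
  qed
  define w where "w = conv K v"
  have tf: "test_function \<Omega> w"
    unfolding w_def
  proof (rule test_function_conv[OF K(1,2,3,5) vL])
    fix x y assume x: "x \<notin> \<Omega>" and y: "v y \<noteq> 0"
    have "\<not> r / 2 \<le> norm (a - y)" using K(2)[of "a - y"] y unfolding v_def by blast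
    then have "norm (a - y) < r / 2" by simp
    moreover have "r \<le> dist a x" using r(2) x by (auto simp: not_less subset_iff)
    moreover have "dist a x \<le> norm (a - y) + norm (x - y)"
      using dist_triangle[of a x y] by (simp add: dist_norm norm_minus_commute)
    ultimately show "r / 2 \<le> norm (x - y)" by linarith
  qed
  then have wL: "w \<in> L12" by (simp add: test_function_def)
  have "mass w \<noteq> 0"
  proof
    assume "mass w = 0"
    then have "AE x in lborel. (w x)^2 = 0" using integral_nonneg_eq_0_iff_AE[OF L12_D(3)[OF wL]] by simp
    then have ae: "AE x in lborel. w x = 0" by eventually_elim simp
    have "fourier w = fourier (\<lambda>x. 0)" by (rule fourier_cong_AE[OF L12_D(1)[OF wL] _ ae]) simp
    then have "fourier w 0 = 0" by (simp add: fourier_def)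
    moreover have "fourier w 0 = ?F K 0 * fourier v 0" unfolding w_def by (rule fourier_conv[OF K(1) vL])
    moreover have "?F K 0 = 1" using K(1) by (simp add: prob_kernel_def)
    moreover have "fourier v 0 \<noteq> 0" using lv by (simp add: fourier_def)
    ultimately show False by simp
  qed
  moreover have "0 \<le> mass w" by simp
  ultimately show ?thesis using that[OF tf] by linarith
qed

subsection \<open>Compactness\<close>

lemma L1_le_L2_bounded_support:
  fixes \<Omega> :: "'a::euclidean_space set"
  assumes "bounded \<Omega>"
  obtains C where "C > 0"
    "\<And>u. u \<in> L12 \<Longrightarrow> vanishes_outside \<Omega> u \<Longrightarrow> (LINT x|lborel. \<bar>u x\<bar>) \<le> C * sqrt (mass u)"
proof -
  obtain R where R: "R > 0" "\<And>x. x \<in> \<Omega> \<Longrightarrow> norm x \<le> R"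
    using assms unfolding bounded_pos by blast
  have [measurable]: "cball (0::'a) R \<in> sets borel" by simp
  define V where "V = measure lborel (cball (0::'a) R)"
  have V: "V > 0" using content_cball_pos[OF R(1), of "0::'a"] by (simp add: V_def)
  have fin: "emeasure lborel (cball (0::'a) R) < \<infinity>" by (rule emeasure_bounded_finite) simp
  show ?thesis
  proof (rule that[of "sqrt V"])
    show "sqrt V > 0" using V by simp
    fix u assume u: "u \<in> L12" and v: "vanishes_outside \<Omega> u"
    note [measurable] = L12_D(1)[OF u]
    define m where "m = (LINT x|lborel. \<bar>u x\<bar>)"
    have m0: "m \<ge> 0" by (simp add: m_def)
    \<comment> \<open>The mean of |u| over the ball; expanding the nonnegative variance about it is
      the Cauchy-Schwarz inequality with the constant function.\<close>
    define t where "t = m / V"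
    let ?i = "\<lambda>x::'a. (indicator (cball 0 R) x :: real)"
    have ii: "integrable lborel ?i" using fin by (intro integrable_real_indicator) auto
    have vu: "AE x in lborel. norm x > R \<longrightarrow> u x = 0"
      using v unfolding vanishes_outside_def by eventually_elim (use R in \<open>auto simp: not_le[symmetric]\<close>)
    have "0 \<le> (LINT x|lborel. (t * ?i x - \<bar>u x\<bar>)^2)" by simp
    also have "\<dots> = (LINT x|lborel. t\<^sup>2 * ?i x - 2 * t * \<bar>u x\<bar> + (u x)^2)"
    proof (rule integral_cong_AE)
      show "AE x in lborel. (t * ?i x - \<bar>u x\<bar>)^2 = t\<^sup>2 * ?i x - 2 * t * \<bar>u x\<bar> + (u x)^2"
        using vu by eventually_elim (auto split: split_indicator simp: power2_diff)
    qed measurable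
    also have "\<dots> = t\<^sup>2 * V - 2 * t * m + mass u"
      using ii L12_D(2,3)[OF u] by (simp add: m_def V_def)
    finally have "m\<^sup>2 \<le> V * mass u"
      using V by (simp add: t_def power2_eq_square field_simps)
    then have "m \<le> sqrt (V * mass u)" by (rule real_le_rsqrt)
    then show "(LINT x|lborel. \<bar>u x\<bar>) \<le> sqrt V * sqrt (mass u)"
      by (simp add: m_def real_sqrt_mult)
  qed
qed

lemma fourier_lipschitz:
  fixes u :: "'a::euclidean_space \<Rightarrow> real"
  assumes u: "integrable lborel u" and R: "AE x in lborel. norm x > R \<longrightarrow> u x = 0" "R \<ge> 0"
  shows "norm (fourier u \<xi> - fourier u \<eta>) \<le> (2 * pi) powr (- (real DIM('a) / 2)) * (R * norm (\<xi> - \<eta>) * (LINT x|lborel. \<bar>u x\<bar>))"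
proof -
  have [measurable]: "u \<in> borel_measurable borel" using u by (auto dest: borel_measurable_integrable)
  let ?e = "\<lambda>\<xi> x::'a. wave x \<xi>"
  have b: "norm (?e \<xi> x - ?e \<eta> x) \<le> norm x * norm (\<xi> - \<eta>)" for x
  proof -
    have "?e \<xi> x - ?e \<eta> x = ?e \<eta> x * (iexp (- (x \<bullet> (\<xi> - \<eta>))) - 1)"
      by (simp add: inner_diff_right right_diff_distrib mult_exp_exp)
    then have "norm (?e \<xi> x - ?e \<eta> x) = norm (iexp (- (x \<bullet> (\<xi> - \<eta>))) - 1)"
      by (simp only: norm_mult norm_iexp_minus mult_1)
    also have "\<dots> \<le> \<bar>x \<bullet> (\<xi> - \<eta>)\<bar>" using iexp_approx1[of "- (x \<bullet> (\<xi> - \<eta>))" 0] by simp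
    also have "\<dots> \<le> norm x * norm (\<xi> - \<eta>)" by (rule Cauchy_Schwarz_ineq2)
    finally show ?thesis .
  qed
  have "(LINT x|lborel. ?e \<xi> x * complex_of_real (u x)) - (LINT x|lborel. ?e \<eta> x * complex_of_real (u x)) =
     (LINT x|lborel. ?e \<xi> x * complex_of_real (u x) - ?e \<eta> x * complex_of_real (u x))"
    using fourier_integrable[OF u] by simp
  also have "norm \<dots> \<le> (LINT x|lborel. norm (?e \<xi> x * complex_of_real (u x) - ?e \<eta> x * complex_of_real (u x)))"
    by (rule integral_norm_bound)
  also have "\<dots> \<le> (LINT x|lborel. R * norm (\<xi> - \<eta>) * \<bar>u x\<bar>)"
  proof (rule integral_mono_AE)
    show "integrable lborel (\<lambda>x. norm (?e \<xi> x * complex_of_real (u x) - ?e \<eta> x * complex_of_real (u x)))"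
      by (intro integrable_norm Bochner_Integration.integrable_diff fourier_integrable u)
    show "integrable lborel (\<lambda>x. R * norm (\<xi> - \<eta>) * \<bar>u x\<bar>)" using u by simp
    show "AE x in lborel. norm (?e \<xi> x * complex_of_real (u x) - ?e \<eta> x * complex_of_real (u x)) \<le> R * norm (\<xi> - \<eta>) * \<bar>u x\<bar>"
      using R(1)
    proof eventually_elim
      case (elim x)
      have "norm (?e \<xi> x * complex_of_real (u x) - ?e \<eta> x * complex_of_real (u x)) = norm (?e \<xi> x - ?e \<eta> x) * \<bar>u x\<bar>"
        unfolding left_diff_distrib[symmetric] norm_mult by simp
      also have "\<dots> \<le> R * norm (\<xi> - \<eta>) * \<bar>u x\<bar>"
      proof (cases "u x = 0")
        case False
        then have "norm x \<le> R" using elim by force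
        then have "norm x * norm (\<xi> - \<eta>) \<le> R * norm (\<xi> - \<eta>)" by (intro mult_right_mono) auto
        then show ?thesis using b[of x] by (intro mult_right_mono) auto
      qed simp
      finally show ?case .
    qed
  qed
  finally have "norm ((LINT x|lborel. ?e \<xi> x * complex_of_real (u x)) - (LINT x|lborel. ?e \<eta> x * complex_of_real (u x))) \<le> R * norm (\<xi> - \<eta>) * (LINT x|lborel. \<bar>u x\<bar>)"
    by simp
  then show ?thesis
    unfolding fourier_def right_diff_distrib[symmetric] norm_mult by (simp add: mult_left_mono)
qed

text \<open>The Arzela-Ascoli argument for pointwise limits: a diagonal subsequence converges on a
  countable dense set, and the common Lipschitz bound extends the Cauchy property to every
  point.\<close>

lemma equilipschitz_convergent_subsequence:
  fixes f :: "nat \<Rightarrow> 'a::euclidean_space \<Rightarrow> complex"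
  assumes M: "\<And>n x. norm (f n x) \<le> M" and L: "\<And>n x y. norm (f n x - f n y) \<le> L * norm (x - y)"
  obtains k where "strict_mono (k :: nat \<Rightarrow> nat)" "\<And>x. convergent (\<lambda>n. f (k n) x)"
proof -
  obtain D :: "'a set" where D: "countable D" "\<And>X. open X \<Longrightarrow> X \<noteq> {} \<Longrightarrow> \<exists>d\<in>D. d \<in> X"
    by (rule countable_dense_setE) auto
  obtain k where k: "strict_mono (k :: nat \<Rightarrow> nat)" "\<And>x. x \<in> D \<Longrightarrow> \<exists>l. (\<lambda>n. f (k n) x) \<longlonglongrightarrow> l"
    by (rule function_convergent_subsequence[OF D(1), of f M]) (use M in auto)
  show ?thesis
  proof (rule that[OF k(1)])
    fix x
    have "Cauchy (\<lambda>n. f (k n) x)"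
    proof (rule metric_CauchyI)
      fix e :: real assume e: "e > 0"
      define L' where "L' = \<bar>L\<bar> + 1"
      have L': "L' > 0" "L \<le> L'" by (auto simp: L'_def)
      have "0 < e / (3 * L')" using e L' by (intro divide_pos_pos) auto
      then have "x \<in> ball x (e / (3 * L'))" by (simp only: centre_in_ball)
      then have "ball x (e / (3 * L')) \<noteq> {}" by blast
      from D(2)[OF open_ball this] obtain d where d: "d \<in> D" "d \<in> ball x (e / (3 * L'))" by blast
      have near: "norm (f n x - f n d) < e / 3" for n
      proof -
        have "norm (f n x - f n d) \<le> L * norm (x - d)" by (rule L)
        also have "\<dots> \<le> L' * norm (x - d)" using L' by (intro mult_right_mono) auto
        also have "\<dots> < L' * (e / (3 * L'))" using d(2) L' by (intro mult_strict_left_mono) (auto simp: dist_norm)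
        also have "\<dots> = e / 3" using L' by simp
        finally show ?thesis .
      qed
      have "Cauchy (\<lambda>n. f (k n) d)" using k(2)[OF d(1)] by (auto intro: LIMSEQ_imp_Cauchy)
      then obtain N where N: "\<And>m n. m \<ge> N \<Longrightarrow> n \<ge> N \<Longrightarrow> dist (f (k m) d) (f (k n) d) < e / 3"
        using e metric_CauchyD[of "\<lambda>n. f (k n) d" "e / 3"] by auto
      have "dist (f (k m) x) (f (k n) x) < e" if "m \<ge> N" "n \<ge> N" for m n
      proof -
        have "dist (f (k m) x) (f (k n) x) \<le> dist (f (k m) x) (f (k m) d) + dist (f (k m) d) (f (k n) d) + dist (f (k n) d) (f (k n) x)"
          using dist_triangle[of "f (k m) x" "f (k n) x" "f (k m) d"] dist_triangle[of "f (k m) d" "f (k n) x" "f (k n) d"] by linarith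
        also have "\<dots> < e / 3 + e / 3 + e / 3"
          using near[of "k m"] near[of "k n"] N[OF that] by (intro add_strict_mono) (auto simp: dist_norm norm_minus_commute)
        finally show ?thesis by simp
      qed
      then show "\<exists>N. \<forall>m\<ge>N. \<forall>n\<ge>N. dist (f (k m) x) (f (k n) x) < e" by blast
    qed
    then show "convergent (\<lambda>n. f (k n) x)" by (rule Cauchy_convergent)
  qed
qed

lemma norm_diff_square_le: "(norm (a - b :: complex))^2 \<le> 2 * (norm (a - c))^2 + 2 * (norm (b - c))^2"
proof -
  have "norm (a - b) \<le> norm (a - c) + norm (b - c)" using norm_triangle_ineq4[of "a - c" "b - c"] by simp
  then have "(norm (a - b))^2 \<le> (norm (a - c) + norm (b - c))^2" by (intro power_mono) auto
  also have "\<dots> \<le> 2 * (norm (a - c))^2 + 2 * (norm (b - c))^2"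
    using sum_squares_bound[of "norm (a - c)" "norm (b - c)"] by (simp add: power2_sum)
  finally show ?thesis .
qed

text \<open>Dominated convergence handles a ball of frequencies. Outside it the weight is at least
  T, so bounded logarithmic energy leaves at most 4A/T there; the limit g satisfies the same energy
  bound by Fatou.\<close>

lemma fourier_L2_convergence:
  fixes F :: "nat \<Rightarrow> 'a::euclidean_space \<Rightarrow> complex"
  assumes [measurable]: "\<And>n. F n \<in> borel_measurable borel" and M: "\<And>n \<xi>. norm (F n \<xi>) \<le> M"
    and g: "\<And>\<xi>. (\<lambda>n. F n \<xi>) \<longlonglongrightarrow> g \<xi>"
    and W: "\<And>n. (\<integral>\<^sup>+\<xi>. ennreal (ln (br \<xi>) * (norm (F n \<xi>))^2) \<partial>lborel) \<le> ennreal A" and A: "A \<ge> 0"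
  shows "(\<lambda>n. \<integral>\<^sup>+\<xi>. ennreal ((norm (F n \<xi> - g \<xi>))^2) \<partial>lborel) \<longlonglongrightarrow> 0"
proof -
  have gm[measurable]: "g \<in> borel_measurable borel"
    by (rule borel_measurable_LIMSEQ_metric[OF _ g]) simp
  let ?w = "\<lambda>\<xi>::'a. ln (br \<xi>)"
  have Wg: "(\<integral>\<^sup>+\<xi>. ennreal (?w \<xi> * (norm (g \<xi>))^2) \<partial>lborel) \<le> ennreal A"
  proof -
    have "(\<integral>\<^sup>+\<xi>. ennreal (?w \<xi> * (norm (g \<xi>))^2) \<partial>lborel) = (\<integral>\<^sup>+\<xi>. liminf (\<lambda>n. ennreal (?w \<xi> * (norm (F n \<xi>))^2)) \<partial>lborel)"
    proof (rule nn_integral_cong)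
      fix \<xi> :: 'a
      have "(\<lambda>n. ennreal (?w \<xi> * (norm (F n \<xi>))^2)) \<longlonglongrightarrow> ennreal (?w \<xi> * (norm (g \<xi>))^2)"
        by (intro tendsto_ennrealI tendsto_intros g)
      then show "ennreal (?w \<xi> * (norm (g \<xi>))^2) = liminf (\<lambda>n. ennreal (?w \<xi> * (norm (F n \<xi>))^2))"
        by (rule lim_imp_Liminf[OF sequentially_bot, symmetric])
    qed
    also have "\<dots> \<le> liminf (\<lambda>n. \<integral>\<^sup>+\<xi>. ennreal (?w \<xi> * (norm (F n \<xi>))^2) \<partial>lborel)"
      by (rule nn_integral_liminf) measurable
    also have "\<dots> \<le> liminf (\<lambda>n::nat. ennreal A)" by (intro Liminf_mono always_eventually allI W)
    also have "\<dots> = ennreal A" by (simp add: Liminf_const)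
    finally show ?thesis .
  qed
  have Mg: "norm (g \<xi>) \<le> M" for \<xi>
    using M by (intro Lim_norm_ubound[OF _ g]) auto
  have key: "eventually (\<lambda>n. (\<integral>\<^sup>+\<xi>. ennreal ((norm (F n \<xi> - g \<xi>))^2) \<partial>lborel) < a) sequentially" if a: "0 < a" for a :: ennreal
  proof -
    define e where "e = (if a = \<infinity> then 1 else enn2real a / 2)"
    have e: "e > 0" "ennreal e < a"
      using a by (cases a; auto simp: e_def ennreal_less_iff zero_less_iff_neq_zero)+
    \<comment> \<open>With T at least 8A/e the high frequencies contribute at most e/2.\<close>
    define T where "T = 8 * A / e + 1"
    have T: "T > 0" using A e by (simp add: T_def add_nonneg_pos)
    define R where "R = sqrt (exp T)"
    have wR: "T \<le> ?w \<xi>" if "norm \<xi> > R" for \<xi> :: 'a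
    proof -
      have "R\<^sup>2 \<le> (norm \<xi>)^2" using that by (intro power_mono) (auto simp: R_def)
      then have "exp T \<le> 1 + (norm \<xi>)^2" by (simp add: R_def)
      then have "ln (exp T) \<le> ?w \<xi>" by (subst ln_le_cancel_iff) (auto intro: less_le_trans[OF exp_gt_zero])
      then show ?thesis by simp
    qed
    have [measurable]: "(indicator (cball (0::'a) R) :: 'a \<Rightarrow> ennreal) \<in> borel_measurable borel"
      by (intro borel_measurable_indicator borel_closed closed_cball)
    let ?B = "\<lambda>n. \<integral>\<^sup>+\<xi>. ennreal ((norm (F n \<xi> - g \<xi>))^2) * indicator (cball 0 R) \<xi> \<partial>lborel"
    have "?B \<longlonglongrightarrow> (\<integral>\<^sup>+\<xi>. 0 \<partial>(lborel::'a measure))"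
    proof (rule nn_integral_dominated_convergence)
      show "AE \<xi> in lborel. ennreal ((norm (F n \<xi> - g \<xi>))^2) * indicator (cball 0 R) \<xi> \<le> ennreal ((2 * M)^2) * indicator (cball 0 R) \<xi>" for n
      proof (rule AE_I2)
        fix \<xi> :: 'a
        have "norm (F n \<xi> - g \<xi>) \<le> 2 * M" using norm_triangle_ineq4[of "F n \<xi>" "g \<xi>"] M[of n \<xi>] Mg[of \<xi>] by linarith
        then have "(norm (F n \<xi> - g \<xi>))^2 \<le> (2 * M)^2" by (intro power_mono) auto
        then show "ennreal ((norm (F n \<xi> - g \<xi>))^2) * indicator (cball 0 R) \<xi> \<le> ennreal ((2 * M)^2) * indicator (cball 0 R) \<xi>"
          by (intro mult_right_mono ennreal_leI) auto
      qed
      show "(\<integral>\<^sup>+\<xi>. ennreal ((2 * M)^2) * indicator (cball 0 R) \<xi> \<partial>(lborel::'a measure)) < \<infinity>"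
        using emeasure_bounded_finite[of "cball (0::'a) R"] by (simp add: nn_integral_cmult_indicator ennreal_mult_less_top)
      show "AE \<xi> in lborel. (\<lambda>n. ennreal ((norm (F n \<xi> - g \<xi>))^2) * indicator (cball 0 R) \<xi>) \<longlonglongrightarrow> 0"
      proof (rule AE_I2)
        fix \<xi> :: 'a
        have "(\<lambda>n. (norm (F n \<xi> - g \<xi>))^2) \<longlonglongrightarrow> (norm (g \<xi> - g \<xi>))\<^sup>2" by (intro tendsto_intros g)
        from tendsto_ennrealI[OF this] have l: "(\<lambda>n. ennreal ((norm (F n \<xi> - g \<xi>))^2)) \<longlonglongrightarrow> 0" by simp
        show "(\<lambda>n. ennreal ((norm (F n \<xi> - g \<xi>))^2) * indicator (cball 0 R) \<xi>) \<longlonglongrightarrow> 0"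
          by (cases "\<xi> \<in> cball 0 R") (use l in simp_all)
      qed
    qed measurable
    then have ev: "eventually (\<lambda>n. ?B n < ennreal (e / 2)) sequentially"
      using e by (intro order_tendstoD(2)) auto
    show ?thesis
      using ev
    proof eventually_elim
      case (elim n)
      have "(\<integral>\<^sup>+\<xi>. ennreal ((norm (F n \<xi> - g \<xi>))^2) \<partial>lborel) \<le>
         (\<integral>\<^sup>+\<xi>. ennreal ((norm (F n \<xi> - g \<xi>))^2) * indicator (cball 0 R) \<xi> + ennreal (2 / T) * (ennreal (?w \<xi> * (norm (F n \<xi>))^2) + ennreal (?w \<xi> * (norm (g \<xi>))^2)) \<partial>lborel)"
      proof (rule nn_integral_mono)
        fix \<xi> :: 'a
        show "ennreal ((norm (F n \<xi> - g \<xi>))^2) \<le> ennreal ((norm (F n \<xi> - g \<xi>))^2) * indicator (cball 0 R) \<xi> + ennreal (2 / T) * (ennreal (?w \<xi> * (norm (F n \<xi>))^2) + ennreal (?w \<xi> * (norm (g \<xi>))^2))"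
        proof (cases "norm \<xi> \<le> R")
          case True
          then show ?thesis by simp
        next
          case False
          then have w: "T \<le> ?w \<xi>" using wR by simp
          have "(norm (F n \<xi> - g \<xi>))^2 \<le> 2 * (norm (F n \<xi>))^2 + 2 * (norm (g \<xi>))^2"
            using norm_diff_square_le[of "F n \<xi>" "g \<xi>" 0] by simp
          also have "\<dots> = 2 / T * (T * (norm (F n \<xi>))^2 + T * (norm (g \<xi>))^2)" using T by (simp add: field_simps)
          also have "\<dots> \<le> 2 / T * (?w \<xi> * (norm (F n \<xi>))^2 + ?w \<xi> * (norm (g \<xi>))^2)"
            using w T by (intro mult_left_mono add_mono mult_right_mono) auto
          finally have "ennreal ((norm (F n \<xi> - g \<xi>))^2) \<le> ennreal (2 / T * (?w \<xi> * (norm (F n \<xi>))^2 + ?w \<xi> * (norm (g \<xi>))^2))"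
            by (rule ennreal_leI)
          also have "\<dots> = ennreal (2 / T) * (ennreal (?w \<xi> * (norm (F n \<xi>))^2) + ennreal (?w \<xi> * (norm (g \<xi>))^2))"
            using T by (subst ennreal_mult') (auto simp: ennreal_plus)
          finally show ?thesis using False by simp
        qed
      qed
      also have "\<dots> = ?B n + ennreal (2 / T) * ((\<integral>\<^sup>+\<xi>. ennreal (?w \<xi> * (norm (F n \<xi>))^2) \<partial>lborel) + (\<integral>\<^sup>+\<xi>. ennreal (?w \<xi> * (norm (g \<xi>))^2) \<partial>lborel))"
        by (simp add: nn_integral_add nn_integral_cmult)
      also have "\<dots> \<le> ennreal (e / 2) + ennreal (2 / T) * (ennreal A + ennreal A)"
        using elim by (intro add_mono mult_left_mono W Wg) auto
      also have "ennreal (2 / T) * (ennreal A + ennreal A) = ennreal (4 * A / T)"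
        using A T by (simp add: ennreal_plus[symmetric] ennreal_mult'[symmetric] del: ennreal_plus)
      also have "ennreal (e / 2) + ennreal (4 * A / T) \<le> ennreal e"
      proof -
        have "8 * A \<le> T * e" using e by (simp add: T_def field_simps)
        then have "4 * A / T \<le> e / 2" using T by (simp add: field_simps)
        then have "ennreal (e / 2 + 4 * A / T) \<le> ennreal e" by (intro ennreal_leI) simp
        moreover have "ennreal (e / 2 + 4 * A / T) = ennreal (e / 2) + ennreal (4 * A / T)"
          using e A T by (intro ennreal_plus) auto
        ultimately show ?thesis by simp
      qed
      finally show ?case using e by simp
    qed
  qed
  show ?thesis
    by (rule order_tendstoI) (use key in auto)
qed

text \<open>The Riesz-Fischer argument with an explicit rate. The rate is kept in the conclusion
  because it later supplies an integrable majorant for the squares along the subsequence.\<close>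

lemma L2_cauchy_converges:
  fixes f :: "nat \<Rightarrow> 'a::euclidean_space \<Rightarrow> real"
  assumes fm[measurable]: "\<And>n. f n \<in> borel_measurable borel"
    and C: "\<And>e. e > 0 \<Longrightarrow> \<exists>N. \<forall>m\<ge>N. \<forall>n\<ge>N. (\<integral>\<^sup>+x. ennreal ((f m x - f n x)^2) \<partial>lborel) \<le> ennreal e"
  obtains r v where "strict_mono (r :: nat \<Rightarrow> nat)" "v \<in> borel_measurable borel"
    "AE x in lborel. (\<lambda>n. f (r n) x) \<longlonglongrightarrow> v x"
    "\<And>n. (\<integral>\<^sup>+x. ennreal ((f (r n) x - v x)^2) \<partial>lborel) \<le> ennreal ((1 / 4) ^ n)"
proof -
  define D where "D m n = (\<integral>\<^sup>+x. ennreal ((f m x - f n x)^2) \<partial>lborel)" for m n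
  have "\<exists>N. \<forall>m\<ge>N. \<forall>n\<ge>N. D m n \<le> ennreal ((1 / 4) ^ i)" for i
    unfolding D_def by (rule C) simp
  then have "\<forall>i. \<exists>N. \<forall>m\<ge>N. \<forall>n\<ge>N. D m n \<le> ennreal ((1 / 4) ^ i)" by blast
  from choice[OF this] obtain N where N: "\<And>i m n. m \<ge> N i \<Longrightarrow> n \<ge> N i \<Longrightarrow> D m n \<le> ennreal ((1 / 4) ^ i)" by blast
  define r where "r = rec_nat (N 0) (\<lambda>i k. max (N (Suc i)) (Suc k))"
  have r0: "r 0 = N 0" and rS: "r (Suc i) = max (N (Suc i)) (Suc (r i))" for i by (simp_all add: r_def)
  have rm: "strict_mono r" by (rule strict_mono_Suc_iff[THEN iffD2]) (simp add: rS less_max_iff_disj)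
  have rN: "N i \<le> r i" for i by (cases i) (simp_all add: r0 rS)
  have rD: "D (r i) (r j) \<le> ennreal ((1 / 4) ^ i)" if "i \<le> j" for i j
  proof (rule N)
    show "N i \<le> r i" by (rule rN)
    also have "r i \<le> r j" using rm that by (simp add: strict_mono_less_eq)
    finally show "N i \<le> r j" .
  qed
  \<comment> \<open>The weights 2^i turn square summability into summability: d \<le> 2^i d^2 +
    2^(-i) for d \<ge> 0.\<close>
  let ?S = "\<lambda>x. \<Sum>i. ennreal (2 ^ i * (f (r i) x - f (r (Suc i)) x)^2)"
  have "(\<integral>\<^sup>+x. ?S x \<partial>lborel) = (\<Sum>i. \<integral>\<^sup>+x. ennreal (2 ^ i * (f (r i) x - f (r (Suc i)) x)^2) \<partial>lborel)"
    by (rule nn_integral_suminf) measurable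
  also have "\<dots> \<le> (\<Sum>i. ennreal ((1 / 2) ^ i))"
  proof (rule suminf_le)
    fix i
    have "(\<integral>\<^sup>+x. ennreal (2 ^ i * (f (r i) x - f (r (Suc i)) x)^2) \<partial>lborel) = ennreal (2 ^ i) * D (r i) (r (Suc i))"
      unfolding D_def by (subst nn_integral_cmult[symmetric]) (auto simp: ennreal_mult')
    also have "\<dots> \<le> ennreal (2 ^ i) * ennreal ((1 / 4) ^ i)" by (intro mult_left_mono rD) auto
    also have "\<dots> = ennreal ((1 / 2) ^ i)"
      by (simp add: ennreal_mult'[symmetric] power_mult_distrib[symmetric])
    finally show "(\<integral>\<^sup>+x. ennreal (2 ^ i * (f (r i) x - f (r (Suc i)) x)^2) \<partial>lborel) \<le> ennreal ((1 / 2) ^ i)" .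
  qed simp_all
  also have "\<dots> = ennreal (\<Sum>i. (1 / 2) ^ i)" by (rule suminf_ennreal2) (auto intro: summable_geometric)
  also have "\<dots> < \<infinity>" by simp
  finally have "(\<integral>\<^sup>+x. ?S x \<partial>lborel) \<noteq> \<infinity>" by simp
  then have "AE x in lborel. ?S x \<noteq> \<infinity>" by (intro nn_integral_PInf_AE) measurable
  then have conv: "AE x in lborel. convergent (\<lambda>i. f (r i) x)"
  proof eventually_elim
    case (elim x)
    have s1: "summable (\<lambda>i. 2 ^ i * (f (r i) x - f (r (Suc i)) x)^2)"
      using elim by (intro summable_suminf_not_top) auto
    have s2: "summable (\<lambda>i. (1 / 2 :: real) ^ i)" by (rule summable_geometric) simp
    have "summable (\<lambda>i. f (r (Suc i)) x - f (r i) x)"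
    proof (rule summable_comparison_test[OF _ summable_add[OF s1 s2]], intro exI allI impI)
      fix i :: nat
      define d where "d = \<bar>f (r (Suc i)) x - f (r i) x\<bar>"
      have sq: "(f (r i) x - f (r (Suc i)) x)^2 = d\<^sup>2" by (simp add: d_def power2_commute)
      have "0 \<le> (2 ^ i * d - 1)^2" by simp
      then have "2 * (2 ^ i * d) \<le> (2 ^ i * d)^2 + 1" by (simp add: power2_diff)
      moreover have "0 \<le> 2 ^ i * d" by (simp add: d_def)
      ultimately have "2 ^ i * d \<le> (2 ^ i * d)^2 + 1" by linarith
      then have "(1 / 2) ^ i * (2 ^ i * d) \<le> (1 / 2) ^ i * ((2 ^ i * d)^2 + 1)" by (intro mult_left_mono) auto
      moreover have "(1 / 2) ^ i * (2 ^ i * d) = d" by (simp add: power_divide)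
      moreover have "(1 / 2) ^ i * ((2 ^ i * d)^2 + 1) = 2 ^ i * d\<^sup>2 + (1 / 2) ^ i"
        by (simp add: power_divide power2_eq_square field_simps)
      ultimately show "norm (f (r (Suc i)) x - f (r i) x) \<le> 2 ^ i * (f (r i) x - f (r (Suc i)) x)^2 + (1 / 2) ^ i"
        unfolding sq d_def by simp
    qed
    then have "convergent (\<lambda>n. \<Sum>i<n. f (r (Suc i)) x - f (r i) x)" by (simp add: summable_iff_convergent)
    moreover have "(\<Sum>i<n. f (r (Suc i)) x - f (r i) x) = f (r n) x - f (r 0) x" for n
      by (rule sum_lessThan_telescope[of "\<lambda>i. f (r i) x"])
    ultimately have "convergent (\<lambda>n. f (r n) x - f (r 0) x)" by (simp only:)
    then have "convergent (\<lambda>n. (f (r n) x - f (r 0) x) + f (r 0) x)" by (intro convergent_add convergent_const)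
    then show ?case by simp
  qed
  define v where "v x = lim (\<lambda>i. f (r i) x)" for x
  have vm[measurable]: "v \<in> borel_measurable borel" unfolding v_def[abs_def] by (rule borel_measurable_lim_metric) simp
  have ae: "AE x in lborel. (\<lambda>n. f (r n) x) \<longlonglongrightarrow> v x"
    using conv by eventually_elim (simp add: v_def convergent_LIMSEQ_iff)
  have bound: "(\<integral>\<^sup>+x. ennreal ((f (r n) x - v x)^2) \<partial>lborel) \<le> ennreal ((1 / 4) ^ n)" for n
  proof -
    have "(\<integral>\<^sup>+x. ennreal ((f (r n) x - v x)^2) \<partial>lborel) = (\<integral>\<^sup>+x. liminf (\<lambda>j. ennreal ((f (r n) x - f (r j) x)^2)) \<partial>lborel)"
    proof (rule nn_integral_cong_AE)
      show "AE x in lborel. ennreal ((f (r n) x - v x)^2) = liminf (\<lambda>j. ennreal ((f (r n) x - f (r j) x)^2))"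
        using ae
      proof eventually_elim
        case (elim x)
        have "(\<lambda>j. ennreal ((f (r n) x - f (r j) x)^2)) \<longlonglongrightarrow> ennreal ((f (r n) x - v x)^2)"
          by (intro tendsto_ennrealI tendsto_intros elim)
        then show ?case by (rule lim_imp_Liminf[OF sequentially_bot, symmetric])
      qed
    qed
    also have "\<dots> \<le> liminf (\<lambda>j. \<integral>\<^sup>+x. ennreal ((f (r n) x - f (r j) x)^2) \<partial>lborel)"
      by (rule nn_integral_liminf) measurable
    also have "\<dots> \<le> liminf (\<lambda>j::nat. ennreal ((1 / 4) ^ n))"
    proof (rule Liminf_mono)
      show "eventually (\<lambda>j. (\<integral>\<^sup>+x. ennreal ((f (r n) x - f (r j) x)^2) \<partial>lborel) \<le> ennreal ((1 / 4) ^ n)) sequentially"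
        using eventually_ge_at_top[of n] by eventually_elim (rule rD[unfolded D_def])
    qed
    also have "\<dots> = ennreal ((1 / 4) ^ n)" by (simp add: Liminf_const)
    finally show ?thesis .
  qed
  show ?thesis by (rule that[OF rm vm ae bound])
qed

text \<open>Functions supported in one bounded set and bounded in L2 have equibounded,
  equi-Lipschitz transforms, so a subsequence of transforms converges pointwise. The energy prevents
  escape of mass to high frequencies, hence the functions converge in L2 by Plancherel.\<close>

theorem log_energy_compactness:
  fixes \<Omega> :: "'a::euclidean_space set" and u :: "nat \<Rightarrow> 'a \<Rightarrow> real"
  assumes bd: "bounded \<Omega>" and u: "\<And>n. log_regular (u n)" and van: "\<And>n. vanishes_outside \<Omega> (u n)"
    and A1: "\<And>n. mass (u n) \<le> A" and A2: "\<And>n. log_energy (u n) \<le> A"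
  obtains r v where "strict_mono (r :: nat \<Rightarrow> nat)" "log_regular v" "vanishes_outside \<Omega> v"
    "AE x in lborel. (\<lambda>n. u (r n) x) \<longlonglongrightarrow> v x"
    "(\<lambda>n. LINT x|lborel. (u (r n) x - v x)^2) \<longlonglongrightarrow> 0"
    "\<And>n. (\<integral>\<^sup>+x. ennreal ((u (r n) x - v x)^2) \<partial>lborel) \<le> ennreal ((1 / 4) ^ n)"
proof -
  have L: "u n \<in> L12" for n using u[of n] by (simp add: log_regular_def)
  note [measurable] = L12_D(1)[OF L]
  have A: "A \<ge> 0"
  proof -
    have "0 \<le> (LINT x|lborel. (u 0 x)^2)" by simp
    then show ?thesis using A1[of 0] by linarith
  qed
  obtain C where C: "C > 0" "\<And>u. u \<in> L12 \<Longrightarrow> vanishes_outside \<Omega> u \<Longrightarrow> (LINT x|lborel. \<bar>u x\<bar>) \<le> C * sqrt (mass u)"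
    using L1_le_L2_bounded_support[OF bd] by blast
  obtain R0 where R0: "\<And>x. x \<in> \<Omega> \<Longrightarrow> norm x \<le> R0" using bd by (auto simp: bounded_iff)
  define R where "R = \<bar>R0\<bar>"
  have R1: "R \<ge> 0" by (simp add: R_def)
  have R2: "norm x \<le> R" if "x \<in> \<Omega>" for x using R0[OF that] by (simp add: R_def)
  note R = R1 R2
  define c where "c = (2 * pi) powr (- (real DIM('a) / 2))"
  have c0: "c \<ge> 0" by (simp add: c_def)
  define M where "M = C * sqrt A"
  have uM: "(LINT x|lborel. \<bar>u n x\<bar>) \<le> M" for n
  proof -
    have "C * sqrt (mass (u n)) \<le> C * sqrt A" using C(1) A1 by (intro mult_left_mono) auto
    then show ?thesis using C(2)[OF L van, of n] by (simp add: M_def)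
  qed
  have Fb: "norm (fourier (u n) \<xi>) \<le> c * M" for n \<xi>
  proof -
    have "c * (LINT x|lborel. \<bar>u n x\<bar>) \<le> c * M" by (intro mult_left_mono uM c0)
    then show ?thesis using fourier_bound[OF L12_D(2)[OF L[of n]], of \<xi>] unfolding c_def[symmetric] by linarith
  qed
  have Fl: "norm (fourier (u n) \<xi> - fourier (u n) \<eta>) \<le> (c * (R * M)) * norm (\<xi> - \<eta>)" for n \<xi> \<eta>
  proof -
    have "AE x in lborel. norm x > R \<longrightarrow> u n x = 0"
      using van[of n] unfolding vanishes_outside_def by eventually_elim (use R in \<open>auto simp: not_le[symmetric]\<close>)
    from fourier_lipschitz[OF L12_D(2)[OF L] this R(1)]
    have "norm (fourier (u n) \<xi> - fourier (u n) \<eta>) \<le> c * (R * norm (\<xi> - \<eta>) * (LINT x|lborel. \<bar>u n x\<bar>))" by (simp add: c_def)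
    also have "\<dots> \<le> c * (R * norm (\<xi> - \<eta>) * M)" by (intro mult_left_mono uM c0 mult_nonneg_nonneg R) auto
    finally show ?thesis by (simp add: mult_ac)
  qed
  obtain k where k: "strict_mono (k :: nat \<Rightarrow> nat)" "\<And>\<xi>. convergent (\<lambda>n. fourier (u (k n)) \<xi>)"
    by (rule equilipschitz_convergent_subsequence[of "\<lambda>n. fourier (u n)", OF Fb Fl]) (rule that)
  define g where "g \<xi> = lim (\<lambda>n. fourier (u (k n)) \<xi>)" for \<xi>
  have g: "(\<lambda>n. fourier (u (k n)) \<xi>) \<longlonglongrightarrow> g \<xi>" for \<xi> using k(2)[of \<xi>] by (simp add: g_def convergent_LIMSEQ_iff)
  have gm[measurable]: "g \<in> borel_measurable borel" by (rule borel_measurable_LIMSEQ_metric[OF _ g]) simp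
  have W: "(\<integral>\<^sup>+\<xi>. ennreal (ln (br \<xi>) * psd (u n) \<xi>) \<partial>lborel) \<le> ennreal A" for n
  proof -
    have "(\<integral>\<^sup>+\<xi>. ennreal (ln (br \<xi>) * psd (u n) \<xi>) \<partial>lborel) = ennreal (log_energy (u n))"
      unfolding log_energy_def using u[of n] by (intro nn_integral_eq_integral) (auto simp: log_regular_def)
    then show ?thesis using A2[of n] by (simp add: ennreal_leI)
  qed
  have conv: "(\<lambda>n. \<integral>\<^sup>+\<xi>. ennreal ((norm (fourier (u (k n)) \<xi> - g \<xi>))^2) \<partial>lborel) \<longlonglongrightarrow> 0"
    by (rule fourier_L2_convergence[OF _ Fb g W A]) measurable
  have PD: "(\<integral>\<^sup>+x. ennreal ((u m x - u n x)^2) \<partial>lborel) = (\<integral>\<^sup>+\<xi>. ennreal ((norm (fourier (u m) \<xi> - fourier (u n) \<xi>))^2) \<partial>lborel)" for m n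
  proof -
    note d = L12_diff[OF L[of m] L[of n]]
    have "(\<integral>\<^sup>+x. ennreal ((u m x - u n x)^2) \<partial>lborel) = ennreal (LINT x|lborel. (u m x - u n x)^2)"
      by (rule nn_integral_eq_integral[OF L12_D(3)[OF d]]) simp
    also have "\<dots> = ennreal (LINT \<xi>|lborel. psd (\<lambda>x. u m x - u n x) \<xi>)" unfolding plancherel(2)[OF d] ..
    also have "\<dots> = (\<integral>\<^sup>+\<xi>. ennreal (psd (\<lambda>x. u m x - u n x) \<xi>) \<partial>lborel)"
      by (rule nn_integral_eq_integral[OF plancherel(1)[OF d], symmetric]) simp
    finally show ?thesis unfolding fourier_diff[OF L12_D(2)[OF L] L12_D(2)[OF L]] .
  qed
  have cauchy: "\<exists>N. \<forall>m\<ge>N. \<forall>n\<ge>N. (\<integral>\<^sup>+x. ennreal ((u (k m) x - u (k n) x)^2) \<partial>lborel) \<le> ennreal e" if e: "e > 0" for e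
  proof -
    have "eventually (\<lambda>n. (\<integral>\<^sup>+\<xi>. ennreal ((norm (fourier (u (k n)) \<xi> - g \<xi>))^2) \<partial>lborel) < ennreal (e / 4)) sequentially"
      using conv e by (intro order_tendstoD(2)) auto
    then obtain N where N: "\<And>n. n \<ge> N \<Longrightarrow> (\<integral>\<^sup>+\<xi>. ennreal ((norm (fourier (u (k n)) \<xi> - g \<xi>))^2) \<partial>lborel) < ennreal (e / 4)"
      by (auto simp: eventually_sequentially)
    have "(\<integral>\<^sup>+x. ennreal ((u (k m) x - u (k n) x)^2) \<partial>lborel) \<le> ennreal e" if "m \<ge> N" "n \<ge> N" for m n
    proof -
      have "(\<integral>\<^sup>+x. ennreal ((u (k m) x - u (k n) x)^2) \<partial>lborel) \<le>
        (\<integral>\<^sup>+\<xi>. 2 * ennreal ((norm (fourier (u (k m)) \<xi> - g \<xi>))^2) + 2 * ennreal ((norm (fourier (u (k n)) \<xi> - g \<xi>))^2) \<partial>lborel)"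
        unfolding PD
      proof (rule nn_integral_mono)
        fix \<xi>
        have "ennreal ((norm (fourier (u (k m)) \<xi> - fourier (u (k n)) \<xi>))^2) \<le> ennreal (2 * (norm (fourier (u (k m)) \<xi> - g \<xi>))^2 + 2 * (norm (fourier (u (k n)) \<xi> - g \<xi>))^2)"
          by (intro ennreal_leI norm_diff_square_le)
        then show "ennreal ((norm (fourier (u (k m)) \<xi> - fourier (u (k n)) \<xi>))^2) \<le> 2 * ennreal ((norm (fourier (u (k m)) \<xi> - g \<xi>))^2) + 2 * ennreal ((norm (fourier (u (k n)) \<xi> - g \<xi>))^2)"
          by (simp add: ennreal_mult')
      qed
      also have "\<dots> = 2 * (\<integral>\<^sup>+\<xi>. ennreal ((norm (fourier (u (k m)) \<xi> - g \<xi>))^2) \<partial>lborel) + 2 * (\<integral>\<^sup>+\<xi>. ennreal ((norm (fourier (u (k n)) \<xi> - g \<xi>))^2) \<partial>lborel)"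
        by (simp add: nn_integral_add nn_integral_cmult)
      also have "\<dots> \<le> 2 * ennreal (e / 4) + 2 * ennreal (e / 4)"
        using N[OF that(1)] N[OF that(2)] by (intro add_mono mult_left_mono) auto
      also have "2 * ennreal (e / 4) = ennreal (e / 2)"
        using e by (subst ennreal_numeral[symmetric], subst ennreal_mult[symmetric]) auto
      also have "ennreal (e / 2) + ennreal (e / 2) = ennreal e" using e by (subst ennreal_plus[symmetric]) auto
      finally show ?thesis .
    qed
    then show ?thesis by blast
  qed
  obtain j v where j: "strict_mono (j :: nat \<Rightarrow> nat)" and vm[measurable]: "v \<in> borel_measurable borel"
    and ae: "AE x in lborel. (\<lambda>n. u (k (j n)) x) \<longlonglongrightarrow> v x"
    and l3: "\<And>n. (\<integral>\<^sup>+x. ennreal ((u (k (j n)) x - v x)^2) \<partial>lborel) \<le> ennreal ((1 / 4) ^ n)"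
    by (rule L2_cauchy_converges[of "\<lambda>n. u (k n)", OF _ cauchy]) auto
  have l2: "(\<lambda>n. \<integral>\<^sup>+x. ennreal ((u (k (j n)) x - v x)^2) \<partial>lborel) \<longlonglongrightarrow> 0"
  proof (rule tendsto_sandwich[of "\<lambda>_. 0" _ _ "\<lambda>n. ennreal ((1 / 4) ^ n)"])
    have "(\<lambda>n. (1 / 4 :: real) ^ n) \<longlonglongrightarrow> 0" by (rule LIMSEQ_realpow_zero) auto
    from tendsto_ennrealI[OF this] show "(\<lambda>n. ennreal ((1 / 4) ^ n)) \<longlonglongrightarrow> 0" by simp
  qed (use l3 in auto)
  define r where "r n = k (j n)" for n
  have r: "strict_mono r" using k(1) j by (simp add: r_def strict_mono_def)
  have vv: "vanishes_outside \<Omega> v"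
  proof -
    have "AE x in lborel. \<forall>n. x \<notin> \<Omega> \<longrightarrow> u (r n) x = 0"
      using van unfolding vanishes_outside_def AE_all_countable by blast
    with ae show ?thesis unfolding vanishes_outside_def
    proof eventually_elim
      case (elim x)
      show ?case
      proof
        assume "x \<notin> \<Omega>"
        then have "(\<lambda>n. u (k (j n)) x) = (\<lambda>n. 0)" using elim(2) by (simp add: r_def)
        then show "v x = 0" using elim(1) LIMSEQ_unique[OF _ tendsto_const] by simp
      qed
    qed
  qed
  have sq: "square_integrable v"
  proof -
    have "eventually (\<lambda>n. (\<integral>\<^sup>+x. ennreal ((u (r n) x - v x)^2) \<partial>lborel) < 1) sequentially"
      using l2 unfolding r_def by (intro order_tendstoD(2)) auto
    then obtain n where n: "(\<integral>\<^sup>+x. ennreal ((u (r n) x - v x)^2) \<partial>lborel) < 1" using eventually_happens'[OF sequentially_bot] by blast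
    then have i: "integrable lborel (\<lambda>x. (u (r n) x - v x)^2)"
      by (intro integrableI_nonneg) (auto intro: order.strict_trans)
    have "integrable lborel (\<lambda>x. (v x)^2)"
    proof (rule Bochner_Integration.integrable_bound)
      show "integrable lborel (\<lambda>x. 2 * (u (r n) x - v x)^2 + 2 * (u (r n) x)^2)" using i L12_D(3)[OF L] by simp
      have "(v x)^2 \<le> 2 * (u (r n) x - v x)^2 + 2 * (u (r n) x)^2" for x
        using zero_le_power2[of "2 * u (r n) x - v x"] by (simp add: power2_eq_square algebra_simps)
      then show "AE x in lborel. norm ((v x)^2) \<le> norm (2 * (u (r n) x - v x)^2 + 2 * (u (r n) x)^2)"
        by (auto intro: order_trans[OF _ abs_ge_self])
    qed measurable
    then show ?thesis by (simp add: square_integrable_def)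
  qed
  have vL: "v \<in> L12" by (rule square_integrable_bounded_L12[OF bd sq vv])
  have dL: "(\<lambda>x. u (r n) x - v x) \<in> L12" for n by (rule L12_diff[OF L vL])
  have dv: "vanishes_outside \<Omega> (\<lambda>x. u (r n) x - v x)" for n
    using van[of "r n"] vv unfolding vanishes_outside_def by eventually_elim auto
  have l2': "(\<lambda>n. LINT x|lborel. (u (r n) x - v x)^2) \<longlonglongrightarrow> 0"
  proof -
    have "(\<integral>\<^sup>+x. ennreal ((u (r n) x - v x)^2) \<partial>lborel) = ennreal (LINT x|lborel. (u (r n) x - v x)^2)" for n
      by (rule nn_integral_eq_integral[OF L12_D(3)[OF dL]]) simp
    then have "(\<lambda>n. ennreal (LINT x|lborel. (u (r n) x - v x)^2)) \<longlonglongrightarrow> ennreal 0" using l2 by (simp add: r_def)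
    from tendsto_enn2real[OF this] show ?thesis by simp
  qed
  \<comment> \<open>On a bounded set L2 convergence implies L1 convergence, hence convergence of the
    transforms at every frequency; Fatou's lemma then gives v finite energy.\<close>
  have Fv: "(\<lambda>n. fourier (u (r n)) \<xi>) \<longlonglongrightarrow> fourier v \<xi>" for \<xi>
  proof -
    have "(\<lambda>n. fourier (u (r n)) \<xi> - fourier v \<xi>) \<longlonglongrightarrow> 0"
    proof (rule Lim_null_comparison)
      show "eventually (\<lambda>n. norm (fourier (u (r n)) \<xi> - fourier v \<xi>) \<le> c * (C * sqrt (LINT x|lborel. (u (r n) x - v x)^2))) sequentially"
      proof (intro always_eventually allI)
        fix n
        have "norm (fourier (u (r n)) \<xi> - fourier v \<xi>) = norm (fourier (\<lambda>x. u (r n) x - v x) \<xi>)"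
          by (simp add: fourier_diff[OF L12_D(2)[OF L] L12_D(2)[OF vL]])
        also have "\<dots> \<le> c * (LINT x|lborel. \<bar>u (r n) x - v x\<bar>)"
          unfolding c_def by (rule fourier_bound[OF L12_D(2)[OF dL]])
        also have "\<dots> \<le> c * (C * sqrt (LINT x|lborel. (u (r n) x - v x)^2))"
          by (intro mult_left_mono C(2)[OF dL dv] c0)
        finally show "norm (fourier (u (r n)) \<xi> - fourier v \<xi>) \<le> c * (C * sqrt (LINT x|lborel. (u (r n) x - v x)^2))" .
      qed
      have "(\<lambda>n. c * (C * sqrt (LINT x|lborel. (u (r n) x - v x)^2))) \<longlonglongrightarrow> c * (C * sqrt 0)"
        by (intro tendsto_intros l2')
      then show "(\<lambda>n. c * (C * sqrt (LINT x|lborel. (u (r n) x - v x)^2))) \<longlonglongrightarrow> 0" by simp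
    qed
    then show ?thesis by (simp add: LIM_zero_iff)
  qed
  have "(\<integral>\<^sup>+\<xi>. ennreal (ln (br \<xi>) * psd v \<xi>) \<partial>lborel) \<le> ennreal A"
  proof -
    let ?w = "\<lambda>\<xi>::'a. ln (br \<xi>)"
    have "(\<integral>\<^sup>+\<xi>. ennreal (?w \<xi> * psd v \<xi>) \<partial>lborel) = (\<integral>\<^sup>+\<xi>. liminf (\<lambda>n. ennreal (?w \<xi> * (norm (fourier (u (r n)) \<xi>))^2)) \<partial>lborel)"
    proof (rule nn_integral_cong)
      fix \<xi> :: 'a
      have "(\<lambda>n. ennreal (?w \<xi> * (norm (fourier (u (r n)) \<xi>))^2)) \<longlonglongrightarrow> ennreal (?w \<xi> * psd v \<xi>)"
        by (intro tendsto_ennrealI tendsto_intros Fv)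
      then show "ennreal (?w \<xi> * psd v \<xi>) = liminf (\<lambda>n. ennreal (?w \<xi> * (norm (fourier (u (r n)) \<xi>))^2))"
        by (rule lim_imp_Liminf[OF sequentially_bot, symmetric])
    qed
    also have "\<dots> \<le> liminf (\<lambda>n. \<integral>\<^sup>+\<xi>. ennreal (?w \<xi> * (norm (fourier (u (r n)) \<xi>))^2) \<partial>lborel)"
      by (rule nn_integral_liminf) measurable
    also have "\<dots> \<le> liminf (\<lambda>n::nat. ennreal A)" by (intro Liminf_mono always_eventually allI W)
    also have "\<dots> = ennreal A" by (simp add: Liminf_const)
    finally show ?thesis .
  qed
  then have "(\<integral>\<^sup>+\<xi>. ennreal (ln (br \<xi>) * psd v \<xi>) \<partial>lborel) < \<infinity>"
    by (rule order_le_less_trans) simp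
  then have "integrable lborel (\<lambda>\<xi>. ln (br \<xi>) * psd v \<xi>)"
    by (intro integrableI_nonneg) auto
  then have vr: "log_regular v" using vL by (simp add: log_regular_def)
  show ?thesis by (rule that[OF r vr vv _ l2']) (use ae l3 in \<open>simp_all add: r_def\<close>)
qed

subsection \<open>Convergence in mean square\<close>

lemma cauchy_schwarz_integral:
  fixes f g :: "'a::euclidean_space \<Rightarrow> 'b::{real_normed_field, banach, second_countable_topology}"
  assumes [measurable]: "f \<in> borel_measurable borel" "g \<in> borel_measurable borel"
    and f: "integrable lborel (\<lambda>x. (norm (f x))^2)" and g: "integrable lborel (\<lambda>x. (norm (g x))^2)"
  shows "integrable lborel (\<lambda>x. f x * g x)"
    and "norm (LINT x|lborel. f x * g x) \<le> sqrt (LINT x|lborel. (norm (f x))^2) * sqrt (LINT x|lborel. (norm (g x))^2)"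
proof -
  define a where "a = (LINT x|lborel. (norm (f x))^2)"
  define b where "b = (LINT x|lborel. (norm (g x))^2)"
  have ab: "a \<ge> 0" "b \<ge> 0" by (auto simp: a_def b_def)
  show i: "integrable lborel (\<lambda>x. f x * g x)"
  proof (rule Bochner_Integration.integrable_bound[OF Bochner_Integration.integrable_add[OF f g]])
    have "norm (f x * g x) \<le> (norm (f x))^2 + (norm (g x))^2" for x
    proof -
      have "0 \<le> norm (f x) * norm (g x)" by simp
      then show ?thesis using sum_squares_bound[of "norm (f x)" "norm (g x)"] unfolding norm_mult by linarith
    qed
    then show "AE x in lborel. norm (f x * g x) \<le> norm ((norm (f x))^2 + (norm (g x))^2)" by simp
  qed measurable
  define m where "m = (LINT x|lborel. norm (f x * g x))"
  have m0: "m \<ge> 0" by (simp add: m_def)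
  have "(\<integral>\<^sup>+x. ennreal (norm (f x)) * ennreal (norm (g x)) \<partial>lborel)^2 \<le>
     (\<integral>\<^sup>+x. (ennreal (norm (f x)))^2 \<partial>lborel) * (\<integral>\<^sup>+x. (ennreal (norm (g x)))^2 \<partial>lborel)"
    by (rule Cauchy_Schwarz_nn_integral) measurable
  moreover have "(\<integral>\<^sup>+x. ennreal (norm (f x)) * ennreal (norm (g x)) \<partial>lborel) = ennreal m"
    unfolding m_def using nn_integral_eq_integral[OF integrable_norm[OF i]] by (simp add: ennreal_mult' norm_mult)
  moreover have "(\<integral>\<^sup>+x. (ennreal (norm (f x)))^2 \<partial>lborel) = ennreal a"
    unfolding a_def using nn_integral_eq_integral[OF f] by (simp add: ennreal_power)
  moreover have "(\<integral>\<^sup>+x. (ennreal (norm (g x)))^2 \<partial>lborel) = ennreal b"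
    unfolding b_def using nn_integral_eq_integral[OF g] by (simp add: ennreal_power)
  ultimately have "ennreal (m\<^sup>2) \<le> ennreal (a * b)"
    using m0 ab by (simp add: ennreal_power ennreal_mult)
  then have "m\<^sup>2 \<le> a * b" using ab by (simp add: ennreal_le_iff)
  then have "m \<le> sqrt a * sqrt b" unfolding real_sqrt_mult[symmetric] by (rule real_le_rsqrt)
  then show "norm (LINT x|lborel. f x * g x) \<le> sqrt (LINT x|lborel. (norm (f x))^2) * sqrt (LINT x|lborel. (norm (g x))^2)"
    using integral_norm_bound[of lborel "\<lambda>x. f x * g x"] unfolding a_def b_def m_def by linarith
qed

text \<open>Splitting the weight into two square roots makes this the Cauchy-Schwarz inequality in
  frequency.\<close>

lemma E_log_cauchy_schwarz:
  fixes u v :: "'a::euclidean_space \<Rightarrow> real"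
  assumes u: "log_regular u" and v: "log_regular v"
  shows "\<bar>E_log u v\<bar> \<le> sqrt (log_energy u) * sqrt (log_energy v)"
proof -
  have L: "u \<in> L12" "v \<in> L12" using u v by (auto simp: log_regular_def)
  note [measurable] = L12_D(1)[OF L(1)] L12_D(1)[OF L(2)]
  let ?s = "\<lambda>\<xi>::'a. complex_of_real (sqrt (ln (br \<xi>)))"
  have n: "(norm (?s \<xi> * z))^2 = ln (br \<xi>) * (norm z)^2" for \<xi> z by (simp add: norm_mult power_mult_distrib)
  have p: "?s \<xi> * fourier u \<xi> * (?s \<xi> * cnj (fourier v \<xi>)) = complex_of_real (ln (br \<xi>)) * (fourier u \<xi> * cnj (fourier v \<xi>))" for \<xi>
  proof -
    have "?s \<xi> * ?s \<xi> = complex_of_real (ln (br \<xi>))" by (simp flip: of_real_mult)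
    moreover have "?s \<xi> * fourier u \<xi> * (?s \<xi> * cnj (fourier v \<xi>)) = (?s \<xi> * ?s \<xi>) * (fourier u \<xi> * cnj (fourier v \<xi>))"
      by (simp only: mult_ac)
    ultimately show ?thesis by (simp only:)
  qed
  note cs = cauchy_schwarz_integral[of "\<lambda>\<xi>. ?s \<xi> * fourier u \<xi>" "\<lambda>\<xi>. ?s \<xi> * cnj (fourier v \<xi>)"]
  have i: "integrable lborel (\<lambda>\<xi>. complex_of_real (ln (br \<xi>)) * (fourier u \<xi> * cnj (fourier v \<xi>)))"
    using cs(1) u v unfolding p n by (simp add: log_regular_def)
  have "E_log u v = Re (LINT \<xi>|lborel. complex_of_real (ln (br \<xi>)) * (fourier u \<xi> * cnj (fourier v \<xi>)))"
    unfolding E_log_fourier[OF u v] integral_Re[OF i, symmetric] by simp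
  also have "\<bar>\<dots>\<bar> \<le> norm (LINT \<xi>|lborel. complex_of_real (ln (br \<xi>)) * (fourier u \<xi> * cnj (fourier v \<xi>)))"
    by (rule abs_Re_le_cmod)
  also have "\<dots> \<le> sqrt (log_energy u) * sqrt (log_energy v)"
    using cs(2) u v unfolding p n log_energy_def by (simp add: log_regular_def)
  finally show ?thesis .
qed

text \<open>Expanding the energy of w = u - (u - w) leaves a cross term that Cauchy-Schwarz
  controls.\<close>

lemma log_energy_tendsto:
  fixes u :: "'a::euclidean_space \<Rightarrow> real"
  assumes u: "log_regular u" and w: "\<And>n. log_regular (w n)" and l: "(\<lambda>n. log_energy (\<lambda>x. u x - w n x)) \<longlonglongrightarrow> 0"
  shows "(\<lambda>n. log_energy (w n)) \<longlonglongrightarrow> log_energy u"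
proof -
  have d: "log_regular (\<lambda>x. u x - w n x)" for n by (rule log_regular_combination(2)[OF u w])
  have e: "log_energy (w n) = log_energy u - 2 * E_log u (\<lambda>x. u x - w n x) + log_energy (\<lambda>x. u x - w n x)" for n
  proof -
    have "(\<lambda>x. u x - (u x - w n x)) = w n" by auto
    then show ?thesis using log_regular_combination(5)[OF u d[of n]] by (simp only: E_log_fourier[OF u d])
  qed
  have "(\<lambda>n. E_log u (\<lambda>x. u x - w n x)) \<longlonglongrightarrow> 0"
  proof (rule Lim_null_comparison)
    show "eventually (\<lambda>n. norm (E_log u (\<lambda>x. u x - w n x)) \<le> sqrt (log_energy u) * sqrt (log_energy (\<lambda>x. u x - w n x))) sequentially"
      unfolding real_norm_def by (intro always_eventually allI E_log_cauchy_schwarz[OF u d])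
    have "(\<lambda>n. sqrt (log_energy u) * sqrt (log_energy (\<lambda>x. u x - w n x))) \<longlonglongrightarrow> sqrt (log_energy u) * sqrt 0"
      by (intro tendsto_intros l)
    then show "(\<lambda>n. sqrt (log_energy u) * sqrt (log_energy (\<lambda>x. u x - w n x))) \<longlonglongrightarrow> 0" by simp
  qed
  then have "(\<lambda>n. log_energy u - 2 * E_log u (\<lambda>x. u x - w n x) + log_energy (\<lambda>x. u x - w n x)) \<longlonglongrightarrow> log_energy u - 2 * 0 + 0"
    by (intro tendsto_intros l)
  then show ?thesis unfolding e by simp
qed

lemma L2_product_tendsto:
  fixes v \<phi> :: "'a::euclidean_space \<Rightarrow> real"
  assumes v: "v \<in> L12" and \<phi>: "\<phi> \<in> L12" and u: "\<And>n. u n \<in> L12" and l: "(\<lambda>n. LINT x|lborel. (u n x - v x)^2) \<longlonglongrightarrow> 0"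
  shows "(\<lambda>n. LINT x|lborel. u n x * \<phi> x) \<longlonglongrightarrow> (LINT x|lborel. v x * \<phi> x)"
    and "(\<lambda>n. LINT x|lborel. (u n x)^2) \<longlonglongrightarrow> (mass v)"
proof -
  have pi: "integrable lborel (\<lambda>x. f x * g x)" if "f \<in> L12" "g \<in> L12" for f g :: "'a \<Rightarrow> real"
    using cauchy_schwarz_integral(1)[of f g] that by (auto simp: L12_def)
  have d: "(\<lambda>x. u n x - v x) \<in> L12" for n by (rule L12_diff[OF u v])
  have key: "(\<lambda>n. LINT x|lborel. (u n x - v x) * g x) \<longlonglongrightarrow> 0" if g: "g \<in> L12" for g
  proof (rule Lim_null_comparison)
    show "eventually (\<lambda>n. norm (LINT x|lborel. (u n x - v x) * g x) \<le> sqrt (LINT x|lborel. (u n x - v x)^2) * sqrt (mass g)) sequentially"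
      using cauchy_schwarz_integral(2)[OF L12_D(1)[OF d] L12_D(1)[OF g]] L12_D(3)[OF d] L12_D(3)[OF g] by simp
    have "(\<lambda>n. sqrt (LINT x|lborel. (u n x - v x)^2) * sqrt (mass g)) \<longlonglongrightarrow> sqrt 0 * sqrt (mass g)"
      by (intro tendsto_intros l)
    then show "(\<lambda>n. sqrt (LINT x|lborel. (u n x - v x)^2) * sqrt (mass g)) \<longlonglongrightarrow> 0" by simp
  qed
  have e1: "(LINT x|lborel. u n x * g x) = (LINT x|lborel. (u n x - v x) * g x) + (LINT x|lborel. v x * g x)" if g: "g \<in> L12" for n g
    using pi[OF d g, of n] pi[OF v g] by (subst Bochner_Integration.integral_add[symmetric]) (auto simp: algebra_simps)
  show "(\<lambda>n. LINT x|lborel. u n x * \<phi> x) \<longlonglongrightarrow> (LINT x|lborel. v x * \<phi> x)"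
    unfolding e1[OF \<phi>] using tendsto_add[OF key[OF \<phi>] tendsto_const] by simp
  have e2: "mass (u n) = (LINT x|lborel. (u n x - v x)^2) + 2 * (LINT x|lborel. (u n x - v x) * v x) + mass v" for n
  proof -
    have "mass (u n) = (LINT x|lborel. (u n x - v x)^2 + 2 * ((u n x - v x) * v x) + (v x)^2)"
      by (intro Bochner_Integration.integral_cong refl) (simp add: power2_eq_square algebra_simps)
    then show ?thesis using L12_D(3)[OF d[of n]] L12_D(3)[OF v] pi[OF d v, of n] by simp
  qed
  have "(\<lambda>n. (LINT x|lborel. (u n x - v x)^2) + 2 * (LINT x|lborel. (u n x - v x) * v x) + mass v) \<longlonglongrightarrow> 0 + 2 * 0 + mass v"
    by (intro tendsto_intros l key[OF v])
  then show "(\<lambda>n. LINT x|lborel. (u n x)^2) \<longlonglongrightarrow> (mass v)" unfolding e2 by simp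
qed

text \<open>A geometric rate makes the sum of all squared distances integrable. This sum forces
  pointwise convergence, and together with v^2 it dominates every (f n)^2.\<close>

lemma fast_L2_convergence:
  fixes f :: "nat \<Rightarrow> 'a::euclidean_space \<Rightarrow> real"
  assumes [measurable]: "\<And>n. f n \<in> borel_measurable borel" and v[measurable]: "v \<in> borel_measurable borel"
    and v2: "integrable lborel (\<lambda>x. (v x)^2)"
    and fast: "\<And>n. (\<integral>\<^sup>+x. ennreal ((f n x - v x)^2) \<partial>lborel) \<le> ennreal ((1 / 4) ^ n)"
  shows "AE x in lborel. (\<lambda>n. f n x) \<longlonglongrightarrow> v x"
    and "\<exists>H. integrable lborel H \<and> (\<forall>n. AE x in lborel. (f n x)^2 \<le> H x)"
proof -
  let ?S = "\<lambda>x. \<Sum>n. ennreal ((f n x - v x)^2)"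
  have "(\<integral>\<^sup>+x. ?S x \<partial>lborel) = (\<Sum>n. \<integral>\<^sup>+x. ennreal ((f n x - v x)^2) \<partial>lborel)"
    by (rule nn_integral_suminf) measurable
  also have "\<dots> \<le> (\<Sum>n. ennreal ((1 / 4) ^ n))" by (intro suminf_le fast) auto
  also have "\<dots> = ennreal (\<Sum>n. (1 / 4) ^ n)" by (rule suminf_ennreal2) (auto intro: summable_geometric)
  also have "\<dots> < \<infinity>" by simp
  finally have fin: "(\<integral>\<^sup>+x. ?S x \<partial>lborel) < \<infinity>" .
  then have "(\<integral>\<^sup>+x. ?S x \<partial>lborel) \<noteq> \<infinity>" by simp
  then have ae: "AE x in lborel. ?S x \<noteq> \<infinity>" by (intro nn_integral_PInf_AE) measurable
  then show "AE x in lborel. (\<lambda>n. f n x) \<longlonglongrightarrow> v x"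
  proof eventually_elim
    case (elim x)
    have "summable (\<lambda>n. (f n x - v x)^2)" using elim by (intro summable_suminf_not_top) auto
    then have "(\<lambda>n. (f n x - v x)^2) \<longlonglongrightarrow> 0" by (rule summable_LIMSEQ_zero)
    then have "(\<lambda>n. sqrt ((f n x - v x)^2)) \<longlonglongrightarrow> sqrt 0" by (intro tendsto_intros)
    then have "(\<lambda>n. \<bar>f n x - v x\<bar>) \<longlonglongrightarrow> 0" by simp
    then have "(\<lambda>n. f n x - v x) \<longlonglongrightarrow> 0" by (simp add: tendsto_rabs_zero_iff)
    then show ?case by (simp add: LIM_zero_iff)
  qed
  define H where "H x = 2 * enn2real (?S x) + 2 * (v x)^2" for x
  have iS: "integrable lborel (\<lambda>x. enn2real (?S x))"
  proof (rule integrableI_nonneg)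
    have "(\<integral>\<^sup>+x. ennreal (enn2real (?S x)) \<partial>lborel) = (\<integral>\<^sup>+x. ?S x \<partial>lborel)"
    proof (rule nn_integral_cong_AE)
      show "AE x in lborel. ennreal (enn2real (?S x)) = ?S x"
        using ae by eventually_elim (simp add: ennreal_enn2real_if)
    qed
    then show "(\<integral>\<^sup>+x. ennreal (enn2real (?S x)) \<partial>lborel) < \<infinity>" using fin by simp
  qed auto
  have "AE x in lborel. (f n x)^2 \<le> H x" for n
    using ae
  proof eventually_elim
    case (elim x)
    have "ennreal ((f n x - v x)^2) \<le> ?S x"
      using sum_le_suminf[of "\<lambda>n. ennreal ((f n x - v x)^2)" "{n}"]
      by (simp only: finite.intros sum.insert finite.emptyI empty_iff not_False_eq_True sum.empty add_0_right summableI zero_le simp_thms)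
    then have "enn2real (ennreal ((f n x - v x)^2)) \<le> enn2real (?S x)"
    proof (rule enn2real_mono)
      show "?S x < top" using elim less_top[of "?S x"] unfolding infinity_ennreal_def by blast
    qed
    then have "(f n x - v x)^2 \<le> enn2real (?S x)" by simp
    moreover have "(f n x)^2 \<le> 2 * (f n x - v x)^2 + 2 * (v x)^2"
      using zero_le_power2[of "f n x - 2 * v x"] by (simp add: power2_eq_square algebra_simps)
    ultimately show ?case by (simp add: H_def)
  qed
  moreover have "integrable lborel H" unfolding H_def[abs_def] using iS v2 by simp
  ultimately show "\<exists>H. integrable lborel H \<and> (\<forall>n. AE x in lborel. (f n x)^2 \<le> H x)" by blast
qed

section \<open>Limits of difference quotients of exponentials and powers\<close>

lemma ln_one_plus_quotient_tendsto:
  fixes a b :: "nat \<Rightarrow> real"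
  assumes a: "a \<longlonglongrightarrow> 0" "\<And>n. a n \<noteq> 0" and b: "b \<longlonglongrightarrow> l"
  shows "(\<lambda>n. ln (1 + a n * b n) / a n) \<longlonglongrightarrow> l"
proof -
  \<comment> \<open>Filling the removable singularity with 1 allows the argument to take the value 0
    along the sequence.\<close>
  define g where "g x = (if x = 0 then 1 else ln (1 + x) / x)" for x :: real
  have "((\<lambda>x::real. ln (1 + x) / x) \<longlongrightarrow> 1) (at_right 0)" "((\<lambda>x::real. ln (1 + x) / x) \<longlongrightarrow> 1) (at_left 0)"
    by real_asymp+
  then have "((\<lambda>x::real. ln (1 + x) / x) \<longlongrightarrow> 1) (at 0)" by (simp add: filterlim_at_split)
  then have "(g \<longlongrightarrow> 1) (at 0)"
    by (rule Lim_transform_eventually) (auto simp: g_def eventually_at_filter)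
  then have c: "isCont g 0" by (simp add: isCont_def g_def)
  have ab: "(\<lambda>n. a n * b n) \<longlonglongrightarrow> 0" using tendsto_mult[OF a(1) b] by simp
  have "(\<lambda>n. g (a n * b n)) \<longlonglongrightarrow> g 0" by (rule isCont_tendsto_compose[OF c ab])
  then have "(\<lambda>n. b n * g (a n * b n)) \<longlonglongrightarrow> l * g 0" by (intro tendsto_mult b)
  moreover have "b n * g (a n * b n) = ln (1 + a n * b n) / a n" for n
    using a(2)[of n] by (auto simp: g_def)
  ultimately show ?thesis by (simp add: g_def)
qed

lemma exp_minus_one_quotient_tendsto:
  fixes a b :: "nat \<Rightarrow> real"
  assumes a: "a \<longlonglongrightarrow> 0" "\<And>n. a n \<noteq> 0" and b: "b \<longlonglongrightarrow> l"
  shows "(\<lambda>n. (exp (a n * b n) - 1) / a n) \<longlonglongrightarrow> l"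
proof -
  define g where "g x = (if x = 0 then 1 else (exp x - 1) / x)" for x :: real
  have "((\<lambda>x::real. (exp x - 1) / x) \<longlongrightarrow> 1) (at 0)" by real_asymp
  then have "(g \<longlongrightarrow> 1) (at 0)"
    by (rule Lim_transform_eventually) (auto simp: g_def eventually_at_filter)
  then have c: "isCont g 0" by (simp add: isCont_def g_def)
  have ab: "(\<lambda>n. a n * b n) \<longlonglongrightarrow> 0" using tendsto_mult[OF a(1) b] by simp
  have "(\<lambda>n. g (a n * b n)) \<longlonglongrightarrow> g 0" by (rule isCont_tendsto_compose[OF c ab])
  then have "(\<lambda>n. b n * g (a n * b n)) \<longlonglongrightarrow> l * g 0" by (intro tendsto_mult b)
  moreover have "b n * g (a n * b n) = (exp (a n * b n) - 1) / a n" for n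
    using a(2)[of n] by (auto simp: g_def)
  ultimately show ?thesis by (simp add: g_def)
qed

lemma powr_minus_one_quotient_tendsto:
  fixes a :: "nat \<Rightarrow> real"
  assumes a: "a \<longlonglongrightarrow> 0" "\<And>n. a n \<noteq> 0" and x: "x > 0"
  shows "(\<lambda>n. (x powr a n - 1) / a n) \<longlonglongrightarrow> ln x"
  using exp_minus_one_quotient_tendsto[OF a tendsto_const[of "ln x"]] x by (simp add: powr_def)

text \<open>For fixed a > 0 the quotient (a^q - 1)/q decreases to ln a as q decreases to 0. For a
  \<ge> 1 it is therefore at most its value a - 1 at q = 1, which gives quadratic growth; for 0 < a
  < 1 its size is at most |ln a|. Both bounds are uniform in q.\<close>

lemma powr_quotient_bound:
  fixes a q :: real
  assumes q: "0 < q" "q \<le> 1" and a: "a \<ge> 0"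
  shows "\<bar>a * ((a powr q - 1) / q)\<bar> \<le> a\<^sup>2 + (if a < 1 then 1 else 0)" "a < 1 \<Longrightarrow> \<bar>a * ((a powr q - 1) / q)\<bar> \<le> \<bar>a * ln a\<bar>"
proof -
  have 2: "\<bar>a * ((a powr q - 1) / q)\<bar> \<le> \<bar>a * ln a\<bar>" if "a < 1"
  proof (cases "a = 0")
    case False
    then have a: "a > 0" using a by simp
    have "1 + q * ln a \<le> a powr q" using exp_ge_add_one_self[of "q * ln a"] a by (simp add: powr_def)
    then have "1 - a powr q \<le> q * (- ln a)" by simp
    then have "(1 - a powr q) / q \<le> - ln a" using q by (simp add: field_simps)
    moreover have "a powr q \<le> 1" using a that q by (simp add: powr_le1)
    moreover have "ln a < 0" using a that by simp
    ultimately have "\<bar>(a powr q - 1) / q\<bar> \<le> \<bar>ln a\<bar>" using q by (simp add: abs_if field_simps)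
    then show ?thesis unfolding abs_mult by (rule mult_left_mono) simp
  qed simp
  then show "a < 1 \<Longrightarrow> \<bar>a * ((a powr q - 1) / q)\<bar> \<le> \<bar>a * ln a\<bar>" .
  show "\<bar>a * ((a powr q - 1) / q)\<bar> \<le> a\<^sup>2 + (if a < 1 then 1 else 0)"
  proof (cases "a < 1")
    case True
    have "\<bar>a * ln a\<bar> \<le> 1"
    proof (cases "a = 0")
      case False
      then have a: "a > 0" using a by simp
      have "- ln a \<le> 1 / a - 1" using ln_le_minus_one[of "1 / a"] a by (simp add: ln_div)
      then have "a * (- ln a) \<le> a * (1 / a - 1)" using a by (intro mult_left_mono) auto
      also have "\<dots> \<le> 1" using a by (simp add: field_simps)
      finally show ?thesis using a True by (simp add: abs_mult)
    qed simp
    then have "\<bar>a * ((a powr q - 1) / q)\<bar> \<le> 1" using 2[OF True] by linarith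
    moreover have "0 \<le> a\<^sup>2" by simp
    moreover have "(if a < 1 then 1 else 0 :: real) = 1" using True by (simp only: if_True)
    ultimately show ?thesis by linarith
  next
    case False
    then have a1: "a \<ge> 1" by simp
    have "a powr q \<le> 1 + q * (a - 1)" using powr_le_linear[OF a1] q by simp
    then have "(a powr q - 1) / q \<le> a - 1" using q by (simp add: field_simps)
    moreover have "1 \<le> a powr q" using a1 q by (simp add: ge_one_powr_ge_zero)
    ultimately have "\<bar>(a powr q - 1) / q\<bar> \<le> a" using q by simp
    then have "a * \<bar>(a powr q - 1) / q\<bar> \<le> a * a" using a by (intro mult_left_mono) auto
    then show ?thesis using False a by (simp add: abs_mult power2_eq_square)
  qed
qed

text \<open>Base and exponent vary together. Away from l = 0 the power is written as an exponential;
  at l = 0, where ln is unbounded, the uniform bound |t ln|t|| takes over.\<close>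

lemma powr_quotient_continuous:
  fixes t q :: "nat \<Rightarrow> real"
  assumes q: "\<And>n. 0 < q n" "\<And>n. q n \<le> 1" "q \<longlonglongrightarrow> 0" and t: "t \<longlonglongrightarrow> l"
  shows "(\<lambda>n. t n * ((\<bar>t n\<bar> powr q n - 1) / q n)) \<longlonglongrightarrow> l * ln \<bar>l\<bar>"
proof (cases "l = 0")
  case True
  have t0: "t \<longlonglongrightarrow> 0" using t True by simp
  have "((\<lambda>x::real. x * ln \<bar>x\<bar>) \<longlongrightarrow> 0) (at 0)"
  proof -
    have "((\<lambda>x::real. x * ln \<bar>x\<bar>) \<longlongrightarrow> 0) (at_right 0)" "((\<lambda>x::real. x * ln \<bar>x\<bar>) \<longlongrightarrow> 0) (at_left 0)"
      by real_asymp+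
    then show ?thesis by (simp add: filterlim_at_split)
  qed
  then have c: "isCont (\<lambda>x::real. \<bar>x * ln \<bar>x\<bar>\<bar>) 0" by (simp add: isCont_def tendsto_rabs_zero)
  have "(\<lambda>n. \<bar>t n * ln \<bar>t n\<bar>\<bar>) \<longlonglongrightarrow> \<bar>0 * ln \<bar>0\<bar>\<bar>" by (rule isCont_tendsto_compose[OF c t0])
  then have l0: "(\<lambda>n. \<bar>t n * ln \<bar>t n\<bar>\<bar>) \<longlonglongrightarrow> 0" by simp
  have ev: "eventually (\<lambda>n. \<bar>t n\<bar> < 1) sequentially"
    using order_tendstoD(2)[OF tendsto_rabs_zero[OF t0], of 1] by simp
  have "(\<lambda>n. t n * ((\<bar>t n\<bar> powr q n - 1) / q n)) \<longlonglongrightarrow> 0"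
  proof (rule Lim_null_comparison[OF _ l0])
    show "eventually (\<lambda>n. norm (t n * ((\<bar>t n\<bar> powr q n - 1) / q n)) \<le> \<bar>t n * ln \<bar>t n\<bar>\<bar>) sequentially"
      using ev
    proof eventually_elim
      case (elim n)
      have "\<bar>\<bar>t n\<bar> * ((\<bar>t n\<bar> powr q n - 1) / q n)\<bar> \<le> \<bar>\<bar>t n\<bar> * ln \<bar>t n\<bar>\<bar>"
        by (rule powr_quotient_bound(2)[OF q(1,2)]) (use elim in auto)
      then show ?case by (simp add: abs_mult)
    qed
  qed
  then show ?thesis using True by simp
next
  case False
  have ev: "eventually (\<lambda>n. t n \<noteq> 0) sequentially" using tendsto_imp_eventually_ne[OF t False] .
  have ln: "(\<lambda>n. ln \<bar>t n\<bar>) \<longlonglongrightarrow> ln \<bar>l\<bar>" using False by (intro tendsto_intros t) auto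
  have "(\<lambda>n. (exp (q n * ln \<bar>t n\<bar>) - 1) / q n) \<longlonglongrightarrow> ln \<bar>l\<bar>"
    by (rule exp_minus_one_quotient_tendsto[OF q(3) _ ln]) (use q(1) in \<open>simp add: less_imp_neq[symmetric]\<close>)
  then have "(\<lambda>n. t n * ((exp (q n * ln \<bar>t n\<bar>) - 1) / q n)) \<longlonglongrightarrow> l * ln \<bar>l\<bar>" by (intro tendsto_mult t)
  moreover have "eventually (\<lambda>n. t n * ((exp (q n * ln \<bar>t n\<bar>) - 1) / q n) = t n * ((\<bar>t n\<bar> powr q n - 1) / q n)) sequentially"
    using ev by eventually_elim (simp add: powr_def)
  ultimately show ?thesis by (rule Lim_transform_eventually)
qed

subsection \<open>Fractional Nehari manifolds and uniform bounds\<close>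

lemma Lp_norm_powr: "p > 0 \<Longrightarrow> Lp_norm p u powr p = (LINT x|lborel. \<bar>u x\<bar> powr p)"
  by (simp add: Lp_norm_def powr_powr)

lemma Lp_norm_2: "Lp_norm 2 u = sqrt (mass u)"
  by (simp add: Lp_norm_def powr_half_sqrt)

lemma Lp_norm_2_square: "(Lp_norm 2 u)^2 = mass u"
  by (simp add: Lp_norm_2)

definition frac_energy :: "real \<Rightarrow> ('a::euclidean_space \<Rightarrow> real) \<Rightarrow> real" where
  "frac_energy s u = (LINT \<xi>|lborel. br \<xi> powr s * psd u \<xi>)"

definition frac_regular :: "real \<Rightarrow> ('a::euclidean_space \<Rightarrow> real) \<Rightarrow> bool" where
  "frac_regular s u \<longleftrightarrow> u \<in> L12 \<and> integrable lborel (\<lambda>\<xi>. br \<xi> powr s * psd u \<xi>)"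

lemma H_frac_iff:
  assumes "bounded \<Omega>"
  shows "u \<in> H_frac \<Omega> s \<longleftrightarrow> frac_regular s u \<and> vanishes_outside \<Omega> u"
proof
  assume "u \<in> H_frac \<Omega> s"
  then have u: "square_integrable u" "vanishes_outside \<Omega> u"
    "integrable lborel (\<lambda>\<xi>. br \<xi> powr s * psd u \<xi>)"
    unfolding H_frac_def by blast+
  show "frac_regular s u \<and> vanishes_outside \<Omega> u"
    unfolding frac_regular_def by (intro conjI square_integrable_bounded_L12[OF assms] u)
next
  assume "frac_regular s u \<and> vanishes_outside \<Omega> u"
  then have u: "u \<in> L12" "vanishes_outside \<Omega> u"
    "integrable lborel (\<lambda>\<xi>. br \<xi> powr s * psd u \<xi>)"
    unfolding frac_regular_def by blast+
  have "square_integrable u" using L12_D[OF u(1)] by (simp add: square_integrable_def)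
  then show "u \<in> H_frac \<Omega> s" unfolding H_frac_def using u by blast
qed

lemma E_frac_self: "E_frac s u u = frac_energy s u"
proof -
  have "complex_of_real (br \<xi> powr s) * fourier u \<xi> * cnj (fourier u \<xi>) =
    complex_of_real (br \<xi> powr s * psd u \<xi>)" for \<xi>
    using complex_norm_square[of "fourier u \<xi>"] by (simp add: mult.assoc)
  then show ?thesis by (simp only: E_frac_def frac_energy_def integral_complex_of_real Re_complex_of_real)
qed

lemma frac_energy_nonneg: "0 \<le> frac_energy s u"
  unfolding frac_energy_def by (intro integral_nonneg_AE AE_I2) auto

lemma norm_frac_square: "(norm_frac s u)^2 = frac_energy s u"
  by (simp add: norm_frac_def E_frac_self frac_energy_nonneg)

text \<open>The tangent inequality s ln x \<le> x^s - 1 under the integral. It turns a bound on the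
  energy excess divided by s into a bound on the logarithmic energy that is uniform in s.\<close>

lemma frac_energy_log_energy:
  fixes u :: "'a::euclidean_space \<Rightarrow> real"
  assumes u: "frac_regular s u" and s: "s > 0"
  shows "log_regular u" "s * log_energy u \<le> frac_energy s u - mass u"
proof -
  have L: "u \<in> L12" and i: "integrable lborel (\<lambda>\<xi>. br \<xi> powr s * psd u \<xi>)"
    using u by (auto simp: frac_regular_def)
  note [measurable] = L12_D(1)[OF L]
  have ptw: "s * ln (br \<xi>) \<le> br \<xi> powr s - 1" for \<xi> :: 'a
  proof -
    have p: "0 < 1 + (norm \<xi>)^2" by (simp add: add_pos_nonneg)
    have "ln (br \<xi> powr s) \<le> br \<xi> powr s - 1" using p by (intro ln_le_minus_one) simp
    then show ?thesis using p by (simp add: ln_powr)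
  qed
  have ptw2: "s * (ln (br \<xi>) * psd u \<xi>) \<le> br \<xi> powr s * psd u \<xi> - psd u \<xi>" for \<xi>
  proof -
    have "s * ln (br \<xi>) * psd u \<xi> \<le> (br \<xi> powr s - 1) * psd u \<xi>"
      using ptw[of \<xi>] by (intro mult_right_mono) auto
    then show ?thesis by (simp add: left_diff_distrib mult.assoc)
  qed
  have j: "integrable lborel (\<lambda>\<xi>. s * (ln (br \<xi>) * psd u \<xi>))"
  proof (rule Bochner_Integration.integrable_bound[OF Bochner_Integration.integrable_diff[OF i plancherel(1)[OF L]]])
    have "0 \<le> s * (ln (br \<xi>) * psd u \<xi>)" for \<xi> :: 'a using s by simp
    then show "AE \<xi> in lborel. norm (s * (ln (br \<xi>) * psd u \<xi>)) \<le> norm (br \<xi> powr s * psd u \<xi> - psd u \<xi>)"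
      using ptw2 unfolding real_norm_def by (intro AE_I2) (metis abs_of_nonneg abs_ge_self order_trans)
  qed measurable
  have "integrable lborel (\<lambda>\<xi>. 1 / s * (s * (ln (br \<xi>) * psd u \<xi>)))"
    by (rule integrable_mult_right[OF j])
  then show "log_regular u" using s L by (simp add: log_regular_def)
  have "(LINT \<xi>|lborel. s * (ln (br \<xi>) * psd u \<xi>)) \<le>
    (LINT \<xi>|lborel. br \<xi> powr s * psd u \<xi> - psd u \<xi>)"
    by (intro integral_mono j Bochner_Integration.integrable_diff i plancherel(1)[OF L] ptw2)
  then show "s * log_energy u \<le> frac_energy s u - mass u"
    using i plancherel[OF L] by (simp add: log_energy_def frac_energy_def)
qed

lemma frac_energy_ge:
  assumes "frac_regular s u" "s > 0"
  shows "mass u \<le> frac_energy s u"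
proof -
  have "0 \<le> s * log_energy u" using assms(2) log_energy_nonneg[of u] by simp
  then show ?thesis using frac_energy_log_energy(2)[OF assms] by linarith
qed

section \<open>First-order expansions along a fixed test function\<close>

lemma test_function_frac_regular:
  fixes w :: "'a::euclidean_space \<Rightarrow> real"
  assumes w: "test_function \<Omega> w" and s: "s \<le> 1"
  shows "frac_regular s w"
proof -
  have L: "w \<in> L12" and i: "integrable lborel (\<lambda>\<xi>. br \<xi> * psd w \<xi>)"
    using w by (auto simp: test_function_def)
  note [measurable] = L12_D(1)[OF L]
  have "integrable lborel (\<lambda>\<xi>. br \<xi> powr s * psd w \<xi>)"
  proof (rule Bochner_Integration.integrable_bound[OF i])
    have "br \<xi> powr s \<le> 1 + (norm \<xi>)^2" for \<xi> :: 'a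
      using powr_mono[OF s one_plus_square_ge_1[of \<xi>]] by (simp add: add_nonneg_nonneg)
    then show "AE \<xi> in lborel. norm (br \<xi> powr s * psd w \<xi>) \<le> norm (br \<xi> * psd w \<xi>)"
      by (auto simp: abs_mult intro!: mult_right_mono)
  qed measurable
  then show ?thesis using L by (simp add: frac_regular_def)
qed

lemma symbol_quotient_bound:
  fixes \<xi> :: "'a::euclidean_space"
  assumes s: "0 < s" "s \<le> 1"
  shows "0 \<le> (br \<xi> powr s - 1) / s" "(br \<xi> powr s - 1) / s \<le> (norm \<xi>)^2"
proof -
  have "1 \<le> br \<xi> powr s" using s by (intro ge_one_powr_ge_zero) auto
  then show "0 \<le> (br \<xi> powr s - 1) / s" using s by simp
  have "br \<xi> powr s \<le> 1 + s * (br \<xi> - 1)"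
    using s by (intro powr_le_linear) auto
  then show "(br \<xi> powr s - 1) / s \<le> (norm \<xi>)^2" using s by (simp add: field_simps)
qed

text \<open>The quotient ((1+|\<xi>|^2)^s - 1)/s converges to the logarithm and is at most
  |\<xi>|^2, so the H^1 weight of a test function dominates.\<close>

lemma frac_energy_expansion:
  fixes w :: "'a::euclidean_space \<Rightarrow> real"
  assumes w: "test_function \<Omega> w" and s: "\<And>n. 0 < s n" "\<And>n. s n \<le> 1" "s \<longlonglongrightarrow> 0"
  shows "(\<lambda>n. (frac_energy (s n) w - mass w) / s n) \<longlonglongrightarrow> log_energy w"
proof -
  have L: "w \<in> L12" and i: "integrable lborel (\<lambda>\<xi>. br \<xi> * psd w \<xi>)"
    using w by (auto simp: test_function_def)
  note [measurable] = L12_D(1)[OF L]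
  let ?m = "\<lambda>n \<xi>. ((1 + (norm (\<xi>::'a))^2) powr s n - 1) / s n"
  have sne: "s n \<noteq> 0" for n using s(1)[of n] by simp
  have "(LINT \<xi>|lborel. ?m n \<xi> * psd w \<xi>) = (frac_energy (s n) w - mass w) / s n" for n
  proof -
    have "(LINT \<xi>|lborel. ?m n \<xi> * psd w \<xi>) = (LINT \<xi>|lborel. (br \<xi> powr s n * psd w \<xi> - psd w \<xi>) / s n)"
      by (intro Bochner_Integration.integral_cong refl) (simp add: left_diff_distrib)
    then show ?thesis
      using test_function_frac_regular[OF w s(2)[of n]] plancherel[OF L] by (simp add: frac_energy_def frac_regular_def)
  qed
  moreover have "(\<lambda>n. LINT \<xi>|lborel. ?m n \<xi> * psd w \<xi>) \<longlonglongrightarrow> (LINT \<xi>|lborel. ln (br \<xi>) * psd w \<xi>)"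
  proof (rule integral_dominated_convergence[where w = "\<lambda>\<xi>. br \<xi> * psd w \<xi>"])
    show "AE \<xi> in lborel. (\<lambda>n. ?m n \<xi> * psd w \<xi>) \<longlonglongrightarrow> ln (br \<xi>) * psd w \<xi>"
      by (intro AE_I2 tendsto_mult tendsto_const powr_minus_one_quotient_tendsto s(3))
         (auto simp: add_pos_nonneg sne)
    show "AE \<xi> in lborel. norm (?m n \<xi> * psd w \<xi>) \<le> br \<xi> * psd w \<xi>" for n
    proof (rule AE_I2)
      fix \<xi> :: 'a
      have "\<bar>?m n \<xi>\<bar> \<le> 1 + (norm \<xi>)^2" using symbol_quotient_bound[OF s(1)[of n] s(2)[of n], of \<xi>] by linarith
      then show "norm (?m n \<xi> * psd w \<xi>) \<le> br \<xi> * psd w \<xi>"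
        unfolding real_norm_def abs_mult by (intro mult_mono) auto
    qed
  qed (use i in measurable)
  ultimately show ?thesis by (simp only: log_energy_def)
qed

text \<open>In |w|^(2+q) = w^2 + q h the function h is at most a multiple of |w|, because w is
  bounded, and it converges to w^2 ln|w|.\<close>

lemma power_expansion:
  fixes w :: "'a::euclidean_space \<Rightarrow> real"
  assumes w: "test_function \<Omega> w" and q: "\<And>n. 0 < q n" "\<And>n. q n \<le> 1" "q \<longlonglongrightarrow> 0"
  shows "(\<lambda>n. ((LINT x|lborel. \<bar>w x\<bar> powr (2 + q n)) - mass w) / q n) \<longlonglongrightarrow> (LINT x|lborel. (w x)^2 * ln \<bar>w x\<bar>)"
    and "integrable lborel (\<lambda>x. \<bar>w x\<bar> powr (2 + q n))"
proof -
  have L: "w \<in> L12" using w by (auto simp: test_function_def)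
  note [measurable] = L12_D(1)[OF L]
  obtain C where C: "\<And>x. \<bar>w x\<bar> \<le> C" using w by (auto simp: test_function_def)
  have C0: "C \<ge> 0" using C[of 0] by linarith
  let ?h = "\<lambda>n x. w x * (w x * ((\<bar>w x\<bar> powr q n - 1) / q n))"
  have bound: "\<bar>?h n x\<bar> \<le> (C\<^sup>2 + 1) * \<bar>w x\<bar>" for n x
  proof -
    have "\<bar>\<bar>w x\<bar> * ((\<bar>w x\<bar> powr q n - 1) / q n)\<bar> \<le> \<bar>w x\<bar>\<^sup>2 + (if \<bar>w x\<bar> < 1 then 1 else 0)"
      by (rule powr_quotient_bound(1)[OF q(1,2)]) simp
    also have "\<dots> \<le> C\<^sup>2 + 1" using C[of x] by (intro add_mono power_mono) auto
    finally have "\<bar>w x * ((\<bar>w x\<bar> powr q n - 1) / q n)\<bar> \<le> C\<^sup>2 + 1" by (simp add: abs_mult)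
    then have "\<bar>w x\<bar> * \<bar>w x * ((\<bar>w x\<bar> powr q n - 1) / q n)\<bar> \<le> \<bar>w x\<bar> * (C\<^sup>2 + 1)" by (rule mult_left_mono) simp
    then show ?thesis by (simp only: abs_mult mult.commute)
  qed
  have eq: "\<bar>w x\<bar> powr (2 + q n) = q n * ?h n x + (w x)^2" for n x
  proof -
    have "\<bar>w x\<bar> powr (2 + q n) = (w x)^2 * \<bar>w x\<bar> powr q n"
      by (cases "w x = 0") (simp_all add: powr_add powr_numeral)
    then show ?thesis using q(1)[of n] by (simp add: power2_eq_square field_simps)
  qed
  have ih: "integrable lborel (?h n)" for n
    by (rule Bochner_Integration.integrable_bound[OF integrable_mult_right[of "C\<^sup>2 + 1", OF integrable_abs[OF L12_D(2)[OF L]]]])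
       (measurable, use bound in \<open>auto intro!: order_trans[OF _ abs_ge_self]\<close>)
  show "integrable lborel (\<lambda>x. \<bar>w x\<bar> powr (2 + q n))" unfolding eq by (intro Bochner_Integration.integrable_add integrable_mult_right ih L12_D(3)[OF L])
  have "((LINT x|lborel. \<bar>w x\<bar> powr (2 + q n)) - mass w) / q n = (LINT x|lborel. ?h n x)" for n
  proof -
    have "(LINT x|lborel. \<bar>w x\<bar> powr (2 + q n)) = q n * (LINT x|lborel. ?h n x) + mass w"
      unfolding eq Bochner_Integration.integral_add[OF integrable_mult_right[OF ih] L12_D(3)[OF L]] by simp
    then show ?thesis using q(1)[of n] by simp
  qed
  moreover have "(\<lambda>n. LINT x|lborel. ?h n x) \<longlonglongrightarrow> (LINT x|lborel. w x * (w x * ln \<bar>w x\<bar>))"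
  proof (rule integral_dominated_convergence[where w = "\<lambda>x. (C\<^sup>2 + 1) * \<bar>w x\<bar>"])
    show "AE x in lborel. (\<lambda>n. ?h n x) \<longlonglongrightarrow> w x * (w x * ln \<bar>w x\<bar>)"
      by (intro AE_I2 tendsto_mult[OF tendsto_const] powr_quotient_continuous q tendsto_const)
    show "AE x in lborel. norm (?h n x) \<le> (C\<^sup>2 + 1) * \<bar>w x\<bar>" for n using bound by simp
    show "integrable lborel (\<lambda>x. (C\<^sup>2 + 1) * \<bar>w x\<bar>)" using L12_D(2)[OF L] by simp
  qed measurable
  moreover have "(LINT x|lborel. w x * (w x * ln \<bar>w x\<bar>)) = (LINT x|lborel. (w x)^2 * ln \<bar>w x\<bar>)"
    by (simp add: power2_eq_square mult.assoc)
  ultimately show "(\<lambda>n. ((LINT x|lborel. \<bar>w x\<bar> powr (2 + q n)) - mass w) / q n) \<longlonglongrightarrow> (LINT x|lborel. (w x)^2 * ln \<bar>w x\<bar>)"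
    by (simp only:)
qed

section \<open>The fractional Nehari manifold in terms of plain integrals\<close>

lemma nontrivial_iff:
  assumes "u \<in> L12"
  shows "nontrivial u \<longleftrightarrow> (mass u) > 0"
proof -
  have "mass u = 0 \<longleftrightarrow> (AE x in lborel. u x = 0)"
    using integral_nonneg_eq_0_iff_AE[OF L12_D(3)[OF assms]] by simp
  moreover have "0 \<le> mass u" by simp
  ultimately show ?thesis unfolding nontrivial_def by linarith
qed

lemma Nehari_frac_iff:
  assumes "bounded \<Omega>" "p > 0"
  shows "u \<in> Nehari_frac \<Omega> s p \<tau> \<longleftrightarrow> frac_regular s u \<and> vanishes_outside \<Omega> u \<and> (mass u) > 0 \<and>
    frac_energy s u = (LINT x|lborel. \<bar>u x\<bar> powr p) + \<tau> * mass u"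
  unfolding Nehari_frac_def mem_Collect_eq H_frac_iff[OF assms(1)] norm_frac_square Lp_norm_2_square Lp_norm_powr[OF assms(2)]
  using nontrivial_iff[of u] by (auto simp: frac_regular_def)

text \<open>On the manifold the quadratic part equals the power integral, so only the factor 1/2 -
  1/p = (p - 2)/(2p) survives. It is of order s in the regime below, which explains why the energy
  is divided by s.\<close>

lemma J_frac_Nehari:
  assumes "u \<in> Nehari_frac \<Omega> s p \<tau>" "p > 0"
  shows "J_frac s p \<tau> u = (1 / 2 - 1 / p) * (LINT x|lborel. \<bar>u x\<bar> powr p)"
proof -
  have "(norm_frac s u)^2 = Lp_norm p u powr p + \<tau> * (Lp_norm 2 u)^2" using assms by (simp add: Nehari_frac_def)
  then show ?thesis unfolding J_frac_def Lp_norm_powr[OF assms(2)] by (simp add: algebra_simps)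
qed

lemma tendsto_imp_norm_bounded:
  fixes X :: "nat \<Rightarrow> real"
  assumes "X \<longlonglongrightarrow> l"
  shows "\<exists>C. \<forall>n. \<bar>X n\<bar> \<le> C"
proof -
  have "Bseq X" using assms by (intro convergent_imp_Bseq convergentI)
  then show ?thesis by (auto simp: Bseq_def)
qed

text \<open>The situation after discarding finitely many indices. The condition \<open>p_s\<close>
  is the inequality \<open>\<theta>\<close> \<le> 1 required by the concavity step, the bound on p
  keeps q at most 1, and \<open>\<tau>_le\<close> keeps the quadratic form coercive with respect to
  the mass.\<close>

locale small_order =
  fixes \<Omega> :: "'a::euclidean_space set" and k :: real and s p \<tau> :: "nat \<Rightarrow> real"
  assumes bd: "bounded \<Omega>" and lip: "lipschitz_domain \<Omega>"
    and k_pos: "0 < k" and k_less: "k * real DIM('a) < 4"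
    and s_pos: "\<And>n. 0 < s n" and s_le: "\<And>n. s n \<le> 1 / 4" and s_lim: "s \<longlonglongrightarrow> 0"
    and p_gt: "\<And>n. 2 < p n" and p_le: "\<And>n. p n \<le> 3" and p_lim: "(\<lambda>n. (p n - 2) / s n) \<longlonglongrightarrow> k"
    and p_s: "\<And>n. (p n - 2) * real DIM('a) \<le> 4 * s n"
    and \<tau>_le: "\<And>n. \<tau> n \<le> 1 / 2" and \<tau>_lim: "(\<lambda>n. \<tau> n / s n) \<longlonglongrightarrow> 0"
begin

definition q where "q n = p n - 2"

lemma q_pos: "0 < q n" and q_le: "q n \<le> 1" and p_eq: "p n = 2 + q n" and p_pos: "0 < p n"
  using p_gt[of n] p_le[of n] by (auto simp: q_def)

lemma s_ne: "s n \<noteq> 0" and q_ne: "q n \<noteq> 0"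
  using s_pos[of n] q_pos[of n] by auto

lemma q_s_lim: "(\<lambda>n. q n / s n) \<longlonglongrightarrow> k" using p_lim by (simp add: q_def)

lemma s_q_lim: "(\<lambda>n. s n / q n) \<longlonglongrightarrow> 1 / k"
  using tendsto_divide[OF tendsto_const[of 1] q_s_lim] k_pos by simp

lemma q_lim: "q \<longlonglongrightarrow> 0"
proof -
  have "(\<lambda>n. q n / s n * s n) \<longlonglongrightarrow> k * 0" by (intro tendsto_mult q_s_lim s_lim)
  moreover have "q n / s n * s n = q n" for n using s_pos[of n] by simp
  ultimately show ?thesis by simp
qed

lemma \<tau>_lim0: "\<tau> \<longlonglongrightarrow> 0"
proof -
  have "(\<lambda>n. \<tau> n / s n * s n) \<longlonglongrightarrow> 0 * 0" by (intro tendsto_mult \<tau>_lim s_lim)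
  moreover have "\<tau> n / s n * s n = \<tau> n" for n using s_pos[of n] by simp
  ultimately show ?thesis by simp
qed

lemma p_lim2: "p \<longlonglongrightarrow> 2"
  using tendsto_add[OF tendsto_const[of 2] q_lim] by (simp only: p_eq[symmetric] add_0_right)

text \<open>Scaling a fixed function onto the fractional Nehari manifolds; the optimal factors
  converge to the one that scales it onto the logarithmic Nehari manifold.\<close>

lemma test_function_energy_limit:
  assumes w: "test_function \<Omega> w" and Mpos: "mass w > 0"
  obtains v where "\<And>n. v n \<in> Nehari_frac \<Omega> (s n) (p n) (\<tau> n)"
    "(\<lambda>n. J_frac (s n) (p n) (\<tau> n) (v n) / s n) \<longlonglongrightarrow>
      k / 4 * (exp (2 * (log_energy w - k * (LINT x|lborel. (w x)^2 * ln \<bar>w x\<bar>)) / (k * mass w)) * mass w)"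
proof -
  define M where "M = mass w"
  define E where "E = log_energy w"
  define Lg where "Lg = (LINT x|lborel. (w x)^2 * ln \<bar>w x\<bar>)"
  define I where "I n = (LINT x|lborel. \<bar>w x\<bar> powr p n)" for n
  define W where "W n = frac_energy (s n) w" for n
  have M: "M > 0" using Mpos by (simp add: M_def)
  have L: "w \<in> L12" using w by (simp add: test_function_def)
  note [measurable] = L12_D(1)[OF L]
  have s1: "s n \<le> 1" for n using s_le[of n] by simp
  have fr: "frac_regular (s n) w" for n by (rule test_function_frac_regular[OF w s1])
  have iI: "integrable lborel (\<lambda>x. \<bar>w x\<bar> powr p n)" for n
    using power_expansion(2)[OF w q_pos q_le q_lim] by (simp add: p_eq)
  have Ipos: "I n > 0" for n
  proof -
    have "I n \<noteq> 0"
    proof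
      assume "I n = 0"
      then have "AE x in lborel. \<bar>w x\<bar> powr p n = 0" unfolding I_def using integral_nonneg_eq_0_iff_AE[OF iI] by simp
      then have "AE x in lborel. (w x)^2 = 0" by eventually_elim simp
      then have "M = 0" unfolding M_def by (rule integral_eq_zero_AE)
      then show False using M by simp
    qed
    moreover have "I n \<ge> 0" by (simp add: I_def)
    ultimately show ?thesis by simp
  qed
  have WM: "M \<le> W n" for n unfolding M_def W_def by (rule frac_energy_ge[OF fr s_pos])
  have num: "W n - \<tau> n * M > 0" for n
  proof -
    have "\<tau> n * M \<le> 1 / 2 * M" using \<tau>_le[of n] M by (intro mult_right_mono) auto
    then show ?thesis using WM[of n] M by linarith
  qed
  \<comment> \<open>The Nehari equation for the multiple t w reduces to t^q = (W - \<tau> M)/I, as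
    the power integral is homogeneous of degree 2 + q.\<close>
  define t where "t n = exp (ln ((W n - \<tau> n * M) / I n) / q n)" for n
  have tpos: "t n > 0" for n by (simp add: t_def)
  have tq: "t n powr q n = (W n - \<tau> n * M) / I n" for n
    using q_pos[of n] num[of n] Ipos[of n] by (simp add: t_def powr_def)
  define v where "v n x = t n * w x" for n x
  have vf: "fourier (v n) \<xi> = complex_of_real (t n) * fourier w \<xi>" for n \<xi> unfolding v_def[abs_def] by (rule fourier_scale)
  have vM: "mass (v n) = (t n)^2 * M" for n by (simp add: v_def power_mult_distrib M_def)
  have sq: "br \<xi> powr s n * psd (v n) \<xi> = (t n)^2 * (br \<xi> powr s n * psd w \<xi>)" for n \<xi>
    unfolding vf by (simp add: norm_mult power_mult_distrib)
  have vW: "frac_energy (s n) (v n) = (t n)^2 * W n" for n unfolding frac_energy_def sq W_def by simp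
  have vr: "frac_regular (s n) (v n)" for n
    unfolding frac_regular_def sq using fr[of n] L12_scale[OF L, of "t n"] by (simp add: frac_regular_def v_def[abs_def])
  have vI: "(LINT x|lborel. \<bar>v n x\<bar> powr p n) = (t n)^2 * (W n - \<tau> n * M)" for n
  proof -
    have "(LINT x|lborel. \<bar>v n x\<bar> powr p n) = (LINT x|lborel. t n powr p n * \<bar>w x\<bar> powr p n)"
      using tpos[of n] by (intro Bochner_Integration.integral_cong refl) (simp add: v_def abs_mult powr_mult)
    also have "\<dots> = t n powr p n * I n" by (simp add: I_def)
    also have "t n powr p n = (t n)^2 * t n powr q n" using tpos[of n] by (simp add: p_eq powr_add powr_numeral)
    finally show ?thesis using Ipos[of n] unfolding tq by simp
  qed
  have vv: "vanishes_outside \<Omega> (v n)" for n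
    using w by (simp add: vanishes_outside_def test_function_def v_def)
  have vN: "v n \<in> Nehari_frac \<Omega> (s n) (p n) (\<tau> n)" for n
    unfolding Nehari_frac_iff[OF bd p_pos] vM vW vI using vr vv M tpos[of n] by (simp add: algebra_simps)
  have J: "J_frac (s n) (p n) (\<tau> n) (v n) / s n = (q n / s n) / (2 * p n) * ((t n)^2 * (W n - \<tau> n * M))" for n
  proof -
    have "1 / 2 - 1 / p n = q n / (2 * p n)" using p_pos[of n] by (simp add: q_def field_simps)
    then show ?thesis unfolding J_frac_Nehari[OF vN p_pos] vI by simp
  qed
  define a where "a n = ((W n - M) / s n - \<tau> n / s n * M) / M" for n
  have Wx: "(\<lambda>n. (W n - M) / s n) \<longlonglongrightarrow> E"
    unfolding E_def W_def M_def by (rule frac_energy_expansion[OF w s_pos s1 s_lim])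
  have M0: "M \<noteq> 0" using M by simp
  have alim: "a \<longlonglongrightarrow> (E - 0 * M) / M"
    unfolding a_def by (rule tendsto_divide[OF tendsto_diff[OF Wx tendsto_mult[OF \<tau>_lim tendsto_const]] tendsto_const M0])
  define b where "b n = ((I n - M) / q n) / M" for n
  have Ix: "(\<lambda>n. (I n - M) / q n) \<longlonglongrightarrow> Lg"
    using power_expansion(1)[OF w q_pos q_le q_lim] by (simp add: I_def M_def Lg_def p_eq)
  have blim: "b \<longlonglongrightarrow> Lg / M"
    unfolding b_def by (rule tendsto_divide[OF Ix tendsto_const M0])
  have l1: "(\<lambda>n. ln (1 + s n * a n) / s n) \<longlonglongrightarrow> E / M"
    using ln_one_plus_quotient_tendsto[OF s_lim s_ne alim] by simp
  have l2: "(\<lambda>n. ln (1 + q n * b n) / q n) \<longlonglongrightarrow> Lg / M"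
    by (rule ln_one_plus_quotient_tendsto[OF q_lim q_ne blim])
  have e1: "1 + s n * a n = (W n - \<tau> n * M) / M" for n
    using s_pos[of n] M by (simp add: a_def field_simps)
  have e2: "1 + q n * b n = I n / M" for n
    using q_pos[of n] M by (simp add: b_def field_simps)
  \<comment> \<open>Both W - \<tau> M and I tend to M, so ln t is an indeterminate quotient.
    Normalising by M splits it into two convergent difference quotients, the first rescaled by
    s/q.\<close>
  have "ln ((W n - \<tau> n * M) / I n) / q n = ln (1 + s n * a n) / s n * (s n / q n) - ln (1 + q n * b n) / q n" for n
  proof -
    have "ln ((W n - \<tau> n * M) / M) / s n * (s n / q n) = ln ((W n - \<tau> n * M) / M) / q n" using s_ne[of n] by simp
    moreover have "ln ((W n - \<tau> n * M) / M) = ln (W n - \<tau> n * M) - ln M" "ln (I n / M) = ln (I n) - ln M"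
      "ln ((W n - \<tau> n * M) / I n) = ln (W n - \<tau> n * M) - ln (I n)"
      using num[of n] Ipos[of n] M by (simp_all add: ln_div)
    ultimately show ?thesis unfolding e1 e2 by (simp only: diff_divide_distrib)
  qed
  moreover have "(\<lambda>n. ln (1 + s n * a n) / s n * (s n / q n) - ln (1 + q n * b n) / q n) \<longlonglongrightarrow> E / M * (1 / k) - Lg / M"
    by (rule tendsto_diff[OF tendsto_mult[OF l1 s_q_lim] l2])
  ultimately have "(\<lambda>n. ln ((W n - \<tau> n * M) / I n) / q n) \<longlonglongrightarrow> E / M * (1 / k) - Lg / M" by simp
  then have tl: "t \<longlonglongrightarrow> exp (E / M * (1 / k) - Lg / M)" unfolding t_def by (intro tendsto_intros)
  have Wl: "(\<lambda>n. W n - \<tau> n * M) \<longlonglongrightarrow> M"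
  proof -
    have "(\<lambda>n. (1 + s n * a n) * M) \<longlonglongrightarrow> (1 + 0 * ((E - 0 * M) / M)) * M"
      by (rule tendsto_mult[OF tendsto_add[OF tendsto_const tendsto_mult[OF s_lim alim]] tendsto_const])
    then show ?thesis unfolding e1 using M by simp
  qed
  have "(\<lambda>n. (q n / s n) / (2 * p n) * ((t n)^2 * (W n - \<tau> n * M))) \<longlonglongrightarrow> k / (2 * 2) * ((exp (E / M * (1 / k) - Lg / M))^2 * M)"
    by (rule tendsto_mult[OF tendsto_divide[OF q_s_lim tendsto_mult[OF tendsto_const p_lim2]] tendsto_mult[OF tendsto_power[OF tl] Wl]]) simp
  moreover have "(exp (E / M * (1 / k) - Lg / M))^2 = exp (2 * (E - k * Lg) / (k * M))"
    unfolding power2_eq_square mult_exp_exp using k_pos M by (simp add: field_simps)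
  ultimately have "(\<lambda>n. J_frac (s n) (p n) (\<tau> n) (v n) / s n) \<longlonglongrightarrow> k / 4 * (exp (2 * (E - k * Lg) / (k * M)) * M)"
    unfolding J by simp
  then show ?thesis using that[of v] vN by (simp add: E_def Lg_def M_def)
qed

end

locale least_energy_sequence = small_order \<Omega> k s p \<tau>
  for \<Omega> :: "'a::euclidean_space set" and k :: real and s p \<tau> :: "nat \<Rightarrow> real" +
  fixes U :: "nat \<Rightarrow> 'a \<Rightarrow> real"
  assumes least: "\<And>n. least_energy_frac \<Omega> (s n) (p n) (\<tau> n) (U n)"
begin

lemma U_Nehari: "U n \<in> Nehari_frac \<Omega> (s n) (p n) (\<tau> n)"
  using least[of n] by (simp add: least_energy_frac_def)

lemma U_facts: "frac_regular (s n) (U n)" "vanishes_outside \<Omega> (U n)" "mass (U n) > 0"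
  "frac_energy (s n) (U n) = (LINT x|lborel. \<bar>U n x\<bar> powr p n) + \<tau> n * mass (U n)"
  using U_Nehari[of n] unfolding Nehari_frac_iff[OF bd p_pos] by auto

lemma U_L12: "U n \<in> L12" using U_facts(1) by (simp add: frac_regular_def)

lemma J_nonneg: "v \<in> Nehari_frac \<Omega> (s n) (p n) (\<tau> n) \<Longrightarrow> 0 \<le> J_frac (s n) (p n) (\<tau> n) v"
proof -
  assume v: "v \<in> Nehari_frac \<Omega> (s n) (p n) (\<tau> n)"
  have "1 / p n \<le> 1 / 2" using p_gt[of n] by (intro divide_left_mono) auto
  then show ?thesis unfolding J_frac_Nehari[OF v p_pos] by (intro mult_nonneg_nonneg) auto
qed

lemma J_minimal:
  assumes "v \<in> Nehari_frac \<Omega> (s n) (p n) (\<tau> n)"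
  shows "J_frac (s n) (p n) (\<tau> n) (U n) \<le> J_frac (s n) (p n) (\<tau> n) v"
proof -
  have "J_frac (s n) (p n) (\<tau> n) (U n) = (INF v\<in>Nehari_frac \<Omega> (s n) (p n) (\<tau> n). J_frac (s n) (p n) (\<tau> n) v)"
    using least[of n] by (simp add: least_energy_frac_def)
  also have "\<dots> \<le> J_frac (s n) (p n) (\<tau> n) v"
    using assms J_nonneg by (intro cINF_lower) (auto intro!: bdd_belowI2[where m = 0])
  finally show ?thesis .
qed

text \<open>Minimality compares J/s with the same quantity along a scaled test function, which
  converges. Since J/s is (q/s)/(2p) times the power integral and q/s has the positive limit k, the
  integral itself is bounded.\<close>

lemma power_integral_bounded: "\<exists>A. \<forall>n. (LINT x|lborel. \<bar>U n x\<bar> powr p n) \<le> A"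
proof -
  have op: "open \<Omega>" "\<Omega> \<noteq> {}" using lip by (auto simp: lipschitz_domain_def)
  obtain w where w: "test_function \<Omega> w" "mass w > 0"
    using nontrivial_test_function_exists[OF op] by blast
  obtain v l where v: "\<And>n. v n \<in> Nehari_frac \<Omega> (s n) (p n) (\<tau> n)" and vl: "(\<lambda>n. J_frac (s n) (p n) (\<tau> n) (v n) / s n) \<longlonglongrightarrow> l"
    using test_function_energy_limit[OF w] by blast
  obtain C where C: "\<And>n. \<bar>J_frac (s n) (p n) (\<tau> n) (v n) / s n\<bar> \<le> C"
    using tendsto_imp_norm_bounded[OF vl] by blast
  obtain S where S: "\<And>n. \<bar>s n / q n\<bar> \<le> S"
    using tendsto_imp_norm_bounded[OF s_q_lim] by blast
  have "(LINT x|lborel. \<bar>U n x\<bar> powr p n) \<le> C * (6 * S)" for n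
  proof -
    let ?J = "J_frac (s n) (p n) (\<tau> n) (U n) / s n"
    have "1 / 2 - 1 / p n = q n / (2 * p n)" using p_pos[of n] by (simp add: q_def field_simps)
    then have "?J = q n / (2 * p n) * (LINT x|lborel. \<bar>U n x\<bar> powr p n) / s n"
      unfolding J_frac_Nehari[OF U_Nehari p_pos] by simp
    then have I: "(LINT x|lborel. \<bar>U n x\<bar> powr p n) = ?J * (2 * p n * (s n / q n))"
      using q_pos[of n] p_pos[of n] s_pos[of n] by (simp add: field_simps)
    have J0: "0 \<le> ?J" using J_nonneg[OF U_Nehari] s_pos[of n] by simp
    have "?J \<le> J_frac (s n) (p n) (\<tau> n) (v n) / s n" using J_minimal[OF v] s_pos[of n] by (intro divide_right_mono) auto
    also have "\<dots> \<le> C" using C[of n] by linarith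
    finally have JC: "?J \<le> C" .
    have sq: "0 \<le> s n / q n" "s n / q n \<le> S" using order_trans[OF abs_ge_self S[of n]] s_pos[of n] q_pos[of n] by auto
    have f1: "2 * p n * (s n / q n) \<le> 6 * S" using p_le[of n] sq by (intro mult_mono) linarith+
    have f2: "0 \<le> 2 * p n * (s n / q n)" using p_pos[of n] sq(1) by (intro mult_nonneg_nonneg) auto
    have f3: "0 \<le> C" using JC J0 by linarith
    show ?thesis unfolding I by (rule mult_mono[OF JC f1 f3 f2])
  qed
  then show ?thesis by blast
qed

lemma L2_le_power_integral: "mass (U n) \<le> 2 * (LINT x|lborel. \<bar>U n x\<bar> powr p n)"
proof -
  have "\<tau> n * mass (U n) \<le> 1 / 2 * mass (U n)"
    using \<tau>_le[of n] by (intro mult_right_mono) auto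
  then show ?thesis using frac_energy_ge[OF U_facts(1) s_pos, of n] U_facts(4)[of n] by linarith
qed

text \<open>The Nehari identity expresses the energy excess as s X = I - M + \<tau> M, and the power
  inequality bounds I by the mass, a multiple of the same excess with a factor eventually below 1,
  and terms of order s. So X is absorbed. Read as a lower bound for B^q, the same inequality keeps
  the mass away from 0.\<close>

theorem uniform_bounds:
  obtains A c n\<^sub>0 where "c > 0" "\<And>n. n \<ge> n\<^sub>0 \<Longrightarrow> (mass (U n)) \<le> A"
    "\<And>n. n \<ge> n\<^sub>0 \<Longrightarrow> c \<le> mass (U n)"
    "\<And>n. n \<ge> n\<^sub>0 \<Longrightarrow> (frac_energy (s n) (U n) - mass (U n)) / s n \<le> A"
proof -
  define N where "N = real DIM('a)"
  have N: "N > 0" by (simp add: N_def)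
  define M where "M n = mass (U n)" for n
  define I where "I n = (LINT x|lborel. \<bar>U n x\<bar> powr p n)" for n
  define X where "X n = (frac_energy (s n) (U n) - M n) / s n" for n
  have M: "M n > 0" for n using U_facts(3) by (simp add: M_def)
  have X0: "X n \<ge> 0" for n using frac_energy_ge[OF U_facts(1) s_pos, of n] s_pos[of n] by (simp add: X_def M_def)
  obtain A1 where A1: "\<And>n. I n \<le> A1" using power_integral_bounded unfolding I_def by blast
  have M2: "M n \<le> 2 * A1" for n using L2_le_power_integral[of n] A1[of n] by (simp add: M_def I_def)
  have A1pos: "A1 > 0" using M2[of 0] M[of 0] by linarith
  define \<kappa> where "\<kappa> = k * N / 4"
  have kap: "0 < \<kappa>" "\<kappa> < 1" using k_pos k_less N by (auto simp: \<kappa>_def N_def)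
  \<comment> \<open>This choice makes 1 - \<epsilon> the midpoint of sqrt \<kappa> and 1, so that (1
    - \<epsilon>)^2 > \<kappa>; it is possible because \<kappa> = kN/4 < 1.\<close>
  define \<epsilon> where "\<epsilon> = (1 - sqrt \<kappa>) / 2"
  have sk: "0 < sqrt \<kappa>" "sqrt \<kappa> < 1" using kap by auto
  have \<epsilon>: "0 < \<epsilon>" using sk by (simp add: \<epsilon>_def)
  have \<epsilon>1: "\<epsilon> < 1"
  proof -
    have "(1 - x) / 2 < 1" if "x > 0" for x :: real using that by simp
    from this[OF sk(1)] show ?thesis by (simp only: \<epsilon>_def)
  qed
  define D where "D = (1 - \<epsilon>)^2"
  have D: "\<kappa> < D" "D > 0"
  proof -
    have "sqrt \<kappa> < 1 - \<epsilon>" using sk by (simp add: \<epsilon>_def field_simps)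
    then have "(sqrt \<kappa>)^2 < (1 - \<epsilon>)^2" using sk by (intro power_strict_mono) auto
    then show "\<kappa> < D" using kap by (simp add: D_def)
    then show "D > 0" using kap by simp
  qed
  define \<theta> where "\<theta> n = q n * N / (4 * s n)" for n
  define R where "R n = \<theta> n * (1 + q n * N / 4) / D" for n
  define G where "G n = (q n / s n) * (N / 4) / D" for n
  have th_lim: "\<theta> \<longlonglongrightarrow> \<kappa>"
  proof -
    have "(\<lambda>n. q n / s n * (N / 4)) \<longlonglongrightarrow> k * (N / 4)" by (intro tendsto_mult q_s_lim tendsto_const)
    moreover have "q n / s n * (N / 4) = \<theta> n" for n by (simp add: \<theta>_def mult.commute)
    ultimately show ?thesis by (simp add: \<kappa>_def)
  qed
  have R_lim: "R \<longlonglongrightarrow> \<kappa> / D"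
  proof -
    have "(\<lambda>n. \<theta> n * (1 + q n * N / 4) / D) \<longlonglongrightarrow> \<kappa> * (1 + 0 * N / 4) / D"
      using D by (intro tendsto_intros th_lim q_lim) auto
    then show ?thesis by (simp add: R_def[abs_def])
  qed
  have R0: "R n \<ge> 0" for n using q_pos[of n] s_pos[of n] N D by (simp add: R_def \<theta>_def)
  define B where "B n = sqrt (M n) / \<epsilon>" for n
  have B: "B n > 0" for n using M \<epsilon> by (simp add: B_def)
  \<comment> \<open>The power inequality with the Nehari identity inserted, divided by s. The first
    term stays bounded above because B is bounded above and q/s converges.\<close>
  have main: "X n \<le> M n * ((B n powr q n - 1) / s n) + B n powr q n * (R n * X n + G n * M n) + \<tau> n / s n * M n" for n
  proof -
    have th1: "\<theta> n * s n = q n * real DIM('a) / 4" "\<theta> n \<le> 1"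
      using s_pos[of n] p_s[of n] by (auto simp: \<theta>_def N_def q_def field_simps)
    have q4: "q n \<le> 4 / real DIM('a)"
    proof -
      have "q n * N \<le> 4" using p_s[of n] s_le[of n] by (simp add: q_def N_def)
      then show ?thesis using N by (simp add: N_def field_simps)
    qed
    note fs = fractional_log_sobolev(2)[OF U_L12[of n] U_facts(3)[of n] \<epsilon> \<epsilon>1 q_pos[of n] q4 s_pos[of n] th1 _]
    have fr: "integrable lborel (\<lambda>\<xi>. br \<xi> powr s n * psd (U n) \<xi>)"
      using U_facts(1)[of n] by (simp add: frac_regular_def)
    have Ieq: "I n = (LINT x|lborel. \<bar>U n x\<bar> powr (2 + q n))" by (simp add: I_def p_eq)
    from fs[OF fr] have "I n \<le> B n powr q n * M n + B n powr q n / D * (\<theta> n * (1 + q n * N / 4) * (s n * X n) + q n * N / 4 * M n)"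
      using s_pos[of n] unfolding Ieq B_def M_def D_def N_def X_def frac_energy_def by simp
    also have "\<dots> = B n powr q n * M n + s n * (B n powr q n * (R n * X n + G n * M n))"
      using s_pos[of n] D by (simp add: R_def G_def field_simps)
    finally have "I n + \<tau> n * M n - M n \<le> B n powr q n * M n - M n + \<tau> n * M n + s n * (B n powr q n * (R n * X n + G n * M n))" by simp
    moreover have "s n * X n = I n + \<tau> n * M n - M n" using s_pos[of n] U_facts(4)[of n] by (simp add: X_def I_def M_def)
    ultimately have "s n * X n \<le> B n powr q n * M n - M n + \<tau> n * M n + s n * (B n powr q n * (R n * X n + G n * M n))" by simp
    also have "\<dots> = s n * (M n * ((B n powr q n - 1) / s n) + B n powr q n * (R n * X n + G n * M n) + \<tau> n / s n * M n)"
      using s_pos[of n] by (simp add: field_simps)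
    finally show ?thesis using s_pos[of n] by (simp only: mult_le_cancel_left_pos)
  qed
  \<comment> \<open>A common upper bound for all \<open>B n\<close>, raised to at least 1 so that
    \<open>b powr q n\<close> stays between 1 and b.\<close>
  define b where "b = max 1 (sqrt (2 * A1) / \<epsilon>)"
  have b1: "b \<ge> 1" by (simp add: b_def)
  have Bb: "B n \<le> b" for n
  proof -
    have "B n \<le> sqrt (2 * A1) / \<epsilon>" unfolding B_def using M2 \<epsilon> by (intro divide_right_mono) auto
    then show ?thesis by (simp add: b_def)
  qed
  have bq: "(\<lambda>n. (b powr q n - 1) / q n) \<longlonglongrightarrow> ln b"
    by (rule powr_minus_one_quotient_tendsto[OF q_lim]) (use q_ne b1 in auto)
  have "(\<lambda>n. (b powr q n - 1) / q n * (q n / s n)) \<longlonglongrightarrow> ln b * k" by (intro tendsto_mult bq q_s_lim)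
  moreover have "(b powr q n - 1) / q n * (q n / s n) = (b powr q n - 1) / s n" for n using q_pos[of n] by simp
  ultimately have bs: "(\<lambda>n. (b powr q n - 1) / s n) \<longlonglongrightarrow> ln b * k" by (simp only:)
  have b_lim: "(\<lambda>n. b powr q n) \<longlonglongrightarrow> 1"
  proof -
    have "(\<lambda>n. b powr q n) \<longlonglongrightarrow> b powr 0" using b1 by (intro tendsto_powr tendsto_const q_lim) auto
    then show ?thesis using b1 by simp
  qed
  obtain G1 where G1: "\<And>n. \<bar>(b powr q n - 1) / s n\<bar> \<le> G1"
    using tendsto_imp_norm_bounded[OF bs] by blast
  have Glim: "G \<longlonglongrightarrow> k * (N / 4) / D" unfolding G_def using D by (intro tendsto_divide tendsto_mult[OF q_s_lim tendsto_const] tendsto_const) auto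
  obtain G2 where G2: "\<And>n. \<bar>G n\<bar> \<le> G2"
    using tendsto_imp_norm_bounded[OF Glim] by blast
  obtain G3 where G3: "\<And>n. \<bar>\<tau> n / s n\<bar> \<le> G3"
    using tendsto_imp_norm_bounded[OF \<tau>_lim] by blast
  obtain S where S: "\<And>n. \<bar>s n / q n\<bar> \<le> S"
    using tendsto_imp_norm_bounded[OF s_q_lim] by blast
  have G0: "G n \<ge> 0" for n using q_pos[of n] s_pos[of n] N D by (simp add: G_def)
  have G2': "0 \<le> G2" "0 \<le> G3" "0 \<le> G1" using G2[of 0] G3[of 0] G1[of 0] abs_ge_zero order_trans by linarith+
  \<comment> \<open>Halfway between the limit \<kappa>/D of the absorption coefficient and
    1.\<close>
  define \<rho> where "\<rho> = (1 + \<kappa> / D) / 2"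
  have rho: "\<kappa> / D < \<rho>" "\<rho> < 1" using D by (auto simp: \<rho>_def field_simps)
  have "(\<lambda>n. b powr q n * R n) \<longlonglongrightarrow> 1 * (\<kappa> / D)" by (intro tendsto_mult b_lim R_lim)
  then have ev1: "eventually (\<lambda>n. b powr q n * R n < \<rho>) sequentially"
    using rho by (intro order_tendstoD(2)) auto
  have ev2: "eventually (\<lambda>n. s n * (G2 + G3) < 1 / 2) sequentially"
  proof -
    have "(\<lambda>n. s n * (G2 + G3)) \<longlonglongrightarrow> 0 * (G2 + G3)" by (intro tendsto_intros s_lim)
    then show ?thesis by (intro order_tendstoD(2)) auto
  qed
  obtain n0 where n0: "\<And>n. n \<ge> n0 \<Longrightarrow> b powr q n * R n < \<rho> \<and> s n * (G2 + G3) < 1 / 2"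
    using eventually_conj[OF ev1 ev2] unfolding eventually_sequentially by blast
  define A where "A = 2 * A1 + 2 * A1 * (G1 + b * G2 + G3) / (1 - \<rho>)"
  \<comment> \<open>The mass is \<epsilon>^2 B^2, so c translates a lower bound on B. The exponent
    comes from q ln B \<ge> -2 s (G2 + G3), divided by q and doubled by the square.\<close>
  define c where "c = \<epsilon>\<^sup>2 * exp (- (4 * (G2 + G3) * \<bar>S\<bar>))"
  have XA: "X n \<le> 2 * A1 * (G1 + b * G2 + G3) / (1 - \<rho>)" if n: "n \<ge> n0" for n
  proof -
    have Bq: "B n powr q n \<le> b powr q n" using B[of n] Bb[of n] q_pos[of n] by (intro powr_mono2) auto
    have bb: "b powr q n \<le> b" using powr_mono[of "q n" 1 b] q_le[of n] b1 by simp
    have t1: "M n * ((B n powr q n - 1) / s n) \<le> M n * G1"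
    proof -
      have "(B n powr q n - 1) / s n \<le> (b powr q n - 1) / s n" using Bq s_pos[of n] by (intro divide_right_mono) auto
      also have "\<dots> \<le> G1" using G1[of n] by linarith
      finally show ?thesis using M[of n] by (intro mult_left_mono) auto
    qed
    have t2: "B n powr q n * (R n * X n) \<le> \<rho> * X n"
    proof -
      have "B n powr q n * (R n * X n) \<le> b powr q n * (R n * X n)" using Bq R0[of n] X0[of n] by (intro mult_right_mono) auto
      also have "\<dots> = (b powr q n * R n) * X n" by simp
      also have "\<dots> \<le> \<rho> * X n" using n0[OF n] X0[of n] by (intro mult_right_mono) auto
      finally show ?thesis .
    qed
    have t3: "B n powr q n * (G n * M n) \<le> b * (G2 * M n)"
    proof -
      have "B n powr q n \<le> b" using Bq bb by linarith
      moreover have "G n * M n \<le> G2 * M n" using G2[of n] M[of n] by (intro mult_right_mono) auto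
      ultimately show ?thesis using G0[of n] M[of n] b1 by (intro mult_mono) auto
    qed
    have t4: "\<tau> n / s n * M n \<le> G3 * M n" using order_trans[OF abs_ge_self G3[of n]] M[of n] by (intro mult_right_mono) auto
    have "X n \<le> M n * G1 + \<rho> * X n + b * (G2 * M n) + G3 * M n"
      using main[of n] t1 t2 t3 t4 unfolding distrib_left by linarith
    then have "(1 - \<rho>) * X n \<le> M n * (G1 + b * G2 + G3)" by (simp add: algebra_simps)
    also have "\<dots> \<le> 2 * A1 * (G1 + b * G2 + G3)" using M2[of n] G2' b1 by (intro mult_right_mono) auto
    finally show ?thesis using rho by (simp add: field_simps)
  qed
  have Mc: "c \<le> M n" if n: "n \<ge> n0" for n
  proof -
    have MB: "M n = \<epsilon>\<^sup>2 * (B n)^2" using \<epsilon> M[of n] by (simp add: B_def power_divide)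
    have ex: "exp (- (4 * (G2 + G3) * \<bar>S\<bar>)) \<le> (B n)^2"
    proof (cases "B n \<ge> 1")
      case True
      have "exp (- (4 * (G2 + G3) * \<bar>S\<bar>)) \<le> 1" using G2' by simp
      also have "1 \<le> (B n)^2" using True by simp
      finally show ?thesis .
    next
      case False
      then have B1: "B n < 1" by simp
      have Bq1: "B n powr q n \<le> 1" using B[of n] B1 q_pos[of n] by (intro powr_le1) auto
      \<comment> \<open>As B < 1 and R \<le> 1, the term with X on the right is at most the X on the
        left and cancels. Only terms proportional to the mass remain, and dividing by the mass
        bounds B^q from below.\<close>
      have t2: "B n powr q n * (R n * X n) \<le> X n"
      proof -
        have "1 \<le> b powr q n" using b1 q_pos[of n] by (intro ge_one_powr_ge_zero) auto
        then have "R n \<le> b powr q n * R n" using R0[of n] by (simp add: mult_le_cancel_right1)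
        then have "R n \<le> 1" using n0[OF n] rho by linarith
        then have "R n * X n \<le> X n" using X0[of n] R0[of n] by (intro mult_left_le_one_le) auto
        moreover have "B n powr q n * (R n * X n) \<le> R n * X n" using Bq1 R0[of n] X0[of n] by (intro mult_left_le_one_le) auto
        ultimately show ?thesis by linarith
      qed
      have t3: "B n powr q n * (G n * M n) \<le> G2 * M n"
      proof -
        have "B n powr q n * (G n * M n) \<le> G n * M n" using Bq1 G0[of n] M[of n] by (intro mult_left_le_one_le) auto
        also have "\<dots> \<le> G2 * M n" using G2[of n] M[of n] by (intro mult_right_mono) auto
        finally show ?thesis .
      qed
      have t4: "\<tau> n / s n * M n \<le> G3 * M n" using order_trans[OF abs_ge_self G3[of n]] M[of n] by (intro mult_right_mono) auto
      have "0 \<le> M n * ((B n powr q n - 1) / s n) + G2 * M n + G3 * M n"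
        using main[of n] t2 t3 t4 unfolding distrib_left by linarith
      also have "\<dots> = M n * ((B n powr q n - 1) / s n + (G2 + G3))" by (simp add: algebra_simps)
      finally have "0 \<le> (B n powr q n - 1) / s n + (G2 + G3)" using M[of n] by (simp add: zero_le_mult_iff)
      then have "1 - s n * (G2 + G3) \<le> B n powr q n" using s_pos[of n] by (simp add: field_simps)
      moreover have pos: "0 < 1 - s n * (G2 + G3)" using n0[OF n] by linarith
      ultimately have "ln (1 - s n * (G2 + G3)) \<le> ln (B n powr q n)" by (subst ln_le_cancel_iff) auto
      moreover have "- (2 * (s n * (G2 + G3))) \<le> ln (1 - s n * (G2 + G3))"
      proof -
        have "0 \<le> s n * (G2 + G3)" using s_pos[of n] G2' by simp
        moreover have h: "s n * (G2 + G3) \<le> 1 / 2" using n0[OF n] by simp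
        ultimately have "- (s n * (G2 + G3)) - 2 * (s n * (G2 + G3))^2 \<le> ln (1 - s n * (G2 + G3))"
          by (rule ln_one_minus_pos_lower_bound)
        moreover have "2 * (s n * (G2 + G3))^2 \<le> s n * (G2 + G3)"
        proof -
          have "(s n * (G2 + G3)) * (s n * (G2 + G3)) \<le> (1 / 2) * (s n * (G2 + G3))"
            using h \<open>0 \<le> s n * (G2 + G3)\<close> by (intro mult_right_mono) auto
          then show ?thesis unfolding power2_eq_square by linarith
        qed
        ultimately show ?thesis by linarith
      qed
      ultimately have "- (2 * (s n * (G2 + G3))) \<le> q n * ln (B n)" using B[of n] by (simp add: ln_powr)
      then have "- (2 * (s n * (G2 + G3))) / q n \<le> ln (B n)" using q_pos[of n] by (simp add: field_simps)
      moreover have "(s n / q n) * (2 * (G2 + G3)) \<le> \<bar>S\<bar> * (2 * (G2 + G3))"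
        using order_trans[OF abs_ge_self order_trans[OF S[of n] abs_ge_self]] G2' by (intro mult_right_mono) auto
      moreover have "- (2 * (s n * (G2 + G3))) / q n = - ((s n / q n) * (2 * (G2 + G3)))" by simp
      ultimately have "- (\<bar>S\<bar> * (2 * (G2 + G3))) \<le> ln (B n)" by linarith
      then have "exp (- (\<bar>S\<bar> * (2 * (G2 + G3)))) \<le> exp (ln (B n))" by simp
      then have "exp (- (\<bar>S\<bar> * (2 * (G2 + G3)))) \<le> B n" using B[of n] by simp
      then have "(exp (- (\<bar>S\<bar> * (2 * (G2 + G3)))))^2 \<le> (B n)^2" by (intro power_mono) auto
      moreover have "(exp (- (\<bar>S\<bar> * (2 * (G2 + G3)))))^2 = exp (- (4 * (G2 + G3) * \<bar>S\<bar>))"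
        unfolding power2_eq_square mult_exp_exp by (simp add: algebra_simps)
      ultimately show ?thesis by simp
    qed
    show ?thesis unfolding c_def MB by (intro mult_left_mono ex) auto
  qed
  have pos2: "0 \<le> 2 * A1 * (G1 + b * G2 + G3) / (1 - \<rho>)" using A1pos G2' b1 rho by simp
  show ?thesis
  proof (rule that[of c n0 A])
    show "c > 0" using \<epsilon> by (simp add: c_def)
    show "mass (U n) \<le> A" if "n \<ge> n0" for n using M2[of n] pos2 by (simp add: A_def M_def)
    show "c \<le> mass (U n)" if "n \<ge> n0" for n using Mc[OF that] by (simp add: M_def)
    show "(frac_energy (s n) (U n) - mass (U n)) / s n \<le> A" if "n \<ge> n0" for n
      using XA[OF that] A1pos unfolding X_def M_def A_def by linarith
  qed
qed

end

subsection \<open>Passage to the limit\<close>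

lemma set_integral_eq_integral:
  fixes f :: "'a::euclidean_space \<Rightarrow> real"
  assumes [measurable]: "\<Omega> \<in> sets borel" "f \<in> borel_measurable borel"
    and v: "AE x in lborel. x \<notin> \<Omega> \<longrightarrow> f x = 0"
  shows "(LINT x:\<Omega>|lborel. f x) = (LINT x|lborel. f x)"
  unfolding set_lebesgue_integral_def
proof (rule integral_cong_AE)
  show "AE x in lborel. indicator \<Omega> x *\<^sub>R f x = f x"
    using v by eventually_elim (auto simp: indicator_def)
qed measurable

text \<open>Expanding Plancherel for the sum of the two functions determines the real part of the
  mixed integral, which is the part that enters the energy form.\<close>

lemma plancherel_polarized:
  fixes u \<phi> :: "'a::euclidean_space \<Rightarrow> real"
  assumes u: "u \<in> L12" and \<phi>: "\<phi> \<in> L12"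
  shows "integrable lborel (\<lambda>\<xi>. fourier \<phi> \<xi> * cnj (fourier u \<xi>))"
    and "Re (LINT \<xi>|lborel. fourier \<phi> \<xi> * cnj (fourier u \<xi>)) = (LINT x|lborel. u x * \<phi> x)"
proof -
  note [measurable] = L12_D(1)[OF u] L12_D(1)[OF \<phi>]
  show i: "integrable lborel (\<lambda>\<xi>. fourier \<phi> \<xi> * cnj (fourier u \<xi>))"
    by (rule cauchy_schwarz_integral(1)) (simp_all add: plancherel(1)[OF u] plancherel(1)[OF \<phi>])
  have j: "integrable lborel (\<lambda>\<xi>. Re (fourier \<phi> \<xi> * cnj (fourier u \<xi>)))" using i by (rule integrable_Re)
  have p: "integrable lborel (\<lambda>x. u x * \<phi> x)"
    by (rule cauchy_schwarz_integral(1)) (simp_all add: L12_D[OF u] L12_D[OF \<phi>])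
  have "(LINT \<xi>|lborel. psd (\<lambda>x. \<phi> x + u x) \<xi>) =
    (LINT \<xi>|lborel. psd \<phi> \<xi> + 2 * Re (fourier \<phi> \<xi> * cnj (fourier u \<xi>)) + psd u \<xi>)"
    by (simp only: fourier_add[OF L12_D(2)[OF \<phi>] L12_D(2)[OF u]] norm_add_square)
  also have "\<dots> = mass \<phi> + 2 * (LINT \<xi>|lborel. Re (fourier \<phi> \<xi> * cnj (fourier u \<xi>))) + mass u"
    by (simp only: Bochner_Integration.integral_add[OF Bochner_Integration.integrable_add[OF plancherel(1)[OF \<phi>] integrable_mult_right[OF j]] plancherel(1)[OF u]]
      Bochner_Integration.integral_add[OF plancherel(1)[OF \<phi>] integrable_mult_right[OF j]] plancherel(2)[OF u] plancherel(2)[OF \<phi>] integral_mult_right_zero)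
  finally have "(LINT x|lborel. (\<phi> x + u x)^2) = mass \<phi> + 2 * (LINT \<xi>|lborel. Re (fourier \<phi> \<xi> * cnj (fourier u \<xi>))) + mass u"
    using plancherel(2)[OF L12_add[OF \<phi> u]] by simp
  moreover have "(LINT x|lborel. (\<phi> x + u x)^2) = (LINT x|lborel. (\<phi> x)^2 + 2 * (u x * \<phi> x) + (u x)^2)"
    by (intro Bochner_Integration.integral_cong refl) (simp add: power2_sum)
  moreover have "(LINT x|lborel. (\<phi> x)^2 + 2 * (u x * \<phi> x) + (u x)^2) = mass \<phi> + 2 * (LINT x|lborel. u x * \<phi> x) + mass u"
    using p L12_D(3)[OF u] L12_D(3)[OF \<phi>] by simp
  ultimately have "(LINT \<xi>|lborel. Re (fourier \<phi> \<xi> * cnj (fourier u \<xi>))) = (LINT x|lborel. u x * \<phi> x)" by linarith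
  then show "Re (LINT \<xi>|lborel. fourier \<phi> \<xi> * cnj (fourier u \<xi>)) = (LINT x|lborel. u x * \<phi> x)"
    by (simp only: integral_Re[OF i])
qed

text \<open>Expanding the product around f g leaves three error terms, each small by
  Cauchy-Schwarz.\<close>

lemma L2_complex_product_tendsto:
  fixes f g :: "'a::euclidean_space \<Rightarrow> complex"
  assumes [measurable]: "\<And>n. F n \<in> borel_measurable borel" "\<And>n. G n \<in> borel_measurable borel" "f \<in> borel_measurable borel" "g \<in> borel_measurable borel"
    and f: "integrable lborel (\<lambda>x. (norm (f x))^2)" and g: "integrable lborel (\<lambda>x. (norm (g x))^2)"
    and F: "\<And>n. integrable lborel (\<lambda>x. (norm (F n x - f x))^2)" and G: "\<And>n. integrable lborel (\<lambda>x. (norm (G n x - g x))^2)"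
    and Fl: "(\<lambda>n. LINT x|lborel. (norm (F n x - f x))^2) \<longlonglongrightarrow> 0" and Gl: "(\<lambda>n. LINT x|lborel. (norm (G n x - g x))^2) \<longlonglongrightarrow> 0"
  shows "integrable lborel (\<lambda>x. F n x * G n x)"
    and "(\<lambda>n. LINT x|lborel. F n x * G n x) \<longlonglongrightarrow> (LINT x|lborel. f x * g x)"
proof -
  have i1: "integrable lborel (\<lambda>x. (F n x - f x) * (G n x - g x))" for n
    by (rule cauchy_schwarz_integral(1)) (auto intro: F G)
  have i2: "integrable lborel (\<lambda>x. (F n x - f x) * g x)" for n
    by (rule cauchy_schwarz_integral(1)) (auto intro: F g)
  have i3: "integrable lborel (\<lambda>x. f x * (G n x - g x))" for n
    by (rule cauchy_schwarz_integral(1)) (auto intro: f G)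
  have i4: "integrable lborel (\<lambda>x. f x * g x)"
    by (rule cauchy_schwarz_integral(1)) (auto intro: f g)
  have eq: "F n x * G n x = (F n x - f x) * (G n x - g x) + (F n x - f x) * g x + f x * (G n x - g x) + f x * g x" for n x
    by (simp add: algebra_simps)
  note i = Bochner_Integration.integrable_add
  show "integrable lborel (\<lambda>x. F n x * G n x)"
    unfolding eq by (intro i i1 i2 i3 i4)
  have e: "(LINT x|lborel. F n x * G n x) = (LINT x|lborel. (F n x - f x) * (G n x - g x)) + (LINT x|lborel. (F n x - f x) * g x) + (LINT x|lborel. f x * (G n x - g x)) + (LINT x|lborel. f x * g x)" for n
    unfolding eq Bochner_Integration.integral_add[OF i[OF i[OF i1 i2] i3] i4] Bochner_Integration.integral_add[OF i[OF i1 i2] i3]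
      Bochner_Integration.integral_add[OF i1 i2] ..
  have sF: "(\<lambda>n. sqrt (LINT x|lborel. (norm (F n x - f x))^2)) \<longlonglongrightarrow> 0" using tendsto_real_sqrt[OF Fl] by simp
  have sG: "(\<lambda>n. sqrt (LINT x|lborel. (norm (G n x - g x))^2)) \<longlonglongrightarrow> 0" using tendsto_real_sqrt[OF Gl] by simp
  have l1: "(\<lambda>n. LINT x|lborel. (F n x - f x) * (G n x - g x)) \<longlonglongrightarrow> 0"
    by (rule Lim_null_comparison[OF always_eventually tendsto_mult_zero[OF sF sG]])
       (intro allI cauchy_schwarz_integral(2) F G, measurable)
  have l2: "(\<lambda>n. LINT x|lborel. (F n x - f x) * g x) \<longlonglongrightarrow> 0"
    by (rule Lim_null_comparison[OF always_eventually tendsto_mult_left_zero[OF sF, of "sqrt (LINT x|lborel. (norm (g x))^2)"]])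
       (intro allI cauchy_schwarz_integral(2) F g, measurable)
  have l3: "(\<lambda>n. LINT x|lborel. f x * (G n x - g x)) \<longlonglongrightarrow> 0"
    by (rule Lim_null_comparison[OF always_eventually tendsto_mult_right_zero[OF sG, of "sqrt (LINT x|lborel. (norm (f x))^2)"]])
       (intro allI cauchy_schwarz_integral(2) f G, measurable)
  have "(\<lambda>n. (LINT x|lborel. (F n x - f x) * (G n x - g x)) + (LINT x|lborel. (F n x - f x) * g x) + (LINT x|lborel. f x * (G n x - g x)) + (LINT x|lborel. f x * g x)) \<longlonglongrightarrow> 0 + 0 + 0 + (LINT x|lborel. f x * g x)"
    by (intro tendsto_add l1 l2 l3 tendsto_const)
  then show "(\<lambda>n. LINT x|lborel. F n x * G n x) \<longlonglongrightarrow> (LINT x|lborel. f x * g x)" unfolding e by simp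
qed

text \<open>A bound by sqrt x instead of x makes the product with the transform of an H^1 function
  square integrable, so it can be paired with a sequence converging only in L2. The square root
  arises by applying the linear bound to sqrt x with exponent 2 s.\<close>

lemma symbol_quotient_sqrt_bound:
  fixes x s :: real
  assumes s: "0 < s" "s \<le> 1 / 2" and x: "1 \<le> x"
  shows "0 \<le> (x powr s - 1) / s" "(x powr s - 1) / s \<le> 2 * sqrt x" "0 \<le> ln x" "ln x \<le> 2 * sqrt x"
proof -
  have "1 \<le> x powr s" using s x by (intro ge_one_powr_ge_zero) auto
  then show "0 \<le> (x powr s - 1) / s" using s by simp
  have s1: "1 \<le> sqrt x" using x by simp
  have "x powr s = sqrt x powr (2 * s)" using x by (simp add: powr_half_sqrt[symmetric] powr_powr)
  also have "\<dots> \<le> 1 + 2 * s * (sqrt x - 1)" using s s1 by (intro powr_le_linear) auto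
  finally have "x powr s - 1 \<le> s * (2 * sqrt x)" using s by (simp add: algebra_simps)
  then show "(x powr s - 1) / s \<le> 2 * sqrt x" using s by (simp add: field_simps)
  show "0 \<le> ln x" using x by simp
  have "ln (sqrt x) \<le> sqrt x - 1" using s1 by (intro ln_le_minus_one) linarith
  then show "ln x \<le> 2 * sqrt x" using x by (simp add: ln_sqrt)
qed

text \<open>After subtracting the L2 pairing and dividing by s, the whole symbol quotient is placed
  on the test function. That factor converges in L2, and so do the transforms of \<open>u n\<close>,
  hence their pairing converges.\<close>

lemma E_frac_weak_limit:
  fixes u :: "nat \<Rightarrow> 'a::euclidean_space \<Rightarrow> real"
  assumes \<phi>: "test_function \<Omega> \<phi>" and u: "\<And>n. u n \<in> L12" and v: "log_regular v"
    and l: "(\<lambda>n. LINT x|lborel. (u n x - v x)^2) \<longlonglongrightarrow> 0"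
    and s: "\<And>n. 0 < s n" "\<And>n. s n \<le> 1 / 2" "s \<longlonglongrightarrow> 0"
  shows "(\<lambda>n. (E_frac (s n) (u n) \<phi> - (LINT x|lborel. u n x * \<phi> x)) / s n) \<longlonglongrightarrow> E_log v \<phi>"
proof -
  have L: "\<phi> \<in> L12" and i: "integrable lborel (\<lambda>\<xi>. br \<xi> * psd \<phi> \<xi>)"
    using \<phi> by (auto simp: test_function_def)
  have vL: "v \<in> L12" using v by (simp add: log_regular_def)
  note [measurable] = L12_D(1)[OF L] L12_D(1)[OF u] L12_D(1)[OF vL]
  let ?o = "\<lambda>\<xi>::'a. 1 + (norm \<xi>)^2"
  define m where "m n \<xi> = (?o \<xi> powr s n - 1) / s n" for n \<xi>
  have [measurable]: "m n \<in> borel_measurable borel" for n unfolding m_def by measurable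
  have sne: "s n \<noteq> 0" for n using s(1)[of n] by simp
  define F where "F n \<xi> = complex_of_real (m n \<xi>) * fourier \<phi> \<xi>" for n \<xi>
  define f where "f \<xi> = complex_of_real (ln (?o \<xi>)) * fourier \<phi> \<xi>" for \<xi>
  define G where "G n \<xi> = cnj (fourier (u n) \<xi>)" for n \<xi>
  define g where "g \<xi> = cnj (fourier v \<xi>)" for \<xi>
  have [measurable]: "F n \<in> borel_measurable borel" "f \<in> borel_measurable borel" "G n \<in> borel_measurable borel" "g \<in> borel_measurable borel" for n
    unfolding F_def f_def G_def g_def by measurable
  have i4: "integrable lborel (\<lambda>\<xi>. 4 * (?o \<xi> * psd \<phi> \<xi>))" using i by simp
  have o1: "1 \<le> ?o \<xi>" for \<xi> by (rule one_plus_square_ge_1)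
  note sb = symbol_quotient_sqrt_bound[OF s(1,2) o1]
  have sq4: "(2 * sqrt (?o \<xi>))^2 = 4 * ?o \<xi>" for \<xi> by (simp add: power_mult_distrib add_nonneg_nonneg)
  have bd1: "(ln (?o \<xi>))^2 \<le> 4 * ?o \<xi>" for \<xi>
    using power_mono[OF sb(4)[of \<xi>] sb(3)[of \<xi>], of 2] unfolding sq4 by simp
  have bd2: "(m n \<xi> - ln (?o \<xi>))^2 \<le> 4 * ?o \<xi>" for n \<xi>
  proof -
    have "\<bar>m n \<xi> - ln (?o \<xi>)\<bar> \<le> 2 * sqrt (?o \<xi>)"
      using sb(1)[of \<xi> n] sb(2)[of \<xi> n] sb(3)[of \<xi>] sb(4)[of \<xi>] unfolding m_def by linarith
    then have "\<bar>m n \<xi> - ln (?o \<xi>)\<bar>\<^sup>2 \<le> (2 * sqrt (?o \<xi>))^2" by (intro power_mono) auto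
    then show ?thesis unfolding sq4 by simp
  qed
  have nf: "(norm (f \<xi>))^2 = (ln (?o \<xi>))^2 * psd \<phi> \<xi>" for \<xi>
    by (simp add: f_def norm_mult power_mult_distrib)
  have nF: "(norm (F n \<xi> - f \<xi>))^2 = (m n \<xi> - ln (?o \<xi>))^2 * psd \<phi> \<xi>" for n \<xi>
  proof -
    have "F n \<xi> - f \<xi> = complex_of_real (m n \<xi> - ln (?o \<xi>)) * fourier \<phi> \<xi>"
      by (simp add: F_def f_def left_diff_distrib)
    then show ?thesis by (simp only: norm_mult power_mult_distrib norm_of_real power2_abs)
  qed
  have b1: "(norm (f \<xi>))^2 \<le> 4 * (?o \<xi> * psd \<phi> \<xi>)" for \<xi>
    unfolding nf using mult_right_mono[OF bd1[of \<xi>], of "psd \<phi> \<xi>"] by (simp only: mult.assoc zero_le_power2)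
  have b2: "(norm (F n \<xi> - f \<xi>))^2 \<le> 4 * (?o \<xi> * psd \<phi> \<xi>)" for n \<xi>
    unfolding nF using mult_right_mono[OF bd2[of n \<xi>], of "psd \<phi> \<xi>"] by (simp only: mult.assoc zero_le_power2)
  have f2: "integrable lborel (\<lambda>\<xi>. (norm (f \<xi>))^2)"
    by (rule Bochner_Integration.integrable_bound[OF i4]) (measurable, use b1 in \<open>auto intro!: order_trans[OF _ abs_ge_self]\<close>)
  have F2: "integrable lborel (\<lambda>\<xi>. (norm (F n \<xi> - f \<xi>))^2)" for n
    by (rule Bochner_Integration.integrable_bound[OF i4]) (measurable, use b2 in \<open>auto intro!: order_trans[OF _ abs_ge_self]\<close>)
  have Fl: "(\<lambda>n. LINT \<xi>|lborel. (norm (F n \<xi> - f \<xi>))^2) \<longlonglongrightarrow> (LINT \<xi>|(lborel :: 'a measure). (0::real))"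
  proof (rule integral_dominated_convergence[where w = "\<lambda>\<xi>. 4 * (?o \<xi> * psd \<phi> \<xi>)"])
    show "AE \<xi> in lborel. (\<lambda>n. (norm (F n \<xi> - f \<xi>))^2) \<longlonglongrightarrow> 0"
    proof (rule AE_I2)
      fix \<xi>
      have "(\<lambda>n. m n \<xi>) \<longlonglongrightarrow> ln (?o \<xi>)" unfolding m_def
        using o1[of \<xi>] by (intro powr_minus_one_quotient_tendsto s(3) sne) linarith
      then have "(\<lambda>n. (m n \<xi> - ln (?o \<xi>))^2 * psd \<phi> \<xi>) \<longlonglongrightarrow> (ln (?o \<xi>) - ln (?o \<xi>))\<^sup>2 * psd \<phi> \<xi>"
        by (intro tendsto_mult tendsto_power tendsto_diff tendsto_const)
      then show "(\<lambda>n. (norm (F n \<xi> - f \<xi>))^2) \<longlonglongrightarrow> 0" unfolding nF by simp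
    qed
    show "AE \<xi> in lborel. norm ((norm (F n \<xi> - f \<xi>))^2) \<le> 4 * (?o \<xi> * psd \<phi> \<xi>)" for n
      using b2 by simp
  qed (use i4 in measurable)
  have nG: "norm (G n \<xi> - g \<xi>) = norm (fourier (\<lambda>x. u n x - v x) \<xi>)" for n \<xi>
  proof -
    have "G n \<xi> - g \<xi> = cnj (fourier (\<lambda>x. u n x - v x) \<xi>)"
      by (simp add: G_def g_def fourier_diff[OF L12_D(2)[OF u] L12_D(2)[OF vL]])
    then show ?thesis by simp
  qed
  have d: "(\<lambda>x. u n x - v x) \<in> L12" for n by (rule L12_diff[OF u vL])
  have G2: "integrable lborel (\<lambda>\<xi>. (norm (G n \<xi> - g \<xi>))^2)" for n unfolding nG by (rule plancherel(1)[OF d])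
  have Gl: "(\<lambda>n. LINT \<xi>|lborel. (norm (G n \<xi> - g \<xi>))^2) \<longlonglongrightarrow> 0" unfolding nG plancherel(2)[OF d] by (rule l)
  have g2: "integrable lborel (\<lambda>\<xi>. (norm (g \<xi>))^2)" using plancherel(1)[OF vL] by (simp add: g_def)
  have Fl0: "(\<lambda>n. LINT \<xi>|lborel. (norm (F n \<xi> - f \<xi>))^2) \<longlonglongrightarrow> 0" using Fl by simp
  note P = L2_complex_product_tendsto[of F G f g, OF _ _ _ _ f2 g2 F2 G2 Fl0 Gl]
  have FG: "integrable lborel (\<lambda>\<xi>. F n \<xi> * G n \<xi>)" for n by (rule P(1)) measurable
  have lim: "(\<lambda>n. LINT \<xi>|lborel. F n \<xi> * G n \<xi>) \<longlonglongrightarrow> (LINT \<xi>|lborel. f \<xi> * g \<xi>)" by (rule P(2)) measurable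
  have fg: "integrable lborel (\<lambda>\<xi>. f \<xi> * g \<xi>)" by (rule cauchy_schwarz_integral(1)) (auto intro: f2 g2)
  have "E_frac (s n) (u n) \<phi> = s n * Re (LINT \<xi>|lborel. F n \<xi> * G n \<xi>) + (LINT x|lborel. u n x * \<phi> x)" for n
  proof -
    have "complex_of_real (?o \<xi> powr s n) * fourier \<phi> \<xi> * cnj (fourier (u n) \<xi>) =
      complex_of_real (s n) * (F n \<xi> * G n \<xi>) + fourier \<phi> \<xi> * cnj (fourier (u n) \<xi>)" for \<xi>
    proof -
      have "complex_of_real (?o \<xi> powr s n) = complex_of_real (s n) * complex_of_real (m n \<xi>) + 1"
        unfolding of_real_mult[symmetric] using sne[of n] by (simp add: m_def)
      then show ?thesis by (simp add: F_def G_def algebra_simps)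
    qed
    then show ?thesis
      using FG[of n] plancherel_polarized[OF u[of n] L] by (simp add: E_frac_def)
  qed
  then have "(E_frac (s n) (u n) \<phi> - (LINT x|lborel. u n x * \<phi> x)) / s n = Re (LINT \<xi>|lborel. F n \<xi> * G n \<xi>)" for n
    using sne[of n] by simp
  moreover have "E_log v \<phi> = Re (LINT \<xi>|lborel. f \<xi> * g \<xi>)"
  proof -
    have "ln (?o \<xi>) * Re (fourier v \<xi> * cnj (fourier \<phi> \<xi>)) = Re (f \<xi> * g \<xi>)" for \<xi>
      by (simp add: f_def g_def algebra_simps)
    then show ?thesis unfolding E_log_fourier[OF v test_function_log_regular[OF \<phi>]] using fg by (simp only: integral_Re)
  qed
  ultimately show ?thesis using tendsto_Re[OF lim] by (simp only:)
qed

text \<open>The factor u (|u|^q - 1)/q is at most u^2 + 1 in size. After pairing with a bounded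
  integrable function it is dominated through the majorant H of the squares, which the geometric
  rate provides.\<close>

lemma nonlinearity_limit:
  fixes u :: "nat \<Rightarrow> 'a::euclidean_space \<Rightarrow> real"
  assumes \<phi>: "\<phi> \<in> L12" and C: "\<And>x. \<bar>\<phi> x\<bar> \<le> C" and u: "\<And>n. u n \<in> L12" and v: "v \<in> L12"
    and fast: "\<And>n. (\<integral>\<^sup>+x. ennreal ((u n x - v x)^2) \<partial>lborel) \<le> ennreal ((1 / 4) ^ n)"
    and q: "\<And>n. 0 < q n" "\<And>n. q n \<le> 1" "q \<longlonglongrightarrow> 0"
  shows "integrable lborel (\<lambda>x. u n x * ((\<bar>u n x\<bar> powr q n - 1) / q n) * \<phi> x)"
    and "(\<lambda>n. LINT x|lborel. u n x * ((\<bar>u n x\<bar> powr q n - 1) / q n) * \<phi> x) \<longlonglongrightarrow> (LINT x|lborel. \<phi> x * v x * ln \<bar>v x\<bar>)"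
proof -
  note [measurable] = L12_D(1)[OF \<phi>] L12_D(1)[OF u] L12_D(1)[OF v]
  have C0: "0 \<le> C" using C[of 0] by linarith
  note fc = fast_L2_convergence[OF L12_D(1)[OF u] L12_D(1)[OF v] L12_D(3)[OF v] fast]
  obtain H where H: "integrable lborel H" "\<And>n. AE x in lborel. (u n x)^2 \<le> H x" using fc(2) by blast
  note [measurable] = borel_measurable_integrable[OF H(1), unfolded measurable_lborel1]
  let ?h = "\<lambda>n x. u n x * ((\<bar>u n x\<bar> powr q n - 1) / q n) * \<phi> x"
  have bound: "AE x in lborel. norm (?h n x) \<le> C * H x + \<bar>\<phi> x\<bar>" for n
    using H(2)[of n]
  proof eventually_elim
    case (elim x)
    have "\<bar>\<bar>u n x\<bar> * ((\<bar>u n x\<bar> powr q n - 1) / q n)\<bar> \<le> \<bar>u n x\<bar>\<^sup>2 + (if \<bar>u n x\<bar> < 1 then 1 else 0)"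
      by (rule powr_quotient_bound(1)[OF q(1,2)]) simp
    also have "\<dots> \<le> H x + 1" using elim by simp
    finally have "\<bar>u n x * ((\<bar>u n x\<bar> powr q n - 1) / q n)\<bar> \<le> H x + 1" by (simp add: abs_mult)
    then have "\<bar>?h n x\<bar> \<le> (H x + 1) * \<bar>\<phi> x\<bar>" unfolding abs_mult[of _ "\<phi> x"] by (rule mult_right_mono) simp
    also have "\<dots> = H x * \<bar>\<phi> x\<bar> + \<bar>\<phi> x\<bar>" by (simp add: distrib_right)
    also have "H x * \<bar>\<phi> x\<bar> \<le> H x * C"
      using order_trans[OF zero_le_power2 elim] by (intro mult_left_mono C)
    finally show ?case by (simp add: mult.commute)
  qed
  have iw: "integrable lborel (\<lambda>x. C * H x + \<bar>\<phi> x\<bar>)" using H(1) L12_D(2)[OF \<phi>] by simp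
  have lim: "AE x in lborel. (\<lambda>n. ?h n x) \<longlonglongrightarrow> v x * ln \<bar>v x\<bar> * \<phi> x"
    using fc(1) by eventually_elim (intro tendsto_mult[OF powr_quotient_continuous tendsto_const] q)
  have mh: "?h n \<in> borel_measurable lborel" for n by measurable
  have ml: "(\<lambda>x. v x * ln \<bar>v x\<bar> * \<phi> x) \<in> borel_measurable lborel" by measurable
  show "integrable lborel (?h n)"
    by (rule integrable_dominated_convergence2[OF ml mh iw lim bound])
  have "(\<lambda>n. LINT x|lborel. ?h n x) \<longlonglongrightarrow> (LINT x|lborel. v x * ln \<bar>v x\<bar> * \<phi> x)"
    by (rule integral_dominated_convergence[OF ml mh iw lim bound])
  then show "(\<lambda>n. LINT x|lborel. ?h n x) \<longlonglongrightarrow> (LINT x|lborel. \<phi> x * v x * ln \<bar>v x\<bar>)"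
    by (simp only: mult_ac)
qed

text \<open>The errors are chosen below (1/4)^(j+1): the rate gives almost everywhere convergence,
  and the bound 1/4 puts every difference in the range of \<open>log_sobolev_small\<close>, which
  forces its entropy to 0.\<close>

lemma test_function_approximation:
  fixes \<Omega> :: "'a::euclidean_space set" and u :: "'a \<Rightarrow> real"
  assumes bd: "bounded \<Omega>" and lip: "lipschitz_domain \<Omega>" and u: "log_regular u" and van: "vanishes_outside \<Omega> u"
  obtains w where "\<And>j. test_function \<Omega> (w j)" "(\<lambda>j. log_energy (\<lambda>x. u x - w j x)) \<longlonglongrightarrow> 0"
    "(\<lambda>j. LINT x|lborel. (u x - w j x)^2) \<longlonglongrightarrow> 0" "(\<lambda>j. LINT x|lborel. \<bar>u x - w j x\<bar>) \<longlonglongrightarrow> 0"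
    "AE x in lborel. (\<lambda>j. w j x) \<longlonglongrightarrow> u x"
    "(\<lambda>j. LINT x|lborel. (u x - w j x)^2 * ln (max 1 \<bar>u x - w j x\<bar>)) \<longlonglongrightarrow> 0"
proof -
  have uL: "u \<in> L12" using u by (simp add: log_regular_def)
  let ?P = "\<lambda>j w. test_function \<Omega> w \<and> log_energy (\<lambda>x. u x - w x) < (1 / 4) ^ Suc j \<and> (LINT x|lborel. (u x - w x)^2) < (1 / 4) ^ Suc j"
  have "\<exists>w. ?P j w" for j
  proof -
    have "(0::real) < (1 / 4) ^ Suc j" by simp
    from test_functions_dense[OF bd lip u van this] show ?thesis by blast
  qed
  then have "\<exists>w. \<forall>j. ?P j (w j)" by (intro choice) blast
  then obtain w where w: "\<And>j. test_function \<Omega> (w j)" "\<And>j. log_energy (\<lambda>x. u x - w j x) < (1 / 4) ^ Suc j"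
    "\<And>j. (LINT x|lborel. (u x - w j x)^2) < (1 / 4) ^ Suc j" by blast
  have wr: "log_regular (w j)" for j by (rule test_function_log_regular[OF w(1)])
  have wL: "w j \<in> L12" for j using wr by (simp add: log_regular_def)
  have d: "log_regular (\<lambda>x. u x - w j x)" for j by (rule log_regular_combination(2)[OF u wr])
  have dL: "(\<lambda>x. u x - w j x) \<in> L12" for j by (rule L12_diff[OF uL wL])
  note [measurable] = L12_D(1)[OF uL] L12_D(1)[OF wL]
  have geo: "(\<lambda>j. (1 / 4 :: real) ^ Suc j) \<longlonglongrightarrow> 0"
    by (rule LIMSEQ_Suc) (simp add: LIMSEQ_power_zero)
  have E: "(\<lambda>j. log_energy (\<lambda>x. u x - w j x)) \<longlonglongrightarrow> 0"
    by (rule real_tendsto_sandwich[OF always_eventually always_eventually tendsto_const geo])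
       (use log_energy_nonneg w(2) in \<open>auto intro: less_imp_le\<close>)
  have M: "(\<lambda>j. LINT x|lborel. (u x - w j x)^2) \<longlonglongrightarrow> 0"
    by (rule real_tendsto_sandwich[OF always_eventually always_eventually tendsto_const geo])
       (use w(3) in \<open>auto intro: less_imp_le\<close>)
  have dv: "vanishes_outside \<Omega> (\<lambda>x. u x - w j x)" for j
  proof -
    have "w j x = 0" if "x \<notin> \<Omega>" for x using w(1)[of j] that by (simp add: test_function_def)
    then show ?thesis using van unfolding vanishes_outside_def by auto
  qed
  obtain C where C: "\<And>u. u \<in> L12 \<Longrightarrow> vanishes_outside \<Omega> u \<Longrightarrow> (LINT x|lborel. \<bar>u x\<bar>) \<le> C * sqrt (mass u)"
    using L1_le_L2_bounded_support[OF bd] by blast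
  have A: "(\<lambda>j. LINT x|lborel. \<bar>u x - w j x\<bar>) \<longlonglongrightarrow> 0"
  proof (rule real_tendsto_sandwich[OF always_eventually always_eventually tendsto_const])
    show "\<forall>j. 0 \<le> (LINT x|lborel. \<bar>u x - w j x\<bar>)" by simp
    show "\<forall>j. (LINT x|lborel. \<bar>u x - w j x\<bar>) \<le> C * sqrt (LINT x|lborel. (u x - w j x)^2)" using C[OF dL dv] by blast
    show "(\<lambda>j. C * sqrt (LINT x|lborel. (u x - w j x)^2)) \<longlonglongrightarrow> 0"
      using tendsto_mult[OF tendsto_const[of C] tendsto_real_sqrt[OF M]] by simp
  qed
  have fast: "(\<integral>\<^sup>+x. ennreal ((w j x - u x)^2) \<partial>lborel) \<le> ennreal ((1 / 4) ^ j)" for j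
  proof -
    have "(\<integral>\<^sup>+x. ennreal ((w j x - u x)^2) \<partial>lborel) = ennreal (LINT x|lborel. (u x - w j x)^2)"
      unfolding power2_commute[of "w j _"] by (rule nn_integral_eq_integral[OF L12_D(3)[OF dL]]) simp
    also have "\<dots> \<le> ennreal ((1 / 4) ^ Suc j)" using w(3)[of j] by (intro ennreal_leI) linarith
    also have "\<dots> \<le> ennreal ((1 / 4) ^ j)" by (intro ennreal_leI) simp
    finally show ?thesis .
  qed
  have P: "AE x in lborel. (\<lambda>j. w j x) \<longlonglongrightarrow> u x"
    by (rule fast_L2_convergence(1)[OF L12_D(1)[OF wL] L12_D(1)[OF uL] L12_D(3)[OF uL] fast])
  have S: "(\<lambda>j. LINT x|lborel. (u x - w j x)^2 * ln (max 1 \<bar>u x - w j x\<bar>)) \<longlonglongrightarrow> 0"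
  proof (rule real_tendsto_sandwich[OF always_eventually always_eventually tendsto_const])
    show "\<forall>j. 0 \<le> (LINT x|lborel. (u x - w j x)^2 * ln (max 1 \<bar>u x - w j x\<bar>))"
      by (intro allI integral_nonneg_AE AE_I2) simp
    show "\<forall>j. (LINT x|lborel. (u x - w j x)^2 * ln (max 1 \<bar>u x - w j x\<bar>)) \<le>
      real DIM('a) * (log_energy (\<lambda>x. u x - w j x) + (LINT x|lborel. (u x - w j x)^2))"
    proof
      fix j
      have "(1 / 4 :: real) ^ Suc j \<le> 1 / 4" by (simp add: power_le_one)
      then have "(LINT x|lborel. (u x - w j x)^2) \<le> 1 / 4" using w(3)[of j] by linarith
      note sob = log_sobolev_small[OF d this]
      have "ennreal (LINT x|lborel. (u x - w j x)^2 * ln (max 1 \<bar>u x - w j x\<bar>)) =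
        (\<integral>\<^sup>+x. ennreal ((u x - w j x)^2 * ln (max 1 \<bar>u x - w j x\<bar>)) \<partial>lborel)"
        by (rule nn_integral_eq_integral[OF log_regular_integrable[OF d], symmetric]) simp
      also note sob
      finally show "(LINT x|lborel. (u x - w j x)^2 * ln (max 1 \<bar>u x - w j x\<bar>)) \<le>
        real DIM('a) * (log_energy (\<lambda>x. u x - w j x) + (LINT x|lborel. (u x - w j x)^2))"
        by (subst (asm) ennreal_le_iff) (intro mult_nonneg_nonneg add_nonneg_nonneg log_energy_nonneg, simp_all)
    qed
    show "(\<lambda>j. real DIM('a) * (log_energy (\<lambda>x. u x - w j x) + (LINT x|lborel. (u x - w j x)^2))) \<longlonglongrightarrow> 0"
      using tendsto_mult[OF tendsto_const[of "real DIM('a)"] tendsto_add[OF E M]] by simp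
  qed
  show ?thesis by (rule that[OF w(1) E M A P S])
qed

text \<open>The \<open>\<psi> j\<close> come with no common majorant. After removing |\<psi>| and
  \<psi>^2 ln(max 1 |\<psi>|), whose integrals tend to 0, the excess of the integrand is dominated
  by the entropy density of v alone, and dominated convergence applies to it.\<close>

lemma entropy_pairing_tendsto_0:
  fixes v :: "'a::euclidean_space \<Rightarrow> real"
  assumes v: "log_regular v" and \<psi>: "\<And>j. log_regular (\<psi> j)"
    and A: "(\<lambda>j. LINT x|lborel. \<bar>\<psi> j x\<bar>) \<longlonglongrightarrow> 0" and P: "AE x in lborel. (\<lambda>j. \<psi> j x) \<longlonglongrightarrow> 0"
    and S: "(\<lambda>j. LINT x|lborel. (\<psi> j x)^2 * ln (max 1 \<bar>\<psi> j x\<bar>)) \<longlonglongrightarrow> 0"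
  shows "(\<lambda>j. LINT x|lborel. \<psi> j x * v x * ln \<bar>v x\<bar>) \<longlonglongrightarrow> 0"
proof -
  have vL: "v \<in> L12" and pL: "\<psi> j \<in> L12" for j using v \<psi> by (auto simp: log_regular_def)
  note [measurable] = L12_D(1)[OF vL] L12_D(1)[OF pL]
  define b where "b j x = (\<psi> j x)^2 * ln (max 1 \<bar>\<psi> j x\<bar>)" for j x
  define g where "g j x = max 0 (\<bar>\<psi> j x * v x * ln \<bar>v x\<bar>\<bar> - b j x - \<bar>\<psi> j x\<bar>)" for j x
  have [measurable]: "b j \<in> borel_measurable borel" "g j \<in> borel_measurable borel" for j unfolding b_def g_def by measurable
  have b0: "0 \<le> b j x" for j x by (simp add: b_def)
  have ib: "integrable lborel (b j)" for j unfolding b_def by (rule log_regular_integrable[OF \<psi>])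
  have ih: "integrable lborel (\<lambda>x. (v x)^2 * ln (max 1 \<bar>v x\<bar>))" by (rule log_regular_integrable[OF v])
  have gb: "norm (g j x) \<le> (v x)^2 * ln (max 1 \<bar>v x\<bar>)" for j x
  proof -
    have "0 \<le> (v x)^2 * ln (max 1 \<bar>v x\<bar>)" by simp
    then show ?thesis using abs_mult_ln_le[of "\<psi> j x" "v x"] unfolding g_def b_def by simp
  qed
  have mg: "g j \<in> borel_measurable lborel" for j by measurable
  have ig: "integrable lborel (g j)" for j
    by (rule Bochner_Integration.integrable_bound[OF ih mg]) (use gb in \<open>auto intro!: order_trans[OF _ abs_ge_self]\<close>)
  have gl: "(\<lambda>j. LINT x|lborel. g j x) \<longlonglongrightarrow> (LINT x|(lborel :: 'a measure). (0::real))"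
  proof (rule integral_dominated_convergence[OF _ mg ih])
    show "AE x in lborel. (\<lambda>j. g j x) \<longlonglongrightarrow> 0"
      using P
    proof eventually_elim
      case (elim x)
      show ?case
      proof (rule real_tendsto_sandwich[OF always_eventually always_eventually tendsto_const])
        show "\<forall>j. 0 \<le> g j x" by (simp add: g_def)
        show "\<forall>j. g j x \<le> \<bar>\<psi> j x\<bar> * \<bar>v x * ln \<bar>v x\<bar>\<bar>"
        proof
          fix j
          have "\<bar>\<psi> j x * v x * ln \<bar>v x\<bar>\<bar> = \<bar>\<psi> j x\<bar> * \<bar>v x * ln \<bar>v x\<bar>\<bar>" by (simp add: abs_mult)
          moreover have "0 \<le> \<bar>\<psi> j x\<bar> * \<bar>v x * ln \<bar>v x\<bar>\<bar>" by simp
          ultimately show "g j x \<le> \<bar>\<psi> j x\<bar> * \<bar>v x * ln \<bar>v x\<bar>\<bar>" using b0[of j x] unfolding g_def by linarith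
        qed
        show "(\<lambda>j. \<bar>\<psi> j x\<bar> * \<bar>v x * ln \<bar>v x\<bar>\<bar>) \<longlonglongrightarrow> 0"
          by (intro tendsto_mult_left_zero tendsto_rabs_zero elim)
      qed
    qed
  qed (use gb in auto)
  have "(\<lambda>j. (LINT x|lborel. g j x) + (LINT x|lborel. b j x) + (LINT x|lborel. \<bar>\<psi> j x\<bar>)) \<longlonglongrightarrow> 0 + 0 + 0"
    using gl S by (intro tendsto_add A) (simp_all add: b_def)
  then have up: "(\<lambda>j. (LINT x|lborel. g j x) + (LINT x|lborel. b j x) + (LINT x|lborel. \<bar>\<psi> j x\<bar>)) \<longlonglongrightarrow> 0" by simp
  show ?thesis
  proof (rule Lim_null_comparison[OF always_eventually up], rule allI)
    fix j
    have ip: "integrable lborel (\<lambda>x. \<psi> j x * v x * ln \<bar>v x\<bar>)" by (rule log_regular_product_integrable[OF v \<psi>])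
    have ia: "integrable lborel (\<lambda>x. \<bar>\<psi> j x\<bar>)" using L12_D(2)[OF pL] by simp
    have "norm (LINT x|lborel. \<psi> j x * v x * ln \<bar>v x\<bar>) \<le> (LINT x|lborel. norm (\<psi> j x * v x * ln \<bar>v x\<bar>))"
      by (rule integral_norm_bound)
    also have "\<dots> \<le> (LINT x|lborel. g j x + b j x + \<bar>\<psi> j x\<bar>)"
    proof (rule integral_mono)
      show "integrable lborel (\<lambda>x. norm (\<psi> j x * v x * ln \<bar>v x\<bar>))" using ip by (rule integrable_norm)
      show "integrable lborel (\<lambda>x. g j x + b j x + \<bar>\<psi> j x\<bar>)" by (intro Bochner_Integration.integrable_add ig ib ia)
      show "norm (\<psi> j x * v x * ln \<bar>v x\<bar>) \<le> g j x + b j x + \<bar>\<psi> j x\<bar>" for x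
        unfolding g_def real_norm_def by linarith
    qed
    also have "\<dots> = (LINT x|lborel. g j x) + (LINT x|lborel. b j x) + (LINT x|lborel. \<bar>\<psi> j x\<bar>)"
      unfolding Bochner_Integration.integral_add[OF Bochner_Integration.integrable_add[OF ig ib] ia] Bochner_Integration.integral_add[OF ig ib] ..
    finally show "norm (LINT x|lborel. \<psi> j x * v x * ln \<bar>v x\<bar>) \<le> (LINT x|lborel. g j x) + (LINT x|lborel. b j x) + (LINT x|lborel. \<bar>\<psi> j x\<bar>)" .
  qed
qed

lemma mult_ln_abs_tendsto:
  fixes t :: "nat \<Rightarrow> real"
  assumes t: "t \<longlonglongrightarrow> l"
  shows "(\<lambda>n. t n * ln \<bar>t n\<bar>) \<longlonglongrightarrow> l * ln \<bar>l\<bar>"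
proof (cases "l = 0")
  case True
  have "((\<lambda>x::real. x * ln \<bar>x\<bar>) \<longlongrightarrow> 0) (at_right 0)" "((\<lambda>x::real. x * ln \<bar>x\<bar>) \<longlongrightarrow> 0) (at_left 0)"
    by real_asymp+
  then have "isCont (\<lambda>x::real. x * ln \<bar>x\<bar>) 0" by (simp add: isCont_def filterlim_at_split)
  from isCont_tendsto_compose[OF this, of t] t True show ?thesis by simp
next
  case False
  then show ?thesis by (intro tendsto_mult tendsto_ln tendsto_rabs t) simp
qed

text \<open>As \<open>t\<^sup>2 ln \<bar>t\<bar> + \<bar>t\<bar>\<close> is nonnegative, dominated convergence applies to the positive part of the
  difference.\<close>

lemma entropy_lower_semicontinuous:
  fixes u :: "'a::euclidean_space \<Rightarrow> real"
  assumes u: "log_regular u" and w: "\<And>j. log_regular (w j)"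
    and A: "(\<lambda>j. LINT x|lborel. \<bar>u x - w j x\<bar>) \<longlonglongrightarrow> 0" and P: "AE x in lborel. (\<lambda>j. w j x) \<longlonglongrightarrow> u x"
  obtains \<delta> where "\<delta> \<longlonglongrightarrow> 0" "\<And>j. (LINT x|lborel. (u x)^2 * ln \<bar>u x\<bar>) \<le> (LINT x|lborel. (w j x)^2 * ln \<bar>w j x\<bar>) + \<delta> j"
proof -
  have uL: "u \<in> L12" and wL: "w j \<in> L12" for j using u w by (auto simp: log_regular_def)
  note [measurable] = L12_D(1)[OF uL] L12_D(1)[OF wL]
  define F where "F t = t\<^sup>2 * ln \<bar>t\<bar> + \<bar>t\<bar>" for t :: real
  have [measurable]: "F \<in> borel_measurable borel" unfolding F_def by measurable
  have F0: "0 \<le> F t" for t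
  proof (cases "t = 0")
    case False
    have aux: "a\<^sup>2 * (1 - 1 / a) = a\<^sup>2 - a" if "a \<noteq> 0" for a :: real
      using that by (simp add: right_diff_distrib power2_eq_square)
    have "1 - 1 / \<bar>t\<bar> \<le> ln \<bar>t\<bar>" using ln_le_minus_one[of "1 / \<bar>t\<bar>"] False by (simp add: ln_div)
    then have "\<bar>t\<bar>\<^sup>2 * (1 - 1 / \<bar>t\<bar>) \<le> \<bar>t\<bar>\<^sup>2 * ln \<bar>t\<bar>" by (intro mult_left_mono) auto
    moreover have "\<bar>t\<bar>\<^sup>2 * (1 - 1 / \<bar>t\<bar>) = \<bar>t\<bar>\<^sup>2 - \<bar>t\<bar>" using aux[of "\<bar>t\<bar>"] False by simp
    moreover have "0 \<le> \<bar>t\<bar>\<^sup>2" by simp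
    ultimately show ?thesis unfolding F_def power2_abs by linarith
  qed (simp add: F_def)
  have ie: "integrable lborel (\<lambda>x. (u x)^2 * ln \<bar>u x\<bar>)" if "log_regular u" for u :: "'a \<Rightarrow> real"
    using log_regular_product_integrable[OF that that] by (simp only: power2_eq_square)
  have ia: "integrable lborel (\<lambda>x. \<bar>u x\<bar>)" "integrable lborel (\<lambda>x. \<bar>w j x\<bar>)" for j
    using L12_D(2)[OF uL] L12_D(2)[OF wL] by simp_all
  have iF: "integrable lborel (\<lambda>x. F (u x))" "integrable lborel (\<lambda>x. F (w j x))" for j
    unfolding F_def by (intro Bochner_Integration.integrable_add ie u w ia)+
  have eF: "(LINT x|lborel. F (u x)) = (LINT x|lborel. (u x)^2 * ln \<bar>u x\<bar>) + (LINT x|lborel. \<bar>u x\<bar>)"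
    "(LINT x|lborel. F (w j x)) = (LINT x|lborel. (w j x)^2 * ln \<bar>w j x\<bar>) + (LINT x|lborel. \<bar>w j x\<bar>)" for j
    unfolding F_def by (intro Bochner_Integration.integral_add ie u w ia)+
  define g where "g j x = max 0 (F (u x) - F (w j x))" for j x
  have mg: "g j \<in> borel_measurable lborel" for j unfolding g_def by measurable
  have gb: "norm (g j x) \<le> F (u x)" for j x using F0[of "u x"] F0[of "w j x"] by (simp add: g_def)
  have ig: "integrable lborel (g j)" for j
    by (rule Bochner_Integration.integrable_bound[OF iF(1) mg]) (use gb in \<open>auto intro!: order_trans[OF _ abs_ge_self]\<close>)
  have gl: "(\<lambda>j. LINT x|lborel. g j x) \<longlonglongrightarrow> (LINT x|(lborel :: 'a measure). (0::real))"
  proof (rule integral_dominated_convergence[OF _ mg iF(1)])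
    show "AE x in lborel. (\<lambda>j. g j x) \<longlonglongrightarrow> 0"
      using P
    proof eventually_elim
      case (elim x)
      have "(\<lambda>j. w j x * (w j x * ln \<bar>w j x\<bar>) + \<bar>w j x\<bar>) \<longlonglongrightarrow> u x * (u x * ln \<bar>u x\<bar>) + \<bar>u x\<bar>"
        by (intro tendsto_add tendsto_mult tendsto_rabs mult_ln_abs_tendsto elim)
      then have "(\<lambda>j. F (w j x)) \<longlonglongrightarrow> F (u x)" by (simp only: F_def power2_eq_square mult.assoc)
      then have "(\<lambda>j. g j x) \<longlonglongrightarrow> max 0 (F (u x) - F (u x))"
        unfolding g_def by (intro tendsto_max tendsto_diff tendsto_const)
      then show ?case by simp
    qed
  qed (use gb in auto)
  \<comment> \<open>The summand |t| that makes F nonnegative has to be removed again, at the cost of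
    the L1 distance.\<close>
  define \<delta> where "\<delta> j = (LINT x|lborel. g j x) + (LINT x|lborel. \<bar>u x - w j x\<bar>)" for j
  show ?thesis
  proof (rule that[of \<delta>])
    have "(\<lambda>j. (LINT x|lborel. g j x) + (LINT x|lborel. \<bar>u x - w j x\<bar>)) \<longlonglongrightarrow> (LINT x|(lborel :: 'a measure). (0::real)) + 0"
      by (rule tendsto_add[OF gl A])
    then show "\<delta> \<longlonglongrightarrow> 0" by (simp add: \<delta>_def[abs_def])
    fix j
    have "(LINT x|lborel. F (u x)) \<le> (LINT x|lborel. g j x + F (w j x))"
      by (intro integral_mono Bochner_Integration.integrable_add ig iF) (simp add: g_def)
    also have "\<dots> = (LINT x|lborel. g j x) + (LINT x|lborel. F (w j x))"
      by (rule Bochner_Integration.integral_add[OF ig iF(2)])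
    finally have "(LINT x|lborel. F (u x)) \<le> (LINT x|lborel. g j x) + (LINT x|lborel. F (w j x))" .
    moreover have "(LINT x|lborel. \<bar>w j x\<bar>) \<le> (LINT x|lborel. \<bar>u x - w j x\<bar> + \<bar>u x\<bar>)"
      using L12_D(2)[OF L12_diff[OF uL wL]] by (intro integral_mono Bochner_Integration.integrable_add ia) auto
    moreover have "(LINT x|lborel. \<bar>u x - w j x\<bar> + \<bar>u x\<bar>) = (LINT x|lborel. \<bar>u x - w j x\<bar>) + (LINT x|lborel. \<bar>u x\<bar>)"
      using L12_D(2)[OF L12_diff[OF uL wL]] by (intro Bochner_Integration.integral_add ia) auto
    ultimately show "(LINT x|lborel. (u x)^2 * ln \<bar>u x\<bar>) \<le> (LINT x|lborel. (w j x)^2 * ln \<bar>w j x\<bar>) + \<delta> j"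
      unfolding eF \<delta>_def by linarith
  qed
qed

section \<open>The logarithmic Nehari manifold and the limiting minimiser\<close>

lemma Nehari_log_iff:
  assumes bd: "bounded \<Omega>" and op: "open \<Omega>"
  shows "u \<in> Nehari_log \<Omega> k \<longleftrightarrow> log_regular u \<and> vanishes_outside \<Omega> u \<and> (mass u) > 0 \<and>
    log_energy u = k * (LINT x|lborel. (u x)^2 * ln \<bar>u x\<bar>)"
proof -
  have "(LINT x:\<Omega>|lborel. (u x)^2 * ln \<bar>u x\<bar>) = (LINT x|lborel. (u x)^2 * ln \<bar>u x\<bar>)"
    if u: "log_regular u" "vanishes_outside \<Omega> u"
  proof (rule set_integral_eq_integral)
    have [measurable]: "u \<in> borel_measurable borel" using u L12_D(1) by (auto simp: log_regular_def)
    show "(\<lambda>x. (u x)^2 * ln \<bar>u x\<bar>) \<in> borel_measurable borel" by measurable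
    show "AE x in lborel. x \<notin> \<Omega> \<longrightarrow> (u x)\<^sup>2 * ln \<bar>u x\<bar> = 0"
      using u(2) unfolding vanishes_outside_def by eventually_elim simp
  qed (use op in simp)
  then show ?thesis
    unfolding Nehari_log_def mem_Collect_eq H_log_iff[OF bd]
    using nontrivial_iff[of u] E_log_self[of u] by (auto simp: log_regular_def)
qed

text \<open>Since ln u^2 = 2 ln|u|, the entropy term of J cancels the energy term on the manifold;
  for positive k, minimising J there is minimising the mass.\<close>

lemma J_log_Nehari:
  assumes bd: "bounded \<Omega>" and op: "open \<Omega>" and u: "u \<in> Nehari_log \<Omega> k"
  shows "J_log \<Omega> k u = k / 4 * mass u"
proof -
  have [measurable]: "\<Omega> \<in> sets borel" using op by simp
  have N: "log_regular u" "vanishes_outside \<Omega> u" using u unfolding Nehari_log_iff[OF bd op] by auto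
  have um[measurable]: "u \<in> borel_measurable borel" using N L12_D(1) by (auto simp: log_regular_def)
  have E: "E_log u u = k * (LINT x:\<Omega>|lborel. (u x)^2 * ln \<bar>u x\<bar>)" using u by (simp add: Nehari_log_def)
  have M: "(LINT x:\<Omega>|lborel. (u x)^2) = mass u"
  proof (rule set_integral_eq_integral)
    show "AE x in lborel. x \<notin> \<Omega> \<longrightarrow> (u x)\<^sup>2 = 0"
      using N(2) unfolding vanishes_outside_def by eventually_elim simp
  qed measurable
  have e: "(u x)^2 * ln ((u x)^2) = 2 * ((u x)^2 * ln \<bar>u x\<bar>)" for x
  proof (cases "u x = 0")
    case False
    then have "ln (\<bar>u x\<bar>\<^sup>2) = 2 * ln \<bar>u x\<bar>" by (subst ln_realpow) auto
    then show ?thesis by simp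
  qed simp
  have "(LINT x:\<Omega>|lborel. (u x)^2 * ln ((u x)^2)) = 2 * (LINT x:\<Omega>|lborel. (u x)^2 * ln \<bar>u x\<bar>)"
    unfolding e by (rule set_integral_mult_right)
  then show ?thesis unfolding J_log_def E M by (simp add: algebra_simps)
qed

text \<open>A limit candidate with everything extracted along the subsequence r. The geometric rate
  \<open>fast\<close> is recorded for the nonlinear term, and \<open>X_le\<close> forces the
  fractional energies to the same limit as the masses.\<close>

locale least_energy_limit = least_energy_sequence \<Omega> k s p \<tau> U
  for \<Omega> :: "'a::euclidean_space set" and k :: real and s p \<tau> :: "nat \<Rightarrow> real" and U :: "nat \<Rightarrow> 'a \<Rightarrow> real" +
  fixes r :: "nat \<Rightarrow> nat" and v :: "'a \<Rightarrow> real" and A :: real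
  assumes r: "strict_mono r" and v: "log_regular v" and v_van: "vanishes_outside \<Omega> v"
    and L2_lim: "(\<lambda>n. LINT x|lborel. (U (r n) x - v x)^2) \<longlonglongrightarrow> 0"
    and fast: "\<And>n. (\<integral>\<^sup>+x. ennreal ((U (r n) x - v x)^2) \<partial>lborel) \<le> ennreal ((1 / 4) ^ n)"
    and X_le: "\<And>n. (frac_energy (s (r n)) (U (r n)) - (LINT x|lborel. (U (r n) x)^2)) / s (r n) \<le> A"
    and v_pos: "0 < mass v"
begin

lemma along_r: "f \<longlonglongrightarrow> l \<Longrightarrow> (\<lambda>n. f (r n)) \<longlonglongrightarrow> l"
  using LIMSEQ_subseq_LIMSEQ[OF _ r] by (simp add: comp_def)

lemma op: "open \<Omega>" using lip by (simp add: lipschitz_domain_def)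

lemma \<Omega>_borel[measurable]: "\<Omega> \<in> sets borel" using op by simp

lemma v_L12: "v \<in> L12" using v by (simp add: log_regular_def)

lemma mass_limit: "(\<lambda>n. LINT x|lborel. (U (r n) x)^2) \<longlonglongrightarrow> (mass v)"
  by (rule L2_product_tendsto(2)[OF v_L12 v_L12 U_L12 L2_lim])

lemma frac_energy_limit: "(\<lambda>n. frac_energy (s (r n)) (U (r n))) \<longlonglongrightarrow> (mass v)"
proof -
  let ?M = "\<lambda>n. LINT x|lborel. (U (r n) x)^2"
  have "(\<lambda>n. frac_energy (s (r n)) (U (r n)) - ?M n) \<longlonglongrightarrow> 0"
  proof (rule real_tendsto_sandwich[OF always_eventually always_eventually tendsto_const])
    show "\<forall>n. 0 \<le> frac_energy (s (r n)) (U (r n)) - ?M n"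
      using frac_energy_ge[OF U_facts(1) s_pos] by simp
    show "\<forall>n. frac_energy (s (r n)) (U (r n)) - ?M n \<le> s (r n) * A"
    proof
      fix n
      show "frac_energy (s (r n)) (U (r n)) - ?M n \<le> s (r n) * A"
        using X_le[of n] s_pos[of "r n"] by (simp add: pos_divide_le_eq mult.commute)
    qed
    show "(\<lambda>n. s (r n) * A) \<longlonglongrightarrow> 0"
      by (rule tendsto_mult_left_zero[OF along_r[OF s_lim]])
  qed
  from tendsto_add[OF this mass_limit] show ?thesis by simp
qed

lemma norm_limit: "(\<lambda>n. norm_frac (s (r n)) (U (r n))) \<longlonglongrightarrow> Lp_norm 2 v"
  unfolding norm_frac_def E_frac_self Lp_norm_2 by (rule tendsto_real_sqrt[OF frac_energy_limit])

text \<open>On the manifold J is q/(2p) times the power integral, and that integral is the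
  fractional energy minus the \<open>\<tau>\<close> term, both with known limits.\<close>

lemma J_limit: "(\<lambda>n. J_frac (s (r n)) (p (r n)) (\<tau> (r n)) (U (r n)) / s (r n)) \<longlonglongrightarrow> k / 4 * mass v"
proof -
  let ?M = "\<lambda>n. LINT x|lborel. (U (r n) x)^2"
  have J: "J_frac (s (r n)) (p (r n)) (\<tau> (r n)) (U (r n)) / s (r n) =
    (q (r n) / s (r n)) / (2 * p (r n)) * (frac_energy (s (r n)) (U (r n)) - \<tau> (r n) * ?M n)" for n
  proof -
    have "1 / 2 - 1 / p (r n) = q (r n) / (2 * p (r n))" using p_pos[of "r n"] by (simp add: q_def field_simps)
    moreover have "(LINT x|lborel. \<bar>U (r n) x\<bar> powr p (r n)) = frac_energy (s (r n)) (U (r n)) - \<tau> (r n) * ?M n"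
      using U_facts(4)[of "r n"] by simp
    ultimately show ?thesis unfolding J_frac_Nehari[OF U_Nehari p_pos] by simp
  qed
  have "(\<lambda>n. (q (r n) / s (r n)) / (2 * p (r n)) * (frac_energy (s (r n)) (U (r n)) - \<tau> (r n) * ?M n)) \<longlonglongrightarrow>
    k / (2 * 2) * (mass v - 0 * mass v)"
    by (rule tendsto_mult[OF tendsto_divide[OF along_r[OF q_s_lim] tendsto_mult[OF tendsto_const along_r[OF p_lim2]]]
      tendsto_diff[OF frac_energy_limit tendsto_mult[OF along_r[OF \<tau>_lim0] mass_limit]]]) simp
  then show ?thesis unfolding J by simp
qed

text \<open>Both sides of the fractional equation share the leading term, the L2 pairing of U with
  the test function. Subtracting it and dividing by s leaves q/s times the nonlinear quotient and
  \<tau>/s times the pairing; these factors tend to k and 0.\<close>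

lemma weak_equation_test:
  assumes \<phi>: "test_function \<Omega> \<phi>"
  shows "E_log v \<phi> = k * (LINT x|lborel. \<phi> x * v x * ln \<bar>v x\<bar>)"
proof -
  have L: "\<phi> \<in> L12" using \<phi> by (simp add: test_function_def)
  obtain C where C: "\<And>x. \<bar>\<phi> x\<bar> \<le> C" using \<phi> by (auto simp: test_function_def)
  have out: "\<phi> x = 0" if "x \<notin> \<Omega>" for x using \<phi> that by (simp add: test_function_def)
  note [measurable] = L12_D(1)[OF L] L12_D(1)[OF U_L12]
  have s2: "s n \<le> 1 / 2" "s n \<le> 1" for n using s_le[of n] by simp_all
  let ?B = "\<lambda>n. LINT x|lborel. U n x * \<phi> x"
  let ?K = "\<lambda>n. LINT x|lborel. U n x * ((\<bar>U n x\<bar> powr q n - 1) / q n) * \<phi> x"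
  note nl = nonlinearity_limit[OF L C U_L12 v_L12 fast q_pos q_le along_r[OF q_lim]]
  have lhs: "(\<lambda>n. (E_frac (s (r n)) (U (r n)) \<phi> - ?B (r n)) / s (r n)) \<longlonglongrightarrow> E_log v \<phi>"
    by (rule E_frac_weak_limit[OF \<phi> U_L12 v L2_lim s_pos s2(1) along_r[OF s_lim]])
  have iB: "integrable lborel (\<lambda>x. U n x * \<phi> x)" for n
    by (rule cauchy_schwarz_integral(1)) (simp_all add: L12_D[OF L] L12_D[OF U_L12])
  have "(E_frac (s (r n)) (U (r n)) \<phi> - ?B (r n)) / s (r n) = q (r n) / s (r n) * ?K (r n) + \<tau> (r n) / s (r n) * ?B (r n)" for n
  proof -
    let ?m = "r n"
    have H: "\<phi> \<in> H_frac \<Omega> (s ?m)"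
      unfolding H_frac_iff[OF bd] vanishes_outside_def using test_function_frac_regular[OF \<phi> s2(2)] out by simp
    have "E_frac (s ?m) (U ?m) \<phi> =
      (LINT x:\<Omega>|lborel. \<bar>U ?m x\<bar> powr (p ?m - 2) * U ?m x * \<phi> x) + \<tau> ?m * (LINT x:\<Omega>|lborel. U ?m x * \<phi> x)"
      using least[of ?m] H unfolding least_energy_frac_def solution_frac_def by blast
    moreover have "(LINT x:\<Omega>|lborel. U ?m x * \<phi> x) = ?B ?m"
      by (rule set_integral_eq_integral) (use out in auto)
    moreover have "(LINT x:\<Omega>|lborel. \<bar>U ?m x\<bar> powr (p ?m - 2) * U ?m x * \<phi> x) = (LINT x|lborel. \<bar>U ?m x\<bar> powr (p ?m - 2) * U ?m x * \<phi> x)"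
      by (rule set_integral_eq_integral) (use out in auto)
    moreover have "(LINT x|lborel. \<bar>U ?m x\<bar> powr (p ?m - 2) * U ?m x * \<phi> x) =
      (LINT x|lborel. q ?m * (U ?m x * ((\<bar>U ?m x\<bar> powr q ?m - 1) / q ?m) * \<phi> x) + U ?m x * \<phi> x)"
    proof (intro Bochner_Integration.integral_cong refl)
      fix x
      have alg: "(a * b + 1) * y * z = a * (y * b * z) + y * z" for a b y z :: real by (simp add: algebra_simps)
      have "q ?m * ((\<bar>U ?m x\<bar> powr q ?m - 1) / q ?m) = \<bar>U ?m x\<bar> powr q ?m - 1" using q_ne[of ?m] by simp
      then have e: "\<bar>U ?m x\<bar> powr q ?m = q ?m * ((\<bar>U ?m x\<bar> powr q ?m - 1) / q ?m) + 1" by linarith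
      have "\<bar>U ?m x\<bar> powr (p ?m - 2) * U ?m x * \<phi> x = (q ?m * ((\<bar>U ?m x\<bar> powr q ?m - 1) / q ?m) + 1) * U ?m x * \<phi> x"
        by (simp only: q_def[symmetric] e[symmetric])
      then show "\<bar>U ?m x\<bar> powr (p ?m - 2) * U ?m x * \<phi> x = q ?m * (U ?m x * ((\<bar>U ?m x\<bar> powr q ?m - 1) / q ?m) * \<phi> x) + U ?m x * \<phi> x"
        by (rule trans) (rule alg)
    qed
    moreover have "\<dots> = q ?m * ?K ?m + ?B ?m"
      by (simp only: Bochner_Integration.integral_add[OF integrable_mult_right[OF nl(1)] iB] integral_mult_right_zero)
    ultimately have "E_frac (s ?m) (U ?m) \<phi> - ?B ?m = q ?m * ?K ?m + \<tau> ?m * ?B ?m" by (simp only:)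
    then show ?thesis by (simp only: add_divide_distrib times_divide_eq_left)
  qed
  moreover have "(\<lambda>n. q (r n) / s (r n) * ?K (r n) + \<tau> (r n) / s (r n) * ?B (r n)) \<longlonglongrightarrow>
    k * (LINT x|lborel. \<phi> x * v x * ln \<bar>v x\<bar>) + 0 * (LINT x|lborel. v x * \<phi> x)"
    by (rule tendsto_add[OF tendsto_mult[OF along_r[OF q_s_lim] nl(2)] tendsto_mult[OF along_r[OF \<tau>_lim] L2_product_tendsto(1)[OF v_L12 L U_L12 L2_lim]]])
  ultimately have "(\<lambda>n. (E_frac (s (r n)) (U (r n)) \<phi> - ?B (r n)) / s (r n)) \<longlonglongrightarrow> k * (LINT x|lborel. \<phi> x * v x * ln \<bar>v x\<bar>) + 0 * (LINT x|lborel. v x * \<phi> x)"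
    by (simp only:)
  from LIMSEQ_unique[OF lhs this] show ?thesis by simp
qed

text \<open>Both sides are continuous along the approximating test functions: the energy by
  Cauchy-Schwarz, the entropy pairing by \<open>entropy_pairing_tendsto_0\<close>.\<close>

lemma weak_equation:
  assumes \<phi>: "log_regular \<phi>" and van: "vanishes_outside \<Omega> \<phi>"
  shows "E_log v \<phi> = k * (LINT x|lborel. \<phi> x * v x * ln \<bar>v x\<bar>)"
proof -
  obtain w where w: "\<And>j. test_function \<Omega> (w j)" "(\<lambda>j. log_energy (\<lambda>x. \<phi> x - w j x)) \<longlonglongrightarrow> 0"
    "(\<lambda>j. LINT x|lborel. (\<phi> x - w j x)^2) \<longlonglongrightarrow> 0" "(\<lambda>j. LINT x|lborel. \<bar>\<phi> x - w j x\<bar>) \<longlonglongrightarrow> 0"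
    "AE x in lborel. (\<lambda>j. w j x) \<longlonglongrightarrow> \<phi> x"
    "(\<lambda>j. LINT x|lborel. (\<phi> x - w j x)^2 * ln (max 1 \<bar>\<phi> x - w j x\<bar>)) \<longlonglongrightarrow> 0"
    by (rule test_function_approximation[OF bd lip \<phi> van]) (rule that)
  have wr: "log_regular (w j)" for j by (rule test_function_log_regular[OF w(1)])
  have d: "log_regular (\<lambda>x. \<phi> x - w j x)" for j by (rule log_regular_combination(2)[OF \<phi> wr])
  have "AE x in lborel. (\<lambda>j. \<phi> x - w j x) \<longlonglongrightarrow> 0"
    using w(5)
  proof eventually_elim
    case (elim x)
    then have "(\<lambda>j. \<phi> x - w j x) \<longlonglongrightarrow> \<phi> x - \<phi> x" by (intro tendsto_diff tendsto_const)
    then show ?case by simp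
  qed
  note T = entropy_pairing_tendsto_0[OF v d w(4) this w(6)]
  have E: "(\<lambda>j. E_log v (\<lambda>x. \<phi> x - w j x)) \<longlonglongrightarrow> 0"
  proof (rule Lim_null_comparison[OF always_eventually])
    show "\<forall>j. norm (E_log v (\<lambda>x. \<phi> x - w j x)) \<le> sqrt (log_energy v) * sqrt (log_energy (\<lambda>x. \<phi> x - w j x))"
      using E_log_cauchy_schwarz[OF v d] by simp
    show "(\<lambda>j. sqrt (log_energy v) * sqrt (log_energy (\<lambda>x. \<phi> x - w j x))) \<longlonglongrightarrow> 0"
      using tendsto_mult[OF tendsto_const[of "sqrt (log_energy v)"] tendsto_real_sqrt[OF w(2)]] by simp
  qed
  have L: "\<phi> \<in> L12" "w j \<in> L12" for j using \<phi> wr by (auto simp: log_regular_def)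
  have "E_log v (\<lambda>x. \<phi> x - w j x) = E_log v \<phi> - E_log v (w j)" for j
  proof -
    have i: "integrable lborel (\<lambda>\<xi>. ln (br \<xi>) * Re (fourier v \<xi> * cnj (fourier u \<xi>)))"
      if u: "log_regular u" for u
      using u v L12_D(1)[OF v_L12]
      by (intro weighted_cross_integrable fourier_measurable) (auto simp: log_regular_def L12_def)
    have "ln (br \<xi>) * Re (fourier v \<xi> * cnj (fourier (\<lambda>x. \<phi> x - w j x) \<xi>)) =
      ln (br \<xi>) * Re (fourier v \<xi> * cnj (fourier \<phi> \<xi>)) - ln (br \<xi>) * Re (fourier v \<xi> * cnj (fourier (w j) \<xi>))" for \<xi>
      unfolding fourier_diff[OF L12_D(2)[OF L(1)] L12_D(2)[OF L(2)]] by (simp add: algebra_simps)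
    then show ?thesis
      unfolding E_log_fourier[OF v d] E_log_fourier[OF v \<phi>] E_log_fourier[OF v wr]
      by (simp only: Bochner_Integration.integral_diff[OF i[OF \<phi>] i[OF wr]])
  qed
  moreover have "(LINT x|lborel. (\<phi> x - w j x) * v x * ln \<bar>v x\<bar>) = (LINT x|lborel. \<phi> x * v x * ln \<bar>v x\<bar>) - (LINT x|lborel. w j x * v x * ln \<bar>v x\<bar>)" for j
    using Bochner_Integration.integral_diff[OF log_regular_product_integrable[OF v \<phi>] log_regular_product_integrable[OF v wr[of j]]]
    by (simp only: left_diff_distrib)
  ultimately have "E_log v (\<lambda>x. \<phi> x - w j x) - k * (LINT x|lborel. (\<phi> x - w j x) * v x * ln \<bar>v x\<bar>) = E_log v \<phi> - k * (LINT x|lborel. \<phi> x * v x * ln \<bar>v x\<bar>)" for j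
    using weak_equation_test[OF w(1)[of j]] by (simp add: right_diff_distrib)
  moreover have "(\<lambda>j. E_log v (\<lambda>x. \<phi> x - w j x) - k * (LINT x|lborel. (\<phi> x - w j x) * v x * ln \<bar>v x\<bar>)) \<longlonglongrightarrow> 0 - k * 0"
    by (intro tendsto_diff tendsto_mult tendsto_const E T)
  ultimately have "(\<lambda>j::nat. E_log v \<phi> - k * (LINT x|lborel. \<phi> x * v x * ln \<bar>v x\<bar>)) \<longlonglongrightarrow> 0" by simp
  then show ?thesis by (simp add: tendsto_const_iff)
qed

lemma solution: "solution_log \<Omega> k v"
  unfolding solution_log_def
proof (intro conjI ballI)
  show "v \<in> H_log \<Omega>" unfolding H_log_iff[OF bd] using v v_van by simp
  fix \<phi> assume "\<phi> \<in> H_log \<Omega>"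
  then have \<phi>: "log_regular \<phi>" "vanishes_outside \<Omega> \<phi>" unfolding H_log_iff[OF bd] by auto
  have [measurable]: "\<phi> \<in> borel_measurable borel" using \<phi> by (simp add: log_regular_def L12_def)
  note [measurable] = L12_D(1)[OF v_L12]
  have "(LINT x:\<Omega>|lborel. \<phi> x * v x * ln \<bar>v x\<bar>) = (LINT x|lborel. \<phi> x * v x * ln \<bar>v x\<bar>)"
  proof (rule set_integral_eq_integral)
    show "AE x in lborel. x \<notin> \<Omega> \<longrightarrow> \<phi> x * v x * ln \<bar>v x\<bar> = 0"
      using \<phi>(2) unfolding vanishes_outside_def by eventually_elim simp
  qed measurable
  then show "E_log v \<phi> = k * (LINT x:\<Omega>|lborel. \<phi> x * v x * ln \<bar>v x\<bar>)"
    using weak_equation[OF \<phi>] by (simp only:)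
qed

lemma v_Nehari: "v \<in> Nehari_log \<Omega> k"
  unfolding Nehari_log_iff[OF bd op]
  using v v_van v_pos weak_equation[OF v v_van] by (simp add: E_log_self power2_eq_square)

text \<open>Scaling w onto the fractional manifolds gives competitors whose energies over s converge
  to k/4 times the right side, while the least energies over s converge to k/4 times the mass of
  v.\<close>

lemma minimal_test:
  assumes w: "test_function \<Omega> w" and pos: "mass w > 0"
  shows "mass v \<le>
    exp (2 * (log_energy w - k * (LINT x|lborel. (w x)^2 * ln \<bar>w x\<bar>)) / (k * mass w)) * mass w"
    (is "?M \<le> ?R")
proof -
  obtain z where z: "\<And>n. z n \<in> Nehari_frac \<Omega> (s n) (p n) (\<tau> n)"
    "(\<lambda>n. J_frac (s n) (p n) (\<tau> n) (z n) / s n) \<longlonglongrightarrow> k / 4 * ?R"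
    by (rule test_function_energy_limit[OF w pos]) (rule that)
  have "k / 4 * ?M \<le> k / 4 * ?R"
  proof (rule LIMSEQ_le[OF J_limit along_r[OF z(2)]], intro exI allI impI)
    fix n
    show "J_frac (s (r n)) (p (r n)) (\<tau> (r n)) (U (r n)) / s (r n) \<le> J_frac (s (r n)) (p (r n)) (\<tau> (r n)) (z (r n)) / s (r n)"
      using J_minimal[OF z(1)] s_pos[of "r n"] by (intro divide_right_mono) auto
  qed
  then show ?thesis by (rule mult_left_le_imp_le) (simp add: k_pos)
qed

text \<open>For u on the logarithmic manifold the exponent in the test-function bound vanishes.
  Along approximations the entropy enters this exponent with a negative sign, so the one-sided
  control given by lower semicontinuity is enough.\<close>

lemma minimal:
  assumes "u \<in> Nehari_log \<Omega> k"
  shows "mass v \<le> mass u"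
proof -
  have u: "log_regular u" "vanishes_outside \<Omega> u" "mass u > 0"
    and N: "log_energy u = k * (LINT x|lborel. (u x)^2 * ln \<bar>u x\<bar>)"
    using assms unfolding Nehari_log_iff[OF bd op] by auto
  obtain w where w: "\<And>j. test_function \<Omega> (w j)" "(\<lambda>j. log_energy (\<lambda>x. u x - w j x)) \<longlonglongrightarrow> 0"
    "(\<lambda>j. LINT x|lborel. (u x - w j x)^2) \<longlonglongrightarrow> 0" "(\<lambda>j. LINT x|lborel. \<bar>u x - w j x\<bar>) \<longlonglongrightarrow> 0"
    "AE x in lborel. (\<lambda>j. w j x) \<longlonglongrightarrow> u x"
    by (rule test_function_approximation[OF bd lip u(1,2)]) (rule that)
  have wr: "log_regular (w j)" for j by (rule test_function_log_regular[OF w(1)])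
  have uL: "u \<in> L12" and wL: "w j \<in> L12" for j using u wr by (auto simp: log_regular_def)
  define M where "M = mass u"
  define Mj where "Mj j = mass (w j)" for j
  define Lg where "Lg = (LINT x|lborel. (u x)^2 * ln \<bar>u x\<bar>)"
  define Lj where "Lj j = (LINT x|lborel. (w j x)^2 * ln \<bar>w j x\<bar>)" for j
  have M: "M > 0" using u(3) by (simp add: M_def)
  obtain \<delta> where "\<delta> \<longlonglongrightarrow> 0" "\<And>j. (LINT x|lborel. (u x)^2 * ln \<bar>u x\<bar>) \<le> (LINT x|lborel. (w j x)^2 * ln \<bar>w j x\<bar>) + \<delta> j"
    by (rule entropy_lower_semicontinuous[OF u(1) wr w(4,5)]) (rule that)
  then have \<delta>: "\<delta> \<longlonglongrightarrow> 0" "\<And>j. Lg \<le> Lj j + \<delta> j" by (simp_all only: Lg_def Lj_def)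
  have El: "(\<lambda>j. log_energy (w j)) \<longlonglongrightarrow> k * Lg"
    using log_energy_tendsto[OF u(1) wr w(2)] unfolding N Lg_def .
  have w3: "(\<lambda>j. LINT x|lborel. (w j x - u x)^2) \<longlonglongrightarrow> 0" using w(3) by (simp only: power2_commute)
  have Ml: "Mj \<longlonglongrightarrow> M" unfolding Mj_def M_def by (rule L2_product_tendsto(2)[OF uL uL wL w3])
  have kM: "k * M \<noteq> 0" using M k_pos by simp
  have "(\<lambda>j. exp (2 * (log_energy (w j) - k * (Lg - \<delta> j)) / (k * Mj j)) * Mj j) \<longlonglongrightarrow>
    exp (2 * (k * Lg - k * (Lg - 0)) / (k * M)) * M"
    by (intro tendsto_mult tendsto_exp tendsto_divide tendsto_diff tendsto_const El Ml \<delta>(1) kM)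
  then have lim: "(\<lambda>j. exp (2 * (log_energy (w j) - k * (Lg - \<delta> j)) / (k * Mj j)) * Mj j) \<longlonglongrightarrow> M" by simp
  have "eventually (\<lambda>j. 0 < Mj j) sequentially" by (rule order_tendstoD(1)[OF Ml M])
  then have "eventually (\<lambda>j. mass v \<le> exp (2 * (log_energy (w j) - k * (Lg - \<delta> j)) / (k * Mj j)) * Mj j) sequentially"
  proof eventually_elim
    case (elim j)
    have "mass v \<le> exp (2 * (log_energy (w j) - k * Lj j) / (k * Mj j)) * Mj j"
      using minimal_test[OF w(1)] elim unfolding Mj_def Lj_def by blast
    also have "\<dots> \<le> exp (2 * (log_energy (w j) - k * (Lg - \<delta> j)) / (k * Mj j)) * Mj j"
    proof -
      have "k * (Lg - \<delta> j) \<le> k * Lj j" using \<delta>(2)[of j] k_pos by (intro mult_left_mono) linarith+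
      then have "2 * (log_energy (w j) - k * Lj j) / (k * Mj j) \<le> 2 * (log_energy (w j) - k * (Lg - \<delta> j)) / (k * Mj j)"
        using elim k_pos by (intro divide_right_mono) auto
      then show ?thesis using elim by (intro mult_right_mono) auto
    qed
    finally show ?case .
  qed
  from tendsto_lowerbound[OF lim this] show ?thesis by (simp add: M_def)
qed

lemma least_energy: "least_energy_log \<Omega> k v"
proof -
  have "J_log \<Omega> k v = (INF u\<in>Nehari_log \<Omega> k. J_log \<Omega> k u)"
  proof (rule cInf_eq_minimum[symmetric])
    show "J_log \<Omega> k v \<in> J_log \<Omega> k ` Nehari_log \<Omega> k" using v_Nehari by (rule imageI)
    fix y assume "y \<in> J_log \<Omega> k ` Nehari_log \<Omega> k"
    then obtain u where u: "u \<in> Nehari_log \<Omega> k" and y: "y = J_log \<Omega> k u" by blast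
    show "J_log \<Omega> k v \<le> y"
      unfolding y J_log_Nehari[OF bd op u] J_log_Nehari[OF bd op v_Nehari]
      using minimal[OF u] k_pos by (intro mult_left_mono) auto
  qed
  then show ?thesis unfolding least_energy_log_def using solution v_Nehari by simp
qed

end

text \<open>The uniform bounds hold from an index n0 on, so compactness is applied to the shifted
  sequence; the lower bound on the masses makes the limit nontrivial.\<close>

theorem (in least_energy_sequence) least_energy_convergence:
  "\<exists>u r. least_energy_log \<Omega> k u \<and> strict_mono r \<and>
    (\<lambda>n. Lp_norm 2 (\<lambda>x. U (r n) x - u x)) \<longlonglongrightarrow> 0 \<and>
    (\<lambda>n. J_frac (s (r n)) (p (r n)) (\<tau> (r n)) (U (r n)) / s (r n)) \<longlonglongrightarrow> J_log \<Omega> k u \<and>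
    J_log \<Omega> k u = k / 4 * (Lp_norm 2 u)^2 \<and>
    (\<lambda>n. norm_frac (s (r n)) (U (r n))) \<longlonglongrightarrow> Lp_norm 2 u"
proof -
  obtain A c n0 where c: "c > 0" and A: "\<And>n. n \<ge> n0 \<Longrightarrow> (mass (U n)) \<le> A"
    and cU: "\<And>n. n \<ge> n0 \<Longrightarrow> c \<le> mass (U n)"
    and X: "\<And>n. n \<ge> n0 \<Longrightarrow> (frac_energy (s n) (U n) - mass (U n)) / s n \<le> A"
    by (rule uniform_bounds) (rule that)
  have reg: "log_regular (U (n + n0))" for n by (rule frac_energy_log_energy(1)[OF U_facts(1) s_pos])
  have en: "log_energy (U (n + n0)) \<le> A" for n
  proof -
    have "log_energy (U (n + n0)) \<le> (frac_energy (s (n + n0)) (U (n + n0)) - (LINT x|lborel. (U (n + n0) x)^2)) / s (n + n0)"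
      using frac_energy_log_energy(2)[OF U_facts(1) s_pos, of "n + n0"] s_pos[of "n + n0"] by (simp add: pos_le_divide_eq mult.commute)
    then show ?thesis using X[of "n + n0"] by simp
  qed
  have A': "(LINT x|lborel. (U (n + n0) x)^2) \<le> A" for n using A[of "n + n0"] by simp
  obtain r' v where r': "strict_mono (r' :: nat \<Rightarrow> nat)" and v: "log_regular v" "vanishes_outside \<Omega> v"
    and l: "(\<lambda>n. LINT x|lborel. (U (r' n + n0) x - v x)^2) \<longlonglongrightarrow> 0"
    and f: "\<And>n. (\<integral>\<^sup>+x. ennreal ((U (r' n + n0) x - v x)^2) \<partial>lborel) \<le> ennreal ((1 / 4) ^ n)"
    by (rule log_energy_compactness[OF bd reg U_facts(2) A' en]) (rule that)
  define r where "r n = r' n + n0" for n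
  have sm: "strict_mono r" using r' by (simp add: strict_mono_def r_def)
  have rn: "n0 \<le> r n" for n by (simp add: r_def)
  have vL: "v \<in> L12" using v by (simp add: log_regular_def)
  have l': "(\<lambda>n. LINT x|lborel. (U (r n) x - v x)^2) \<longlonglongrightarrow> 0" using l by (simp only: r_def)
  have "c \<le> mass v"
    by (rule LIMSEQ_le_const[OF L2_product_tendsto(2)[OF vL vL U_L12 l']]) (use cU[OF rn] in blast)
  then interpret least_energy_limit \<Omega> k s p \<tau> U r v A
    using c f X[OF rn] by unfold_locales (auto simp: sm v l r_def)
  have n: "(\<lambda>n. Lp_norm 2 (\<lambda>x. U (r n) x - v x)) \<longlonglongrightarrow> 0"
    using tendsto_real_sqrt[OF l'] unfolding Lp_norm_2 by simp
  have J: "J_log \<Omega> k v = k / 4 * mass v" by (rule J_log_Nehari[OF bd op v_Nehari])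
  have J': "(\<lambda>n. J_frac (s (r n)) (p (r n)) (\<tau> (r n)) (U (r n)) / s (r n)) \<longlonglongrightarrow> J_log \<Omega> k v"
    unfolding J by (rule J_limit)
  show ?thesis
    by (intro exI[of _ v] exI[of _ r] conjI least_energy sm n J' norm_limit J[folded Lp_norm_2_square])
qed

theorem theorem1p4:
  fixes \<Omega> :: "'a::euclidean_space set"
    and s\<^sub>0 :: real and s :: "nat \<Rightarrow> real"
    and p p' \<tau> \<tau>' :: "real \<Rightarrow> real"
    and U :: "nat \<Rightarrow> 'a \<Rightarrow> real"
  assumes "bounded \<Omega>" and "lipschitz_domain \<Omega>"
    and "s\<^sub>0 < min 1 (real DIM('a) / 4)"
    and "\<And>n. s n \<in> {0<..s\<^sub>0}" and "s \<longlonglongrightarrow> 0"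
    and "\<And>t. t \<in> {0..s\<^sub>0} \<Longrightarrow> (p has_real_derivative p' t) (at t within {0..s\<^sub>0})"
    and "continuous_on {0..s\<^sub>0} p'"
    and "\<And>t. t \<in> {0<..<s\<^sub>0} \<Longrightarrow> 2 < p t \<and> p t < 2 * real DIM('a) / (real DIM('a) - 2 * t)"
    and "p' 0 \<notin> {0, 4 / real DIM('a)}"
    and "\<And>t. t \<in> {0..s\<^sub>0} \<Longrightarrow> (\<tau> has_real_derivative \<tau>' t) (at t within {0..s\<^sub>0})"
    and "continuous_on {0..s\<^sub>0} \<tau>'"
    and "\<And>t. t \<in> {0<..s\<^sub>0} \<Longrightarrow> \<tau> t < lambda1_frac \<Omega> t"
    and "\<tau> \<in> o[at_right 0](\<lambda>t. t)"
    and "\<And>n. least_energy_frac \<Omega> (s n) (p (s n)) (\<tau> (s n)) (U n)"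
  shows "\<exists>u r. least_energy_log \<Omega> (p' 0) u \<and> strict_mono (r :: nat \<Rightarrow> nat) \<and>
     (\<lambda>n. Lp_norm 2 (\<lambda>x. U (r n) x - u x)) \<longlonglongrightarrow> 0 \<and>
     (\<lambda>n. 1 / s (r n) * J_frac (s (r n)) (p (s (r n))) (\<tau> (s (r n))) (U (r n)))
        \<longlonglongrightarrow> J_log \<Omega> (p' 0) u \<and>
     J_log \<Omega> (p' 0) u = p' 0 / 4 * (Lp_norm 2 u)\<^sup>2 \<and>
     (\<lambda>n. norm_frac (s (r n)) (U (r n))) \<longlonglongrightarrow> Lp_norm 2 u"
proof -
  define N where "N = real DIM('a)"
  have N: "N > 0" by (simp add: N_def)
  define k where "k = p' 0"
  have s: "0 < s n" "s n \<le> s\<^sub>0" for n using assms(4)[of n] by auto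
  have s0: "0 < s\<^sub>0" using s[of 0] by linarith
  have small: "eventually (\<lambda>n. s n < t) sequentially" if "t > 0" for t by (rule order_tendstoD(2)[OF assms(5) that])
  \<comment> \<open>Subcriticality rearranges to (p - 2)/s < 4/(N - 2 s). It is given on the open
    interval only, hence the restriction on \<open>s n\<close>, which holds eventually.\<close>
  have crit: "2 < p (s n)" "(p (s n) - 2) / s n < 4 / (N - 2 * s n)" if "s n < s\<^sub>0" for n
  proof -
    have t: "s n \<in> {0<..<s\<^sub>0}" using that s[of n] by simp
    show "2 < p (s n)" using assms(8)[OF t] by simp
    have d: "0 < N - 2 * s n" using assms(3) s(2)[of n] N by (simp add: N_def)
    have "p (s n) < 2 * N / (N - 2 * s n)" using assms(8)[OF t] by (simp add: N_def)
    then have "p (s n) * (N - 2 * s n) < 2 * N" using d by (simp add: pos_less_divide_eq)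
    then have "(p (s n) - 2) * (N - 2 * s n) < 4 * s n" by (simp add: algebra_simps)
    then show "(p (s n) - 2) / s n < 4 / (N - 2 * s n)" using d s(1)[of n] by (simp add: divide_simps mult.commute)
  qed
  have fil: "filterlim s (at 0 within {0..s\<^sub>0}) sequentially"
    unfolding filterlim_at using s assms(5) by (auto intro!: always_eventually simp: less_imp_le less_imp_neq[symmetric])
  have filr: "filterlim s (at_right 0) sequentially"
    unfolding filterlim_at using s assms(5) by (auto intro!: always_eventually simp: less_imp_neq[symmetric])
  have der: "(p has_real_derivative k) (at 0 within {0..s\<^sub>0})" using assms(6)[of 0] s0 by (simp add: k_def)
  have "(p \<longlongrightarrow> p 0) (at 0 within {0..s\<^sub>0})"
    using DERIV_continuous[OF der] by (simp add: continuous_within)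
  then have pl: "(\<lambda>n. p (s n)) \<longlonglongrightarrow> p 0" by (rule filterlim_compose[OF _ fil])
  have Nl: "(\<lambda>n. 4 / (N - 2 * s n)) \<longlonglongrightarrow> 4 / (N - 2 * 0)"
    using N by (intro tendsto_divide tendsto_diff tendsto_mult tendsto_const assms(5)) simp
  \<comment> \<open>The value at 0 is not prescribed; continuity and the two-sided bound along
    \<open>s n\<close> force it to be 2.\<close>
  have p0: "p 0 = 2"
  proof (rule antisym)
    have "eventually (\<lambda>n. p (s n) \<le> 2 + 4 / (N - 2 * s n) * s n) sequentially"
      using small[OF s0]
    proof eventually_elim
      case (elim n)
      then show ?case using crit(2)[of n] s(1)[of n] by (simp add: pos_divide_less_eq)
    qed
    moreover have "(\<lambda>n. 2 + 4 / (N - 2 * s n) * s n) \<longlonglongrightarrow> 2 + 4 / (N - 2 * 0) * 0"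
      by (intro tendsto_add tendsto_mult[OF Nl assms(5)] tendsto_const)
    ultimately show "p 0 \<le> 2" using tendsto_le[OF sequentially_bot _ pl] by fastforce
    have "eventually (\<lambda>n. 2 \<le> p (s n)) sequentially"
      using small[OF s0] by eventually_elim (use crit(1) in \<open>auto intro: less_imp_le\<close>)
    then show "2 \<le> p 0" by (rule tendsto_lowerbound[OF pl]) simp
  qed
  have ql: "(\<lambda>n. (p (s n) - 2) / s n) \<longlonglongrightarrow> k"
    using filterlim_compose[OF der[unfolded has_field_derivative_iff] fil] by (simp add: p0)
  have k0: "0 \<le> k"
  proof (rule tendsto_lowerbound[OF ql])
    show "eventually (\<lambda>n. 0 \<le> (p (s n) - 2) / s n) sequentially"
      using small[OF s0]
    proof eventually_elim
      case (elim n)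
      then show ?case using crit(1)[of n] s(1)[of n] by simp
    qed
  qed simp
  have k4: "k \<le> 4 / N"
  proof -
    have "eventually (\<lambda>n. (p (s n) - 2) / s n \<le> 4 / (N - 2 * s n)) sequentially"
      using small[OF s0] by eventually_elim (use crit(2) in \<open>auto intro: less_imp_le\<close>)
    from tendsto_le[OF sequentially_bot Nl ql this] show ?thesis by simp
  qed
  \<comment> \<open>The limits give only 0 \<le> k \<le> 4/N; excluding both endpoints makes the
    inequalities strict.\<close>
  have kN: "0 < k" "k < 4 / N" using k0 k4 assms(9) by (auto simp: k_def N_def less_le)
  have tl: "(\<lambda>n. \<tau> (s n) / s n) \<longlonglongrightarrow> 0"
    by (rule filterlim_compose[OF smalloD_tendsto[OF assms(13)] filr])
  have "(\<lambda>n. \<tau> (s n) / s n * s n) \<longlonglongrightarrow> 0 * 0" by (rule tendsto_mult[OF tl assms(5)])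
  moreover have "\<tau> (s n) / s n * s n = \<tau> (s n)" for n using s(1)[of n] by simp
  ultimately have tl0: "(\<lambda>n. \<tau> (s n)) \<longlonglongrightarrow> 0" by simp
  \<comment> \<open>Because k is strictly below 4/N, also (p - 2)/s < 4/N from some index on; this
    becomes the inequality \<open>\<theta>\<close> \<le> 1 for the tail.\<close>
  have "eventually (\<lambda>n. s n < s\<^sub>0 \<and> s n < 1 / 4 \<and> p (s n) < 3 \<and> (p (s n) - 2) / s n < 4 / N \<and> \<tau> (s n) < 1 / 2) sequentially"
    by (intro eventually_conj small s0 order_tendstoD(2)[OF pl] order_tendstoD(2)[OF ql] order_tendstoD(2)[OF tl0] kN) (auto simp: p0)
  then obtain m where m: "\<And>n. n \<ge> m \<Longrightarrow> s n < s\<^sub>0 \<and> s n < 1 / 4 \<and> p (s n) < 3 \<and> (p (s n) - 2) / s n < 4 / N \<and> \<tau> (s n) < 1 / 2"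
    unfolding eventually_sequentially by blast
  have m': "s (n + m) < s\<^sub>0" "s (n + m) \<le> 1 / 4" "p (s (n + m)) \<le> 3" "(p (s (n + m)) - 2) / s (n + m) < 4 / N" "\<tau> (s (n + m)) \<le> 1 / 2" for n
    using m[of "n + m"] by auto
  interpret least_energy_sequence \<Omega> k "\<lambda>n. s (n + m)" "\<lambda>n. p (s (n + m))" "\<lambda>n. \<tau> (s (n + m))" "\<lambda>n. U (n + m)"
  proof
    show "k * real DIM('a) < 4" using kN N by (simp add: N_def pos_less_divide_eq)
    show "(p (s (n + m)) - 2) * real DIM('a) \<le> 4 * s (n + m)" for n
      using m'(4)[of n] s(1)[of "n + m"] N by (simp add: N_def field_simps)
    show "(\<lambda>n. s (n + m)) \<longlonglongrightarrow> 0" by (rule LIMSEQ_ignore_initial_segment[OF assms(5)])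
    show "(\<lambda>n. (p (s (n + m)) - 2) / s (n + m)) \<longlonglongrightarrow> k" by (rule LIMSEQ_ignore_initial_segment[OF ql])
    show "(\<lambda>n. \<tau> (s (n + m)) / s (n + m)) \<longlonglongrightarrow> 0" by (rule LIMSEQ_ignore_initial_segment[OF tl])
  qed (rule assms kN s m' crit(1))+
  obtain u r where u: "least_energy_log \<Omega> k u" "strict_mono r"
    "(\<lambda>n. Lp_norm 2 (\<lambda>x. U (r n + m) x - u x)) \<longlonglongrightarrow> 0"
    "(\<lambda>n. J_frac (s (r n + m)) (p (s (r n + m))) (\<tau> (s (r n + m))) (U (r n + m)) / s (r n + m)) \<longlonglongrightarrow> J_log \<Omega> k u"
    "J_log \<Omega> k u = k / 4 * (Lp_norm 2 u)^2" "(\<lambda>n. norm_frac (s (r n + m)) (U (r n + m))) \<longlonglongrightarrow> Lp_norm 2 u"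
    using least_energy_convergence by blast
  have sm: "strict_mono (\<lambda>n. r n + m)" using u(2) by (simp add: strict_mono_def)
  have u4: "(\<lambda>n. 1 / s (r n + m) * J_frac (s (r n + m)) (p (s (r n + m))) (\<tau> (s (r n + m))) (U (r n + m))) \<longlonglongrightarrow> J_log \<Omega> k u"
    using u(4) by (simp only: times_divide_eq_left mult_1_left)
  show ?thesis
    unfolding k_def[symmetric]
    by (intro exI[of _ u] exI[of _ "\<lambda>n. r n + m"] conjI sm u(1,3) u4 u(5,6))
qed

end
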